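(* Let $d\in\{1,2,3\}$, $\sigma\in(\frac d4,1)$ with $\sigma\ne\frac12$, $\mu\in\{1,-1\}$ and $p>1$. If $p$ is not an odd integer, assume in addition that $p\ge k+1$, where $k$ is an integer larger than $\frac d2$. Put $s_c=\frac d2-\frac{2\sigma}{p-1}$. Then the Cauchy problem $$i\partial_t u+(-\Delta)^\sigma u+\mu|u|^{p-1}u=0,\qquad u(0)=u_0\in H^s(\mathbb{R}^d),$$ is ill-posed in $H^s(\mathbb{R}^d)$ for every $s\in(s_c,0)$.
   Context: The unknown is a complex-valued function $u(t,x)$, $x\in\mathbb{R}^d$. The operator $(-\Delta)^\sigma$ is the Fourier multiplier on $\mathbb{R}^d$ with symbol $|\xi|^{2\sigma}$. $H^s=H^s(\mathbb{R}^d)$ is the inhomogeneous $L^2$-based Sobolev space. Ill-posed in $H^s$ means that the data-to-solution map fails to be uniformly continuous in the $H^s$ topology, on arbitrarily small balls and for arbitrarily short times: for every $R>0$ and $T>0$ there exist Schwartz initial data $u_{0,n},v_{0,n}$ ($n\in\mathbb{N}$) with $\|u_{0,n}\|_{H^s}\le R$, $\|v_{0,n}\|_{H^s}\le R$ and $\|u_{0,n}-v_{0,n}\|_{H^s}\to 0$, and times $t_n\in[0,T]$, such that the corresponding solutions $u_n,v_n$ of the equation exist on $[0,t_n]$ (as continuous functions of time with values in $H^k(\mathbb{R}^d)$, where $k$ is an integer larger than $\frac d2$, equal to the one in the claim when $p$ is not an odd integer) and $$\liminf_{n\to\infty}\|u_n(t_n)-v_n(t_n)\|_{H^s}>0 .$$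 *)

theory Defs
  imports "HOL-Analysis.Analysis"
begin

section \<open>Schwartz functions and the Fourier transform\<close>

definition pderiv_dir :: "'d::finite \<Rightarrow> (real ^ 'd \<Rightarrow> complex) \<Rightarrow> real ^ 'd \<Rightarrow> complex" where
  "pderiv_dir j f x = frechet_derivative f (at x) (axis j 1)"

text \<open>The list \<open>js\<close> ranges over all iterated partial derivatives; differentiability of every
  one of them amounts to smoothness of \<open>f\<close>.\<close>

definition schwartz :: "(real ^ 'd::finite \<Rightarrow> complex) \<Rightarrow> bool" where
  "schwartz f \<longleftrightarrow>
     (\<forall>js. (\<forall>x. foldr pderiv_dir js f differentiable (at x)) \<and>
           (\<forall>m::nat. \<exists>C. \<forall>x. norm x ^ m * norm (foldr pderiv_dir js f x) \<le> C))"

text \<open>Unitary normalisation with phase \<open>exp (- i x \<bullet> \<xi>)\<close>, so that \<open>- \<Delta>\<close> has symbol \<open>\<bar>\<xi>\<bar>\<^sup>2\<close> and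
  the \<open>H\<^sup>0\<close> norm below is the \<open>L\<^sup>2\<close> norm.\<close>

definition fourier :: "(real ^ 'd::finite \<Rightarrow> complex) \<Rightarrow> real ^ 'd \<Rightarrow> complex" where
  "fourier f \<xi> =
     of_real ((2 * pi) powr (- real CARD('d) / 2)) * (LINT x|lborel. cis (- (x \<bullet> \<xi>)) * f x)"

section \<open>Sobolev spaces\<close>

text \<open>A tempered distribution is represented by its action on Schwartz functions; the values on
  other functions are irrelevant.  Only distributions whose Fourier transform is a function occur.\<close>

type_synonym 'd distr = "(real ^ 'd \<Rightarrow> complex) \<Rightarrow> complex"

definition tempered_fun :: "(real ^ 'd::finite \<Rightarrow> complex) \<Rightarrow> bool" where
  "tempered_fun f \<longleftrightarrow> f \<in> borel_measurable borel \<and>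
     (\<forall>\<phi>. schwartz \<phi> \<longrightarrow> integrable lborel (\<lambda>x. f x * \<phi> x))"

definition distr_of :: "(real ^ 'd::finite \<Rightarrow> complex) \<Rightarrow> 'd distr" where
  "distr_of f = (\<lambda>\<phi>. LINT x|lborel. f x * \<phi> x)"

text \<open>The Fourier transform of \<open>T\<close>, defined by duality, is the function \<open>g\<close>.\<close>

definition is_fourier_of_distr :: "'d::finite distr \<Rightarrow> (real ^ 'd \<Rightarrow> complex) \<Rightarrow> bool" where
  "is_fourier_of_distr T g \<longleftrightarrow> tempered_fun g \<and>
     (\<forall>\<phi>. schwartz \<phi> \<longrightarrow> T (fourier \<phi>) = distr_of g \<phi>)"

text \<open>Unique up to null sets when it exists; everything below is insensitive to the choice.\<close>

definition fourier_distr :: "'d::finite distr \<Rightarrow> real ^ 'd \<Rightarrow> complex" where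
  "fourier_distr T = (SOME g. is_fourier_of_distr T g)"

definition sobolev_weight :: "real \<Rightarrow> 'd::finite distr \<Rightarrow> real ^ 'd \<Rightarrow> real" where
  "sobolev_weight s T \<xi> = (1 + (norm \<xi>)\<^sup>2) powr s * (norm (fourier_distr T \<xi>))\<^sup>2"

definition sobolev_space :: "real \<Rightarrow> 'd::finite distr set" where
  "sobolev_space s = {T. (\<exists>g. is_fourier_of_distr T g) \<and> integrable lborel (sobolev_weight s T)}"

text \<open>The norm is \<open>\<infinity>\<close> outside the space, so that finiteness (in particular smallness) of the norm
  includes membership.\<close>

definition sobolev_norm :: "real \<Rightarrow> 'd::finite distr \<Rightarrow> ennreal" where
  "sobolev_norm s T =
     (if T \<in> sobolev_space s then ennreal (sqrt (LINT \<xi>|lborel. sobolev_weight s T \<xi>)) else \<infinity>)"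

text \<open>The argument \<open>- \<xi>\<close> turns the Fourier transform of the test function into its inverse Fourier
  transform: the resulting distribution has Fourier transform \<open>m \<cdot> fourier_distr T\<close>.\<close>

definition fourier_multiplier :: "(real ^ 'd::finite \<Rightarrow> complex) \<Rightarrow> 'd distr \<Rightarrow> 'd distr" where
  "fourier_multiplier m T =
     (\<lambda>\<phi>. LINT \<xi>|lborel. m \<xi> * fourier_distr T \<xi> * fourier \<phi> (- \<xi>))"

definition frac_laplacian :: "real \<Rightarrow> 'd::finite distr \<Rightarrow> 'd distr" where
  "frac_laplacian \<sigma> = fourier_multiplier (\<lambda>\<xi>. of_real (norm \<xi> powr (2 * \<sigma>)))"

section \<open>The Cauchy problem\<close>

definition nonlinearity :: "real \<Rightarrow> (real ^ 'd::finite \<Rightarrow> complex) \<Rightarrow> real ^ 'd \<Rightarrow> complex" where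
  "nonlinearity p u x = of_real (norm (u x) powr (p - 1)) * u x"

definition continuous_in_sobolev ::
    "real \<Rightarrow> real \<Rightarrow> (real \<Rightarrow> real ^ 'd::finite \<Rightarrow> complex) \<Rightarrow> bool" where
  "continuous_in_sobolev k T u \<longleftrightarrow>
     (\<forall>t\<in>{0..T}. tempered_fun (u t) \<and> distr_of (u t) \<in> sobolev_space k \<and>
        ((\<lambda>r. sobolev_norm k (distr_of (\<lambda>x. u r x - u t x))) \<longlongrightarrow> 0) (at t within {0..T}))"

text \<open>Solutions in \<open>C([0,T]; H\<^sup>k)\<close>.  The equation \<open>i \<partial>\<^sub>t u + (-\<Delta>)\<^sup>\<sigma> u + \<mu> \<bar>u\<bar>\<^bsup>p-1\<^esup> u = 0\<close> holds at every
  time in \<open>H\<^bsup>k-2\<sigma>\<^esup>\<close>, which contains \<open>(-\<Delta>)\<^sup>\<sigma> u(t)\<close>: the time derivative is the limit in that space of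
  the difference quotients (one-sided at the end points).\<close>

definition nls_solution ::
    "real \<Rightarrow> real \<Rightarrow> real \<Rightarrow> nat \<Rightarrow> real \<Rightarrow> (real ^ 'd::finite \<Rightarrow> complex)
      \<Rightarrow> (real \<Rightarrow> real ^ 'd \<Rightarrow> complex) \<Rightarrow> bool" where
  "nls_solution \<sigma> \<mu> p k T u0 u \<longleftrightarrow>
     continuous_in_sobolev (real k) T u \<and>
     (AE x in lborel. u 0 x = u0 x) \<and>
     (\<forall>t\<in>{0..T}.
        ((\<lambda>r. sobolev_norm (real k - 2 * \<sigma>)
            (\<lambda>\<phi>. \<i> * ((distr_of (u r) \<phi> - distr_of (u t) \<phi>) / of_real (r - t))
                 + frac_laplacian \<sigma> (distr_of (u t)) \<phi>
                 + of_real \<mu> * distr_of (nonlinearity p (u t)) \<phi>)) \<longlongrightarrow> 0)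
        (at t within {0..T}))"

text \<open>The first argument only fixes the dimension \<open>d = CARD('d)\<close>.\<close>

definition nls_ill_posed ::
    "'d::finite itself \<Rightarrow> real \<Rightarrow> real \<Rightarrow> real \<Rightarrow> nat \<Rightarrow> real \<Rightarrow> bool" where
  "nls_ill_posed _ \<sigma> \<mu> p k s \<longleftrightarrow>
     (\<forall>R>0. \<forall>T>0. \<exists>(u0 :: nat \<Rightarrow> real ^ 'd \<Rightarrow> complex) v0 \<tau> u v.
        (\<forall>n. schwartz (u0 n) \<and> schwartz (v0 n) \<and>
             sobolev_norm s (distr_of (u0 n)) \<le> ennreal R \<and>
             sobolev_norm s (distr_of (v0 n)) \<le> ennreal R) \<and>
        (\<lambda>n. sobolev_norm s (distr_of (\<lambda>x. u0 n x - v0 n x))) \<longlonglongrightarrow> 0 \<and>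
        (\<forall>n. \<tau> n \<in> {0..T} \<and>
             nls_solution \<sigma> \<mu> p k (\<tau> n) (u0 n) (u n) \<and>
             nls_solution \<sigma> \<mu> p k (\<tau> n) (v0 n) (v n)) \<and>
        0 < liminf (\<lambda>n. sobolev_norm s (distr_of (\<lambda>x. u n (\<tau> n) x - v n (\<tau> n) x))))"

end

theory Submission
  imports Defs "HOL-Probability.Probability"
begin

text \<open>Since \<open>s\<^sub>c < s < 0\<close> forces \<open>p < 1 + 4\<sigma>/d\<close>, the hypothesis on \<open>k\<close> leaves only \<open>d = 1\<close>, with \<open>p = 3\<close> or
  \<open>p \<ge> k + 1\<close>.  There the small dispersion argument applies.  In a frame moving with the group velocity of the
  frequency \<open>N\<close>, a solution \<open>A e\<^sup>i\<^sup>N\<^sup>x W(A\<^sup>p\<^sup>-\<^sup>1 t, x)\<close> has a profile \<open>W\<close> driven by a dispersion relation of size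
  \<open>O(N\<^sup>2\<^sup>\<sigma>\<^sup>-\<^sup>2 (1 + \<xi>\<^sup>2))\<close>, so that \<open>W\<close> stays close, in \<open>H\<^sup>k\<close> and up to the unimodular linear propagator, to the explicit
  solution \<open>\<phi> exp(i \<mu> t |\<phi>|\<^sup>p\<^sup>-\<^sup>1)\<close> of the equation without dispersion.  For the initial profiles \<open>\<phi>\<close> and \<open>b \<phi>\<close> with
  \<open>b\<close> close to \<open>1\<close> these explicit solutions are a fixed \<open>L\<^sup>2\<close> distance apart at a time \<open>K\<close> depending on \<open>b\<close> only.  With
  \<open>A = \<kappa> N\<^sup>-\<^sup>s\<close> the \<open>H\<^sup>s\<close> norms are of order \<open>\<kappa>\<close> uniformly in \<open>N\<close>, while the physical time \<open>K / A\<^sup>p\<^sup>-\<^sup>1\<close> tends to \<open>0\<close>;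
  \<open>N\<close> is chosen after \<open>b\<close>.

  The profile equation is solved by Picard iteration for the Fourier transform in the interaction picture.  Pointwise
  continuity and the weighted \<open>L\<^sup>2\<close> bounds on the Fourier side replace a topology on \<open>H\<^sup>k\<close>.\<close>

text \<open>Two obstacles shape the proof. First, |z|^q z with q = p - 1 has in general only
  finitely many bounded derivatives near 0. An H^k Lipschitz bound costs k + 1 of them, one for the
  difference and k for the norm, and |z|^q z is homogeneous of degree q + 1: hence the condition k
  <= q, while q = 2 gives a polynomial. The bound is proved for smooth regularisations and frequency
  cutoffs, uniformly in both, and passes to the limit by Fatou. Second, the reference solutions
  separate only after a time K = 1 / (b^q - 1), which blows up as b tends to 1, so the perturbation
  argument must reach arbitrary times. It does, because the error is of order N^(2\<sigma>-2), which
  tends to 0 for \<sigma> < 1, while the Gronwall factor exp(2LK) does not depend on N. The Gaussian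
  datum is positive and its powers are Gaussians, so the phase |\<phi>|^q is smooth for real q; this
  pays for the two derivatives that the factor 1 + \<xi>^2 in the symbol bound costs. Modulation,
  translation and gauge phase, which relate profile and solution, are exact symmetries of the
  nonlinearity.\<close>

section \<open>Weighted L2 bounds on the line\<close>

definition wt :: "(real \<Rightarrow> real) \<Rightarrow> bool" where
  "wt w \<longleftrightarrow> w \<in> borel_measurable borel \<and> (\<forall>x. 0 \<le> w x)"

text \<open>A bound instead of a norm: measurability and finiteness travel with it, and it is stable
  under limits both of \<open>B\<close> and of \<open>f\<close>.\<close>

definition L2b :: "(real \<Rightarrow> real) \<Rightarrow> real \<Rightarrow> (real \<Rightarrow> complex) \<Rightarrow> bool" where
  "L2b w B f \<longleftrightarrow> 0 \<le> B \<and> f \<in> borel_measurable borel \<and>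
     (\<integral>\<^sup>+x. ennreal (w x * (norm (f x))\<^sup>2) \<partial>lborel) \<le> ennreal (B\<^sup>2)"

lemma wt_measurable [measurable_dest]: "wt w \<Longrightarrow> w \<in> borel_measurable borel"
  by (simp add: wt_def)

lemma wt_nonneg: "wt w \<Longrightarrow> 0 \<le> w x"
  by (simp add: wt_def)

lemma wt_one [simp]: "wt (\<lambda>_. 1)"
  by (simp add: wt_def)

lemma L2b_measurable [measurable_dest]: "L2b w B f \<Longrightarrow> f \<in> borel_measurable borel"
  by (simp add: L2b_def)

lemma L2b_nonneg: "L2b w B f \<Longrightarrow> 0 \<le> B"
  by (simp add: L2b_def)

lemma L2b_le:
  assumes "wt w" "L2b w B f" "g \<in> borel_measurable borel" "0 \<le> c"
    and "\<And>x. w' x * (norm (g x))\<^sup>2 \<le> c\<^sup>2 * (w x * (norm (f x))\<^sup>2)"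
  shows "L2b w' (c * B) g"
proof -
  have [measurable]: "w \<in> borel_measurable borel" "f \<in> borel_measurable borel"
    using assms by (auto simp: wt_def L2b_def)
  have "(\<integral>\<^sup>+x. ennreal (w' x * (norm (g x))\<^sup>2) \<partial>lborel) \<le>
      (\<integral>\<^sup>+x. ennreal (c\<^sup>2) * ennreal (w x * (norm (f x))\<^sup>2) \<partial>lborel)"
    using assms(1,5) by (intro nn_integral_mono) (auto simp: ennreal_mult[symmetric] wt_def intro!: ennreal_leI)
  also have "\<dots> = ennreal (c\<^sup>2) * (\<integral>\<^sup>+x. ennreal (w x * (norm (f x))\<^sup>2) \<partial>lborel)"
    by (rule nn_integral_cmult) simp
  also have "\<dots> \<le> ennreal (c\<^sup>2) * ennreal (B\<^sup>2)"
    using assms(2) by (intro mult_left_mono) (auto simp: L2b_def)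
  also have "\<dots> = ennreal ((c * B)\<^sup>2)"
    by (simp add: ennreal_mult[symmetric] power_mult_distrib)
  finally show ?thesis using assms by (auto simp: L2b_def)
qed

lemma L2b_mono:
  assumes "wt w" "L2b w B f" "g \<in> borel_measurable borel"
    and "\<And>x. w' x * (norm (g x))\<^sup>2 \<le> w x * (norm (f x))\<^sup>2"
  shows "L2b w' B g"
  using L2b_le[OF assms(1-3), of 1 w'] assms(4) by simp

lemma L2b_mono_norm:
  assumes "wt w" "L2b w B f" "g \<in> borel_measurable borel" "\<And>x. norm (g x) \<le> norm (f x)"
  shows "L2b w B g"
  using assms by (intro L2b_mono[OF assms(1-3)]) (auto intro!: mult_left_mono power_mono simp: wt_def)

lemma L2b_mono_bound: "L2b w B f \<Longrightarrow> B \<le> C \<Longrightarrow> L2b w C f"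
  by (auto simp: L2b_def intro: order_trans ennreal_leI power_mono)

lemma L2b_mono_weight:
  assumes "wt w" "L2b w B f" "\<And>x. w' x \<le> w x"
  shows "L2b w' B f"
  by (rule L2b_mono[OF assms(1,2)]) (use assms in \<open>auto intro!: mult_right_mono simp: L2b_def\<close>)

lemma L2b_zero [simp]: "0 \<le> B \<Longrightarrow> L2b w B (\<lambda>_. 0)"
  by (simp add: L2b_def)

lemma L2b_cmult:
  assumes "wt w" "L2b w B f"
  shows "L2b w (norm c * B) (\<lambda>x. c * f x)"
proof -
  have "f \<in> borel_measurable borel" using assms by (auto simp: L2b_def)
  then show ?thesis
    by (intro L2b_le[OF assms]) (auto simp: norm_mult power_mult_distrib)
qed

lemma L2b_cnj:
  assumes "L2b w B f" shows "L2b w B (\<lambda>x. cnj (f x))"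
proof -
  have "(\<lambda>x. cnj (f x)) \<in> borel_measurable borel"
    by (rule measurable_compose[of f borel borel])
       (use assms in \<open>auto simp: L2b_def intro!: borel_measurable_continuous_onI[of cnj] continuous_intros\<close>)
  then show ?thesis using assms by (auto simp: L2b_def)
qed

lemma L2b_uminus:
  assumes "L2b w B f" shows "L2b w B (\<lambda>x. - f x)"
  using assms by (auto simp: L2b_def)

text \<open>Removes a positive slack: a bound proved with a margin 1/(n+1) holds without it.\<close>

lemma L2b_lim_bound:
  assumes "\<And>n. L2b w (b n) f" "b \<longlonglongrightarrow> B"
  shows "L2b w B f"
proof -
  have "(\<lambda>n. ennreal ((b n)\<^sup>2)) \<longlonglongrightarrow> ennreal (B\<^sup>2)"
    using assms(2) by (intro tendsto_ennrealI tendsto_power)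
  then have "(\<integral>\<^sup>+x. ennreal (w x * (norm (f x))\<^sup>2) \<partial>lborel) \<le> ennreal (B\<^sup>2)"
    by (rule LIMSEQ_le_const) (use assms(1) in \<open>auto simp: L2b_def\<close>)
  moreover have "0 \<le> B"
    by (rule LIMSEQ_le_const[OF assms(2)]) (use assms(1) in \<open>auto simp: L2b_def\<close>)
  ultimately show ?thesis using assms(1)[of 0] by (auto simp: L2b_def)
qed

text \<open>The pointwise inequality (u + v)^2 <= (1 + b/a) u^2 + (1 + a/b) v^2 integrates to
  exactly (a + b)^2 when a and b bound the two norms. Dividing by the bounds requires them to be
  positive, hence the slack \<open>d\<close>.\<close>

lemma L2b_add:
  assumes w: "wt w" and f: "L2b w A f" and g: "L2b w B g"
  shows "L2b w (A + B) (\<lambda>x. f x + g x)"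
proof -
  have [measurable]: "w \<in> borel_measurable borel" "f \<in> borel_measurable borel" "g \<in> borel_measurable borel"
    using assms by (auto simp: wt_def L2b_def)
  have AB: "0 \<le> A" "0 \<le> B" using f g by (auto simp: L2b_def)
  have "L2b w ((A + d) + (B + d)) (\<lambda>x. f x + g x)" if d: "d > 0" for d
  proof -
    define a b where "a = A + d" and "b = B + d"
    have ab: "a > 0" "b > 0" using AB d by (auto simp: a_def b_def)
    have fa: "L2b w a f" and gb: "L2b w b g"
      using f g d by (auto simp: a_def b_def intro: L2b_mono_bound)
    have pt: "w x * (norm (f x + g x))\<^sup>2 \<le>
       (1 + b / a) * (w x * (norm (f x))\<^sup>2) + (1 + a / b) * (w x * (norm (g x))\<^sup>2)" for x
    proof -
      define u v where "u = norm (f x)" and "v = norm (g x)"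
      have "0 \<le> (b * u - a * v)\<^sup>2 / (a * b)" using ab by simp
      also have "\<dots> = (b / a) * u\<^sup>2 + (a / b) * v\<^sup>2 - 2 * u * v"
        using ab by (simp add: field_simps power2_eq_square)
      finally have "(u + v)\<^sup>2 \<le> (1 + b / a) * u\<^sup>2 + (1 + a / b) * v\<^sup>2"
        by (simp add: power2_sum algebra_simps)
      moreover have "(norm (f x + g x))\<^sup>2 \<le> (u + v)\<^sup>2"
        by (intro power_mono) (auto simp: u_def v_def norm_triangle_ineq)
      ultimately have "w x * (norm (f x + g x))\<^sup>2 \<le> w x * ((1 + b / a) * u\<^sup>2 + (1 + a / b) * v\<^sup>2)"
        using wt_nonneg[OF w] by (intro mult_left_mono) auto
      then show ?thesis by (simp add: u_def v_def algebra_simps)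
    qed
    have nn: "0 \<le> w x" for x using w by (rule wt_nonneg)
    have "(\<integral>\<^sup>+x. ennreal (w x * (norm (f x + g x))\<^sup>2) \<partial>lborel) \<le>
       (\<integral>\<^sup>+x. ennreal (1 + b / a) * ennreal (w x * (norm (f x))\<^sup>2)
          + ennreal (1 + a / b) * ennreal (w x * (norm (g x))\<^sup>2) \<partial>lborel)"
      using pt ab nn
      by (intro nn_integral_mono) (auto simp flip: ennreal_mult ennreal_plus intro!: ennreal_leI)
    also have "\<dots> = ennreal (1 + b / a) * (\<integral>\<^sup>+x. ennreal (w x * (norm (f x))\<^sup>2) \<partial>lborel)
          + ennreal (1 + a / b) * (\<integral>\<^sup>+x. ennreal (w x * (norm (g x))\<^sup>2) \<partial>lborel)"
      by (simp add: nn_integral_add nn_integral_cmult)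
    also have "\<dots> \<le> ennreal (1 + b / a) * ennreal (a\<^sup>2) + ennreal (1 + a / b) * ennreal (b\<^sup>2)"
      using fa gb by (intro add_mono mult_left_mono) (auto simp: L2b_def)
    also have "\<dots> = ennreal ((1 + b / a) * a\<^sup>2 + (1 + a / b) * b\<^sup>2)"
      using ab by (simp flip: ennreal_mult ennreal_plus)
    also have "(1 + b / a) * a\<^sup>2 + (1 + a / b) * b\<^sup>2 = (a + b)\<^sup>2"
      using ab by (simp add: field_simps power2_eq_square)
    finally show ?thesis using ab by (auto simp: L2b_def a_def b_def)
  qed
  then have 1: "L2b w ((A + inverse (real (Suc n))) + (B + inverse (real (Suc n)))) (\<lambda>x. f x + g x)" for n
    by simp
  have "(\<lambda>n. (A + inverse (real (Suc n))) + (B + inverse (real (Suc n)))) \<longlonglongrightarrow> (A + 0) + (B + 0)"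
    by (intro tendsto_intros LIMSEQ_inverse_real_of_nat)
  from L2b_lim_bound[OF 1 this] show ?thesis by simp
qed

lemma L2b_diff:
  assumes "wt w" "L2b w A f" "L2b w B g"
  shows "L2b w (A + B) (\<lambda>x. f x - g x)"
  using L2b_add[OF assms(1,2) L2b_uminus[OF assms(3)]] by simp

text \<open>Convergence at every point takes the place of convergence in a norm. Gaussian factors,
  cutoffs, regularisations and Picard iterates are all removed in this way.\<close>

lemma L2b_Fatou:
  assumes w: "wt w" and f: "\<And>n. L2b w (b n) (f n)" and lim: "\<And>x. (\<lambda>n. f n x) \<longlonglongrightarrow> g x"
    and b: "b \<longlonglongrightarrow> B"
  shows "L2b w B g"
proof -
  have [measurable]: "w \<in> borel_measurable borel" "\<And>n. f n \<in> borel_measurable borel"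
    using assms by (auto simp: wt_def L2b_def)
  have g [measurable]: "g \<in> borel_measurable borel"
    by (rule borel_measurable_LIMSEQ_metric[of f]) (use lim in auto)
  have "(\<integral>\<^sup>+x. ennreal (w x * (norm (g x))\<^sup>2) \<partial>lborel) =
      (\<integral>\<^sup>+x. liminf (\<lambda>n. ennreal (w x * (norm (f n x))\<^sup>2)) \<partial>lborel)"
  proof (intro nn_integral_cong)
    fix x
    have "(\<lambda>n. ennreal (w x * (norm (f n x))\<^sup>2)) \<longlonglongrightarrow> ennreal (w x * (norm (g x))\<^sup>2)"
      by (intro tendsto_ennrealI tendsto_intros lim)
    then show "ennreal (w x * (norm (g x))\<^sup>2) = liminf (\<lambda>n. ennreal (w x * (norm (f n x))\<^sup>2))"
      by (simp add: lim_imp_Liminf)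
  qed
  also have "\<dots> \<le> liminf (\<lambda>n. \<integral>\<^sup>+x. ennreal (w x * (norm (f n x))\<^sup>2) \<partial>lborel)"
    by (rule nn_integral_liminf) simp
  also have "\<dots> \<le> liminf (\<lambda>n. ennreal ((b n)\<^sup>2))"
    by (rule Liminf_mono) (use f in \<open>auto simp: L2b_def\<close>)
  also have "\<dots> = ennreal (B\<^sup>2)"
  proof -
    have "(\<lambda>n. ennreal ((b n)\<^sup>2)) \<longlonglongrightarrow> ennreal (B\<^sup>2)"
      using b by (intro tendsto_ennrealI tendsto_power)
    then show ?thesis by (simp add: lim_imp_Liminf)
  qed
  finally have "(\<integral>\<^sup>+x. ennreal (w x * (norm (g x))\<^sup>2) \<partial>lborel) \<le> ennreal (B\<^sup>2)" .
  moreover have "0 \<le> B"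
    by (rule LIMSEQ_le_const[OF b]) (use f in \<open>auto simp: L2b_def\<close>)
  ultimately show ?thesis using g by (auto simp: L2b_def)
qed

lemma L2b_integrable:
  assumes "wt w" "L2b w B f"
  shows "integrable lborel (\<lambda>x. w x * (norm (f x))\<^sup>2)"
    and "(LINT x|lborel. w x * (norm (f x))\<^sup>2) \<le> B\<^sup>2"
proof -
  have [measurable]: "w \<in> borel_measurable borel" "f \<in> borel_measurable borel"
    using assms by (auto simp: wt_def L2b_def)
  have nn: "0 \<le> w x * (norm (f x))\<^sup>2" for x using wt_nonneg[OF assms(1)] by simp
  show int: "integrable lborel (\<lambda>x. w x * (norm (f x))\<^sup>2)"
  proof (rule integrableI_nonneg)
    show "(\<integral>\<^sup>+x. ennreal (w x * (norm (f x))\<^sup>2) \<partial>lborel) < \<infinity>"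
      using assms(2) by (auto simp: L2b_def intro: le_less_trans)
  qed (use nn in auto)
  have "ennreal (LINT x|lborel. w x * (norm (f x))\<^sup>2) = (\<integral>\<^sup>+x. ennreal (w x * (norm (f x))\<^sup>2) \<partial>lborel)"
    using nn by (intro nn_integral_eq_integral[symmetric] int) auto
  also have "\<dots> \<le> ennreal (B\<^sup>2)" using assms by (simp add: L2b_def)
  finally show "(LINT x|lborel. w x * (norm (f x))\<^sup>2) \<le> B\<^sup>2" by (simp add: ennreal_le_iff)
qed

lemma L2bI:
  assumes "f \<in> borel_measurable borel" "wt w" "integrable lborel (\<lambda>x. w x * (norm (f x))\<^sup>2)"
    and "(LINT x|lborel. w x * (norm (f x))\<^sup>2) \<le> B\<^sup>2" "0 \<le> B"
  shows "L2b w B f"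
proof -
  have "(\<integral>\<^sup>+x. ennreal (w x * (norm (f x))\<^sup>2) \<partial>lborel) = ennreal (LINT x|lborel. w x * (norm (f x))\<^sup>2)"
    using wt_nonneg[OF assms(2)] by (intro nn_integral_eq_integral assms(3)) auto
  then show ?thesis using assms by (auto simp: L2b_def intro!: ennreal_leI)
qed

lemma L2b_prod_integrable:
  assumes "L2b (\<lambda>_. 1) A f" "L2b (\<lambda>_. 1) B g"
  shows "integrable lborel (\<lambda>x. f x * g x)" "(LINT x|lborel. norm (f x * g x)) \<le> A * B"
proof -
  have [measurable]: "f \<in> borel_measurable borel" "g \<in> borel_measurable borel"
    using assms by (auto simp: L2b_def)
  define I where "I = (\<integral>\<^sup>+x. ennreal (norm (f x * g x)) \<partial>lborel)"
  have "I\<^sup>2 = (\<integral>\<^sup>+x. ennreal (norm (f x)) * ennreal (norm (g x)) \<partial>lborel)\<^sup>2"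
    by (simp add: I_def norm_mult ennreal_mult)
  also have "\<dots> \<le> (\<integral>\<^sup>+x. (ennreal (norm (f x)))\<^sup>2 \<partial>lborel) * (\<integral>\<^sup>+x. (ennreal (norm (g x)))\<^sup>2 \<partial>lborel)"
    by (rule Cauchy_Schwarz_nn_integral) auto
  also have "\<dots> \<le> ennreal (A\<^sup>2) * ennreal (B\<^sup>2)"
    using assms by (intro mult_mono) (auto simp: L2b_def ennreal_power)
  also have "\<dots> = (ennreal (A * B))\<^sup>2"
    using assms by (simp add: L2b_def ennreal_mult[symmetric] ennreal_power power_mult_distrib)
  finally have "I\<^sup>2 \<le> (ennreal (A * B))\<^sup>2" .
  \<comment> \<open>The square root is taken among extended reals, so the infinite case of
    \<open>I\<close> is excluded separately.\<close>
  then have I: "I \<le> ennreal (A * B)"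
  proof (cases I)
    case (real r)
    with \<open>I\<^sup>2 \<le> _\<close> assms have "r\<^sup>2 \<le> (A * B)\<^sup>2"
      by (simp add: ennreal_power L2b_def)
    then show ?thesis using real assms
      by (auto simp: L2b_def intro!: ennreal_leI power2_le_imp_le[of r])
  qed (use \<open>I\<^sup>2 \<le> _\<close> assms in \<open>simp add: ennreal_power L2b_def top_unique\<close>)
  have *: "integrable lborel (\<lambda>x. norm (f x * g x))"
    by (rule integrableI_nonneg) (use I in \<open>auto simp: I_def intro: le_less_trans\<close>)
  then show "integrable lborel (\<lambda>x. f x * g x)"
    by (rule Bochner_Integration.integrable_norm_cancel) simp
  have "ennreal (LINT x|lborel. norm (f x * g x)) = I"
    unfolding I_def by (intro nn_integral_eq_integral[symmetric] *) auto
  with I show "(LINT x|lborel. norm (f x * g x)) \<le> A * B"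
    using assms ennreal_le_iff[of "A * B"] by (auto simp: L2b_def)
qed

section \<open>Integrals over a time strip\<close>

lemma borel_measurable_strip:
  fixes H :: "real \<Rightarrow> real \<Rightarrow> 'b::{second_countable_topology,real_normed_vector}"
  assumes "continuous_on ({a..b} \<times> UNIV) (\<lambda>(s, x). H s x)"
  shows "(\<lambda>(s, x). indicator {a..b} s *\<^sub>R H s x) \<in> borel_measurable (borel \<Otimes>\<^sub>M borel)"
proof -
  have "(\<lambda>z. indicator ({a..b} \<times> UNIV) z *\<^sub>R (case z of (s, x) \<Rightarrow> H s x)) \<in> borel_measurable borel"
    by (rule borel_measurable_continuous_on_indicator[OF _ assms])
       (intro borel_closed closed_Times; simp)
  also have "(\<lambda>z. indicator ({a..b} \<times> UNIV) z *\<^sub>R (case z of (s, x) \<Rightarrow> H s x)) =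
      (\<lambda>(s, x). indicator {a..b} s *\<^sub>R H s x)"
    by (auto simp: fun_eq_iff indicator_def)
  finally show ?thesis by (simp add: borel_prod)
qed

lemma continuous_on_strip_section:
  fixes H :: "real \<Rightarrow> real \<Rightarrow> 'b::topological_space"
  assumes "continuous_on ({a..b} \<times> UNIV) (\<lambda>(s, x). H s x)"
  shows "continuous_on {a..b} (\<lambda>s. H s x)"
proof -
  have "continuous_on {a..b} (\<lambda>s. (\<lambda>(s, x). H s x) (s, x))"
    by (rule continuous_on_compose2[OF assms]) (auto intro!: continuous_intros)
  then show ?thesis by simp
qed

lemma continuous_on_strip_section2:
  fixes H :: "real \<Rightarrow> real \<Rightarrow> 'b::topological_space"
  assumes "continuous_on ({a..b} \<times> UNIV) (\<lambda>(s, x). H s x)" "s \<in> {a..b}"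
  shows "continuous_on UNIV (H s)"
proof -
  have "continuous_on UNIV (\<lambda>x. (\<lambda>(s, x). H s x) (s, x))"
    by (rule continuous_on_compose2[OF assms(1)]) (use assms(2) in \<open>auto intro!: continuous_intros\<close>)
  then show ?thesis by simp
qed

lemma integral_strip_eq_LINT:
  fixes H :: "real \<Rightarrow> complex"
  assumes "continuous_on {a..b} H"
  shows "integral {a..b} H = (LINT s|lborel. indicator {a..b} s *\<^sub>R H s)"
    and "integrable lborel (\<lambda>s. indicator {a..b} s *\<^sub>R H s)"
proof -
  have *: "set_integrable lborel {a..b} H"
    using borel_integrable_compact[of "{a..b}" H] assms by (simp add: set_integrable_def)
  then show "integrable lborel (\<lambda>s. indicator {a..b} s *\<^sub>R H s)" by (simp add: set_integrable_def)
  from set_borel_integral_eq_integral(2)[OF *]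
  show "integral {a..b} H = (LINT s|lborel. indicator {a..b} s *\<^sub>R H s)"
    by (simp add: set_lebesgue_integral_def)
qed

text \<open>Cauchy--Schwarz with the weight \<open>a\<close> in time, followed by Tonelli.\<close>

lemma Minkowski_strip:
  fixes H :: "real \<Rightarrow> real \<Rightarrow> complex" and a :: "real \<Rightarrow> real"
  assumes w: "wt w" and cont: "continuous_on ({0..t} \<times> UNIV) (\<lambda>(s, x). H s x)"
    and L: "\<And>s. s \<in> {0..t} \<Longrightarrow> L2b w (a s) (H s)"
    and a: "continuous_on {0..t} a" "\<And>s. s \<in> {0..t} \<Longrightarrow> 0 < a s"
  shows "L2b w (integral {0..t} a) (\<lambda>x. integral {0..t} (\<lambda>s. H s x))"
proof -
  note [measurable] = borel_measurable_strip[OF cont]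
  have [measurable]: "w \<in> borel_measurable borel" using w by (simp add: wt_def)
  note cs = continuous_on_strip_section[OF cont]
  define A where "A = integral {0..t} a"
  have aint: "set_integrable lborel {0..t} a"
    using borel_integrable_compact[of "{0..t}" a] a(1) by (simp add: set_integrable_def)
  have am [measurable]: "(\<lambda>s. indicator {0..t} s *\<^sub>R a s) \<in> borel_measurable borel"
    using aint by (auto simp: set_integrable_def dest: borel_measurable_integrable)
  have A: "(\<integral>\<^sup>+s. ennreal (indicator {0..t} s *\<^sub>R a s) \<partial>lborel) = ennreal A"
  proof -
    have "A = (LINT s|lborel. indicator {0..t} s *\<^sub>R a s)"
      using set_borel_integral_eq_integral(2)[OF aint] by (simp add: A_def set_lebesgue_integral_def)
    then show ?thesis
      using aint a(2) by (auto simp: set_integrable_def indicator_def less_imp_le intro!: nn_integral_eq_integral)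
  qed
  have A0: "0 \<le> A" unfolding A_def using a(2) by (intro integral_nonneg) (auto intro: less_imp_le set_borel_integral_eq_integral(1)[OF aint])
  define h where "h s x = norm (indicator {0..t} s *\<^sub>R H s x)" for s x
  have [measurable]: "(\<lambda>(s, x). h s x) \<in> borel_measurable (borel \<Otimes>\<^sub>M borel)"
    unfolding h_def by measurable
  define \<alpha> where "\<alpha> s = indicator {0..t} s *\<^sub>R a s" for s
  have [measurable]: "\<alpha> \<in> borel_measurable borel" using am by (simp add: \<alpha>_def[abs_def])
  define b where "b s = sqrt (\<alpha> s)" for s
  have [measurable]: "b \<in> borel_measurable borel" unfolding b_def by measurable
  have b0: "0 \<le> b s" "(b s)\<^sup>2 = \<alpha> s" for s
    using a(2)[of s] by (auto simp: b_def \<alpha>_def indicator_def less_imp_le)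
  \<comment> \<open>Off the time interval \<open>h\<close> and \<open>b\<close> both vanish, and
    division by zero yields zero; inside it \<open>b\<close> is positive.\<close>
  have split: "h s x = b s * (h s x / b s)" for s x
    using a(2)[of s] by (auto simp: h_def b_def \<alpha>_def indicator_def)
  have pt: "ennreal (w x * (norm (integral {0..t} (\<lambda>s. H s x)))\<^sup>2) \<le>
      ennreal A * (\<integral>\<^sup>+s. ennreal (w x * (h s x / b s)\<^sup>2) \<partial>lborel)" for x
  proof -
    note i = integral_strip_eq_LINT[OF cs[of x]]
    have "norm (integral {0..t} (\<lambda>s. H s x)) \<le> (LINT s|lborel. h s x)"
      unfolding i(1) h_def by (rule integral_norm_bound)
    then have "ennreal (norm (integral {0..t} (\<lambda>s. H s x))) \<le> (\<integral>\<^sup>+s. ennreal (h s x) \<partial>lborel)"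
      using integrable_norm[OF i(2)] by (subst nn_integral_eq_integral) (auto simp: h_def[abs_def] intro!: ennreal_leI simp del: norm_scaleR)
    also have "\<dots> = (\<integral>\<^sup>+s. ennreal (b s) * ennreal (h s x / b s) \<partial>lborel)"
      using split b0 by (intro nn_integral_cong) (auto simp: ennreal_mult[symmetric] h_def)
    finally have "(ennreal (norm (integral {0..t} (\<lambda>s. H s x))))\<^sup>2 \<le>
        (\<integral>\<^sup>+s. ennreal (b s) * ennreal (h s x / b s) \<partial>lborel)\<^sup>2"
      by (rule power_mono) simp
    also have "\<dots> \<le> (\<integral>\<^sup>+s. (ennreal (b s))\<^sup>2 \<partial>lborel) * (\<integral>\<^sup>+s. (ennreal (h s x / b s))\<^sup>2 \<partial>lborel)"
      by (rule Cauchy_Schwarz_nn_integral) measurable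
    also have "(\<integral>\<^sup>+s. (ennreal (b s))\<^sup>2 \<partial>lborel) = ennreal A"
      using A b0 by (simp add: ennreal_power \<alpha>_def)
    also have "(\<integral>\<^sup>+s. (ennreal (h s x / b s))\<^sup>2 \<partial>lborel) = (\<integral>\<^sup>+s. ennreal ((h s x / b s)\<^sup>2) \<partial>lborel)"
      using b0 by (intro nn_integral_cong ennreal_power) (auto simp: h_def)
    finally have *: "(ennreal (norm (integral {0..t} (\<lambda>s. H s x))))\<^sup>2 \<le>
        ennreal A * (\<integral>\<^sup>+s. ennreal ((h s x / b s)\<^sup>2) \<partial>lborel)" .
    have "ennreal (w x * (norm (integral {0..t} (\<lambda>s. H s x)))\<^sup>2) =
        ennreal (w x) * (ennreal (norm (integral {0..t} (\<lambda>s. H s x))))\<^sup>2"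
      using wt_nonneg[OF w] by (simp add: ennreal_mult ennreal_power)
    also have "\<dots> \<le> ennreal (w x) * (ennreal A * (\<integral>\<^sup>+s. ennreal ((h s x / b s)\<^sup>2) \<partial>lborel))"
      using * by (rule mult_left_mono) simp
    also have "\<dots> = ennreal A * (ennreal (w x) * (\<integral>\<^sup>+s. ennreal ((h s x / b s)\<^sup>2) \<partial>lborel))"
      by (simp add: ac_simps)
    also have "ennreal (w x) * (\<integral>\<^sup>+s. ennreal ((h s x / b s)\<^sup>2) \<partial>lborel) =
       (\<integral>\<^sup>+s. ennreal (w x * (h s x / b s)\<^sup>2) \<partial>lborel)"
      using wt_nonneg[OF w] by (subst nn_integral_cmult[symmetric]) (auto simp: ennreal_mult)
    finally show ?thesis .
  qed
  have meas: "(\<lambda>x. integral {0..t} (\<lambda>s. H s x)) \<in> borel_measurable borel"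
  proof -
    have "(\<lambda>x. LINT s|lborel. indicator {0..t} s *\<^sub>R H s x) \<in> borel_measurable borel"
      by measurable
    then show ?thesis using integral_strip_eq_LINT(1)[OF cs] by simp
  qed
  have "(\<integral>\<^sup>+x. ennreal (w x * (norm (integral {0..t} (\<lambda>s. H s x)))\<^sup>2) \<partial>lborel) \<le>
      (\<integral>\<^sup>+x. ennreal A * (\<integral>\<^sup>+s. ennreal (w x * (h s x / b s)\<^sup>2) \<partial>lborel) \<partial>lborel)"
    by (intro nn_integral_mono pt)
  also have "\<dots> = ennreal A * (\<integral>\<^sup>+x. (\<integral>\<^sup>+s. ennreal (w x * (h s x / b s)\<^sup>2) \<partial>lborel) \<partial>lborel)"
    by (rule nn_integral_cmult) measurable
  also have "(\<integral>\<^sup>+x. (\<integral>\<^sup>+s. ennreal (w x * (h s x / b s)\<^sup>2) \<partial>lborel) \<partial>lborel) =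
      (\<integral>\<^sup>+s. (\<integral>\<^sup>+x. ennreal (w x * (h s x / b s)\<^sup>2) \<partial>lborel) \<partial>lborel)"
    by (rule lborel_pair.Fubini') measurable
  also have "\<dots> \<le> (\<integral>\<^sup>+s. ennreal (indicator {0..t} s *\<^sub>R a s) \<partial>lborel)"
  proof (intro nn_integral_mono)
    fix s
    show "(\<integral>\<^sup>+x. ennreal (w x * (h s x / b s)\<^sup>2) \<partial>lborel) \<le> ennreal (indicator {0..t} s *\<^sub>R a s)"
    proof (cases "s \<in> {0..t}")
      case True
      have as: "0 < a s" using a(2) True by simp
      \<comment> \<open>Dividing by the square root of \<open>a s\<close> turns the squared bound (a
        s)^2 into \<open>a s\<close>, whose time integral is the second factor A of A^2.\<close>
      have "L2b w (1 / sqrt (a s) * a s) (\<lambda>x. H s x / of_real (sqrt (a s)))"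
      proof (rule L2b_le[OF w L[OF True]])
        show "(\<lambda>x. H s x / complex_of_real (sqrt (a s))) \<in> borel_measurable borel"
          using L[OF True] by (auto simp: L2b_def)
      qed (use as in \<open>auto simp: norm_divide power_divide\<close>)
      moreover have "(1 / sqrt (a s) * a s)\<^sup>2 = a s"
        using as by (simp add: power_mult_distrib power_divide power2_eq_square)
      ultimately have "(\<integral>\<^sup>+x. ennreal (w x * (norm (H s x / of_real (sqrt (a s))))\<^sup>2) \<partial>lborel) \<le> ennreal (a s)"
        by (simp add: L2b_def)
      moreover have "h s x / b s = norm (H s x / of_real (sqrt (a s)))" for x
        using True as by (simp add: h_def b_def \<alpha>_def norm_divide)
      ultimately show ?thesis using True by simp
    qed (simp add: h_def)
  qed
  also have "\<dots> = ennreal A" by (rule A)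
  finally have "(\<integral>\<^sup>+x. ennreal (w x * (norm (integral {0..t} (\<lambda>s. H s x)))\<^sup>2) \<partial>lborel) \<le> ennreal (A\<^sup>2)"
    using A0 by (simp add: mult_left_mono ennreal_mult power2_eq_square)
  then show ?thesis using A0 meas by (auto simp: L2b_def A_def)
qed

lemma Minkowski_strip_const:
  fixes H :: "real \<Rightarrow> real \<Rightarrow> complex"
  assumes w: "wt w" and cont: "continuous_on ({0..t} \<times> UNIV) (\<lambda>(s, x). H s x)"
    and L: "\<And>s. s \<in> {0..t} \<Longrightarrow> L2b w a (H s)" and a: "0 \<le> a" "0 \<le> t"
  shows "L2b w (a * t) (\<lambda>x. integral {0..t} (\<lambda>s. H s x))"
proof -
  \<comment> \<open>\<open>Minkowski_strip\<close> divides by the bound, so a constant that may be 0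
    is first made positive.\<close>
  have "L2b w (integral {0..t} (\<lambda>_. a + inverse (real (Suc n)))) (\<lambda>x. integral {0..t} (\<lambda>s. H s x))" for n
    by (rule Minkowski_strip[OF w cont]) (use a in \<open>auto intro!: add_nonneg_pos L2b_mono_bound[OF L]\<close>)
  then have 1: "L2b w ((a + inverse (real (Suc n))) * t) (\<lambda>x. integral {0..t} (\<lambda>s. H s x))" for n
    using a by (simp add: mult.commute)
  have "(\<lambda>n. (a + inverse (real (Suc n))) * t) \<longlonglongrightarrow> (a + 0) * t"
    by (intro tendsto_intros LIMSEQ_inverse_real_of_nat)
  from L2b_lim_bound[OF 1 this] show ?thesis by simp
qed

section \<open>The Fourier transform on the line\<close>

definition ft :: "(real \<Rightarrow> complex) \<Rightarrow> real \<Rightarrow> complex" where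
  "ft f \<xi> = of_real (1 / sqrt (2 * pi)) * (LINT x|lborel. cis (- (x * \<xi>)) * f x)"

text \<open>In the unitary normalisation the inverse transform is the reflected transform, so every
  estimate for \<open>ft\<close> transfers by reflection.\<close>

definition ift :: "(real \<Rightarrow> complex) \<Rightarrow> real \<Rightarrow> complex" where
  "ift f x = ft f (- x)"

lemma cis_measurable [measurable]: "cis \<in> borel_measurable borel"
  by (intro borel_measurable_continuous_onI continuous_intros)

lemma cnj_measurable [measurable]: "cnj \<in> borel_measurable borel"
  by (intro borel_measurable_continuous_onI continuous_intros)

lemma integrable_cis_mult:
  assumes "integrable lborel f" "g \<in> borel_measurable borel"
  shows "integrable lborel (\<lambda>x. cis (g x) * f x)"
proof -
  have [measurable]: "f \<in> borel_measurable borel" using assms(1) by auto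
  note [measurable] = assms(2)
  show ?thesis
    by (rule Bochner_Integration.integrable_bound[OF assms(1)]) (auto simp: norm_mult)
qed

lemma ift_eq: "ift f x = of_real (1 / sqrt (2 * pi)) * (LINT \<xi>|lborel. cis (x * \<xi>) * f \<xi>)"
  by (simp add: ift_def ft_def mult.commute)

lemma inverse_sqrt_2pi_le_1: "1 / sqrt (2 * pi) \<le> 1"
proof -
  have "1 \<le> sqrt (2 * pi)" using pi_ge_two by (simp add: real_le_rsqrt)
  then show ?thesis by simp
qed

lemma norm_ft_le: "norm (ft f \<xi>) \<le> (LINT x|lborel. norm (f x))"
proof -
  have "norm (ft f \<xi>) = 1 / sqrt (2 * pi) * norm (LINT x|lborel. cis (- (x * \<xi>)) * f x)"
    by (simp add: ft_def norm_mult norm_divide)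
  also have "\<dots> \<le> 1 * norm (LINT x|lborel. cis (- (x * \<xi>)) * f x)"
    by (rule mult_right_mono[OF inverse_sqrt_2pi_le_1]) simp
  also have "\<dots> \<le> (LINT x|lborel. norm (f x))"
    using integral_norm_bound[of lborel "\<lambda>x. cis (- (x * \<xi>)) * f x"] by (simp add: norm_mult)
  finally show ?thesis .
qed

lemma norm_ift_le: "norm (ift f \<xi>) \<le> (LINT x|lborel. norm (f x))"
  unfolding ift_def by (rule norm_ft_le)

lemma ft_add:
  assumes "integrable lborel f" "integrable lborel g"
  shows "ft (\<lambda>x. f x + g x) \<xi> = ft f \<xi> + ft g \<xi>"
  using assms by (simp add: ft_def ring_distribs integrable_cis_mult)

lemma ft_diff:
  assumes "integrable lborel f" "integrable lborel g"
  shows "ft (\<lambda>x. f x - g x) \<xi> = ft f \<xi> - ft g \<xi>"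
  using assms by (simp add: ft_def ring_distribs integrable_cis_mult)

lemma ft_cmult: "ft (\<lambda>x. c * f x) \<xi> = c * ft f \<xi>"
proof -
  have "(LINT x|lborel. cis (- (x * \<xi>)) * (c * f x)) = c * (LINT x|lborel. cis (- (x * \<xi>)) * f x)"
    by (subst integral_mult_right_zero[symmetric]) (simp add: mult.left_commute)
  then show ?thesis by (simp add: ft_def)
qed

lemma ft_zero [simp]: "ft (\<lambda>_. 0) \<xi> = 0"
  by (simp add: ft_def)

lemma ift_add:
  assumes "integrable lborel f" "integrable lborel g"
  shows "ift (\<lambda>x. f x + g x) \<xi> = ift f \<xi> + ift g \<xi>"
  using ft_add[OF assms] by (simp add: ift_def)

lemma ift_diff:
  assumes "integrable lborel f" "integrable lborel g"
  shows "ift (\<lambda>x. f x - g x) \<xi> = ift f \<xi> - ift g \<xi>"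
  using ft_diff[OF assms] by (simp add: ift_def)

lemma ift_cmult: "ift (\<lambda>x. c * f x) \<xi> = c * ift f \<xi>"
  by (simp add: ift_def ft_cmult)

lemma lborel_integral_shift:
  fixes f :: "real \<Rightarrow> 'a::{banach, second_countable_topology}"
  shows "(LINT x|lborel. f (x + y)) = (LINT x|lborel. f x)"
  using lborel_integral_real_affine[of 1 f y] by (simp add: add.commute)

lemma lborel_integrable_shift:
  fixes f :: "real \<Rightarrow> 'a::{banach, second_countable_topology}"
  assumes "integrable lborel f" shows "integrable lborel (\<lambda>x. f (x + y))"
  using lborel_integrable_real_affine[OF assms, of 1 y] by (simp add: add.commute)

lemma ft_shift: "ft (\<lambda>x. f (x + y)) \<xi> = cis (y * \<xi>) * ft f \<xi>"
proof -
  have "(LINT x|lborel. cis (- (x * \<xi>)) * f x) = (LINT x|lborel. cis (- ((x + y) * \<xi>)) * f (x + y))"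
    by (rule lborel_integral_shift[symmetric])
  also have "\<dots> = (LINT x|lborel. cis (- (y * \<xi>)) * (cis (- (x * \<xi>)) * f (x + y)))"
    by (intro Bochner_Integration.integral_cong) (auto simp: cis_mult algebra_simps simp flip: mult.assoc)
  also have "\<dots> = cis (- (y * \<xi>)) * (LINT x|lborel. cis (- (x * \<xi>)) * f (x + y))"
    by (rule integral_mult_right_zero)
  finally have "cis (y * \<xi>) * (LINT x|lborel. cis (- (x * \<xi>)) * f x) =
      (LINT x|lborel. cis (- (x * \<xi>)) * f (x + y))"
    by (simp add: cis_mult flip: mult.assoc)
  then show ?thesis by (simp add: ft_def mult.left_commute)
qed

lemma ft_modulate: "ft (\<lambda>x. cis (N * x) * f x) \<xi> = ft f (\<xi> - N)"
proof -
  have "cis (- (x * \<xi>)) * (cis (N * x) * f x) = cis (- (x * (\<xi> - N))) * f x" for x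
  proof -
    have "cis (- (x * (\<xi> - N))) = cis (- (x * \<xi>)) * cis (N * x)"
      by (simp add: cis_mult algebra_simps)
    then show ?thesis by simp
  qed
  then show ?thesis by (simp only: ft_def)
qed

text \<open>Dominated convergence along sequences in both variables at once; the majorant
  \<open>g\<close> serves all parameters.\<close>

lemma ft_param_continuous:
  fixes h :: "real \<Rightarrow> real \<Rightarrow> complex"
  assumes h: "\<And>x. continuous_on S (\<lambda>s. h s x)" and m: "\<And>s. s \<in> S \<Longrightarrow> h s \<in> borel_measurable borel"
    and g: "integrable lborel g" and b: "\<And>s x. s \<in> S \<Longrightarrow> norm (h s x) \<le> g x"
  shows "continuous_on (S \<times> UNIV) (\<lambda>(s, \<xi>). ft (h s) \<xi>)"
proof (rule continuous_on_sequentiallyI)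
  fix u :: "nat \<Rightarrow> real \<times> real" and a
  assume u: "\<forall>n. u n \<in> S \<times> UNIV" and a: "a \<in> S \<times> UNIV" and lim: "u \<longlonglongrightarrow> a"
  have l1: "(\<lambda>n. fst (u n)) \<longlonglongrightarrow> fst a" and l2: "(\<lambda>n. snd (u n)) \<longlonglongrightarrow> snd a"
    using lim by (auto intro: tendsto_fst tendsto_snd)
  have [measurable]: "h (fst (u n)) \<in> borel_measurable borel" for n
    using u by (intro m) (auto simp: mem_Times_iff)
  have [measurable]: "h (fst a) \<in> borel_measurable borel"
    using a by (intro m) (auto simp: mem_Times_iff)
  have "(\<lambda>n. LINT x|lborel. cis (- (x * snd (u n))) * h (fst (u n)) x) \<longlonglongrightarrow>
      (LINT x|lborel. cis (- (x * snd a)) * h (fst a) x)"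
  proof (rule integral_dominated_convergence[OF _ _ g])
    show "AE x in lborel. (\<lambda>n. cis (- (x * snd (u n))) * h (fst (u n)) x) \<longlonglongrightarrow> cis (- (x * snd a)) * h (fst a) x"
    proof (intro AE_I2 tendsto_mult)
      fix x
      have "continuous_on UNIV cis" by (intro continuous_intros)
      then have "isCont cis (- (x * snd a))" by (simp add: continuous_on_eq_continuous_at)
      then show "(\<lambda>n. cis (- (x * snd (u n)))) \<longlonglongrightarrow> cis (- (x * snd a))"
        by (rule isCont_tendsto_compose) (intro tendsto_intros l2)
      show "(\<lambda>n. h (fst (u n)) x) \<longlonglongrightarrow> h (fst a) x"
        using h[of x] l1 u a unfolding continuous_on_sequentially comp_def
        by (auto simp: mem_Times_iff)
    qed
    show "AE x in lborel. norm (cis (- (x * snd (u n))) * h (fst (u n)) x) \<le> g x" for n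
      using b u by (auto simp: norm_mult mem_Times_iff)
  qed auto
  then show "(\<lambda>n. case u n of (s, \<xi>) \<Rightarrow> ft (h s) \<xi>) \<longlonglongrightarrow> (case a of (s, \<xi>) \<Rightarrow> ft (h s) \<xi>)"
    unfolding ft_def case_prod_beta by (intro tendsto_intros)
qed

lemma ft_continuous:
  assumes "integrable lborel f" shows "continuous_on A (ft f)"
proof -
  have "continuous_on ({0::real} \<times> UNIV) (\<lambda>(s, \<xi>). ft f \<xi>)"
    by (rule ft_param_continuous[where h="\<lambda>_. f" and g="\<lambda>x. norm (f x)"]) (use assms in auto)
  then have "continuous_on UNIV (\<lambda>\<xi>. (\<lambda>(s, \<xi>). ft f \<xi>) (0::real, \<xi>))"
    by (rule continuous_on_compose2) (auto intro!: continuous_intros)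
  then show ?thesis by (auto intro: continuous_on_subset)
qed

lemma ft_measurable [measurable]:
  assumes "integrable lborel f" shows "ft f \<in> borel_measurable borel"
  using ft_continuous[OF assms] by (rule borel_measurable_continuous_onI)

lemma ift_continuous:
  assumes "integrable lborel f" shows "continuous_on A (ift f)"
  unfolding ift_def[abs_def]
  by (rule continuous_on_compose2[OF ft_continuous[OF assms, of UNIV]]) (auto intro!: continuous_intros)

lemma ift_measurable [measurable]:
  assumes "integrable lborel f" shows "ift f \<in> borel_measurable borel"
  using ift_continuous[OF assms] by (rule borel_measurable_continuous_onI)

lemma swap_integrals:
  fixes f :: "real \<Rightarrow> real \<Rightarrow> complex"
  assumes g: "integrable lborel g" and h: "integrable lborel h"
    and f [measurable]: "(\<lambda>(x, y). f x y) \<in> borel_measurable (borel \<Otimes>\<^sub>M borel)"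
    and b: "\<And>x y. norm (f x y) \<le> g x * h y"
  shows "(LINT x|lborel. LINT y|lborel. f x y) = (LINT y|lborel. LINT x|lborel. f x y)"
proof -
  have fy: "integrable lborel (f x)" for x
  proof (rule Bochner_Integration.integrable_bound)
    show "integrable lborel (\<lambda>y. g x * h y)" using h by simp
    show "AE y in lborel. norm (f x y) \<le> norm (g x * h y)"
      using b by (auto intro: order_trans[OF _ abs_ge_self])
  qed measurable
  have "integrable (lborel \<Otimes>\<^sub>M lborel) (\<lambda>(x, y). f x y)"
  proof (rule lborel_pair.Fubini_integrable)
    show "AE x in lborel. integrable lborel (\<lambda>y. case (x, y) of (x, y) \<Rightarrow> f x y)"
      using fy by simp
    show "integrable lborel (\<lambda>x. LINT y|lborel. norm (case (x, y) of (x, y) \<Rightarrow> f x y))"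
    proof (rule Bochner_Integration.integrable_bound)
      show "integrable lborel (\<lambda>x. g x * (LINT y|lborel. h y))" using g by simp
      show "AE x in lborel. norm (LINT y|lborel. norm (case (x, y) of (x, y) \<Rightarrow> f x y))
          \<le> norm (g x * (LINT y|lborel. h y))"
      proof (intro AE_I2)
        fix x
        have "(LINT y|lborel. norm (f x y)) \<le> (LINT y|lborel. g x * h y)"
          using fy h b by (intro integral_mono) auto
        moreover have "0 \<le> (LINT y|lborel. norm (f x y))" by simp
        ultimately show "norm (LINT y|lborel. norm (case (x, y) of (x, y) \<Rightarrow> f x y))
          \<le> norm (g x * (LINT y|lborel. h y))" by simp
      qed
    qed measurable
  qed measurable
  from lborel_pair.Fubini_integral[OF this] show ?thesis by simp
qed

lemma ft_integral_strip:
  fixes h :: "real \<Rightarrow> real \<Rightarrow> complex"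
  assumes h: "continuous_on ({0..T} \<times> UNIV) (\<lambda>(s, x). h s x)" and g: "integrable lborel g"
    and b: "\<And>s x. s \<in> {0..T} \<Longrightarrow> norm (h s x) \<le> g x"
  shows "integral {0..T} (\<lambda>s. ft (h s) \<xi>) = ft (\<lambda>x. integral {0..T} (\<lambda>s. h s x)) \<xi>"
    and "continuous_on ({0..T} \<times> UNIV) (\<lambda>(s, \<xi>). ft (h s) \<xi>)"
proof -
  define c where "c = complex_of_real (1 / sqrt (2 * pi))"
  have [measurable]: "g \<in> borel_measurable borel" using g by auto
  have hm: "h s \<in> borel_measurable borel" if "s \<in> {0..T}" for s
    using continuous_on_strip_section2[OF h that] by (rule borel_measurable_continuous_onI)
  show cft: "continuous_on ({0..T} \<times> UNIV) (\<lambda>(s, \<xi>). ft (h s) \<xi>)"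
    by (rule ft_param_continuous[OF continuous_on_strip_section[OF h] hm g b])
  have c1: "continuous_on {0..T} (\<lambda>s. ft (h s) \<xi>)" by (rule continuous_on_strip_section[OF cft])
  have [measurable]: "(\<lambda>(s, x). indicator {0..T} s *\<^sub>R h s x) \<in> borel_measurable (borel \<Otimes>\<^sub>M borel)"
    by (rule borel_measurable_strip[OF h])
  have "integral {0..T} (\<lambda>s. ft (h s) \<xi>) = (LINT s|lborel. c * (LINT x|lborel. cis (- (x * \<xi>)) * (indicator {0..T} s *\<^sub>R h s x)))"
  proof -
    have "indicator {0..T} s *\<^sub>R ft (h s) \<xi> = c * (LINT x|lborel. cis (- (x * \<xi>)) * (indicator {0..T} s *\<^sub>R h s x))" for s :: real
      unfolding ft_def c_def[symmetric] by (simp only: integral_scaleR_right mult_scaleR_right)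
    then show ?thesis by (simp only: integral_strip_eq_LINT(1)[OF c1])
  qed
  also have "\<dots> = c * (LINT s|lborel. LINT x|lborel. cis (- (x * \<xi>)) * (indicator {0..T} s *\<^sub>R h s x))"
    by (rule integral_mult_right_zero)
  also have "(LINT s|lborel. LINT x|lborel. cis (- (x * \<xi>)) * (indicator {0..T} s *\<^sub>R h s x)) =
     (LINT x|lborel. LINT s|lborel. cis (- (x * \<xi>)) * (indicator {0..T} s *\<^sub>R h s x))"
  proof (rule swap_integrals)
    show "integrable lborel (indicator {0..T} :: real \<Rightarrow> real)" by (cases "0 \<le> T") (simp_all add: integrable_indicator_iff)
    show "integrable lborel g" by (rule g)
    show "norm (cis (- (x * \<xi>)) * (indicator {0..T} s *\<^sub>R h s x)) \<le> indicator {0..T} s * g x" for s x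
      using b[of s x] by (auto simp: indicator_def norm_mult)
  qed measurable
  also have "\<dots> = (LINT x|lborel. cis (- (x * \<xi>)) * integral {0..T} (\<lambda>s. h s x))"
    by (simp only: integral_mult_right_zero integral_strip_eq_LINT(1)[OF continuous_on_strip_section[OF h]])
  finally show "integral {0..T} (\<lambda>s. ft (h s) \<xi>) = ft (\<lambda>x. integral {0..T} (\<lambda>s. h s x)) \<xi>"
    by (simp add: ft_def c_def)
qed

lemma ft_multiplication:
  assumes "integrable lborel f" "integrable lborel g"
  shows "(LINT x|lborel. ft f x * g x) = (LINT x|lborel. f x * ft g x)"
proof -
  have [measurable]: "f \<in> borel_measurable borel" "g \<in> borel_measurable borel" using assms by auto
  have "(LINT x|lborel. ft f x * g x) =
      of_real (1 / sqrt (2 * pi)) * (LINT x|lborel. LINT y|lborel. (cis (- (y * x)) * f y) * g x)"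
    unfolding ft_def integral_mult_left_zero integral_mult_right_zero
    by (simp only: mult.assoc integral_mult_right_zero)
  also have "(LINT x|lborel. LINT y|lborel. (cis (- (y * x)) * f y) * g x) =
     (LINT y|lborel. LINT x|lborel. (cis (- (y * x)) * f y) * g x)"
    by (rule swap_integrals[of "\<lambda>x. norm (g x)" "\<lambda>x. norm (f x)"])
       (use assms in \<open>auto simp: norm_mult mult.commute\<close>)
  also have "\<dots> = (LINT y|lborel. f y * (LINT x|lborel. cis (- (x * y)) * g x))"
    by (subst integral_mult_right_zero[symmetric]) (simp add: ac_simps)
  also have "of_real (1 / sqrt (2 * pi)) * \<dots> = (LINT x|lborel. f x * ft g x)"
    unfolding ft_def by (simp only: mult.left_commute[of "f _"] integral_mult_right_zero)
  finally show ?thesis .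
qed

text \<open>Read off from the characteristic function of the standard normal distribution.\<close>

lemma fourier_std_normal:
  "(LINT x|lborel. cis (t * x) * of_real (exp (- x\<^sup>2 / 2))) = of_real (sqrt (2 * pi) * exp (- t\<^sup>2 / 2))"
proof -
  have "of_real (exp (- (t^2) / 2)) = char std_normal_distribution t"
    by (simp add: char_std_normal_distribution)
  also have "\<dots> = (LINT x|lborel. std_normal_density x *\<^sub>R iexp (t * x))"
    unfolding char_def by (subst integral_density) auto
  also have "\<dots> = (LINT x|lborel. of_real (1 / sqrt (2 * pi)) * (cis (t * x) * of_real (exp (- x\<^sup>2 / 2))))"
    by (intro Bochner_Integration.integral_cong)
       (auto simp: std_normal_density_def scaleR_conv_of_real cis_conv_exp mult.commute)
  also have "\<dots> = of_real (1 / sqrt (2 * pi)) * (LINT x|lborel. cis (t * x) * of_real (exp (- x\<^sup>2 / 2)))"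
    by (rule integral_mult_right_zero)
  finally show ?thesis by (simp add: field_simps)
qed

lemma integrable_gauss: "integrable lborel (\<lambda>x. exp (- x\<^sup>2 / 2 :: real))"
proof -
  have "integrable lborel (\<lambda>x. sqrt (2 * pi) * std_normal_density x)" by simp
  then show ?thesis by (simp add: std_normal_density_def)
qed

lemma integrable_gauss_scaled:
  assumes "e \<noteq> 0" shows "integrable lborel (\<lambda>x. exp (- (e * x)\<^sup>2 / 2 :: real))"
  using lborel_integrable_real_affine[OF integrable_gauss, of e 0] assms by simp

lemma fourier_gauss_scaled:
  assumes "0 < e"
  shows "(LINT x|lborel. cis (t * x) * of_real (exp (- (e * x)\<^sup>2 / 2))) =
     of_real (sqrt (2 * pi) * normal_density 0 e t * sqrt (2 * pi))"
proof -
  have "(LINT x|lborel. cis (t * x) * of_real (exp (- (e * x)\<^sup>2 / 2))) =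
    \<bar>1 / e\<bar> *\<^sub>R (LINT x|lborel. cis (t * (0 + (1 / e) * x)) * of_real (exp (- (e * (0 + (1 / e) * x))\<^sup>2 / 2)))"
    using assms by (intro lborel_integral_real_affine) simp
  also have "\<dots> = of_real (1 / e) * (LINT x|lborel. cis ((t / e) * x) * of_real (exp (- x\<^sup>2 / 2)))"
    using assms by (simp add: scaleR_conv_of_real)
  also have "\<dots> = of_real (1 / e) * of_real (sqrt (2 * pi) * exp (- (t / e)\<^sup>2 / 2))"
    by (simp only: fourier_std_normal)
  also have "\<dots> = of_real (sqrt (2 * pi) * normal_density 0 e t * sqrt (2 * pi))"
    using assms by (simp add: normal_density_def real_sqrt_mult power_divide field_simps)
  finally show ?thesis .
qed

text \<open>The Gaussian factor makes the double integral absolutely convergent, so Fubini applies,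
  and the inner integral over \<xi> is a normal density. This smoothing of \<open>f\<close> serves
  both for the Bessel inequality and for inversion.\<close>

lemma ft_gauss_regularised:
  assumes f: "integrable lborel f" and e: "0 < e"
  shows "of_real (1 / sqrt (2 * pi)) *
      (LINT \<xi>|lborel. cis (x * \<xi>) * of_real (exp (- (e * \<xi>)\<^sup>2 / 2)) * ft f \<xi>) =
    (LINT y|lborel. of_real (normal_density 0 e (x - y)) * f y)"
proof -
  have [measurable]: "f \<in> borel_measurable borel" using f by auto
  define c where "c = complex_of_real (1 / sqrt (2 * pi))"
  define E where "E \<xi> = exp (- (e * \<xi>)\<^sup>2 / 2)" for \<xi>
  have [measurable]: "E \<in> borel_measurable borel" unfolding E_def by measurable
  have "(LINT \<xi>|lborel. cis (x * \<xi>) * of_real (E \<xi>) * ft f \<xi>) =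
      c * (LINT \<xi>|lborel. LINT y|lborel. cis (x * \<xi>) * of_real (E \<xi>) * (cis (- (y * \<xi>)) * f y))"
    unfolding ft_def c_def[symmetric]
    by (subst integral_mult_right_zero[symmetric])+ (simp add: ac_simps)
  also have "(LINT \<xi>|lborel. LINT y|lborel. cis (x * \<xi>) * of_real (E \<xi>) * (cis (- (y * \<xi>)) * f y)) =
      (LINT y|lborel. LINT \<xi>|lborel. cis (x * \<xi>) * of_real (E \<xi>) * (cis (- (y * \<xi>)) * f y))"
    by (rule swap_integrals[of E "\<lambda>x. norm (f x)"])
       (use f integrable_gauss_scaled[of e] e in \<open>auto simp: norm_mult E_def[abs_def]\<close>)
  also have "\<dots> = (LINT y|lborel. f y * (LINT \<xi>|lborel. cis ((x - y) * \<xi>) * of_real (E \<xi>)))"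
  proof (intro Bochner_Integration.integral_cong refl)
    fix y
    have "cis (x * \<xi>) * of_real (E \<xi>) * (cis (- (y * \<xi>)) * f y) = f y * (cis ((x - y) * \<xi>) * of_real (E \<xi>))" for \<xi>
    proof -
      have "cis ((x - y) * \<xi>) = cis (x * \<xi>) * cis (- (y * \<xi>))"
        by (simp add: cis_mult algebra_simps)
      then show ?thesis by (simp add: ac_simps)
    qed
    then show "(LINT \<xi>|lborel. cis (x * \<xi>) * of_real (E \<xi>) * (cis (- (y * \<xi>)) * f y)) =
      f y * (LINT \<xi>|lborel. cis ((x - y) * \<xi>) * of_real (E \<xi>))"
      by (simp only: integral_mult_right_zero)
  qed
  also have "\<dots> = (LINT y|lborel. of_real (2 * pi) * (of_real (normal_density 0 e (x - y)) * f y))"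
    unfolding E_def fourier_gauss_scaled[OF e]
    by (intro Bochner_Integration.integral_cong refl)
       (simp add: ac_simps flip: of_real_mult power2_eq_square mult.assoc)
  also have "\<dots> = of_real (2 * pi) * (LINT y|lborel. of_real (normal_density 0 e (x - y)) * f y)"
    by (rule integral_mult_right_zero)
  finally have *: "(LINT \<xi>|lborel. cis (x * \<xi>) * of_real (E \<xi>) * ft f \<xi>) =
      c * (of_real (2 * pi) * (LINT y|lborel. of_real (normal_density 0 e (x - y)) * f y))" .
  have "c * (c * of_real (2 * pi)) = 1"
  proof -
    have "(1 / sqrt (2 * pi)) * ((1 / sqrt (2 * pi)) * (2 * pi)) = 1"
      by (simp add: field_simps)
    then show ?thesis unfolding c_def by (simp only: of_real_mult[symmetric] of_real_1)
  qed
  then show ?thesis unfolding E_def[symmetric] * c_def[symmetric]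
    by (simp flip: mult.assoc)
qed

lemma nn_integral_normal_density:
  assumes "0 < e"
  shows "(\<integral>\<^sup>+y. ennreal (normal_density 0 e (x - y)) \<partial>lborel) = 1"
    "(\<integral>\<^sup>+y. ennreal (normal_density 0 e (y - x)) \<partial>lborel) = 1"
proof -
  have 1: "normal_density 0 e (x - y) = normal_density x e y" "normal_density 0 e (y - x) = normal_density x e y" for y
    by (auto simp: normal_density_def power2_commute)
  have "(\<integral>\<^sup>+y. ennreal (normal_density x e y) \<partial>lborel) = ennreal (LINT y|lborel. normal_density x e y)"
    using assms by (intro nn_integral_eq_integral) auto
  then show "(\<integral>\<^sup>+y. ennreal (normal_density 0 e (x - y)) \<partial>lborel) = 1"
    "(\<integral>\<^sup>+y. ennreal (normal_density 0 e (y - x)) \<partial>lborel) = 1"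
    using assms by (simp_all add: 1)
qed

text \<open>The inequality half of Plancherel. With a Gaussian weight, the square integral of
  \<open>ft f\<close> equals the pairing of \<open>f\<close> with its convolution by a normal
  density. Since |f x| |f y| is at most the mean of the squares and the density has mass 1 in either
  variable, that pairing is at most the square of the L2 norm; Fatou removes the weight.\<close>

lemma Bessel_ft:
  assumes f: "integrable lborel f" and B: "L2b (\<lambda>_. 1) B f"
  shows "L2b (\<lambda>_. 1) B (ft f)"
proof -
  have [measurable]: "f \<in> borel_measurable borel" "ft f \<in> borel_measurable borel" using f by auto
  have B0: "0 \<le> B" using B by (rule L2b_nonneg)
  \<comment> \<open>A quarter in the exponent, because the square of this factor is the weight
    \<open>E\<close> with a half.\<close>
  have main: "L2b (\<lambda>_. 1) B (\<lambda>\<xi>. of_real (exp (- (e * \<xi>)\<^sup>2 / 4)) * ft f \<xi>)" if e: "0 < e" for e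
  proof -
    define E where "E \<xi> = exp (- (e * \<xi>)\<^sup>2 / 2)" for \<xi>
    have [measurable]: "E \<in> borel_measurable borel" unfolding E_def by measurable
    have Eint: "integrable lborel E" using integrable_gauss_scaled[of e] e by (simp add: E_def[abs_def])
    define C where "C = (LINT x|lborel. norm (f x))"
    have C: "norm (ft f \<xi>) \<le> C" for \<xi> unfolding C_def by (rule norm_ft_le)
    have C0: "0 \<le> C" by (simp add: C_def)
    define g where "g y = (LINT x|lborel. of_real (normal_density 0 e (y - x)) * f x)" for y
    have [measurable]: "g \<in> borel_measurable borel" unfolding g_def by measurable
    define c where "c = complex_of_real (1 / sqrt (2 * pi))"
    have cc: "norm c \<le> 1" "cnj c = c" using inverse_sqrt_2pi_le_1 by (auto simp: c_def norm_divide)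
    have cnjft: "cnj (ft f \<xi>) = c * (LINT y|lborel. cis (y * \<xi>) * cnj (f y))" for \<xi>
    proof -
      have "cnj (LINT y|lborel. cis (- (y * \<xi>)) * f y) = (LINT y|lborel. cnj (cis (- (y * \<xi>)) * f y))"
        by (rule Bochner_Integration.integral_cnj[symmetric])
      then show ?thesis by (simp add: ft_def c_def cis_cnj)
    qed
    have int: "integrable lborel (\<lambda>\<xi>. E \<xi> * (norm (ft f \<xi>))\<^sup>2)"
    proof (rule Bochner_Integration.integrable_bound)
      show "integrable lborel (\<lambda>\<xi>. E \<xi> * C\<^sup>2)" using Eint by simp
      show "AE \<xi> in lborel. norm (E \<xi> * (norm (ft f \<xi>))\<^sup>2) \<le> norm (E \<xi> * C\<^sup>2)"
        using C by (auto simp: E_def abs_mult intro!: mult_left_mono power_mono)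
    qed measurable
    have "of_real (LINT \<xi>|lborel. E \<xi> * (norm (ft f \<xi>))\<^sup>2) =
        (LINT \<xi>|lborel. of_real (E \<xi>) * ft f \<xi> * cnj (ft f \<xi>))"
    proof -
      have "complex_of_real (E \<xi> * (norm (ft f \<xi>))\<^sup>2) = of_real (E \<xi>) * ft f \<xi> * cnj (ft f \<xi>)" for \<xi>
        by (simp only: of_real_mult complex_norm_square mult.assoc)
      then show ?thesis by (simp only: integral_complex_of_real[symmetric])
    qed
    also have "\<dots> = (LINT \<xi>|lborel. LINT y|lborel. c * of_real (E \<xi>) * ft f \<xi> * (cis (y * \<xi>) * cnj (f y)))"
      unfolding cnjft by (subst integral_mult_right_zero[symmetric])+ (simp add: ac_simps)
    also have "\<dots> = (LINT y|lborel. LINT \<xi>|lborel. c * of_real (E \<xi>) * ft f \<xi> * (cis (y * \<xi>) * cnj (f y)))"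
    proof (rule swap_integrals[of "\<lambda>\<xi>. C * E \<xi>" "\<lambda>y. norm (f y)"])
      fix \<xi> y
      have "norm c * (E \<xi> * norm (ft f \<xi>)) \<le> 1 * (E \<xi> * C)"
        using cc C C0 by (intro mult_mono) (auto simp: E_def)
      then show "norm (c * of_real (E \<xi>) * ft f \<xi> * (cis (y * \<xi>) * cnj (f y))) \<le> C * E \<xi> * norm (f y)"
        by (simp add: norm_mult E_def mult.assoc[symmetric] mult.commute[of C] mult_right_mono)
    qed (use f Eint in auto)
    also have "\<dots> = (LINT y|lborel. cnj (f y) * (c * (LINT \<xi>|lborel. cis (y * \<xi>) * of_real (E \<xi>) * ft f \<xi>)))"
      by (subst integral_mult_right_zero[symmetric])+ (simp add: ac_simps)
    also have "\<dots> = (LINT y|lborel. cnj (f y) * g y)"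
      unfolding g_def c_def E_def ft_gauss_regularised[OF f e] ..
    finally have I: "complex_of_real (LINT \<xi>|lborel. E \<xi> * (norm (ft f \<xi>))\<^sup>2) = (LINT y|lborel. cnj (f y) * g y)" .
    have "ennreal (LINT \<xi>|lborel. E \<xi> * (norm (ft f \<xi>))\<^sup>2) \<le> ennreal (norm (LINT y|lborel. cnj (f y) * g y))"
      unfolding I[symmetric] norm_of_real by (intro ennreal_leI abs_ge_self)
    also have "\<dots> \<le> (\<integral>\<^sup>+y. ennreal (norm (cnj (f y) * g y)) \<partial>lborel)"
      by (cases "integrable lborel (\<lambda>y. cnj (f y) * g y)")
         (auto simp: integral_norm_bound_ennreal not_integrable_integral_eq)
    also have "\<dots> \<le> (\<integral>\<^sup>+y. (\<integral>\<^sup>+x. ennreal (normal_density 0 e (y - x) * (norm (f x))\<^sup>2 / 2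
           + normal_density 0 e (y - x) * (norm (f y))\<^sup>2 / 2) \<partial>lborel) \<partial>lborel)"
    proof (intro nn_integral_mono)
      fix y
      have "ennreal (norm (cnj (f y) * g y)) = ennreal (norm (f y)) * ennreal (norm (g y))"
        by (simp add: norm_mult ennreal_mult)
      also have "ennreal (norm (g y)) \<le> (\<integral>\<^sup>+x. ennreal (norm (of_real (normal_density 0 e (y - x)) * f x)) \<partial>lborel)"
        unfolding g_def
        by (cases "integrable lborel (\<lambda>x. of_real (normal_density 0 e (y - x)) * f x)")
           (auto simp: integral_norm_bound_ennreal not_integrable_integral_eq)
      also have "ennreal (norm (f y)) * \<dots> = (\<integral>\<^sup>+x. ennreal (norm (f y)) * ennreal (norm (of_real (normal_density 0 e (y - x)) * f x)) \<partial>lborel)"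
        by (rule nn_integral_cmult[symmetric]) measurable
      also have "\<dots> \<le> (\<integral>\<^sup>+x. ennreal (normal_density 0 e (y - x) * (norm (f x))\<^sup>2 / 2
           + normal_density 0 e (y - x) * (norm (f y))\<^sup>2 / 2) \<partial>lborel)"
      proof (intro nn_integral_mono)
        fix x
        have "0 \<le> normal_density 0 e (y - x) * (norm (f x) - norm (f y))\<^sup>2" by simp
        then have "norm (f y) * norm (of_real (normal_density 0 e (y - x)) * f x) \<le>
           normal_density 0 e (y - x) * (norm (f x))\<^sup>2 / 2 + normal_density 0 e (y - x) * (norm (f y))\<^sup>2 / 2"
          by (simp add: norm_mult power2_diff field_simps)
        then show "ennreal (norm (f y)) * ennreal (norm (of_real (normal_density 0 e (y - x)) * f x)) \<le>
           ennreal (normal_density 0 e (y - x) * (norm (f x))\<^sup>2 / 2 + normal_density 0 e (y - x) * (norm (f y))\<^sup>2 / 2)"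
          by (subst ennreal_mult[symmetric]) (auto intro!: ennreal_leI simp del: ennreal_plus norm_mult)
      qed
      finally show "ennreal (norm (cnj (f y) * g y)) \<le> (\<integral>\<^sup>+x. ennreal (normal_density 0 e (y - x) * (norm (f x))\<^sup>2 / 2
           + normal_density 0 e (y - x) * (norm (f y))\<^sup>2 / 2) \<partial>lborel)"
        by (simp add: mult_left_mono)
    qed
    also have "\<dots> = (\<integral>\<^sup>+y. (\<integral>\<^sup>+x. ennreal ((norm (f x))\<^sup>2 / 2) * ennreal (normal_density 0 e (y - x)) \<partial>lborel) \<partial>lborel)
         + (\<integral>\<^sup>+y. (\<integral>\<^sup>+x. ennreal ((norm (f y))\<^sup>2 / 2) * ennreal (normal_density 0 e (y - x)) \<partial>lborel) \<partial>lborel)"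
      by (subst nn_integral_add[symmetric])
         (auto intro!: nn_integral_cong simp: nn_integral_add[symmetric] ennreal_mult[symmetric] mult.commute ennreal_plus[symmetric] simp del: ennreal_plus)
    also have "(\<integral>\<^sup>+y. (\<integral>\<^sup>+x. ennreal ((norm (f x))\<^sup>2 / 2) * ennreal (normal_density 0 e (y - x)) \<partial>lborel) \<partial>lborel)
        = (\<integral>\<^sup>+x. (\<integral>\<^sup>+y. ennreal ((norm (f x))\<^sup>2 / 2) * ennreal (normal_density 0 e (y - x)) \<partial>lborel) \<partial>lborel)"
      by (rule lborel_pair.Fubini') measurable
    also have "\<dots> = (\<integral>\<^sup>+x. ennreal ((norm (f x))\<^sup>2 / 2) \<partial>lborel)"
      by (simp add: nn_integral_cmult nn_integral_normal_density[OF e])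
    also have "(\<integral>\<^sup>+y. (\<integral>\<^sup>+x. ennreal ((norm (f y))\<^sup>2 / 2) * ennreal (normal_density 0 e (y - x)) \<partial>lborel) \<partial>lborel)
       = (\<integral>\<^sup>+x. ennreal ((norm (f x))\<^sup>2 / 2) \<partial>lborel)"
      by (simp add: nn_integral_cmult nn_integral_normal_density[OF e])
    also have "(\<integral>\<^sup>+x. ennreal ((norm (f x))\<^sup>2 / 2) \<partial>lborel) + (\<integral>\<^sup>+x. ennreal ((norm (f x))\<^sup>2 / 2) \<partial>lborel)
       = (\<integral>\<^sup>+x. ennreal ((norm (f x))\<^sup>2) \<partial>lborel)"
      by (subst nn_integral_add[symmetric]) (auto simp flip: ennreal_plus)
    also have "\<dots> \<le> ennreal (B\<^sup>2)" using B by (simp add: L2b_def)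
    finally have "(LINT \<xi>|lborel. E \<xi> * (norm (ft f \<xi>))\<^sup>2) \<le> B\<^sup>2" by (simp add: ennreal_le_iff)
    moreover have eq: "(norm (of_real (exp (- (e * \<xi>)\<^sup>2 / 4)) * ft f \<xi>))\<^sup>2 = E \<xi> * (norm (ft f \<xi>))\<^sup>2" for \<xi>
    proof -
      have "(exp (- (e * \<xi>)\<^sup>2 / 4))\<^sup>2 = E \<xi>" by (simp add: E_def flip: exp_of_nat_mult)
      then show ?thesis by (simp add: norm_mult power_mult_distrib)
    qed
    ultimately show ?thesis
      by (intro L2bI) (use int B0 in \<open>simp_all only: eq mult_1 wt_one, measurable\<close>)
  qed
  have lim: "(\<lambda>n. of_real (exp (- (inverse (real (Suc n)) * \<xi>)\<^sup>2 / 4)) * ft f \<xi>) \<longlonglongrightarrow> ft f \<xi>" for \<xi>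
  proof -
    have "(\<lambda>n. of_real (exp (- (inverse (real (Suc n)) * \<xi>)\<^sup>2 / 4)) * ft f \<xi>) \<longlonglongrightarrow> of_real (exp (- (0 * \<xi>)\<^sup>2 / 4)) * ft f \<xi>"
      by (intro tendsto_intros LIMSEQ_inverse_real_of_nat) auto
    then show ?thesis by simp
  qed
  show ?thesis
    by (rule L2b_Fatou[OF wt_one main lim tendsto_const]) simp
qed

lemma L2b_reflect:
  assumes "L2b (\<lambda>_. 1) B f" shows "L2b (\<lambda>_. 1) B (\<lambda>x. f (- x))"
proof -
  have [measurable]: "f \<in> borel_measurable borel" using assms by (auto simp: L2b_def)
  have "(\<integral>\<^sup>+x. ennreal ((norm (f x))\<^sup>2) \<partial>lborel) = (\<integral>\<^sup>+x. ennreal ((norm (f (- x)))\<^sup>2) \<partial>lborel)"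
    by (subst nn_integral_real_affine[of _ "-1" 0]) auto
  then show ?thesis using assms by (auto simp: L2b_def)
qed

lemma Bessel_ift:
  assumes "integrable lborel f" "L2b (\<lambda>_. 1) B f"
  shows "L2b (\<lambda>_. 1) B (ift f)"
  unfolding ift_def[abs_def] by (rule L2b_reflect[OF Bessel_ft[OF assms]])

text \<open>Both sides of \<open>ft_gauss_regularised\<close> converge as the width tends to 0: the
  left one with majorant |ft f|, the right one after the substitution y = x - e z, which makes it an
  average of \<open>f\<close> near \<open>x\<close> against the standard normal density.\<close>

lemma ft_inversion:
  assumes f: "integrable lborel f" "continuous_on UNIV f" "\<And>x. norm (f x) \<le> M"
    and ft: "integrable lborel (ft f)"
  shows "ift (ft f) x = f x"
proof -
  have [measurable]: "f \<in> borel_measurable borel" "ft f \<in> borel_measurable borel" using f by auto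
  define e where "e n = inverse (real (Suc n))" for n
  have e: "0 < e n" for n by (simp add: e_def)
  have el: "e \<longlonglongrightarrow> 0" unfolding e_def by (rule LIMSEQ_inverse_real_of_nat)
  have l1: "(\<lambda>n. of_real (1 / sqrt (2 * pi)) *
      (LINT \<xi>|lborel. cis (x * \<xi>) * of_real (exp (- (e n * \<xi>)\<^sup>2 / 2)) * ft f \<xi>)) \<longlonglongrightarrow>
      of_real (1 / sqrt (2 * pi)) * (LINT \<xi>|lborel. cis (x * \<xi>) * of_real (exp (- (0 * \<xi>)\<^sup>2 / 2)) * ft f \<xi>)"
  proof (intro tendsto_mult tendsto_const integral_dominated_convergence[where w="\<lambda>\<xi>. norm (ft f \<xi>)"])
    show "AE \<xi> in lborel. (\<lambda>n. cis (x * \<xi>) * of_real (exp (- (e n * \<xi>)\<^sup>2 / 2)) * ft f \<xi>)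
        \<longlonglongrightarrow> cis (x * \<xi>) * of_real (exp (- (0 * \<xi>)\<^sup>2 / 2)) * ft f \<xi>"
      by (intro AE_I2 tendsto_intros el) auto
    show "AE \<xi> in lborel. norm (cis (x * \<xi>) * of_real (exp (- (e n * \<xi>)\<^sup>2 / 2)) * ft f \<xi>) \<le> norm (ft f \<xi>)" for n
      by (intro AE_I2) (auto simp: norm_mult intro!: mult_left_le_one_le)
  qed (use ft in auto)
  have r: "of_real (1 / sqrt (2 * pi)) *
      (LINT \<xi>|lborel. cis (x * \<xi>) * of_real (exp (- (e n * \<xi>)\<^sup>2 / 2)) * ft f \<xi>) =
      (LINT z|lborel. of_real (std_normal_density z) * f (x + (- e n) * z))" for n
  proof -
    have "(LINT y|lborel. of_real (normal_density 0 (e n) (x - y)) * f y) =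
       \<bar>- e n\<bar> *\<^sub>R (LINT z|lborel. of_real (normal_density 0 (e n) (x - (x + (- e n) * z))) * f (x + (- e n) * z))"
      using e[of n] by (intro lborel_integral_real_affine) simp
    also have "\<dots> = (LINT z|lborel. of_real (std_normal_density z) * f (x + (- e n) * z))"
    proof -
      have "e n * normal_density 0 (e n) (e n * z) = std_normal_density z" for z
        using e[of n] by (simp add: normal_density_def real_sqrt_mult power_mult_distrib)
      then have "of_real (std_normal_density z) * f (x + (- e n) * z) =
         of_real (e n) * (of_real (normal_density 0 (e n) (x - (x + (- e n) * z))) * f (x + (- e n) * z))" for z
        by (simp flip: of_real_mult mult.assoc)
      then show ?thesis using e[of n]
        by (simp only: scaleR_conv_of_real abs_minus_cancel abs_of_pos integral_mult_right_zero)
    qed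
    finally show ?thesis using ft_gauss_regularised[OF f(1) e[of n], of x] by simp
  qed
  have "(\<lambda>n. LINT z|lborel. of_real (std_normal_density z) * f (x + (- e n) * z)) \<longlonglongrightarrow>
     (LINT z|lborel. of_real (std_normal_density z) * f (x + (- 0) * z))"
  proof (rule integral_dominated_convergence[where w="\<lambda>z. std_normal_density z * M"])
    show "AE z in lborel. (\<lambda>n. complex_of_real (std_normal_density z) * f (x + (- e n) * z)) \<longlonglongrightarrow>
        complex_of_real (std_normal_density z) * f (x + (- 0) * z)"
    proof (intro AE_I2 tendsto_mult tendsto_const)
      fix z
      have "isCont f (x + (- 0) * z)" using f(2) by (simp add: continuous_on_eq_continuous_at)
      then show "(\<lambda>n. f (x + (- e n) * z)) \<longlonglongrightarrow> f (x + (- 0) * z)"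
        by (rule isCont_tendsto_compose) (intro tendsto_intros el)
    qed
    show "AE z in lborel. norm (complex_of_real (std_normal_density z) * f (x + (- e n) * z)) \<le> std_normal_density z * M" for n
      using f(3) by (intro AE_I2) (auto simp: norm_mult intro!: mult_left_mono)
  qed auto
  also have "(LINT z|lborel. of_real (std_normal_density z) * f (x + (- 0) * z)) = f x"
    by (simp del: of_real_divide of_real_mult add: integral_complex_of_real)
  finally have "(\<lambda>n. of_real (1 / sqrt (2 * pi)) *
      (LINT \<xi>|lborel. cis (x * \<xi>) * of_real (exp (- (e n * \<xi>)\<^sup>2 / 2)) * ft f \<xi>)) \<longlonglongrightarrow> f x"
    unfolding r .
  from LIMSEQ_unique[OF l1 this] show ?thesis by (simp add: ift_eq)
qed

text \<open>The positive and negative parts have equal transforms, in particular the same mass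
  \<open>m\<close>. If \<open>m\<close> is 0 both vanish almost everywhere; otherwise dividing by
  \<open>m\<close> gives two probability densities with the same characteristic function, and Levy's
  uniqueness theorem identifies them.\<close>

lemma L1_uniqueness_real:
  assumes r: "integrable lborel r" and z: "\<And>t. (LINT x|lborel. cis (t * x) * of_real (r x)) = 0"
  shows "AE x in lborel. r x = (0::real)"
proof -
  have [measurable]: "r \<in> borel_measurable borel" using r by auto
  define P where "P x = max (r x) 0" for x
  define Q where "Q x = max (- r x) 0" for x
  have [measurable]: "P \<in> borel_measurable borel" "Q \<in> borel_measurable borel"
    unfolding P_def Q_def by measurable
  have P: "integrable lborel P" and Q: "integrable lborel Q"
    unfolding P_def Q_def using r by auto
  have P0: "0 \<le> P x" and Q0: "0 \<le> Q x" and rPQ: "r x = P x - Q x" for x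
    by (auto simp: P_def Q_def)
  have iP: "integrable lborel (\<lambda>x. cis (t * x) * of_real (P x))"
    and iQ: "integrable lborel (\<lambda>x. cis (t * x) * of_real (Q x))" for t
    using P Q by (auto intro!: integrable_cis_mult)
  have eq: "(LINT x|lborel. cis (t * x) * of_real (P x)) = (LINT x|lborel. cis (t * x) * of_real (Q x))" for t
  proof -
    have "0 = (LINT x|lborel. cis (t * x) * of_real (P x) - cis (t * x) * of_real (Q x))"
      using z[of t] by (simp add: rPQ ring_distribs)
    also have "\<dots> = (LINT x|lborel. cis (t * x) * of_real (P x)) - (LINT x|lborel. cis (t * x) * of_real (Q x))"
      by (rule Bochner_Integration.integral_diff[OF iP iQ])
    finally show ?thesis by simp
  qed
  define m where "m = (LINT x|lborel. P x)"
  have mQ: "m = (LINT x|lborel. Q x)" using eq[of 0] by (simp add: m_def)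
  show ?thesis
  proof (cases "m = 0")
    case True
    have "AE x in lborel. P x = 0"
      using True integral_nonneg_eq_0_iff_AE[OF P] P0 by (simp add: m_def)
    moreover have "AE x in lborel. Q x = 0"
      using True integral_nonneg_eq_0_iff_AE[OF Q] Q0 by (simp add: mQ)
    ultimately show ?thesis by eventually_elim (simp add: rPQ)
  next
    case False
    have m: "0 < m" using False P0 by (simp add: m_def order_less_le)
    have dist: "real_distribution (density lborel (\<lambda>x. ennreal (p x / m)))"
      and chr: "char (density lborel (\<lambda>x. ennreal (p x / m))) t = of_real (1 / m) * (LINT x|lborel. cis (t * x) * of_real (p x))"
      if p [measurable]: "p \<in> borel_measurable borel" and pi: "integrable lborel p" and p0: "\<And>x. 0 \<le> p x"
        and pm: "m = (LINT x|lborel. p x)" for p t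
    proof -
      have "(\<integral>\<^sup>+x. ennreal (p x / m) \<partial>lborel) = ennreal (LINT x|lborel. p x / m)"
        using pi p0 m by (intro nn_integral_eq_integral) auto
      also have "\<dots> = 1" using m pm by simp
      finally have "emeasure (density lborel (\<lambda>x. ennreal (p x / m))) UNIV = 1"
        by (subst emeasure_density) auto
      then show "real_distribution (density lborel (\<lambda>x. ennreal (p x / m)))"
        by (intro real_distribution.intro prob_spaceI real_distribution_axioms.intro) auto
      have "char (density lborel (\<lambda>x. ennreal (p x / m))) t = (LINT x|lborel. (p x / m) *\<^sub>R iexp (t * x))"
        unfolding char_def using p0 m by (subst integral_density) auto
      also have "\<dots> = (LINT x|lborel. of_real (1 / m) * (cis (t * x) * of_real (p x)))"
        by (intro Bochner_Integration.integral_cong) (auto simp: scaleR_conv_of_real cis_conv_exp)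
      finally show "char (density lborel (\<lambda>x. ennreal (p x / m))) t = of_real (1 / m) * (LINT x|lborel. cis (t * x) * of_real (p x))"
        by (simp only: integral_mult_right_zero)
    qed
    have "density lborel (\<lambda>x. ennreal (P x / m)) = density lborel (\<lambda>x. ennreal (Q x / m))"
    proof (rule Levy_uniqueness)
      show "char (density lborel (\<lambda>x. ennreal (P x / m))) = char (density lborel (\<lambda>x. ennreal (Q x / m)))"
        using chr[OF _ P P0 m_def] chr[OF _ Q Q0 mQ] eq by (intro ext) simp
    qed (use dist[OF _ P P0 m_def] dist[OF _ Q Q0 mQ] in auto)
    then have "AE x in lborel. ennreal (P x / m) = ennreal (Q x / m)"
      by (subst (asm) sigma_finite_measure.density_unique_iff[OF lborel.sigma_finite_measure_axioms]) auto
    then show ?thesis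
      by eventually_elim (use P0 Q0 m in \<open>auto simp: rPQ\<close>)
  qed
qed

text \<open>Conjugation reflects and conjugates the transform, so the transform of
  \<open>cnj h\<close> vanishes too; hence so do those of the real and imaginary parts.\<close>

lemma L1_uniqueness:
  assumes h: "integrable lborel h" and z: "\<And>\<xi>. ft h \<xi> = 0"
  shows "AE x in lborel. h x = 0"
proof -
  have a: "(LINT x|lborel. cis (t * x) * h x) = 0" for t
    using z[of "- t"] by (simp add: ft_def mult.commute)
  have b: "(LINT x|lborel. cis (t * x) * cnj (h x)) = 0" for t
  proof -
    have "(LINT x|lborel. cis (t * x) * cnj (h x)) = (LINT x|lborel. cnj (cis ((- t) * x) * h x))"
      by (simp add: cis_cnj)
    also have "\<dots> = cnj (LINT x|lborel. cis ((- t) * x) * h x)"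
      by (rule Bochner_Integration.integral_cnj)
    finally show ?thesis using a[of "- t"] by simp
  qed
  have i1: "integrable lborel (\<lambda>x. cis (t * x) * h x)" and i2: "integrable lborel (\<lambda>x. cis (t * x) * cnj (h x))" for t
    using h by (auto intro!: integrable_cis_mult)
  have "AE x in lborel. Re (h x) = 0"
  proof (rule L1_uniqueness_real)
    fix t
    have "(LINT x|lborel. cis (t * x) * of_real (Re (h x))) = (LINT x|lborel. (cis (t * x) * h x + cis (t * x) * cnj (h x)) / 2)"
      by (intro Bochner_Integration.integral_cong refl) (simp add: complex_eq_iff field_simps)
    also have "\<dots> = 0" using a b i1 i2 by simp
    finally show "(LINT x|lborel. cis (t * x) * of_real (Re (h x))) = 0" .
  qed (use h in auto)
  moreover have "AE x in lborel. Im (h x) = 0"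
  proof (rule L1_uniqueness_real)
    fix t
    have "(LINT x|lborel. cis (t * x) * of_real (Im (h x))) = (LINT x|lborel. (cis (t * x) * h x - cis (t * x) * cnj (h x)) / (2 * \<i>))"
    proof (intro Bochner_Integration.integral_cong refl)
      fix x
      have "cis (t * x) * h x - cis (t * x) * cnj (h x) = cis (t * x) * of_real (Im (h x)) * (2 * \<i>)"
        by (simp add: complex_diff_cnj flip: right_diff_distrib)
      then show "cis (t * x) * of_real (Im (h x)) = (cis (t * x) * h x - cis (t * x) * cnj (h x)) / (2 * \<i>)"
        by (simp only: nonzero_mult_div_cancel_right complex_i_not_zero mult_eq_0_iff zero_neq_numeral[symmetric] simp_thms)
    qed
    also have "\<dots> = 0" using a b i1 i2 by simp
    finally show "(LINT x|lborel. cis (t * x) * of_real (Im (h x))) = 0" .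
  qed (use h in auto)
  ultimately show ?thesis by eventually_elim (simp add: complex_eq_iff)
qed

text \<open>Cauchy-Schwarz after splitting off the square root of 1 + \<xi>^2. The constant 2 comes
  from the integral of 1/(1 + \<xi>^2), which is \<pi> < 4.\<close>

lemma L2b_imp_L1:
  assumes "L2b (\<lambda>\<xi>. 1 + \<xi>\<^sup>2) B F"
  shows "integrable lborel F" "(LINT \<xi>|lborel. norm (F \<xi>)) \<le> 2 * B"
proof -
  have [measurable]: "F \<in> borel_measurable borel" using assms by (simp add: L2b_def)
  have "set_integrable lborel UNIV (\<lambda>x. inverse (1 + x\<^sup>2) :: real)" "(LBINT x:UNIV. inverse (1 + x\<^sup>2)) = pi"
    using integrable_inverse_1_plus_square LBINT_inverse_1_plus_square
    by (auto simp: interval_lebesgue_integral_def)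
  then have i: "integrable lborel (\<lambda>x. inverse (1 + x\<^sup>2) :: real)" "(LINT x|lborel. inverse (1 + x\<^sup>2)) = pi"
    by (auto simp: set_integrable_def set_lebesgue_integral_def)
  define a where "a \<xi> = complex_of_real (1 / sqrt (1 + \<xi>\<^sup>2))" for \<xi>
  define b where "b \<xi> = complex_of_real (sqrt (1 + \<xi>\<^sup>2)) * F \<xi>" for \<xi>
  have a2: "(norm (a \<xi>))\<^sup>2 = inverse (1 + \<xi>\<^sup>2)" for \<xi>
    by (simp add: a_def norm_divide power_divide inverse_eq_divide)
  have A: "L2b (\<lambda>_. 1) 2 a"
  proof (rule L2bI)
    show "a \<in> borel_measurable borel" unfolding a_def by measurable
    show "(LINT x|lborel. 1 * (norm (a x))\<^sup>2) \<le> 2\<^sup>2" using i pi_less_4 by (simp add: a2)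
  qed (use i in \<open>simp_all add: a2\<close>)
  have "L2b (\<lambda>_. 1) B b"
  proof (rule L2b_mono[OF _ assms])
    show "wt (\<lambda>\<xi>. 1 + \<xi>\<^sup>2)" by (auto simp: wt_def)
    show "b \<in> borel_measurable borel" unfolding b_def by measurable
  qed (auto simp: b_def norm_mult power_mult_distrib)
  note ab = L2b_prod_integrable[OF A this]
  have "a \<xi> * b \<xi> = F \<xi>" for \<xi>
  proof -
    have "sqrt (1 + \<xi>\<^sup>2) \<noteq> 0" using zero_le_power2[of \<xi>] by (simp add: add_nonneg_eq_0_iff)
    then show ?thesis by (simp add: a_def b_def flip: mult.assoc)
  qed
  with ab show "integrable lborel F" "(LINT \<xi>|lborel. norm (F \<xi>)) \<le> 2 * B" by simp_all
qed

section \<open>Sobolev spaces in physical space\<close>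

text \<open>A ball in H^j described by classical derivatives: those up to order j all have L2 norm
  at most \<open>B\<close>, and the last one is continuous. Weak derivatives are avoided because the
  functions concerned are band limited or built smoothly from such functions, Gaussian, or
  Schwartz.\<close>

primrec hb :: "nat \<Rightarrow> real \<Rightarrow> (real \<Rightarrow> complex) \<Rightarrow> bool" where
  "hb 0 B f \<longleftrightarrow> continuous_on UNIV f \<and> L2b (\<lambda>_. 1) B f"
| "hb (Suc j) B f \<longleftrightarrow> L2b (\<lambda>_. 1) B f \<and>
     (\<exists>f'. (\<forall>x. (f has_vector_derivative f' x) (at x)) \<and> hb j B f')"

lemma hb_continuous: "hb j B f \<Longrightarrow> continuous_on UNIV f"
  by (cases j) (auto simp: continuous_on_eq_continuous_at intro: has_vector_derivative_continuous)

lemma hb_L2b: "hb j B f \<Longrightarrow> L2b (\<lambda>_. 1) B f"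
  by (cases j) auto

lemma hb_nonneg: "hb j B f \<Longrightarrow> 0 \<le> B"
  by (auto dest: hb_L2b L2b_nonneg)

lemma hb_SucI:
  "L2b (\<lambda>_. 1) B f \<Longrightarrow> (\<And>x. (f has_vector_derivative f' x) (at x)) \<Longrightarrow> hb j B f' \<Longrightarrow> hb (Suc j) B f"
  by auto

lemma hb_mono: "hb j B f \<Longrightarrow> B \<le> C \<Longrightarrow> hb j C f"
  by (induction j arbitrary: f) (auto intro: L2b_mono_bound)

lemma hb_SucD: "hb (Suc j) B f \<Longrightarrow> hb j B f"
proof (induction j arbitrary: f)
  case 0
  then show ?case using hb_continuous[OF 0] by auto
next
  case (Suc j)
  from Suc.prems obtain f' where f: "L2b (\<lambda>_. 1) B f"
    "\<forall>x. (f has_vector_derivative f' x) (at x)" "hb (Suc j) B f'"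
    unfolding hb.simps(2)[of "Suc j"] by blast
  from f(1,2) Suc.IH[OF f(3)] show ?case by (subst hb.simps) blast
qed

lemma hb_add: "hb j A f \<Longrightarrow> hb j B g \<Longrightarrow> hb j (A + B) (\<lambda>x. f x + g x)"
proof (induction j arbitrary: f g)
  case 0
  then show ?case by (auto intro!: continuous_intros L2b_add)
next
  case (Suc j)
  then obtain f' g' where d: "\<And>x. (f has_vector_derivative f' x) (at x)" "hb j A f'"
    "\<And>x. (g has_vector_derivative g' x) (at x)" "hb j B g'" by auto
  have "\<forall>x. ((\<lambda>x. f x + g x) has_vector_derivative f' x + g' x) (at x)"
    using d by (auto intro!: derivative_intros)
  with Suc.IH[OF d(2,4)] Suc.prems show ?case by (auto intro!: L2b_add exI[of _ "\<lambda>x. f' x + g' x"])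
qed

lemma hb_cnj: "hb j A f \<Longrightarrow> hb j A (\<lambda>x. cnj (f x))"
proof (induction j arbitrary: f)
  case 0
  then show ?case by (auto intro!: continuous_intros L2b_cnj)
next
  case (Suc j)
  then obtain f' where d: "\<And>x. (f has_vector_derivative f' x) (at x)" "hb j A f'" by auto
  have "\<forall>x. ((\<lambda>x. cnj (f x)) has_vector_derivative cnj (f' x)) (at x)"
    using d bounded_linear.has_vector_derivative[OF bounded_linear_cnj] by auto
  with Suc.IH[OF d(2)] Suc.prems show ?case by (auto intro!: L2b_cnj exI[of _ "\<lambda>x. cnj (f' x)"])
qed

lemma L2b_indicator:
  assumes "0 \<le> l" "l \<le> 1"
  shows "L2b (\<lambda>_. 1) 1 (\<lambda>x. complex_of_real (indicator {a..a + l} x))"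
proof (rule L2bI)
  have "(norm (complex_of_real (indicator {a..a + l} x)))\<^sup>2 = indicator {a..a + l} x" for x
    by (auto simp: indicator_def)
  then show "integrable lborel (\<lambda>x. 1 * (norm (complex_of_real (indicator {a..a + l} x)))\<^sup>2)"
    "(LINT x|lborel. 1 * (norm (complex_of_real (indicator {a..a + l} x)))\<^sup>2) \<le> 1\<^sup>2"
    using assms by (auto simp: integrable_indicator_iff)
qed auto

lemma L2b_unit_interval:
  assumes f: "L2b (\<lambda>_. 1) B f" and l: "0 \<le> l" "l \<le> 1"
  shows "set_integrable lborel {a..a + l} f" "(LINT x:{a..a + l}|lborel. norm (f x)) \<le> B"
proof -
  note p = L2b_prod_integrable[OF L2b_indicator[OF l, of a] f]
  show "set_integrable lborel {a..a + l} f"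
    using p(1) by (simp add: set_integrable_def scaleR_conv_of_real)
  show "(LINT x:{a..a + l}|lborel. norm (f x)) \<le> B"
    using p(2) by (simp add: set_lebesgue_integral_def norm_mult)
qed

lemma hb_FTC:
  fixes f :: "real \<Rightarrow> complex"
  assumes "\<And>x. (f has_vector_derivative f' x) (at x)" "a \<le> b"
  shows "(f' has_integral (f b - f a)) {a..b}"
  by (rule fundamental_theorem_of_calculus) (use assms in \<open>auto intro: has_vector_derivative_at_within\<close>)

text \<open>Averaging |f x| <= |f y| + (integral of |f'| between them) over y in the unit interval
  to the right of x; Cauchy-Schwarz bounds each of the two terms by \<open>B\<close>.\<close>

lemma hb_sup:
  assumes "hb (Suc j) B f" shows "norm (f x) \<le> 2 * B"
proof -
  obtain f' where d: "\<And>x. (f has_vector_derivative f' x) (at x)" "hb j B f'" using assms by auto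
  have f: "L2b (\<lambda>_. 1) B f" "L2b (\<lambda>_. 1) B f'" using assms d hb_L2b by auto
  have step: "norm (f x) \<le> norm (f y) + B" if y: "y \<in> {x..x + 1}" for y
  proof -
    define l where "l = y - x"
    have l: "0 \<le> l" "l \<le> 1" "y = x + l" using y by (auto simp: l_def)
    have "f y - f x = (LINT s:{x..x + l}|lborel. f' s)"
      using hb_FTC[OF d(1), of x y] L2b_unit_interval(1)[OF f(2) l(1,2)] set_borel_integral_eq_integral(2) l
      by (metis integral_unique le_add_same_cancel1)
    also have "norm \<dots> \<le> (LINT s:{x..x + l}|lborel. norm (f' s))"
      by (rule set_integral_norm_bound[OF L2b_unit_interval(1)[OF f(2) l(1,2)]])
    also have "\<dots> \<le> B" by (rule L2b_unit_interval(2)[OF f(2) l(1,2)])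
    finally show ?thesis by (metis add.commute diff_le_eq norm_minus_commute norm_triangle_ineq2 order_trans)
  qed
  have i: "set_integrable lborel {x..x + 1} f" using L2b_unit_interval(1)[OF f(1), of 1 x] by simp
  have c: "set_integrable lborel {x..x + 1} (\<lambda>_. c)" for c :: real
    by (simp add: set_integrable_def)
  have "(LINT y:{x..x + 1}|lborel. norm (f x)) \<le> (LINT y:{x..x + 1}|lborel. norm (f y) + B)"
    by (rule set_integral_mono) (use step in \<open>auto intro!: set_integral_add c set_integrable_norm[OF i]\<close>)
  also have "\<dots> = (LINT y:{x..x + 1}|lborel. norm (f y)) + (LINT y:{x..x + 1}|lborel. B)"
    by (rule set_integral_add) (auto intro!: c set_integrable_norm[OF i])
  also have "\<dots> \<le> B + B"
    using L2b_unit_interval(2)[OF f(1), of 1 x] by (simp add: set_lebesgue_integral_def)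
  finally show ?thesis by (simp add: set_lebesgue_integral_def)
qed

lemma L2b_bounded_mult:
  assumes f: "L2b (\<lambda>_. 1) A f" and g: "g \<in> borel_measurable borel" "\<And>x. norm (g x) \<le> M"
  shows "L2b (\<lambda>_. 1) (M * A) (\<lambda>x. g x * f x)"
proof (rule L2b_le[OF _ f])
  have [measurable]: "f \<in> borel_measurable borel" using f by (simp add: L2b_def)
  note [measurable] = g(1)
  show "(\<lambda>x. g x * f x) \<in> borel_measurable borel" by measurable
  show "0 \<le> M" using g(2)[of 0] norm_ge_zero order_trans by blast
  show "1 * (norm (g x * f x))\<^sup>2 \<le> M\<^sup>2 * (1 * (norm (f x))\<^sup>2)" for x
    using power_mono[OF g(2), of x 2] by (simp add: norm_mult power_mult_distrib mult_right_mono)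
qed simp

text \<open>The factor with one more derivative is bounded by \<open>hb_sup\<close>, which starts
  the induction with the constant 2; each Leibniz rule doubles it. The asymmetry is the one met by
  the chain rule, where a derivative of the inner function multiplies an undifferentiated
  factor.\<close>

lemma hb_mult: "hb j A f \<Longrightarrow> hb (Suc j) B g \<Longrightarrow> hb j (2 ^ Suc j * A * B) (\<lambda>x. f x * g x)"
proof (induction j arbitrary: f g A B)
  case 0
  have "L2b (\<lambda>_. 1) (2 * B * A) (\<lambda>x. g x * f x)"
    by (rule L2b_bounded_mult)
       (use 0 hb_sup[OF 0(2)] hb_continuous[OF 0(2)] in \<open>auto intro: borel_measurable_continuous_onI\<close>)
  then show ?case using 0(1) hb_continuous[OF 0(2)]
    by (auto simp: mult.commute mult.left_commute intro!: continuous_intros)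
next
  case (Suc j)
  obtain f' where f': "\<And>x. (f has_vector_derivative f' x) (at x)" "hb j A f'" using Suc.prems(1) by auto
  obtain g' where g': "\<And>x. (g has_vector_derivative g' x) (at x)" "hb (Suc j) B g'" using Suc.prems(2) by (auto simp del: hb.simps(1))
  have 1: "hb j (2 ^ Suc j * A * B) (\<lambda>x. f' x * g x)"
    by (rule Suc.IH[OF f'(2) hb_SucD[OF Suc.prems(2)]])
  \<comment> \<open>The roles are exchanged: here \<open>f\<close> is the factor with the additional
    derivative.\<close>
  have 2: "hb j (2 ^ Suc j * B * A) (\<lambda>x. g' x * f x)"
    by (rule Suc.IH[OF hb_SucD[OF g'(2)] Suc.prems(1)])
  have 3: "hb j (2 ^ Suc (Suc j) * A * B) (\<lambda>x. f' x * g x + g' x * f x)"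
    using hb_add[OF 1 2] by (simp add: algebra_simps)
  have d: "((\<lambda>x. f x * g x) has_vector_derivative f' x * g x + g' x * f x) (at x)" for x
    using has_vector_derivative_mult[OF f'(1) g'(1), of x] by (simp add: algebra_simps)
  have AB: "0 \<le> A" "0 \<le> B" using Suc.prems by (auto dest: hb_nonneg simp del: hb.simps)
  have "L2b (\<lambda>_. 1) (2 * B * A) (\<lambda>x. g x * f x)"
    by (rule L2b_bounded_mult)
       (use Suc.prems hb_sup[OF Suc.prems(2)] hb_continuous[OF Suc.prems(2)] in \<open>auto intro: borel_measurable_continuous_onI hb_L2b\<close>)
  then have "L2b (\<lambda>_. 1) (2 ^ Suc (Suc j) * A * B) (\<lambda>x. f x * g x)"
  proof -
    have "2 * B * A \<le> 2 ^ Suc (Suc j) * B * A"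
    proof -
      have "(2::real) * 1 \<le> 2 ^ Suc (Suc j)"
        unfolding power_Suc by (intro mult_left_mono) (use one_le_power[of "2::real" "Suc j"] in auto)
      then show ?thesis using AB by (intro mult_right_mono) auto
    qed
    then show ?thesis using L2b_mono_bound[OF \<open>L2b (\<lambda>_. 1) (2 * B * A) (\<lambda>x. g x * f x)\<close>, of "2 ^ Suc (Suc j) * A * B"]
      by (simp add: ac_simps)
  qed
  from hb_SucI[OF this d 3] show ?case .
qed

lemma has_vector_derivative_shift:
  fixes h :: "real \<Rightarrow> complex"
  assumes "\<And>x. (h has_vector_derivative h' x) (at x)"
  shows "((\<lambda>s. h (s + x)) has_vector_derivative h' (s + x)) (at s)"
proof -
  have "((\<lambda>s. s + x) has_vector_derivative (1 + 0)) (at s)"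
    by (intro has_vector_derivative_add has_vector_derivative_const has_vector_derivative_id)
  from vector_diff_chain_at[OF this assms] show ?thesis by (simp add: o_def)
qed

text \<open>A difference quotient is an average of translates of the derivative, and Minkowski's
  inequality preserves the bound. It also commutes with differentiation, which gives the
  induction.\<close>

lemma hb_diffquot:
  assumes "hb (Suc i) A h" "0 < y"
  shows "hb i A (\<lambda>x. (h (x + y) - h x) / of_real y)"
  using assms(1)
proof (induction i arbitrary: h)
  case 0
  note h = 0
  obtain h' where d: "\<And>x. (h has_vector_derivative h' x) (at x)" "hb 0 A h'" using h by auto
  have c: "continuous_on UNIV h'" "L2b (\<lambda>_. 1) A h'" using d by auto
  have "L2b (\<lambda>_. 1) (A * y) (\<lambda>x. integral {0..y} (\<lambda>s. h' (x + s)))"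
  proof (rule Minkowski_strip_const)
    show "continuous_on ({0..y} \<times> UNIV) (\<lambda>(s, x). h' (x + s))"
      unfolding case_prod_beta by (intro continuous_on_compose2[OF c(1)] continuous_intros) auto
    show "L2b (\<lambda>_. 1) A (\<lambda>x. h' (x + s))" for s
    proof -
      have [measurable]: "h' \<in> borel_measurable borel" using c by (simp add: L2b_def)
      have "(\<integral>\<^sup>+x. ennreal ((norm (h' x))\<^sup>2) \<partial>lborel) = (\<integral>\<^sup>+x. ennreal ((norm (h' (x + s)))\<^sup>2) \<partial>lborel)"
        by (subst nn_integral_real_affine[of _ 1 s]) (auto simp: add.commute)
      then show ?thesis using c(2) by (auto simp: L2b_def)
    qed
  qed (use c assms L2b_nonneg in auto)
  from L2b_cmult[OF wt_one this, of "1 / of_real y"]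
  have "L2b (\<lambda>_. 1) A (\<lambda>x. 1 / of_real y * integral {0..y} (\<lambda>s. h' (x + s)))"
    using assms(2) by (simp add: norm_divide)
  moreover have "integral {0..y} (\<lambda>s. h' (x + s)) = h (x + y) - h x" for x
  proof -
    have "((\<lambda>s. h (x + s)) has_vector_derivative h' (x + s)) (at s)" for s
      using has_vector_derivative_shift[OF d(1), of x s] by (simp add: add.commute)
    from hb_FTC[OF this, of 0 y] assms(2) show ?thesis by (simp add: integral_unique)
  qed
  ultimately have "L2b (\<lambda>_. 1) A (\<lambda>x. (h (x + y) - h x) / of_real y)" by (simp add: field_simps)
  moreover have "continuous_on UNIV (\<lambda>x. (h (x + y) - h x) / of_real y)"
    using assms(2) hb_continuous[OF h]
    by (intro continuous_intros continuous_on_compose2[OF hb_continuous[OF h]]) auto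
  ultimately show ?case by simp
next
  case (Suc i)
  obtain h' where d: "\<And>x. (h has_vector_derivative h' x) (at x)" "hb (Suc i) A h'"
    using Suc.prems by (auto simp del: hb.simps(1))
  have "((\<lambda>x. h (x + y)) has_vector_derivative h' (x + y)) (at x)" for x
    by (rule has_vector_derivative_shift[OF d(1)])
  then have "((\<lambda>x. (h (x + y) - h x) / of_real y) has_vector_derivative (h' (x + y) - h' x) / of_real y) (at x)" for x
    using d(1) by (intro has_vector_derivative_divide has_vector_derivative_diff) auto
  moreover have "L2b (\<lambda>_. 1) A (\<lambda>x. (h (x + y) - h x) / of_real y)"
    using Suc.IH[OF hb_SucD[OF Suc.prems]] by (rule hb_L2b)
  ultimately show ?case using Suc.IH[OF d(2)] by (intro hb_SucI)
qed

text \<open>Difference quotients instead of derivatives, because the derivatives of \<open>h\<close> need not be integrable.\<close>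

lemma hb_ft:
  assumes "integrable lborel h" "hb j A h"
  shows "L2b (\<lambda>\<xi>. \<xi> ^ (2 * j)) A (ft h)"
  using assms
proof (induction j arbitrary: h)
  case 0
  then show ?case by (simp add: Bessel_ft)
next
  case (Suc j)
  have w: "wt (\<lambda>\<xi>. \<xi> ^ (2 * j))" for j by (simp add: wt_def)
  define y where "y n = inverse (real (Suc n))" for n
  have y: "0 < y n" for n by (simp add: y_def)
  define q where "q n x = (h (x + y n) - h x) / of_real (y n)" for n x
  have qi: "integrable lborel (q n)" for n
    unfolding q_def using Suc.prems(1) lborel_integrable_shift[of h "y n"] by auto
  have q: "L2b (\<lambda>\<xi>. \<xi> ^ (2 * j)) A (ft (q n))" for n
    by (rule Suc.IH[OF qi]) (unfold q_def, rule hb_diffquot[OF Suc.prems(2) y])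
  have ftq: "ft (q n) \<xi> = (cis (\<xi> * y n) - cis (\<xi> * 0)) / of_real (y n) * ft h \<xi>" for n \<xi>
  proof -
    have "ft (q n) \<xi> = ft (\<lambda>x. (1 / of_real (y n)) * (h (x + y n) - h x)) \<xi>"
      by (simp add: q_def[abs_def])
    also have "\<dots> = (1 / of_real (y n)) * (ft (\<lambda>x. h (x + y n)) \<xi> - ft h \<xi>)"
      unfolding ft_cmult using Suc.prems(1) by (subst ft_diff) (auto intro: lborel_integrable_shift)
    finally show ?thesis by (simp add: ft_shift algebra_simps diff_divide_distrib)
  qed
  \<comment> \<open>The multiplier of the difference quotient tends to the derivative of the
    exponential at 0; in the limit the weight gains a factor \<xi>^2.\<close>
  have lim: "(\<lambda>n. ft (q n) \<xi>) \<longlonglongrightarrow> \<i> * of_real \<xi> * ft h \<xi>" for \<xi>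
  proof -
    have "((\<lambda>z. exp (\<i> * of_real \<xi> * z)) has_field_derivative (\<i> * of_real \<xi>)) (at 0)"
      by (auto intro!: derivative_eq_intros)
    then have "((\<lambda>h. (exp (\<i> * of_real \<xi> * (0 + h)) - exp (\<i> * of_real \<xi> * 0)) / h) \<longlongrightarrow> \<i> * of_real \<xi>) (at 0)"
      unfolding DERIV_def .
    moreover have "filterlim (\<lambda>n. complex_of_real (y n)) (at 0) sequentially"
      unfolding filterlim_at using y tendsto_of_real[OF LIMSEQ_inverse_real_of_nat]
      by (auto simp: y_def intro!: eventuallyI simp del: of_real_inverse)
    ultimately have "(\<lambda>n. (exp (\<i> * of_real \<xi> * (0 + complex_of_real (y n))) - exp (\<i> * of_real \<xi> * 0)) / complex_of_real (y n)) \<longlonglongrightarrow> \<i> * of_real \<xi>"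
      by (rule filterlim_compose)
    then have "(\<lambda>n. (exp (\<i> * of_real \<xi> * (0 + complex_of_real (y n))) - exp (\<i> * of_real \<xi> * 0)) / complex_of_real (y n) * ft h \<xi>) \<longlonglongrightarrow> \<i> * of_real \<xi> * ft h \<xi>"
      by (intro tendsto_intros)
    then show ?thesis unfolding ftq by (simp add: cis_conv_exp mult.assoc)
  qed
  have *: "L2b (\<lambda>\<xi>. \<xi> ^ (2 * j)) A (\<lambda>\<xi>. \<i> * of_real \<xi> * ft h \<xi>)"
    by (rule L2b_Fatou[OF w q lim tendsto_const])
  show ?case
    by (rule L2b_mono[OF w *]) (use Suc.prems in \<open>auto simp: norm_mult power_mult_distrib power2_eq_square ac_simps\<close>)
qed

lemma L2b_weight_add:
  assumes "wt w1" "wt w2" "L2b w1 A f" "L2b w2 A f"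
  shows "L2b (\<lambda>x. w1 x + w2 x) (2 * A) f"
proof -
  have [measurable]: "w1 \<in> borel_measurable borel" "w2 \<in> borel_measurable borel" "f \<in> borel_measurable borel"
    using assms by (auto simp: wt_def L2b_def)
  have "(\<integral>\<^sup>+x. ennreal ((w1 x + w2 x) * (norm (f x))\<^sup>2) \<partial>lborel) =
    (\<integral>\<^sup>+x. ennreal (w1 x * (norm (f x))\<^sup>2) \<partial>lborel) + (\<integral>\<^sup>+x. ennreal (w2 x * (norm (f x))\<^sup>2) \<partial>lborel)"
    using wt_nonneg[OF assms(1)] wt_nonneg[OF assms(2)]
    by (subst nn_integral_add[symmetric]) (auto simp: ring_distribs intro!: nn_integral_cong ennreal_plus)
  also have "\<dots> \<le> ennreal (A\<^sup>2) + ennreal (A\<^sup>2)"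
    using assms by (intro add_mono) (auto simp: L2b_def)
  also have "\<dots> \<le> ennreal ((2 * A)\<^sup>2)"
    by (subst ennreal_plus[symmetric]) (auto intro!: ennreal_leI simp: power_mult_distrib)
  finally show ?thesis using assms by (auto simp: L2b_def)
qed

definition sobw :: "nat \<Rightarrow> real \<Rightarrow> real" where
  "sobw j \<xi> = (1 + \<xi>\<^sup>2) ^ j"

lemma wt_sobw [simp]: "wt (sobw j)"
  by (auto simp: wt_def sobw_def[abs_def])

lemma sobw_ge_1: "1 \<le> sobw j \<xi>"
  by (simp add: sobw_def)

lemma sobw_mono: "i \<le> j \<Longrightarrow> sobw i \<xi> \<le> sobw j \<xi>"
  by (auto simp: sobw_def intro!: power_increasing)

lemma sobw_le: "sobw j \<xi> \<le> 2 ^ j * (1 + \<xi> ^ (2 * j))"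
proof -
  have "sobw j \<xi> \<le> (2 * max 1 (\<xi>\<^sup>2)) ^ j"
    unfolding sobw_def by (intro power_mono) auto
  also have "\<dots> = 2 ^ j * (max 1 (\<xi>\<^sup>2)) ^ j" by (rule power_mult_distrib)
  also have "(max 1 (\<xi>\<^sup>2)) ^ j \<le> 1 + \<xi> ^ (2 * j)"
    by (auto simp: max_def power_mult)
  finally show ?thesis by simp
qed

lemma hb_ft_sobw:
  assumes "integrable lborel h" "hb j A h"
  shows "L2b (sobw j) (2 ^ Suc j * A) (ft h)"
proof -
  have w: "wt (\<lambda>\<xi>. \<xi> ^ (2 * j))" by (simp add: wt_def)
  have *: "L2b (\<lambda>x. 1 + x ^ (2 * j)) (2 * A) (ft h)"
    using L2b_weight_add[OF wt_one w _ hb_ft[OF assms]] Bessel_ft[OF assms(1) hb_L2b[OF assms(2)]] by simp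
  have "L2b (sobw j) (2 ^ j * (2 * A)) (ft h)"
  proof (rule L2b_le[OF _ *])
    show "wt (\<lambda>x. 1 + x ^ (2 * j))" by (simp add: wt_def)
    show "sobw j x * (norm (ft h x))\<^sup>2 \<le> (2 ^ j)\<^sup>2 * ((1 + x ^ (2 * j)) * (norm (ft h x))\<^sup>2)" for x
    proof -
      have "sobw j x \<le> 2 ^ j * (1 + x ^ (2 * j))" by (rule sobw_le)
      also have "\<dots> \<le> (2 ^ j)\<^sup>2 * (1 + x ^ (2 * j))"
        by (intro mult_right_mono) (auto simp: power2_eq_square)
      finally show ?thesis by (simp add: mult_right_mono flip: mult.assoc)
    qed
  qed (use assms in auto)
  then show ?thesis by (simp add: mult.assoc mult.left_commute)
qed

section \<open>Composition with smooth functions\<close>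

text \<open>\<open>g1\<close> and \<open>g2\<close> are the Wirtinger derivatives with respect to z
  and its conjugate. Both are bounded by \<open>C\<close> on the disc of radius \<open>R\<close>,
  and so are all further ones up to order j, while differentiability is demanded on the whole
  plane.\<close>

primrec sb :: "real \<Rightarrow> real \<Rightarrow> nat \<Rightarrow> (complex \<Rightarrow> complex) \<Rightarrow> bool" where
  "sb R C 0 g \<longleftrightarrow> continuous_on UNIV g \<and> (\<forall>z. norm z \<le> R \<longrightarrow> norm (g z) \<le> C)"
| "sb R C (Suc j) g \<longleftrightarrow> (\<forall>z. norm z \<le> R \<longrightarrow> norm (g z) \<le> C) \<and>
     (\<exists>g1 g2. (\<forall>z. (g has_derivative (\<lambda>h. g1 z * h + g2 z * cnj h)) (at z)) \<and>
        sb R C j g1 \<and> sb R C j g2)"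

lemma sb_continuous: "sb R C j g \<Longrightarrow> continuous_on UNIV g"
  by (cases j) (auto simp: continuous_on_eq_continuous_at intro: has_derivative_continuous)

lemma sb_SucD: "sb R C (Suc j) g \<Longrightarrow> sb R C j g"
proof (induction j arbitrary: g)
  case 0
  then show ?case using sb_continuous[OF 0] by auto
next
  case (Suc j)
  from Suc.prems obtain g1 g2 where g: "\<forall>z. norm z \<le> R \<longrightarrow> norm (g z) \<le> C"
    "\<forall>z. (g has_derivative (\<lambda>h. g1 z * h + g2 z * cnj h)) (at z)"
    "sb R C (Suc j) g1" "sb R C (Suc j) g2"
    unfolding sb.simps(2)[of _ _ "Suc j"] by blast
  from g(1,2) Suc.IH[OF g(3)] Suc.IH[OF g(4)] show ?case by (subst sb.simps) blast
qed

lemma sb_bound: "sb R C j g \<Longrightarrow> norm z \<le> R \<Longrightarrow> norm (g z) \<le> C"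
  by (cases j) auto

text \<open>The recursion of \<open>hb_comp\<close>: two Wirtinger terms, each with the product
  constant \<open>2 ^ Suc j * B\<close>, and one term in which \<open>V\<close> is
  differentiated.\<close>

primrec comp_const :: "nat \<Rightarrow> real \<Rightarrow> real" where
  "comp_const 0 B = 1"
| "comp_const (Suc j) B = comp_const j B * (2 * (2 ^ Suc j * B) + 1)"

lemma comp_const_ge_1: "0 \<le> B \<Longrightarrow> 1 \<le> comp_const j B"
proof (induction j)
  case (Suc j)
  then have "1 * 1 \<le> comp_const j B * (2 * (2 ^ Suc j * B) + 1)"
    by (intro mult_mono) auto
  then show ?case by simp
qed simp

lemma has_vector_derivative_comp_sb:
  assumes "(g has_derivative (\<lambda>h. g1 * h + g2 * cnj h)) (at (W x))" "(W has_vector_derivative W') (at x)"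
  shows "((\<lambda>x. g (W x)) has_vector_derivative g1 * W' + g2 * cnj W') (at x)"
proof -
  have "((\<lambda>x. g (W x)) has_derivative (\<lambda>h. g1 * (h *\<^sub>R W') + g2 * cnj (h *\<^sub>R W'))) (at x)"
    using has_derivative_compose[OF assms(2)[unfolded has_vector_derivative_def] assms(1)] .
  then show ?thesis
    by (simp add: has_vector_derivative_def scaleR_conv_of_real ring_distribs ac_simps)
qed

text \<open>The linear factor \<open>V\<close> makes the class closed under differentiation: g(W) V
  has derivative g1(W) (W' V) + g2(W) (cnj W' V) + g(W) V', three terms of the same form with one
  derivative less to control. The outer function itself is only bounded; square integrability comes
  from \<open>V\<close>.\<close>

lemma hb_comp:
  assumes "\<And>x. norm (W x) \<le> R" "0 \<le> C"
  shows "hb j B W \<Longrightarrow> hb j A V \<Longrightarrow> sb R C j g \<Longrightarrow> hb j (C * comp_const j B * A) (\<lambda>x. g (W x) * V x)"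
proof (induction j arbitrary: V A g)
  case 0
  have c: "continuous_on UNIV (\<lambda>x. g (W x))"
    by (rule continuous_on_compose2[of UNIV g]) (use 0 in auto)
  have "L2b (\<lambda>_. 1) (C * A) (\<lambda>x. g (W x) * V x)"
    by (rule L2b_bounded_mult) (use 0 assms c in \<open>auto intro: borel_measurable_continuous_onI\<close>)
  then show ?case using 0 c by (auto intro!: continuous_intros)
next
  case (Suc j)
  obtain W' where W': "\<And>x. (W has_vector_derivative W' x) (at x)" "hb j B W'" using Suc.prems by auto
  obtain V' where V': "\<And>x. (V has_vector_derivative V' x) (at x)" "hb j A V'" using Suc.prems by auto
  obtain g1 g2 where g: "\<And>z. (g has_derivative (\<lambda>h. g1 z * h + g2 z * cnj h)) (at z)"
    "sb R C j g1" "sb R C j g2" using Suc.prems by auto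
  have A0: "0 \<le> A" and B0: "0 \<le> B" using Suc.prems by (auto dest: hb_nonneg simp del: hb.simps)
  have sbg: "sb R C j g" by (rule sb_SucD[OF Suc.prems(3)])
  note Wj = hb_SucD[OF Suc.prems(1)]
  note V1 = hb_mult[OF W'(2) Suc.prems(2)]
  note V2 = hb_mult[OF hb_cnj[OF W'(2)] Suc.prems(2)]
  note h = hb_add[OF hb_add[OF Suc.IH[OF Wj V1 g(2)] Suc.IH[OF Wj V2 g(3)]] Suc.IH[OF Wj V'(2) sbg]]
  have eqc: "C * comp_const j B * (2 ^ Suc j * B * A) + C * comp_const j B * (2 ^ Suc j * B * A) + C * comp_const j B * A
     = C * comp_const (Suc j) B * A"
    by (simp add: algebra_simps)
  have d: "((\<lambda>x. g (W x) * V x) has_vector_derivative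
      g1 (W x) * (W' x * V x) + g2 (W x) * (cnj (W' x) * V x) + g (W x) * V' x) (at x)" for x
    using has_vector_derivative_mult[OF has_vector_derivative_comp_sb[OF g(1) W'(1)] V'(1), of x]
    by (simp add: algebra_simps)
  have c: "continuous_on UNIV (\<lambda>x. g (W x))"
    by (rule continuous_on_compose2[OF sb_continuous[OF sbg] hb_continuous[OF Wj]]) auto
  have "L2b (\<lambda>_. 1) (C * A) (\<lambda>x. g (W x) * V x)"
    by (rule L2b_bounded_mult)
       (use hb_L2b[OF Suc.prems(2)] assms c sb_bound[OF sbg] in \<open>auto intro: borel_measurable_continuous_onI\<close>)
  moreover have "C * A \<le> C * comp_const (Suc j) B * A"
    using mult_mono[OF mult_left_mono[OF comp_const_ge_1[OF B0, of "Suc j"] assms(2)] order_refl[of A]] A0 assms(2)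
      comp_const_ge_1[OF B0, of "Suc j"]
    by (auto intro!: mult_nonneg_nonneg)
  ultimately have "L2b (\<lambda>_. 1) (C * comp_const (Suc j) B * A) (\<lambda>x. g (W x) * V x)"
    by (rule L2b_mono_bound)
  from hb_SucI[OF this d h[unfolded eqc]] show ?case .
qed

lemma sb_mono: "sb R C j g \<Longrightarrow> C \<le> D \<Longrightarrow> sb R D j g"
proof (induction j arbitrary: g)
  case 0
  then show ?case by force
next
  case (Suc j)
  from Suc.prems obtain g1 g2 where g: "\<forall>z. norm z \<le> R \<longrightarrow> norm (g z) \<le> C"
    "\<forall>z. (g has_derivative (\<lambda>h. g1 z * h + g2 z * cnj h)) (at z)" "sb R C j g1" "sb R C j g2"
    unfolding sb.simps by blast
  have "\<forall>z. norm z \<le> R \<longrightarrow> norm (g z) \<le> D" using g(1) Suc.prems(2) by force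
  with g(2) Suc.IH[OF g(3) Suc.prems(2)] Suc.IH[OF g(4) Suc.prems(2)] show ?case
    by (subst sb.simps) blast
qed

lemma sb_SucI:
  "(\<And>z. norm z \<le> R \<Longrightarrow> norm (g z) \<le> C) \<Longrightarrow> (\<And>z. (g has_derivative (\<lambda>h. g1 z * h + g2 z * cnj h)) (at z)) \<Longrightarrow>
   sb R C j g1 \<Longrightarrow> sb R C j g2 \<Longrightarrow> sb R C (Suc j) g"
  by auto

lemma sb_zero: "0 \<le> C \<Longrightarrow> sb R C j (\<lambda>_. 0)"
  by (induction j) (auto intro!: exI[of _ "\<lambda>_. 0"])

lemma sb_const: "norm c \<le> C \<Longrightarrow> sb R C j (\<lambda>_. c)"
  using sb_zero[of C R] norm_ge_zero[of c]
  by (cases j) (auto intro!: exI[of _ "\<lambda>_. 0"] intro: order_trans)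

lemma sb_add: "sb R C j g \<Longrightarrow> sb R D j h \<Longrightarrow> sb R (C + D) j (\<lambda>z. g z + h z)"
proof (induction j arbitrary: g h)
  case 0
  then show ?case by (auto intro!: continuous_intros norm_triangle_mono)
next
  case (Suc j)
  from Suc.prems obtain g1 g2 where g: "\<forall>z. norm z \<le> R \<longrightarrow> norm (g z) \<le> C"
    "\<And>z. (g has_derivative (\<lambda>h. g1 z * h + g2 z * cnj h)) (at z)" "sb R C j g1" "sb R C j g2"
    unfolding sb.simps by blast
  from Suc.prems obtain h1 h2 where h: "\<forall>z. norm z \<le> R \<longrightarrow> norm (h z) \<le> D"
    "\<And>z. (h has_derivative (\<lambda>x. h1 z * x + h2 z * cnj x)) (at z)" "sb R D j h1" "sb R D j h2"
    unfolding sb.simps by blast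
  show ?case
  proof (rule sb_SucI[OF _ _ Suc.IH[OF g(3) h(3)] Suc.IH[OF g(4) h(4)]])
    show "norm (g z + h z) \<le> C + D" if "norm z \<le> R" for z
      using g(1) h(1) that by (auto intro!: norm_triangle_mono)
    show "((\<lambda>z. g z + h z) has_derivative (\<lambda>x. (g1 z + h1 z) * x + (g2 z + h2 z) * cnj x)) (at z)" for z
      by (rule has_derivative_eq_rhs[OF has_derivative_add[OF g(2) h(2)]]) (simp add: algebra_simps)
  qed
qed

lemma sb_cmult: "sb R C j g \<Longrightarrow> sb R (norm c * C) j (\<lambda>z. c * g z)"
proof (induction j arbitrary: g)
  case 0
  then show ?case by (auto intro!: continuous_intros mult_left_mono simp: norm_mult)
next
  case (Suc j)
  from Suc.prems obtain g1 g2 where g: "\<forall>z. norm z \<le> R \<longrightarrow> norm (g z) \<le> C"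
    "\<And>z. (g has_derivative (\<lambda>h. g1 z * h + g2 z * cnj h)) (at z)" "sb R C j g1" "sb R C j g2"
    unfolding sb.simps by blast
  show ?case
  proof (rule sb_SucI[OF _ _ Suc.IH[OF g(3)] Suc.IH[OF g(4)]])
    show "norm (c * g z) \<le> norm c * C" if "norm z \<le> R" for z
      using g(1) that by (auto intro!: mult_left_mono simp: norm_mult)
    show "((\<lambda>z. c * g z) has_derivative (\<lambda>x. (c * g1 z) * x + (c * g2 z) * cnj x)) (at z)" for z
      by (rule has_derivative_eq_rhs[OF has_derivative_mult_right[OF g(2)]]) (simp add: algebra_simps)
  qed
qed

text \<open>A family whose linear span is closed under Wirtinger derivatives. At
  \<open>e = 0\<close> it is homogeneous of degree q + a + b.\<close>

definition Fpow :: "real \<Rightarrow> real \<Rightarrow> nat \<Rightarrow> nat \<Rightarrow> complex \<Rightarrow> complex" where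
  "Fpow e q a b z = of_real (((norm z)\<^sup>2 + e) powr (q / 2)) * z ^ a * cnj z ^ b"

lemma has_derivative_norm_sq_powr:
  assumes "0 < e"
  shows "((\<lambda>z::complex. complex_of_real (((norm z)\<^sup>2 + e) powr (q / 2))) has_derivative
     (\<lambda>h. of_real (q / 2 * ((norm z)\<^sup>2 + e) powr ((q - 2) / 2)) * (cnj z * h + z * cnj h))) (at z)"
proof -
  have pos: "0 < z \<bullet> z + e" using assms by (simp add: add_nonneg_pos)
  have 1: "((\<lambda>z::complex. z \<bullet> z + e) has_derivative (\<lambda>h. 2 * (z \<bullet> h))) (at z)"
    by (auto intro!: derivative_eq_intros simp: inner_commute)
  have "((\<lambda>x. x powr (q / 2)) has_real_derivative q / 2 * (z \<bullet> z + e) powr (q / 2 - 1)) (at (z \<bullet> z + e))"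
    by (rule has_real_derivative_powr[OF pos])
  then have "((\<lambda>x. x powr (q / 2)) has_derivative (\<lambda>h. q / 2 * (z \<bullet> z + e) powr (q / 2 - 1) * h)) (at (z \<bullet> z + e))"
    unfolding has_field_derivative_def .
  from has_derivative_of_real[OF has_derivative_compose[OF 1 this]]
  have "((\<lambda>z. complex_of_real ((z \<bullet> z + e) powr (q / 2))) has_derivative
     (\<lambda>h. complex_of_real (q / 2 * (z \<bullet> z + e) powr (q / 2 - 1) * (2 * (z \<bullet> h))))) (at z)" .
  moreover have "(\<lambda>h. complex_of_real (q / 2 * (z \<bullet> z + e) powr (q / 2 - 1) * (2 * (z \<bullet> h)))) =
        (\<lambda>h. of_real (q / 2 * ((norm z)\<^sup>2 + e) powr ((q - 2) / 2)) * (cnj z * h + z * cnj h))"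
    proof
      fix h
      have "cnj z * h + z * cnj h = complex_of_real (2 * (z \<bullet> h))"
        by (simp add: complex_eq_iff inner_complex_def algebra_simps)
      moreover have "q / 2 - 1 = (q - 2) / 2" by (simp add: field_simps)
      ultimately show "complex_of_real (q / 2 * (z \<bullet> z + e) powr (q / 2 - 1) * (2 * (z \<bullet> h))) =
        of_real (q / 2 * ((norm z)\<^sup>2 + e) powr ((q - 2) / 2)) * (cnj z * h + z * cnj h)"
        by (simp only: of_real_mult power2_norm_eq_inner)
    qed
  ultimately show ?thesis by (simp only: power2_norm_eq_inner)
qed

text \<open>Truncated subtraction in \<open>a - 1\<close> and \<open>b - 1\<close> is harmless: at 0
  the factor in front vanishes.\<close>

lemma has_derivative_Fpow:
  assumes "0 < e"
  shows "(Fpow e q a b has_derivative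
     (\<lambda>h. (of_real (q / 2) * Fpow e (q - 2) a (Suc b) z + of_nat a * Fpow e q (a - 1) b z) * h +
          (of_real (q / 2) * Fpow e (q - 2) (Suc a) b z + of_nat b * Fpow e q a (b - 1) z) * cnj h)) (at z)"
proof -
  have 1: "((\<lambda>z::complex. z ^ a) has_derivative (\<lambda>h. of_nat a * z ^ (a - 1) * h)) (at z)"
    by (rule has_derivative_eq_rhs, rule has_derivative_power[OF has_derivative_ident]) auto
  have 2: "((\<lambda>z::complex. cnj z ^ b) has_derivative (\<lambda>h. of_nat b * cnj z ^ (b - 1) * cnj h)) (at z)"
    by (rule has_derivative_eq_rhs, rule has_derivative_power[OF bounded_linear_imp_has_derivative[OF bounded_linear_cnj]]) auto
  show ?thesis
    unfolding Fpow_def[abs_def]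
    by (rule has_derivative_eq_rhs[OF has_derivative_mult[OF has_derivative_mult[OF has_derivative_norm_sq_powr[OF assms] 1] 2]])
       (simp add: fun_eq_iff algebra_simps)
qed

lemma Fpow_continuous: "0 < e \<Longrightarrow> continuous_on A (Fpow e q a b)"
  by (intro continuous_at_imp_continuous_on ballI has_derivative_continuous[OF has_derivative_Fpow])

lemma Fpow_bound:
  assumes "0 < e" "e \<le> 1" "norm z \<le> R" "0 \<le> q + real (a + b)"
  shows "norm (Fpow e q a b z) \<le> (R\<^sup>2 + 1) powr ((q + real (a + b)) / 2)"
proof -
  define X where "X = (norm z)\<^sup>2 + e"
  have X: "0 < X" "X \<le> R\<^sup>2 + 1"
    using assms by (auto simp: X_def add_nonneg_pos intro!: add_mono power_mono)
  have "norm z \<le> X powr (1 / 2)"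
    using X assms by (simp add: powr_half_sqrt X_def real_le_rsqrt)
  then have "norm z ^ (a + b) \<le> (X powr (1 / 2)) ^ (a + b)"
    by (intro power_mono) auto
  also have "\<dots> = X powr (real (a + b) / 2)"
    using X by (simp add: powr_powr flip: powr_realpow)
  finally have "X powr (q / 2) * norm z ^ (a + b) \<le> X powr (q / 2) * X powr (real (a + b) / 2)"
    by (intro mult_left_mono) auto
  also have "\<dots> = X powr ((q + real (a + b)) / 2)"
    by (simp flip: powr_add add: add_divide_distrib)
  also have "\<dots> \<le> (R\<^sup>2 + 1) powr ((q + real (a + b)) / 2)"
    using X assms by (intro powr_mono2) auto
  finally show ?thesis
    by (simp add: Fpow_def norm_mult norm_power power_add X_def mult.assoc)
qed

text \<open>Each derivative lowers the degree q + a + b by one, and a bound uniform in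
  \<open>e\<close> holds as long as the degree is nonnegative. For q = 0 the function is a
  polynomial, whose derivatives vanish before the degree could become negative. The constant is
  independent of \<open>e\<close>, which makes the later limit possible.\<close>

lemma sb_Fpow:
  assumes "0 \<le> R" "0 \<le> q + real (a + b)" "real j \<le> q + real (a + b) \<or> q = 0"
  shows "\<exists>C\<ge>0. \<forall>e. 0 < e \<and> e \<le> 1 \<longrightarrow> sb R C j (Fpow e q a b)"
  using assms(2,3)
proof (induction j arbitrary: q a b)
  case 0
  then show ?case
    by (intro exI[of _ "(R\<^sup>2 + 1) powr ((q + real (a + b)) / 2)"])
       (use Fpow_bound[of _ _ R q a b] in \<open>auto intro: Fpow_continuous\<close>)
next
  case (Suc j)
  note IH = Suc.IH and pr = Suc.prems
  \<comment> \<open>The terms from differentiating the power: q drops by 2 and one of the exponents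
    rises by 1. For q = 0 the coefficient kills them.\<close>
  have T1: "\<exists>C\<ge>0. \<forall>e. 0 < e \<and> e \<le> 1 \<longrightarrow> sb R C j (\<lambda>z. of_real (q / 2) * Fpow e (q - 2) a' b' z)"
    if ab: "a' + b' = Suc (a + b)" for a' b'
  proof (cases "q = 0")
    case True
    then show ?thesis by (auto intro!: exI[of _ 0] sb_zero)
  next
    case False
    have r: "real (a' + b') = real (a + b) + 1" using ab by simp
    obtain C where C: "0 \<le> C" "\<forall>e. 0 < e \<and> e \<le> 1 \<longrightarrow> sb R C j (Fpow e (q - 2) a' b')"
      using IH[of "q - 2" a' b'] pr False unfolding r by force
    then show ?thesis by (intro exI[of _ "norm (complex_of_real (q / 2)) * C"] conjI allI impI sb_cmult) auto
  qed
  \<comment> \<open>The terms from differentiating the monomial. The premise speaks of nonzero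
    \<open>c\<close> only, since otherwise \<open>a - 1\<close> or \<open>b - 1\<close> would be
    truncated.\<close>
  have T2: "\<exists>C\<ge>0. \<forall>e. 0 < e \<and> e \<le> 1 \<longrightarrow> sb R C j (\<lambda>z. of_nat c * Fpow e q a' b' z)"
    if ab: "c \<noteq> 0 \<longrightarrow> Suc (a' + b') = a + b" for a' b' c
  proof (cases "c = 0")
    case True
    then show ?thesis by (auto intro!: exI[of _ 0] sb_zero)
  next
    case False
    have r: "real (a + b) = real (a' + b') + 1" using ab False by simp
    obtain C where C: "0 \<le> C" "\<forall>e. 0 < e \<and> e \<le> 1 \<longrightarrow> sb R C j (Fpow e q a' b')"
      using IH[of q a' b'] pr unfolding r by force
    then show ?thesis by (intro exI[of _ "norm (complex_of_nat c) * C"] conjI allI impI sb_cmult) auto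
  qed
  obtain C1 where C1: "0 \<le> C1" "\<forall>e. 0 < e \<and> e \<le> 1 \<longrightarrow> sb R C1 j (\<lambda>z. of_real (q / 2) * Fpow e (q - 2) a (Suc b) z)"
    using T1[of a "Suc b"] by auto
  obtain C2 where C2: "0 \<le> C2" "\<forall>e. 0 < e \<and> e \<le> 1 \<longrightarrow> sb R C2 j (\<lambda>z. of_real (q / 2) * Fpow e (q - 2) (Suc a) b z)"
    using T1[of "Suc a" b] by auto
  obtain C3 where C3: "0 \<le> C3" "\<forall>e. 0 < e \<and> e \<le> 1 \<longrightarrow> sb R C3 j (\<lambda>z. of_nat a * Fpow e q (a - 1) b z)"
    using T2[of a "a - 1" b] by auto
  obtain C4 where C4: "0 \<le> C4" "\<forall>e. 0 < e \<and> e \<le> 1 \<longrightarrow> sb R C4 j (\<lambda>z. of_nat b * Fpow e q a (b - 1) z)"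
    using T2[of b a "b - 1"] by auto
  define C where "C = (R\<^sup>2 + 1) powr ((q + real (a + b)) / 2) + (C1 + C3) + (C2 + C4)"
  show ?case
  proof (intro exI[of _ C] conjI allI impI)
    show "0 \<le> C" using C1 C2 C3 C4 by (simp add: C_def)
    fix e :: real
    assume e: "0 < e \<and> e \<le> 1"
    show "sb R C (Suc j) (Fpow e q a b)"
    proof (rule sb_SucI)
      show "norm (Fpow e q a b z) \<le> C" if "norm z \<le> R" for z
        using Fpow_bound[of e z R q a b] e that pr C1 C2 C3 C4 by (simp add: C_def)
      show "(Fpow e q a b has_derivative
       (\<lambda>h. (of_real (q / 2) * Fpow e (q - 2) a (Suc b) z + of_nat a * Fpow e q (a - 1) b z) * h +
          (of_real (q / 2) * Fpow e (q - 2) (Suc a) b z + of_nat b * Fpow e q a (b - 1) z) * cnj h)) (at z)" for z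
        using has_derivative_Fpow e by blast
      show "sb R C j (\<lambda>z. of_real (q / 2) * Fpow e (q - 2) a (Suc b) z + of_nat a * Fpow e q (a - 1) b z)"
        by (rule sb_mono[OF sb_add[of R C1 _ _ C3]]) (use e C1 C2 C3 C4 in \<open>auto simp: C_def\<close>)
      show "sb R C j (\<lambda>z. of_real (q / 2) * Fpow e (q - 2) (Suc a) b z + of_nat b * Fpow e q a (b - 1) z)"
        by (rule sb_mono[OF sb_add[of R C2 _ _ C4]]) (use e C1 C2 C3 C4 in \<open>auto simp: C_def\<close>)
    qed
  qed
qed

text \<open>A smooth regularisation of \<open>\<bar>z\<bar>\<^sup>q z\<close>.  Subtracting the linear part makes it vanish to second order
  at \<open>0\<close> (which yields integrability), and makes it exact for \<open>q = 2\<close>.\<close>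

definition Gam :: "real \<Rightarrow> real \<Rightarrow> complex \<Rightarrow> complex" where
  "Gam e q z = of_real (((norm z)\<^sup>2 + e) powr (q / 2)) * z - of_real (e powr (q / 2)) * z"

text \<open>\<open>Gam1\<close> and \<open>Gam2\<close> are the Wirtinger derivatives of
  \<open>Gam\<close>, written through \<open>Fpow\<close> so that its uniform bounds apply.\<close>

definition Gam1 :: "real \<Rightarrow> real \<Rightarrow> complex \<Rightarrow> complex" where
  "Gam1 e q z = of_real (q / 2) * Fpow e (q - 2) 1 1 z + (Fpow e q 0 0 z + - of_real (e powr (q / 2)))"

definition Gam2 :: "real \<Rightarrow> real \<Rightarrow> complex \<Rightarrow> complex" where
  "Gam2 e q z = of_real (q / 2) * Fpow e (q - 2) 2 0 z"

lemma has_derivative_Gam: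
  assumes "0 < e"
  shows "(Gam e q has_derivative (\<lambda>h. Gam1 e q z * h + Gam2 e q z * cnj h)) (at z)"
proof -
  have eq: "Gam e q = (\<lambda>z. Fpow e q 1 0 z - of_real (e powr (q / 2)) * z)"
    by (auto simp: Gam_def Fpow_def)
  show ?thesis unfolding eq
    by (rule has_derivative_eq_rhs[OF has_derivative_diff[OF has_derivative_Fpow[OF assms] has_derivative_mult_right[OF has_derivative_ident]]])
       (simp add: fun_eq_iff Gam1_def Gam2_def algebra_simps numeral_2_eq_2)
qed

text \<open>The nonconstant terms have degree q, so k <= q derivatives stay bounded uniformly in
  \<open>e\<close>. For q = 2 the subtracted linear part cancels the dependence on \<open>e\<close>,
  and the derivatives are the polynomials 2 |z|^2 and z^2, which are controlled to every
  order.\<close>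

lemma Gam_sb:
  assumes "0 \<le> R" "1 \<le> q" "real k \<le> q \<or> q = 2"
  shows "\<exists>C\<ge>0. \<forall>e. 0 < e \<and> e \<le> 1 \<longrightarrow> sb R C k (Gam1 e q) \<and> sb R C k (Gam2 e q)"
proof (cases "q = 2")
  case True
  obtain C1 where C1: "0 \<le> C1" "\<forall>e. 0 < e \<and> e \<le> 1 \<longrightarrow> sb R C1 k (Fpow e 0 1 1)"
    using sb_Fpow[of R 0 1 1 k] assms by auto
  obtain C2 where C2: "0 \<le> C2" "\<forall>e. 0 < e \<and> e \<le> 1 \<longrightarrow> sb R C2 k (Fpow e 0 2 0)"
    using sb_Fpow[of R 0 2 0 k] assms by auto
  show ?thesis
  proof (intro exI[of _ "2 * C1 + C2"] conjI allI impI)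
    fix e :: real assume e: "0 < e \<and> e \<le> 1"
    have zz: "0 < (norm z)\<^sup>2 + e" for z :: complex using e by (simp add: add_nonneg_pos)
    have "Gam1 e q = (\<lambda>z. 2 * Fpow e 0 1 1 z)"
    proof
      fix z
      have "(complex_of_real (norm z))\<^sup>2 = z * cnj z" by (metis complex_norm_square of_real_power)
      then show "Gam1 e q z = 2 * Fpow e 0 1 1 z"
        using True e zz[of z] by (simp add: Gam1_def Fpow_def)
    qed
    moreover have "Gam2 e q = (\<lambda>z. Fpow e 0 2 0 z)"
      using True e zz by (auto simp: Gam2_def)
    ultimately show "sb R (2 * C1 + C2) k (Gam1 e q)" "sb R (2 * C1 + C2) k (Gam2 e q)"
      using sb_cmult[of R C1 k "Fpow e 0 1 1" 2] C1 C2 e by (auto elim!: sb_mono)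
  qed (use C1 C2 in auto)
next
  case False
  then have kq: "real k \<le> q" using assms by auto
  obtain C1 where C1: "0 \<le> C1" "\<forall>e. 0 < e \<and> e \<le> 1 \<longrightarrow> sb R C1 k (Fpow e (q - 2) 1 1)"
    using sb_Fpow[of R "q - 2" 1 1 k] assms kq by auto
  obtain C2 where C2: "0 \<le> C2" "\<forall>e. 0 < e \<and> e \<le> 1 \<longrightarrow> sb R C2 k (Fpow e (q - 2) 2 0)"
    using sb_Fpow[of R "q - 2" 2 0 k] assms kq by auto
  obtain C3 where C3: "0 \<le> C3" "\<forall>e. 0 < e \<and> e \<le> 1 \<longrightarrow> sb R C3 k (Fpow e q 0 0)"
    using sb_Fpow[of R q 0 0 k] assms kq by auto
  define c where "c = norm (complex_of_real (q / 2))"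
  have c0: "0 \<le> c" by (simp add: c_def)
  show ?thesis
  proof (intro exI[of _ "c * C1 + (C3 + 1) + c * C2"] conjI allI impI)
    fix e :: real assume e: "0 < e \<and> e \<le> 1"
    have "e powr (q / 2) \<le> 1 powr (q / 2)" using e assms by (intro powr_mono2) auto
    then have cst: "norm (- complex_of_real (e powr (q / 2))) \<le> 1" by simp
    have p: "0 \<le> c * C1" "0 \<le> c * C2" using C1 C2 c0 by auto
    show "sb R (c * C1 + (C3 + 1) + c * C2) k (Gam1 e q)"
      unfolding Gam1_def[abs_def] c_def
      by (rule sb_mono, rule sb_add, rule sb_cmult[of R C1], use C1 e in simp, rule sb_add[of R C3 _ _ 1], use C3 e in simp,
          rule sb_const[OF cst]) (use p in \<open>simp add: c_def\<close>)
    show "sb R (c * C1 + (C3 + 1) + c * C2) k (Gam2 e q)"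
      unfolding Gam2_def[abs_def] c_def
      by (rule sb_mono, rule sb_cmult[of R C2], use C2 e in simp) (use p C3 in \<open>simp add: c_def\<close>)
  qed (use C1 C2 C3 c0 in auto)
qed

lemma powr_diff_le:
  fixes A B q :: real
  assumes "0 < B" "B \<le> A" "1 \<le> q"
  shows "A powr q - B powr q \<le> q * A powr (q - 1) * (A - B)"
proof (cases "A = B")
  case False
  then have AB: "B < A" using assms by simp
  have "\<exists>z>B. z < A \<and> A powr q - B powr q = (A - B) * (q * z powr (q - 1))"
    by (rule MVT2[OF AB]) (use assms in \<open>auto intro!: has_real_derivative_powr\<close>)
  then obtain z where z: "B < z" "z < A" "A powr q - B powr q = (A - B) * (q * z powr (q - 1))" by blast
  have "z powr (q - 1) \<le> A powr (q - 1)" using z assms by (intro powr_mono2) auto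
  then have "(A - B) * (q * z powr (q - 1)) \<le> (A - B) * (q * A powr (q - 1))"
    using AB assms by (intro mult_left_mono) auto
  then show ?thesis using z by (simp add: ac_simps)
qed simp

text \<open>The derivatives vanish at least linearly at 0, uniformly in \<open>e\<close>. Writing A
  for the square root of |z|^2 + e, the delicate term is A^q - (sqrt e)^q: it is at most q A^(q-1)
  (A - sqrt e), and A - sqrt e <= |z|.\<close>

lemma Gam_deriv_bound:
  assumes "0 \<le> R" "1 \<le> q" "0 < e" "e \<le> 1" "norm z \<le> R"
  shows "norm (Gam1 e q z) \<le> 2 * q * (R\<^sup>2 + 1) powr (q / 2) * norm z"
    and "norm (Gam2 e q z) \<le> 2 * q * (R\<^sup>2 + 1) powr (q / 2) * norm z"
proof -
  define X where "X = (norm z)\<^sup>2 + e"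
  define A where "A = X powr (1 / 2)"
  have X: "0 < X" "X \<le> R\<^sup>2 + 1"
    using assms by (auto simp: X_def add_nonneg_pos intro!: add_mono power_mono)
  have A: "0 < A" "A = sqrt X" using X by (auto simp: A_def powr_half_sqrt)
  have zA: "norm z \<le> A" using assms by (simp add: A X_def real_le_rsqrt)
  have Apow: "X powr (r / 2) = A powr r" for r by (simp add: A_def powr_powr)
  have Ab: "A powr (q - 1) \<le> (R\<^sup>2 + 1) powr (q / 2)"
  proof -
    have "A powr (q - 1) = X powr ((q - 1) / 2)" by (simp add: Apow)
    also have "\<dots> \<le> (R\<^sup>2 + 1) powr ((q - 1) / 2)" using X assms by (intro powr_mono2) auto
    also have "\<dots> \<le> (R\<^sup>2 + 1) powr (q / 2)" by (intro powr_mono) auto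
    finally show ?thesis .
  qed
  define D where "D = (R\<^sup>2 + 1) powr (q / 2)"
  have D: "0 \<le> D" "A powr (q - 1) \<le> D" using Ab by (auto simp: D_def)
  have sq: "A powr (q - 2) * (norm z)\<^sup>2 \<le> D * norm z"
  proof -
    have "A powr (q - 2) * (norm z)\<^sup>2 \<le> A powr (q - 2) * (A * norm z)"
      using zA by (intro mult_left_mono) (auto simp: power2_eq_square intro!: mult_right_mono)
    also have "A powr (q - 2) * (A * norm z) = A powr (q - 1) * norm z"
      using A(1) powr_add[of A "q - 2" 1] by simp
    also have "\<dots> \<le> D * norm z" using D by (intro mult_right_mono) auto
    finally show ?thesis .
  qed
  have h: "q / 2 * (A powr (q - 2) * (norm z)\<^sup>2) \<le> q * (D * norm z)"
  proof -
    have "q / 2 * (A powr (q - 2) * (norm z)\<^sup>2) \<le> q / 2 * (D * norm z)" using sq assms by (intro mult_left_mono) auto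
    also have "\<dots> \<le> q * (D * norm z)" using assms D by (intro mult_right_mono) auto
    finally show ?thesis .
  qed
  have n2: "norm (of_real (q / 2) * Fpow e (q - 2) a b z) = q / 2 * (A powr (q - 2) * (norm z)\<^sup>2)" if "a + b = 2" for a b
  proof -
    have "norm z ^ a * norm z ^ b = (norm z)\<^sup>2" using that by (simp flip: power_add)
    then show ?thesis using assms by (simp add: Fpow_def norm_mult norm_power X_def[symmetric] Apow mult.assoc)
  qed
  have "0 \<le> q * (D * norm z)" using assms D by auto
  then show "norm (Gam2 e q z) \<le> 2 * q * D * norm z"
    using n2[of 2 0] h by (simp add: Gam2_def)
  have "norm (Fpow e q 0 0 z + - of_real (e powr (q / 2))) = \<bar>A powr q - sqrt e powr q\<bar>"
  proof -
    have "e powr (q / 2) = sqrt e powr q" using assms by (simp add: powr_powr flip: powr_half_sqrt)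
    then have "Fpow e q 0 0 z + - of_real (e powr (q / 2)) = of_real (A powr q - sqrt e powr q)"
      by (simp add: Fpow_def X_def[symmetric] Apow)
    then show ?thesis by (simp only: norm_of_real)
  qed
  also have "\<dots> \<le> q * A powr (q - 1) * (A - sqrt e)"
  proof -
    have "sqrt e \<le> A" by (simp add: A X_def)
    moreover from this have "sqrt e powr q \<le> A powr q" using assms by (intro powr_mono2) auto
    ultimately show ?thesis using powr_diff_le[of "sqrt e" A q] assms by simp
  qed
  also have "A - sqrt e \<le> norm z"
    using sqrt_add_le_add_sqrt[of "(norm z)\<^sup>2" e] assms by (simp add: A X_def)
  also have "q * A powr (q - 1) * norm z \<le> q * D * norm z"
    using D assms by (intro mult_right_mono mult_left_mono) auto
  finally have "norm (Fpow e q 0 0 z + - of_real (e powr (q / 2))) \<le> q * (D * norm z)"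
    using assms by (simp add: mult_left_mono mult.assoc)
  then have "norm (Gam1 e q z) \<le> q * (D * norm z) + q * (D * norm z)"
    unfolding Gam1_def using h n2[of 1 1] by (intro norm_triangle_mono) auto
  then show "norm (Gam1 e q z) \<le> 2 * q * D * norm z" by (simp add: algebra_simps)
qed

text \<open>Twice the coefficient in \<open>Gam_deriv_bound\<close>, because the contributions of
  the two Wirtinger derivatives add up.\<close>

definition powc :: "real \<Rightarrow> real \<Rightarrow> real" where
  "powc q R = 4 * q * (R\<^sup>2 + 1) powr (q / 2)"

lemma powc_nonneg: "0 \<le> q \<Longrightarrow> 0 \<le> powc q R"
  by (simp add: powc_def)

text \<open>The mean value inequality on the disc of radius max |z| |y|, where the derivatives are
  at most linear in the radius. The factor |z| + |y| later makes differences of nonlinear terms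
  integrable.\<close>

lemma Gam_Lipschitz:
  assumes "0 \<le> R" "1 \<le> q" "0 < e" "e \<le> 1" "norm z \<le> R" "norm y \<le> R"
  shows "norm (Gam e q z - Gam e q y) \<le> powc q R * (norm z + norm y) * norm (z - y)"
proof -
  define r where "r = max (norm z) (norm y)"
  define D where "D = 2 * q * (R\<^sup>2 + 1) powr (q / 2)"
  have D: "0 \<le> D" using assms by (simp add: D_def)
  have r: "r \<le> R" "0 \<le> r" "r \<le> norm z + norm y" using assms by (auto simp: r_def le_max_iff_disj)
  have "norm (Gam e q z - Gam e q y) \<le> (2 * D * r) * norm (z - y)"
  proof (rule differentiable_bound)
    show "convex (cball 0 r :: complex set)" by simp
    show "(Gam e q has_derivative (\<lambda>h. Gam1 e q x * h + Gam2 e q x * cnj h)) (at x within cball 0 r)" for x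
      using has_derivative_Gam[OF assms(3)] has_derivative_at_withinI by blast
    show "onorm (\<lambda>h. Gam1 e q x * h + Gam2 e q x * cnj h) \<le> 2 * D * r" if "x \<in> cball 0 r" for x
    proof (rule onorm_bound)
      have x: "norm x \<le> r" using that by simp
      have "norm (Gam1 e q x) \<le> D * norm x" "norm (Gam2 e q x) \<le> D * norm x"
        using Gam_deriv_bound[OF assms(1-4), of x] x r by (auto simp: D_def)
      moreover have "D * norm x \<le> D * r" using x D by (intro mult_left_mono)
      ultimately have b: "norm (Gam1 e q x) \<le> D * r" "norm (Gam2 e q x) \<le> D * r" by auto
      fix h
      have "norm (Gam1 e q x * h + Gam2 e q x * cnj h) \<le> D * r * norm h + D * r * norm h"
        using b by (intro norm_triangle_mono) (auto simp: norm_mult intro!: mult_right_mono)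
      then show "norm (Gam1 e q x * h + Gam2 e q x * cnj h) \<le> 2 * D * r * norm h" by simp
    qed (use D r in auto)
  qed (auto simp: r_def)
  also have "\<dots> \<le> (2 * D * (norm z + norm y)) * norm (z - y)"
    using r D by (intro mult_right_mono mult_left_mono) auto
  finally show ?thesis by (simp add: D_def powc_def ac_simps)
qed

definition Gq :: "real \<Rightarrow> complex \<Rightarrow> complex" where
  "Gq q z = of_real (norm z powr q) * z"

lemma Gam_tendsto:
  assumes "0 < q" "e \<longlonglongrightarrow> 0" "\<And>n. 0 < e n"
  shows "(\<lambda>n. Gam (e n) q z) \<longlonglongrightarrow> Gq q z"
proof -
  have "(\<lambda>n. ((norm z)\<^sup>2 + e n) powr (q / 2)) \<longlonglongrightarrow> ((norm z)\<^sup>2 + 0) powr (q / 2)"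
    by (rule tendsto_powr2[OF tendsto_add[OF tendsto_const assms(2)] tendsto_const])
       (use assms in \<open>auto intro!: always_eventually simp: less_imp_le\<close>)
  moreover have "((norm z)\<^sup>2 + 0) powr (q / 2) = norm z powr q"
    by (cases "z = 0") (auto simp: powr_powr simp flip: powr_numeral)
  moreover have "(\<lambda>n. e n powr (q / 2)) \<longlonglongrightarrow> 0 powr (q / 2)"
    by (rule tendsto_powr2) (use assms in \<open>auto intro!: tendsto_intros always_eventually simp: less_imp_le\<close>)
  ultimately have "(\<lambda>n. of_real (((norm z)\<^sup>2 + e n) powr (q / 2)) * z - of_real (e n powr (q / 2)) * z)
    \<longlonglongrightarrow> of_real (norm z powr q) * z - of_real 0 * z"
    by (intro tendsto_diff tendsto_mult tendsto_of_real tendsto_const) simp_all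
  then show ?thesis by (simp add: Gam_def Gq_def)
qed

text \<open>The constant in \<open>Gam_Lipschitz\<close> does not involve \<open>e\<close>, so it
  survives the limit.\<close>

lemma Gq_Lipschitz:
  assumes "0 \<le> R" "1 \<le> q" "norm z \<le> R" "norm y \<le> R"
  shows "norm (Gq q z - Gq q y) \<le> powc q R * (norm z + norm y) * norm (z - y)"
proof -
  define e where "e n = inverse (real (Suc n))" for n
  have e: "0 < e n" "e n \<le> 1" for n by (auto simp: e_def inverse_le_1_iff)
  have el: "e \<longlonglongrightarrow> 0" unfolding e_def by (rule LIMSEQ_inverse_real_of_nat)
  have "(\<lambda>n. norm (Gam (e n) q z - Gam (e n) q y)) \<longlonglongrightarrow> norm (Gq q z - Gq q y)"
    using assms by (intro tendsto_intros Gam_tendsto el e) auto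
  then show ?thesis
    by (rule LIMSEQ_le_const2) (use Gam_Lipschitz[OF assms(1,2) e assms(3,4)] in auto)
qed

lemma Gq_zero [simp]: "Gq q 0 = 0" by (simp add: Gq_def)
lemma Gam_zero [simp]: "Gam e q 0 = 0" by (simp add: Gam_def)

lemma Gq_continuous:
  assumes "1 \<le> q" shows "continuous_on A (Gq q)"
proof -
  have "continuous_on (UNIV :: complex set) (\<lambda>z. complex_of_real (norm z powr q) * z)"
    using assms by (intro continuous_intros continuous_on_powr') auto
  then show ?thesis unfolding Gq_def[abs_def] by (rule continuous_on_subset) simp
qed

lemma Gam_continuous: "0 < e \<Longrightarrow> continuous_on A (Gam e q)"
  by (intro continuous_at_imp_continuous_on ballI has_derivative_continuous[OF has_derivative_Gam])

section \<open>Frequency cutoffs and the nonlinearity on the Fourier side\<close>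

text \<open>A sharp cutoff makes the inverse transform classically differentiable, as
  \<open>hb\<close> demands, and does not increase any weighted L2 bound.\<close>

definition bl :: "real \<Rightarrow> (real \<Rightarrow> complex) \<Rightarrow> real \<Rightarrow> complex" where
  "bl M F \<xi> = indicator {-M..M} \<xi> *\<^sub>R F \<xi>"

lemma bl_integrable: "continuous_on UNIV F \<Longrightarrow> integrable lborel (bl M F)"
  unfolding bl_def[abs_def] by (rule borel_integrable_compact) (auto intro: continuous_on_subset)

lemma bl_measurable [measurable]: "F \<in> borel_measurable borel \<Longrightarrow> bl M F \<in> borel_measurable borel"
  unfolding bl_def[abs_def] by measurable

lemma norm_bl_le: "norm (bl M F \<xi>) \<le> norm (F \<xi>)"
  by (simp add: bl_def indicator_def)

lemma L2b_bl: "wt w \<Longrightarrow> L2b w B F \<Longrightarrow> L2b w B (bl M F)"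
  by (rule L2b_mono_norm) (auto simp: norm_bl_le L2b_def)

lemma has_vector_derivative_cis_mult:
  "((\<lambda>x. cis (x * \<xi>)) has_vector_derivative (\<i> * of_real \<xi> * cis (x * \<xi>))) (at x)"
proof -
  have "((\<lambda>z. exp (\<i> * (z * of_real \<xi>))) has_field_derivative (\<i> * of_real \<xi> * exp (\<i> * (of_real x * of_real \<xi>)))) (at (of_real x))"
    by (auto intro!: derivative_eq_intros)
  from has_vector_derivative_real_field[OF this] show ?thesis
    by (simp add: cis_conv_exp o_def)
qed

lemma ift_bl:
  assumes "continuous_on UNIV F"
  shows "ift (bl M F) x = of_real (1 / sqrt (2 * pi)) * integral {-M..M} (\<lambda>\<xi>. cis (x * \<xi>) * F \<xi>)"
proof -
  have c: "continuous_on {-M..M} (\<lambda>\<xi>. cis (x * \<xi>) * F \<xi>)"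
    using assms by (auto intro!: continuous_intros intro: continuous_on_subset)
  show ?thesis
    unfolding ift_eq integral_strip_eq_LINT(1)[OF c] by (simp add: bl_def)
qed

lemma has_vector_derivative_ift_bl:
  assumes F: "continuous_on UNIV F"
  shows "(ift (bl M F) has_vector_derivative ift (bl M (\<lambda>\<xi>. \<i> * of_real \<xi> * F \<xi>)) x) (at x)"
proof -
  have c: "continuous_on UNIV (\<lambda>\<xi>. \<i> * of_real \<xi> * F \<xi>)"
    using F by (intro continuous_intros)
  have "((\<lambda>x. integral (cbox (-M) M) (\<lambda>\<xi>. cis (x * \<xi>) * F \<xi>)) has_vector_derivative
      integral (cbox (-M) M) (\<lambda>\<xi>. cis (x * \<xi>) * (\<i> * of_real \<xi> * F \<xi>))) (at x within UNIV)"
  proof (rule leibniz_rule_vector_derivative)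
    show "((\<lambda>x. cis (x * t) * F t) has_vector_derivative cis (x * t) * (\<i> * of_real t * F t)) (at x within UNIV)" for x t
      using has_vector_derivative_mult_left[OF has_vector_derivative_cis_mult[of t x], of "F t"]
      by (simp add: ac_simps)
    show "(\<lambda>\<xi>. cis (x * \<xi>) * F \<xi>) integrable_on cbox (- M) M" for x
      using F by (intro integrable_continuous) (auto intro!: continuous_intros intro: continuous_on_subset)
    show "continuous_on (UNIV \<times> cbox (- M) M) (\<lambda>(x, t). cis (x * t) * (\<i> * complex_of_real t * F t))"
      unfolding case_prod_beta
      by (intro continuous_intros continuous_on_compose2[OF F]) auto
  qed auto
  then have "((\<lambda>x. of_real (1 / sqrt (2 * pi)) * integral {-M..M} (\<lambda>\<xi>. cis (x * \<xi>) * F \<xi>)) has_vector_derivative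
      of_real (1 / sqrt (2 * pi)) * integral {-M..M} (\<lambda>\<xi>. cis (x * \<xi>) * (\<i> * of_real \<xi> * F \<xi>))) (at x)"
    by (intro has_vector_derivative_mult_right) simp
  then show ?thesis
    unfolding ift_bl[OF F, symmetric] ift_bl[OF c, symmetric] by simp
qed

text \<open>Differentiation multiplies the frequency side by \<open>\<i> * \<xi>\<close>, so the
  induction moves one unit from \<open>i\<close> to \<open>j\<close>; the weight
  \<open>sobw k\<close> absorbs the powers of \<xi> up to order k.\<close>

lemma hb_ift_bl:
  assumes F: "continuous_on UNIV F" "L2b (sobw k) B F"
  shows "i + j \<le> k \<Longrightarrow> hb i B (ift (bl M (\<lambda>\<xi>. (\<i> * of_real \<xi>) ^ j * F \<xi>)))"
proof (induction i arbitrary: j)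
  have L: "L2b (\<lambda>_. 1) B (ift (bl M (\<lambda>\<xi>. (\<i> * of_real \<xi>) ^ j * F \<xi>)))" if "j \<le> k" for j
  proof (rule Bessel_ift)
    have c: "continuous_on UNIV (\<lambda>\<xi>. (\<i> * of_real \<xi>) ^ j * F \<xi>)"
      using F by (intro continuous_intros)
    then show "integrable lborel (bl M (\<lambda>\<xi>. (\<i> * of_real \<xi>) ^ j * F \<xi>))" by (rule bl_integrable)
    show "L2b (\<lambda>_. 1) B (bl M (\<lambda>\<xi>. (\<i> * complex_of_real \<xi>) ^ j * F \<xi>))"
    proof (rule L2b_mono[OF wt_sobw F(2)])
      show "bl M (\<lambda>\<xi>. (\<i> * complex_of_real \<xi>) ^ j * F \<xi>) \<in> borel_measurable borel"
        using c by (intro bl_measurable borel_measurable_continuous_onI)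
      fix \<xi>
      have "(norm (bl M (\<lambda>\<xi>. (\<i> * complex_of_real \<xi>) ^ j * F \<xi>) \<xi>))\<^sup>2 \<le> (norm ((\<i> * complex_of_real \<xi>) ^ j * F \<xi>))\<^sup>2"
        by (intro power_mono norm_bl_le) simp
      also have "\<dots> = (\<xi>\<^sup>2) ^ j * (norm (F \<xi>))\<^sup>2"
      proof -
        have "(norm ((\<i> * complex_of_real \<xi>) ^ j))\<^sup>2 = (\<bar>\<xi>\<bar>\<^sup>2) ^ j"
          by (simp only: norm_power norm_mult norm_ii norm_of_real mult_1 mult.commute[of j] flip: power_mult)
        then show ?thesis by (simp only: norm_mult power_mult_distrib power2_abs)
      qed
      also have "\<dots> \<le> sobw k \<xi> * (norm (F \<xi>))\<^sup>2"
        using order_trans[OF power_mono[of "\<xi>\<^sup>2" "1 + \<xi>\<^sup>2" j] sobw_mono[OF that, unfolded sobw_def]]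
        by (intro mult_right_mono) (auto simp: sobw_def)
      finally show "1 * (norm (bl M (\<lambda>\<xi>. (\<i> * complex_of_real \<xi>) ^ j * F \<xi>) \<xi>))\<^sup>2 \<le> sobw k \<xi> * (norm (F \<xi>))\<^sup>2" by simp
    qed
  qed
  {
    case 0
    have c: "continuous_on UNIV (\<lambda>\<xi>. (\<i> * of_real \<xi>) ^ j * F \<xi>)"
      using F by (intro continuous_intros)
    show ?case using L 0 ift_continuous[OF bl_integrable[OF c]] by simp
  next
    case (Suc i)
    have c: "continuous_on UNIV (\<lambda>\<xi>. (\<i> * of_real \<xi>) ^ j * F \<xi>)"
      using F by (intro continuous_intros)
    have "hb i B (ift (bl M (\<lambda>\<xi>. (\<i> * of_real \<xi>) ^ (Suc j) * F \<xi>)))"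
      by (rule Suc.IH) (use Suc.prems in simp)
    then have "hb i B (ift (bl M (\<lambda>\<xi>. \<i> * of_real \<xi> * ((\<i> * of_real \<xi>) ^ j * F \<xi>))))"
      by (simp add: mult.assoc)
    with L Suc.prems show ?case
      by (intro hb_SucI[OF _ has_vector_derivative_ift_bl[OF c]]) auto
  }
qed

lemma L2b_sobw_L1:
  assumes "1 \<le> k" "L2b (sobw k) B F"
  shows "integrable lborel F" "(LINT \<xi>|lborel. norm (F \<xi>)) \<le> 2 * B"
proof -
  have "L2b (\<lambda>\<xi>. 1 + \<xi>\<^sup>2) B F"
  proof (rule L2b_mono_weight[OF wt_sobw assms(2)])
    show "1 + \<xi>\<^sup>2 \<le> sobw k \<xi>" for \<xi>
      using sobw_mono[OF assms(1), of \<xi>] by (simp add: sobw_def)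
  qed
  from L2b_imp_L1[OF this] show "integrable lborel F" "(LINT \<xi>|lborel. norm (F \<xi>)) \<le> 2 * B" by auto
qed

lemma L2b_sobw_L2: "L2b (sobw k) B F \<Longrightarrow> L2b (\<lambda>_. 1) B F"
  by (rule L2b_mono_weight[OF wt_sobw]) (auto simp: sobw_ge_1)

lemma ift_sobw:
  assumes "1 \<le> k" "L2b (sobw k) B F"
  shows "norm (ift F x) \<le> 2 * B" "L2b (\<lambda>_. 1) B (ift F)" "continuous_on UNIV (ift F)"
proof -
  note L1 = L2b_sobw_L1[OF assms]
  show "norm (ift F x) \<le> 2 * B" by (rule order_trans[OF norm_ift_le L1(2)])
  show "L2b (\<lambda>_. 1) B (ift F)" by (rule Bessel_ift[OF L1(1) L2b_sobw_L2[OF assms(2)]])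
  show "continuous_on UNIV (ift F)" by (rule ift_continuous[OF L1(1)])
qed

text \<open>The Lipschitz factor |z| + |y| bounds the difference by products of two
  square-integrable functions, and Cauchy-Schwarz applies. So the transform of a nonlinear term is a
  convergent integral, with a sup bound from L2 data.\<close>

lemma Lip_compose_L1:
  fixes g :: "complex \<Rightarrow> complex"
  assumes g: "continuous_on UNIV g"
    "\<And>z y. norm z \<le> R \<Longrightarrow> norm y \<le> R \<Longrightarrow> norm (g z - g y) \<le> P * (norm z + norm y) * norm (z - y)"
    and W: "\<And>x. norm (W x) \<le> R" "L2b (\<lambda>_. 1) B W" and V: "\<And>x. norm (V x) \<le> R" "L2b (\<lambda>_. 1) B V"
    and d: "L2b (\<lambda>_. 1) d (\<lambda>x. W x - V x)" and P: "0 \<le> P"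
  shows "integrable lborel (\<lambda>x. g (W x) - g (V x))"
    "(LINT x|lborel. norm (g (W x) - g (V x))) \<le> 2 * P * B * d"
proof -
  have [measurable]: "g \<in> borel_measurable borel" using g(1) by (rule borel_measurable_continuous_onI)
  have [measurable]: "W \<in> borel_measurable borel" "V \<in> borel_measurable borel" using W V by (auto simp: L2b_def)
  note p1 = L2b_prod_integrable[OF W(2) d] and p2 = L2b_prod_integrable[OF V(2) d]
  define h where "h x = P * (norm (W x * (W x - V x)) + norm (V x * (W x - V x)))" for x
  have h: "integrable lborel h" unfolding h_def using p1(1) p2(1) by (auto intro: integrable_norm)
  have b: "norm (g (W x) - g (V x)) \<le> h x" for x
    using g(2)[OF W(1) V(1), of x x] by (simp only: h_def norm_mult distrib_right[symmetric] mult.assoc)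
  show i: "integrable lborel (\<lambda>x. g (W x) - g (V x))"
    by (rule Bochner_Integration.integrable_bound[OF h]) (use b in \<open>auto intro: order_trans[OF _ abs_ge_self]\<close>)
  have "(LINT x|lborel. norm (g (W x) - g (V x))) \<le> (LINT x|lborel. h x)"
    using b h i by (intro integral_mono) (auto intro: integrable_norm)
  also have "\<dots> = P * ((LINT x|lborel. norm (W x * (W x - V x))) + (LINT x|lborel. norm (V x * (W x - V x))))"
    unfolding h_def using p1(1) p2(1) by (simp add: integrable_norm)
  also have "\<dots> \<le> P * (B * d + B * d)"
    using p1(2) p2(2) P by (intro mult_left_mono add_mono) auto
  finally show "(LINT x|lborel. norm (g (W x) - g (V x))) \<le> 2 * P * B * d" by (simp add: algebra_simps)
qed

lemma Lip_compose_integrable: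
  fixes g :: "complex \<Rightarrow> complex"
  assumes g: "continuous_on UNIV g"
    "\<And>z y. norm z \<le> R \<Longrightarrow> norm y \<le> R \<Longrightarrow> norm (g z - g y) \<le> P * (norm z + norm y) * norm (z - y)"
    and W: "\<And>x. norm (W x) \<le> R" "L2b (\<lambda>_. 1) B W" and P: "0 \<le> P" and z: "g 0 = 0"
  shows "integrable lborel (\<lambda>x. g (W x))"
proof -
  have R: "0 \<le> R" using W(1) norm_ge_zero order_trans by blast
  have "integrable lborel (\<lambda>x. g (W x) - g 0)"
    using Lip_compose_L1(1)[OF g W, of "\<lambda>_. 0" B] W(2) P R L2b_nonneg[OF W(2)] by simp
  then show ?thesis by (simp add: z)
qed

lemma L2b_convex:
  assumes "wt w" "L2b w B F" "L2b w B F'" "0 \<le> \<theta>" "\<theta> \<le> 1"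
  shows "L2b w B (\<lambda>\<xi>. F' \<xi> + of_real \<theta> * (F \<xi> - F' \<xi>))"
proof -
  have "L2b w (norm (complex_of_real (1 - \<theta>)) * B + norm (complex_of_real \<theta>) * B) (\<lambda>\<xi>. of_real (1 - \<theta>) * F' \<xi> + of_real \<theta> * F \<xi>)"
    by (intro L2b_add L2b_cmult assms)
  moreover have "norm (complex_of_real (1 - \<theta>)) * B + norm (complex_of_real \<theta>) * B = B"
    using assms(4,5) by (simp only: norm_of_real) (simp add: algebra_simps)
  ultimately show ?thesis by (simp add: algebra_simps)
qed

text \<open>The difference is the integral of a derivative along the segment from \<open>W'\<close>
  to \<open>W\<close>. The integrand is real-linear in V = W - W', so \<open>hb_comp\<close> bounds
  it by a multiple of \<open>d\<close>; then come the transform and Minkowski's inequality in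
  \<theta>.\<close>

lemma Gam_diff_smooth:
  assumes k: "1 \<le> k" and q: "1 \<le> q" and e: "0 < e" "e \<le> 1" and C: "0 \<le> C"
    and sb: "sb (2 * B) C k (Gam1 e q)" "sb (2 * B) C k (Gam2 e q)"
    and F: "continuous_on UNIV F" "L2b (sobw k) B F" and F': "continuous_on UNIV F'" "L2b (sobw k) B F'"
    and d: "L2b (sobw k) d (\<lambda>\<xi>. F \<xi> - F' \<xi>)"
  shows "L2b (sobw k) (2 ^ Suc k * (2 * (C * comp_const k B * d)))
     (\<lambda>\<xi>. ft (\<lambda>x. Gam e q (ift (bl M F) x)) \<xi> - ft (\<lambda>x. Gam e q (ift (bl M F') x)) \<xi>)"
proof -
  have B0: "0 \<le> B" "0 \<le> d" using F d by (auto dest: L2b_nonneg)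
  define W where "W = ift (bl M F)"
  define W' where "W' = ift (bl M F')"
  define V where "V = ift (bl M (\<lambda>\<xi>. F \<xi> - F' \<xi>))"
  define Wt where "Wt \<theta> x = W' x + of_real \<theta> * V x" for \<theta> x
  have cd: "continuous_on UNIV (\<lambda>\<xi>. F \<xi> - F' \<xi>)" using F F' by (intro continuous_intros)
  have Wt_eq: "Wt \<theta> = ift (bl M (\<lambda>\<xi>. F' \<xi> + of_real \<theta> * (F \<xi> - F' \<xi>)))" for \<theta>
  proof
    fix x
    have "bl M (\<lambda>\<xi>. F' \<xi> + of_real \<theta> * (F \<xi> - F' \<xi>)) = (\<lambda>\<xi>. bl M F' \<xi> + of_real \<theta> * bl M (\<lambda>\<xi>. F \<xi> - F' \<xi>) \<xi>)"
      by (auto simp: bl_def indicator_def)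
    then show "Wt \<theta> x = ift (bl M (\<lambda>\<xi>. F' \<xi> + of_real \<theta> * (F \<xi> - F' \<xi>))) x"
      using bl_integrable[OF F'(1)] bl_integrable[OF cd]
      by (simp add: Wt_def W'_def V_def ift_add ift_cmult)
  qed
  have W1: "Wt 1 = W" and W0: "Wt 0 = W'"
    unfolding Wt_eq W_def W'_def by simp_all
  have WV: "V x = W x - W' x" for x using fun_cong[OF W1, of x] by (simp add: Wt_def algebra_simps)
  have ct: "continuous_on UNIV (\<lambda>\<xi>. F' \<xi> + of_real \<theta> * (F \<xi> - F' \<xi>))" for \<theta>
    using F F' by (intro continuous_intros)
  \<comment> \<open>Convexity keeps the segment in the ball, hence its values in the disc of radius
    2B where the derivative bounds are assumed.\<close>
  have Lt: "L2b (sobw k) B (\<lambda>\<xi>. F' \<xi> + of_real \<theta> * (F \<xi> - F' \<xi>))" if "\<theta> \<in> {0..1}" for \<theta>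
    using that by (intro L2b_convex F F') auto
  have hbW: "hb k B (Wt \<theta>)" if "\<theta> \<in> {0..1}" for \<theta>
    using hb_ift_bl[OF ct Lt[OF that], of k 0 M] by (simp add: Wt_eq)
  have hbV: "hb k d V" using hb_ift_bl[OF cd d, of k 0 M] by (simp add: V_def)
  have bW: "norm (Wt \<theta> x) \<le> 2 * B" if "\<theta> \<in> {0..1}" for \<theta> x
    unfolding Wt_eq by (rule ift_sobw(1)[OF k L2b_bl[OF wt_sobw Lt[OF that]]])
  have L2W: "L2b (\<lambda>_. 1) B W" "L2b (\<lambda>_. 1) B W'" and L2V: "L2b (\<lambda>_. 1) d V"
    using hb_L2b[OF hbW[of 1]] hb_L2b[OF hbW[of 0]] hb_L2b[OF hbV] by (auto simp: W1 W0)
  have cW: "continuous_on UNIV (Wt \<theta>)" if "\<theta> \<in> {0..1}" for \<theta> using hb_continuous[OF hbW[OF that]] .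
  have cV: "continuous_on UNIV V" using hb_continuous[OF hbV] .
  have cW': "continuous_on UNIV W'" using cW[of 0] by (simp add: W0)
  define h where "h \<theta> x = Gam1 e q (Wt \<theta> x) * V x + Gam2 e q (Wt \<theta> x) * cnj (V x)" for \<theta> x
  define P where "P = powc q (2 * B)"
  have P0: "0 \<le> P" using q by (simp add: P_def powc_nonneg)
  \<comment> \<open>A majorant for all \<theta>. It is integrable because the linear vanishing of
    the derivatives supplies a second square-integrable factor.\<close>
  define g where "g x = 2 * P * (norm (W x * V x) + norm (W' x * V x))" for x
  have gi: "integrable lborel g"
    unfolding g_def using L2b_prod_integrable(1)[OF L2W(1) L2V] L2b_prod_integrable(1)[OF L2W(2) L2V]
    by (auto intro: integrable_norm)
  have hg: "norm (h \<theta> x) \<le> g x" if t: "\<theta> \<in> {0..1}" for \<theta> x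
  proof -
    have G: "norm (Gam1 e q (Wt \<theta> x)) \<le> P * norm (Wt \<theta> x)" "norm (Gam2 e q (Wt \<theta> x)) \<le> P * norm (Wt \<theta> x)"
    proof -
      have "2 * q * ((2 * B)\<^sup>2 + 1) powr (q / 2) * norm (Wt \<theta> x) \<le> P * norm (Wt \<theta> x)"
        using q by (intro mult_right_mono) (auto simp: P_def powc_def)
      with Gam_deriv_bound[OF _ q e bW[OF t]] B0
      show "norm (Gam1 e q (Wt \<theta> x)) \<le> P * norm (Wt \<theta> x)" "norm (Gam2 e q (Wt \<theta> x)) \<le> P * norm (Wt \<theta> x)"
        by (smt (verit))+
    qed
    have "Wt \<theta> x = of_real (1 - \<theta>) * W' x + of_real \<theta> * W x"
      by (simp add: Wt_def WV algebra_simps)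
    also have "norm \<dots> \<le> 1 * norm (W' x) + 1 * norm (W x)"
      using t by (intro norm_triangle_mono) (auto simp: norm_mult simp del: of_real_diff intro!: mult_left_le_one_le)
    finally have w: "norm (Wt \<theta> x) \<le> norm (W x) + norm (W' x)" by simp
    have "norm (h \<theta> x) \<le> P * norm (Wt \<theta> x) * norm (V x) + P * norm (Wt \<theta> x) * norm (V x)"
      unfolding h_def using G by (intro norm_triangle_mono) (auto simp: norm_mult intro!: mult_right_mono)
    also have "\<dots> = 2 * P * norm (V x) * norm (Wt \<theta> x)" by simp
    also have "\<dots> \<le> 2 * P * norm (V x) * (norm (W x) + norm (W' x))"
      using w P0 by (intro mult_left_mono) auto
    finally show ?thesis by (simp add: g_def norm_mult algebra_simps)
  qed
  have cG1: "continuous_on UNIV (Gam1 e q)" and cG2: "continuous_on UNIV (Gam2 e q)"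
    using sb by (auto dest: sb_continuous)
  have cWt: "continuous_on UNIV (\<lambda>z. Wt (fst z) (snd z))"
    unfolding Wt_def by (intro continuous_intros continuous_on_compose2[OF cW'] continuous_on_compose2[OF cV]) auto
  have ch: "continuous_on UNIV (\<lambda>z. h (fst z) (snd z))"
    unfolding h_def
    by (intro continuous_intros continuous_on_compose2[OF cG1 cWt] continuous_on_compose2[OF cG2 cWt]
        continuous_on_compose2[OF cV]) auto
  have ch2: "continuous_on UNIV (h \<theta>)" for \<theta>
  proof -
    have "continuous_on UNIV (\<lambda>x. (\<lambda>z. h (fst z) (snd z)) (\<theta>, x))"
      by (rule continuous_on_compose2[OF ch]) (auto intro!: continuous_intros)
    then show ?thesis by simp
  qed
  have hm [measurable]: "h \<theta> \<in> borel_measurable borel" for \<theta>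
    using ch2 by (rule borel_measurable_continuous_onI)
  have hi: "integrable lborel (h \<theta>)" if "\<theta> \<in> {0..1}" for \<theta>
    by (rule Bochner_Integration.integrable_bound[OF gi]) (use hg[OF that] in \<open>auto intro: order_trans[OF _ abs_ge_self]\<close>)
  have hbh: "hb k (2 * (C * comp_const k B * d)) (h \<theta>)" if t: "\<theta> \<in> {0..1}" for \<theta>
    using hb_add[OF hb_comp[OF bW[OF t] C hbW[OF t] hbV sb(1)] hb_comp[OF bW[OF t] C hbW[OF t] hb_cnj[OF hbV] sb(2)]]
    by (simp add: h_def[abs_def] ac_simps)
  have L: "L2b (sobw k) (2 ^ Suc k * (2 * (C * comp_const k B * d))) (ft (h \<theta>))" if "\<theta> \<in> {0..1}" for \<theta>
    using that by (intro hb_ft_sobw hi hbh)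
  have "continuous_on ({0..1} \<times> UNIV) (\<lambda>(\<theta>, x). h \<theta> x)"
    using ch by (auto simp: case_prod_beta intro: continuous_on_subset)
  note sw = ft_integral_strip[OF this gi hg]
  have cc0: "0 \<le> comp_const k B" using comp_const_ge_1[OF B0(1), of k] by simp
  have "L2b (sobw k) (2 ^ Suc k * (2 * (C * comp_const k B * d)) * 1) (\<lambda>\<xi>. integral {0..1} (\<lambda>\<theta>. ft (h \<theta>) \<xi>))"
    by (rule Minkowski_strip_const[OF wt_sobw sw(2) L]) (use C B0 cc0 in auto)
  moreover have "integral {0..1} (\<lambda>\<theta>. ft (h \<theta>) \<xi>) = ft (\<lambda>x. Gam e q (W x)) \<xi> - ft (\<lambda>x. Gam e q (W' x)) \<xi>" for \<xi>
  proof -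
    have FTC: "integral {0..1} (\<lambda>\<theta>. h \<theta> x) = Gam e q (W x) - Gam e q (W' x)" for x
    proof -
      have "((\<lambda>\<theta>. Wt \<theta> x) has_vector_derivative V x) (at \<theta>)" for \<theta>
        unfolding Wt_def by (auto intro!: derivative_eq_intros)
      then have "((\<lambda>\<theta>. Gam e q (Wt \<theta> x)) has_vector_derivative h \<theta> x) (at \<theta>)" for \<theta>
        unfolding h_def by (rule has_vector_derivative_comp_sb[OF has_derivative_Gam[OF e(1)]])
      from hb_FTC[OF this, of 0 1] show ?thesis by (simp add: integral_unique W1 W0)
    qed
    have 1: "integral {0..1} (\<lambda>\<theta>. ft (h \<theta>) \<xi>) = ft (\<lambda>x. Gam e q (W x) - Gam e q (W' x)) \<xi>"
      using sw(1)[of \<xi>] by (simp only: FTC)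
    have GL: "norm (Gam e q z - Gam e q y) \<le> P * (norm z + norm y) * norm (z - y)"
      if "norm z \<le> 2 * B" "norm y \<le> 2 * B" for z y
      using Gam_Lipschitz[OF _ q e that] B0 by (simp add: P_def)
    have bW1: "norm (W x) \<le> 2 * B" "norm (W' x) \<le> 2 * B" for x
      using bW[of 1 x] bW[of 0 x] by (simp_all add: W1 W0)
    have "integrable lborel (\<lambda>x. Gam e q (W x))"
      by (rule Lip_compose_integrable[OF Gam_continuous[OF e(1)] GL bW1(1) L2W(1) P0 Gam_zero])
    moreover have "integrable lborel (\<lambda>x. Gam e q (W' x))"
      by (rule Lip_compose_integrable[OF Gam_continuous[OF e(1)] GL bW1(2) L2W(2) P0 Gam_zero])
    ultimately show ?thesis unfolding 1 by (rule ft_diff)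
  qed
  ultimately show ?thesis by (simp add: W_def W'_def)
qed

lemma L2b_bl_tail:
  assumes "1 \<le> k" "L2b (sobw k) B F" "0 < M"
  shows "L2b (\<lambda>_. 1) (B / M) (\<lambda>\<xi>. bl M F \<xi> - F \<xi>)"
proof -
  have [measurable]: "F \<in> borel_measurable borel" using assms by (simp add: L2b_def)
  have "L2b (\<lambda>_. 1) (1 / M * B) (\<lambda>\<xi>. bl M F \<xi> - F \<xi>)"
  proof (rule L2b_le[OF wt_sobw assms(2)])
    fix \<xi>
    show "1 * (norm (bl M F \<xi> - F \<xi>))\<^sup>2 \<le> (1 / M)\<^sup>2 * (sobw k \<xi> * (norm (F \<xi>))\<^sup>2)"
    proof (cases "\<xi> \<in> {-M..M}")
      case True
      then show ?thesis using sobw_ge_1[of k \<xi>] by (simp add: bl_def)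
    next
      case False
      then have "M \<le> \<bar>\<xi>\<bar>" by auto
      then have "M\<^sup>2 \<le> \<bar>\<xi>\<bar>\<^sup>2" using assms by (intro power_mono) auto
      also have "\<dots> \<le> sobw 1 \<xi>" by (simp add: sobw_def)
      also have "\<dots> \<le> sobw k \<xi>" by (rule sobw_mono[OF assms(1)])
      finally have "M\<^sup>2 * (norm (F \<xi>))\<^sup>2 \<le> sobw k \<xi> * (norm (F \<xi>))\<^sup>2" by (rule mult_right_mono) simp
      then show ?thesis using False assms by (simp add: bl_def field_simps)
    qed
  qed (use assms in auto)
  then show ?thesis by simp
qed

text \<open>The two limits are separated by the intermediate term without cutoff. Removing the
  cutoff costs B/(n+1) times a Lipschitz constant independent of \<open>e n\<close>; removing the
  regularisation is dominated convergence with majorant a multiple of |W|^2.\<close>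

lemma ft_Gam_tendsto:
  assumes k: "1 \<le> k" and q: "1 \<le> q" and F: "continuous_on UNIV F" "L2b (sobw k) B F"
    and e: "\<And>n. 0 < e n" "\<And>n. e n \<le> 1" "e \<longlonglongrightarrow> 0"
  shows "(\<lambda>n. ft (\<lambda>x. Gam (e n) q (ift (bl (real (Suc n)) F) x)) \<xi>) \<longlonglongrightarrow> ft (\<lambda>x. Gq q (ift F x)) \<xi>"
proof -
  have B0: "0 \<le> B" using F by (auto dest: L2b_nonneg)
  define P where "P = powc q (2 * B)"
  have P0: "0 \<le> P" using q by (simp add: P_def powc_nonneg)
  define W where "W = ift F"
  define Wn where "Wn n = ift (bl (real (Suc n)) F)" for n
  have W: "\<And>x. norm (W x) \<le> 2 * B" "L2b (\<lambda>_. 1) B W" unfolding W_def using ift_sobw[OF k F(2)] by auto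
  have Wn: "\<And>x. norm (Wn n x) \<le> 2 * B" "L2b (\<lambda>_. 1) B (Wn n)" for n
    unfolding Wn_def using ift_sobw[OF k L2b_bl[OF wt_sobw F(2)]] by auto
  have dn: "L2b (\<lambda>_. 1) (B / real (Suc n)) (\<lambda>x. Wn n x - W x)" for n
  proof -
    have "L2b (\<lambda>_. 1) (B / real (Suc n)) (ift (\<lambda>\<xi>. bl (real (Suc n)) F \<xi> - F \<xi>))"
      using bl_integrable[OF F(1), of "real (Suc n)"] L2b_sobw_L1(1)[OF k F(2)]
      by (intro Bessel_ift L2b_bl_tail[OF k F(2)]) auto
    moreover have "ift (\<lambda>\<xi>. bl (real (Suc n)) F \<xi> - F \<xi>) = (\<lambda>x. Wn n x - W x)"
      unfolding Wn_def W_def by (intro ext ift_diff bl_integrable F(1) L2b_sobw_L1(1)[OF k F(2)])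
    ultimately show ?thesis by simp
  qed
  have GL: "norm (Gam (e n) q z - Gam (e n) q y) \<le> P * (norm z + norm y) * norm (z - y)"
    if "norm z \<le> 2 * B" "norm y \<le> 2 * B" for z y n
    using Gam_Lipschitz[OF _ q e(1,2) that] B0 by (simp add: P_def)
  have iGW: "integrable lborel (\<lambda>x. Gam (e n) q (W x))" for n
    by (rule Lip_compose_integrable[OF Gam_continuous[OF e(1)] GL W P0 Gam_zero])
  have iGWn: "integrable lborel (\<lambda>x. Gam (e n) q (Wn n x))" for n
    by (rule Lip_compose_integrable[OF Gam_continuous[OF e(1)] GL Wn P0 Gam_zero])
  have 1: "norm (ft (\<lambda>x. Gam (e n) q (Wn n x)) \<xi> - ft (\<lambda>x. Gam (e n) q (W x)) \<xi>) \<le> 2 * P * B * (B / real (Suc n))" for n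
  proof -
    have "ft (\<lambda>x. Gam (e n) q (Wn n x)) \<xi> - ft (\<lambda>x. Gam (e n) q (W x)) \<xi> = ft (\<lambda>x. Gam (e n) q (Wn n x) - Gam (e n) q (W x)) \<xi>"
      by (rule ft_diff[OF iGWn iGW, symmetric])
    also have "norm \<dots> \<le> (LINT x|lborel. norm (Gam (e n) q (Wn n x) - Gam (e n) q (W x)))"
      by (rule norm_ft_le)
    also have "\<dots> \<le> 2 * P * B * (B / real (Suc n))"
      by (rule Lip_compose_L1(2)[OF Gam_continuous[OF e(1)] GL Wn W dn P0])
    finally show ?thesis .
  qed
  have l1: "(\<lambda>n. ft (\<lambda>x. Gam (e n) q (Wn n x)) \<xi> - ft (\<lambda>x. Gam (e n) q (W x)) \<xi>) \<longlonglongrightarrow> 0"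
  proof (rule Lim_null_comparison[OF always_eventually])
    show "\<forall>n. norm (ft (\<lambda>x. Gam (e n) q (Wn n x)) \<xi> - ft (\<lambda>x. Gam (e n) q (W x)) \<xi>) \<le> 2 * P * B * (B * inverse (real (Suc n)))"
      using 1 by (simp add: divide_inverse)
    have "(\<lambda>n. 2 * P * B * (B * inverse (real (Suc n)))) \<longlonglongrightarrow> 2 * P * B * (B * 0)"
      by (intro tendsto_mult tendsto_const LIMSEQ_inverse_real_of_nat)
    then show "(\<lambda>n. 2 * P * B * (B * inverse (real (Suc n)))) \<longlonglongrightarrow> 0" by simp
  qed
  have l2: "(\<lambda>n. ft (\<lambda>x. Gam (e n) q (W x)) \<xi>) \<longlonglongrightarrow> ft (\<lambda>x. Gq q (W x)) \<xi>"
    unfolding ft_def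
  proof (intro tendsto_mult tendsto_const integral_dominated_convergence[where w="\<lambda>x. P * norm (W x * W x)"])
    have [measurable]: "W \<in> borel_measurable borel" using W(2) by (simp add: L2b_def)
    have [measurable]: "Gq q \<in> borel_measurable borel" "\<And>n. Gam (e n) q \<in> borel_measurable borel"
      using Gq_continuous[OF q] Gam_continuous[OF e(1)] by (auto intro!: borel_measurable_continuous_onI)
    show "(\<lambda>x. cis (- (x * \<xi>)) * Gq q (W x)) \<in> borel_measurable lborel" "\<And>n. (\<lambda>x. cis (- (x * \<xi>)) * Gam (e n) q (W x)) \<in> borel_measurable lborel"
      by measurable
    show "integrable lborel (\<lambda>x. P * norm (W x * W x))"
      using L2b_prod_integrable(1)[OF W(2) W(2)] by (auto intro: integrable_norm)
    show "AE x in lborel. (\<lambda>n. cis (- (x * \<xi>)) * Gam (e n) q (W x)) \<longlonglongrightarrow> cis (- (x * \<xi>)) * Gq q (W x)"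
      using q by (intro AE_I2 tendsto_mult tendsto_const Gam_tendsto e) auto
    show "AE x in lborel. norm (cis (- (x * \<xi>)) * Gam (e n) q (W x)) \<le> P * norm (W x * W x)" for n
    proof (intro AE_I2)
      fix x
      show "norm (cis (- (x * \<xi>)) * Gam (e n) q (W x)) \<le> P * norm (W x * W x)"
        using GL[of "W x" 0 n] W(1)[of x] B0 by (simp add: norm_mult mult.assoc)
    qed
  qed
  from tendsto_add[OF l1 l2] show ?thesis by (simp add: Wn_def W_def)
qed

definition nlc :: "real \<Rightarrow> (real \<Rightarrow> complex) \<Rightarrow> real \<Rightarrow> complex" where
  "nlc q F = ft (\<lambda>x. Gq q (ift F x))"

lemma Gq_ift_integrable:
  assumes k: "1 \<le> k" and q: "1 \<le> q" and F: "L2b (sobw k) B F"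
  shows "integrable lborel (\<lambda>x. Gq q (ift F x))"
  using ift_sobw[OF k F] L2b_nonneg[OF F]
  by (intro Lip_compose_integrable[OF Gq_continuous[OF q] Gq_Lipschitz[OF _ q], where R="2 * B" and B=B] powc_nonneg)
     (use q in auto)

lemma Gq_ift_L1_diff:
  assumes k: "1 \<le> k" and q: "1 \<le> q" and F: "L2b (sobw k) B F" "L2b (sobw k) B F'"
    and d: "L2b (\<lambda>_. 1) d (\<lambda>\<xi>. F \<xi> - F' \<xi>)"
  shows "(LINT x|lborel. norm (Gq q (ift F x) - Gq q (ift F' x))) \<le> 2 * powc q (2 * B) * B * d"
proof (rule Lip_compose_L1(2)[OF Gq_continuous[OF q] Gq_Lipschitz[OF _ q]])
  have "L2b (\<lambda>_. 1) d (ift (\<lambda>\<xi>. F \<xi> - F' \<xi>))"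
    using L2b_sobw_L1(1)[OF k F(1)] L2b_sobw_L1(1)[OF k F(2)] d by (intro Bessel_ift) auto
  moreover have "ift (\<lambda>\<xi>. F \<xi> - F' \<xi>) = (\<lambda>x. ift F x - ift F' x)"
    by (intro ext ift_diff L2b_sobw_L1(1)[OF k F(1)] L2b_sobw_L1(1)[OF k F(2)])
  ultimately show "L2b (\<lambda>_. 1) d (\<lambda>x. ift F x - ift F' x)" by simp
qed (use ift_sobw[OF k F(1)] ift_sobw[OF k F(2)] L2b_nonneg[OF F(1)] q powc_nonneg in auto)

lemma nlc_sup_diff:
  assumes k: "1 \<le> k" and q: "1 \<le> q" and F: "L2b (sobw k) B F" "L2b (sobw k) B F'"
    and d: "L2b (\<lambda>_. 1) d (\<lambda>\<xi>. F \<xi> - F' \<xi>)"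
  shows "norm (nlc q F \<xi> - nlc q F' \<xi>) \<le> 2 * powc q (2 * B) * B * d"
proof -
  have "nlc q F \<xi> - nlc q F' \<xi> = ft (\<lambda>x. Gq q (ift F x) - Gq q (ift F' x)) \<xi>"
    unfolding nlc_def by (rule ft_diff[OF Gq_ift_integrable[OF k q F(1)] Gq_ift_integrable[OF k q F(2)], symmetric])
  also have "norm \<dots> \<le> (LINT x|lborel. norm (Gq q (ift F x) - Gq q (ift F' x)))" by (rule norm_ft_le)
  also have "\<dots> \<le> 2 * powc q (2 * B) * B * d" by (rule Gq_ift_L1_diff[OF assms])
  finally show ?thesis .
qed

lemma nlc_continuous:
  assumes "1 \<le> k" "1 \<le> q" "L2b (sobw k) B F"
  shows "continuous_on A (nlc q F)"
  unfolding nlc_def by (rule ft_continuous[OF Gq_ift_integrable[OF assms]])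

text \<open>The first estimate drives the contraction in H^k. The second asks for closeness in L2
  only and controls each frequency; it yields pointwise continuity in time and uniform convergence
  of the iterates.\<close>

theorem nlc_Lipschitz:
  assumes k: "1 \<le> k" and q: "1 \<le> q" "real k \<le> q \<or> q = 2" and B: "0 \<le> B"
  obtains L where "0 < L"
    "\<And>F F' d. continuous_on UNIV F \<Longrightarrow> continuous_on UNIV F' \<Longrightarrow> L2b (sobw k) B F \<Longrightarrow> L2b (sobw k) B F' \<Longrightarrow>
       L2b (sobw k) d (\<lambda>\<xi>. F \<xi> - F' \<xi>) \<Longrightarrow> L2b (sobw k) (L * d) (\<lambda>\<xi>. nlc q F \<xi> - nlc q F' \<xi>)"
    "\<And>F F' d \<xi>. L2b (sobw k) B F \<Longrightarrow> L2b (sobw k) B F' \<Longrightarrow>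
       L2b (\<lambda>_. 1) d (\<lambda>\<xi>. F \<xi> - F' \<xi>) \<Longrightarrow> norm (nlc q F \<xi> - nlc q F' \<xi>) \<le> L * d"
proof -
  obtain C where C: "0 \<le> C" "\<And>e. 0 < e \<Longrightarrow> e \<le> 1 \<Longrightarrow> sb (2 * B) C k (Gam1 e q) \<and> sb (2 * B) C k (Gam2 e q)"
    using Gam_sb[of "2 * B" q k] q B by auto
  define L1 where "L1 = 2 ^ Suc k * (2 * (C * comp_const k B))"
  define L2 where "L2 = 2 * powc q (2 * B) * B"
  have L0: "0 \<le> L1" "0 \<le> L2"
    using C comp_const_ge_1[OF B, of k] B q powc_nonneg[of q] by (auto simp: L1_def L2_def)
  show thesis
  proof (rule that[of "L1 + L2 + 1"])
    show "0 < L1 + L2 + 1" using L0 by simp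
    fix F F' d
    assume F: "L2b (sobw k) B F" "L2b (sobw k) B F'"
    {
      assume c: "continuous_on UNIV F" "continuous_on UNIV F'" and d: "L2b (sobw k) d (\<lambda>\<xi>. F \<xi> - F' \<xi>)"
      define e where "e n = inverse (real (Suc n))" for n
      have e: "0 < e n" "e n \<le> 1" for n by (auto simp: e_def inverse_le_1_iff)
      have el: "e \<longlonglongrightarrow> 0" unfolding e_def by (rule LIMSEQ_inverse_real_of_nat)
      define D where "D n \<xi> = ft (\<lambda>x. Gam (e n) q (ift (bl (real (Suc n)) F) x)) \<xi> - ft (\<lambda>x. Gam (e n) q (ift (bl (real (Suc n)) F') x)) \<xi>" for n \<xi>
      have b: "L2b (sobw k) (L1 * d) (D n)" for n
      proof -
        have "sb (2 * B) C k (Gam1 (e n) q)" "sb (2 * B) C k (Gam2 (e n) q)"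
          using C(2)[OF e] by auto
        from Gam_diff_smooth[OF k q(1) e C(1) this c(1) F(1) c(2) F(2) d, of "real (Suc n)"]
        show ?thesis by (simp add: D_def[abs_def] L1_def mult.assoc)
      qed
      have l: "(\<lambda>n. D n \<xi>) \<longlonglongrightarrow> nlc q F \<xi> - nlc q F' \<xi>" for \<xi>
        unfolding D_def nlc_def
        by (intro tendsto_diff ft_Gam_tendsto[OF k q(1) c(1) F(1) e el] ft_Gam_tendsto[OF k q(1) c(2) F(2) e el])
      have "L2b (sobw k) (L1 * d) (\<lambda>\<xi>. nlc q F \<xi> - nlc q F' \<xi>)"
        by (rule L2b_Fatou[OF wt_sobw b l tendsto_const])
      moreover have "L1 * d \<le> (L1 + L2 + 1) * d" using L0 L2b_nonneg[OF d] by (intro mult_right_mono) auto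
      ultimately show "L2b (sobw k) ((L1 + L2 + 1) * d) (\<lambda>\<xi>. nlc q F \<xi> - nlc q F' \<xi>)"
        by (rule L2b_mono_bound)
    }
    {
      fix \<xi>
      assume d: "L2b (\<lambda>_. 1) d (\<lambda>\<xi>. F \<xi> - F' \<xi>)"
      have "L2 * d \<le> (L1 + L2 + 1) * d" using L0 L2b_nonneg[OF d] by (intro mult_right_mono) auto
      with nlc_sup_diff[OF k q(1) F d, of \<xi>]
      show "norm (nlc q F \<xi> - nlc q F' \<xi>) \<le> (L1 + L2 + 1) * d" by (simp add: L2_def)
    }
  qed
qed

text \<open>Pointwise continuity gives uniform smallness on a compact band of frequencies, and the
  weight controls the rest uniformly in time.\<close>

lemma L2_strip_continuous:
  fixes H :: "real \<Rightarrow> real \<Rightarrow> complex"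
  assumes k: "1 \<le> k" and cont: "continuous_on ({0..T} \<times> UNIV) (\<lambda>(t, \<xi>). H t \<xi>)"
    and b: "\<And>t. t \<in> {0..T} \<Longrightarrow> L2b (sobw k) B (H t)" and t: "t \<in> {0..T}" and \<epsilon>: "0 < \<epsilon>"
  shows "\<exists>\<delta>>0. \<forall>s\<in>{0..T}. \<bar>s - t\<bar> < \<delta> \<longrightarrow> L2b (\<lambda>_. 1) \<epsilon> (\<lambda>\<xi>. H s \<xi> - H t \<xi>)"
proof -
  have B: "0 \<le> B" using b[OF t] by (rule L2b_nonneg)
  \<comment> \<open>The tail beyond \<open>M\<close> has norm at most 2B/M, which is then at most
    \<epsilon>/2.\<close>
  define M where "M = 4 * B / \<epsilon> + 1"
  have M: "0 < M" using B \<epsilon> by (simp add: M_def add_nonneg_pos)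
  \<comment> \<open>Chosen so that \<eta>^2 times the length 2M of the band equals
    (\<epsilon>/2)^2.\<close>
  define \<eta> where "\<eta> = \<epsilon> / (2 * sqrt (2 * M))"
  have \<eta>: "0 < \<eta>" using \<epsilon> M by (simp add: \<eta>_def)
  have "uniformly_continuous_on ({0..T} \<times> {-M..M}) (\<lambda>(t, \<xi>). H t \<xi>)"
    by (rule compact_uniformly_continuous[OF continuous_on_subset[OF cont]]) (auto intro: compact_Times)
  then obtain \<delta> where \<delta>: "0 < \<delta>" "\<And>x y. x \<in> {0..T} \<times> {-M..M} \<Longrightarrow> y \<in> {0..T} \<times> {-M..M} \<Longrightarrow> dist y x < \<delta> \<Longrightarrow>
      dist (case y of (t, \<xi>) \<Rightarrow> H t \<xi>) (case x of (t, \<xi>) \<Rightarrow> H t \<xi>) < \<eta>"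
    unfolding uniformly_continuous_on_def using \<eta> by metis
  show ?thesis
  proof (intro exI[of _ \<delta>] conjI \<delta>(1) ballI impI)
    fix s assume s: "s \<in> {0..T}" "\<bar>s - t\<bar> < \<delta>"
    define D where "D \<xi> = H s \<xi> - H t \<xi>" for \<xi>
    have D: "L2b (sobw k) (B + B) D" unfolding D_def by (intro L2b_diff wt_sobw b s t)
    have [measurable]: "D \<in> borel_measurable borel" using D by (simp add: L2b_def)
    have Db: "norm (D \<xi>) \<le> \<eta>" if "\<xi> \<in> {-M..M}" for \<xi>
      using \<delta>(2)[of "(t, \<xi>)" "(s, \<xi>)"] s t that by (simp add: dist_Pair_Pair dist_norm D_def)
    have tail: "L2b (\<lambda>_. 1) (\<epsilon> / 2) (\<lambda>\<xi>. bl M D \<xi> - D \<xi>)"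
    proof (rule L2b_mono_bound[OF L2b_bl_tail[OF k D M]])
      have "B * 4 \<le> M * \<epsilon>" using \<epsilon> by (simp add: M_def field_simps)
      then show "(B + B) / M \<le> \<epsilon> / 2" using M by (simp add: field_simps)
    qed
    have "L2b (\<lambda>_. 1) (\<epsilon> / 2) (bl M D)"
      unfolding L2b_def
    proof (intro conjI)
      have "(\<integral>\<^sup>+x. ennreal (1 * (norm (bl M D x))\<^sup>2) \<partial>lborel) \<le> (\<integral>\<^sup>+x. ennreal (\<eta>\<^sup>2) * indicator {-M..M} x \<partial>lborel)"
        using Db by (intro nn_integral_mono) (auto simp: bl_def indicator_def intro!: ennreal_leI power_mono)
      also have "\<dots> = ennreal (\<eta>\<^sup>2) * ennreal (2 * M)"
        using M by (subst nn_integral_cmult_indicator) auto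
      also have "\<dots> = ennreal ((\<epsilon> / 2)\<^sup>2)"
        using M by (simp add: \<eta>_def power_divide power_mult_distrib flip: ennreal_mult)
      finally show "(\<integral>\<^sup>+x. ennreal (1 * (norm (bl M D x))\<^sup>2) \<partial>lborel) \<le> ennreal ((\<epsilon> / 2)\<^sup>2)" .
    qed (use \<epsilon> in auto)
    from L2b_diff[OF wt_one this tail] show "L2b (\<lambda>_. 1) \<epsilon> (\<lambda>\<xi>. H s \<xi> - H t \<xi>)"
      by (simp add: D_def)
  qed
qed

text \<open>Names the Lipschitz constant as a quantity depending on \<open>k\<close>,
  \<open>q\<close> and \<open>B\<close> alone, so that it can be fixed before the dispersion
  relation and thus before N.\<close>

definition nlc_lip :: "nat \<Rightarrow> real \<Rightarrow> real \<Rightarrow> real \<Rightarrow> bool" where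
  "nlc_lip k q B L \<longleftrightarrow> 0 < L \<and>
     (\<forall>F F' d. continuous_on UNIV F \<longrightarrow> continuous_on UNIV F' \<longrightarrow> L2b (sobw k) B F \<longrightarrow> L2b (sobw k) B F' \<longrightarrow>
        L2b (sobw k) d (\<lambda>\<xi>. F \<xi> - F' \<xi>) \<longrightarrow> L2b (sobw k) (L * d) (\<lambda>\<xi>. nlc q F \<xi> - nlc q F' \<xi>)) \<and>
     (\<forall>F F' d \<xi>. L2b (sobw k) B F \<longrightarrow> L2b (sobw k) B F' \<longrightarrow>
        L2b (\<lambda>_. 1) d (\<lambda>\<xi>. F \<xi> - F' \<xi>) \<longrightarrow> norm (nlc q F \<xi> - nlc q F' \<xi>) \<le> L * d)"

lemma nlc_lip_exists:
  assumes "1 \<le> k" "1 \<le> q" "real k \<le> q \<or> q = 2" "0 \<le> B"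
  obtains L where "nlc_lip k q B L"
  by (rule nlc_Lipschitz[OF assms]) (auto simp: nlc_lip_def intro!: that)

lemma nlc_lipD:
  assumes "nlc_lip k q B L"
  shows "0 < L"
    "\<And>F F' d. continuous_on UNIV F \<Longrightarrow> continuous_on UNIV F' \<Longrightarrow> L2b (sobw k) B F \<Longrightarrow> L2b (sobw k) B F' \<Longrightarrow>
       L2b (sobw k) d (\<lambda>\<xi>. F \<xi> - F' \<xi>) \<Longrightarrow> L2b (sobw k) (L * d) (\<lambda>\<xi>. nlc q F \<xi> - nlc q F' \<xi>)"
    "\<And>F F' d \<xi>. L2b (sobw k) B F \<Longrightarrow> L2b (sobw k) B F' \<Longrightarrow>
       L2b (\<lambda>_. 1) d (\<lambda>\<xi>. F \<xi> - F' \<xi>) \<Longrightarrow> norm (nlc q F \<xi> - nlc q F' \<xi>) \<le> L * d"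
  using assms unfolding nlc_lip_def by simp_all

section \<open>Picard iteration in the interaction picture\<close>

text \<open>The symbol \<open>m\<close> is a parameter because the theory is used twice, for the
  remainder symbol of the moving frame and for \<bar>\<xi>\<bar> powr (2 * \<sigma>).\<close>

locale semilinear =
  fixes k :: nat and q \<mu> :: real and m :: "real \<Rightarrow> real"
  assumes k: "1 \<le> k" and q: "1 \<le> q" and kq: "real k \<le> q \<or> q = 2"
    and \<mu>: "\<bar>\<mu>\<bar> = 1" and m: "continuous_on UNIV m"
begin

definition tw :: "real \<Rightarrow> (real \<Rightarrow> complex) \<Rightarrow> real \<Rightarrow> complex" where
  "tw t F \<xi> = cis (t * m \<xi>) * F \<xi>"

text \<open>The nonlinearity in the interaction picture, where the free evolution is the identity.\<close>

definition NN :: "real \<Rightarrow> (real \<Rightarrow> complex) \<Rightarrow> real \<Rightarrow> complex" where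
  "NN t F \<xi> = \<i> * of_real \<mu> * (cis (- (t * m \<xi>)) * nlc q (tw t F) \<xi>)"

lemma cis_m_measurable [measurable]: "(\<lambda>\<xi>. cis (t * m \<xi>)) \<in> borel_measurable borel"
  using m by (intro borel_measurable_continuous_onI continuous_intros)

lemma L2b_tw: "wt w \<Longrightarrow> L2b w B F \<Longrightarrow> L2b w B (tw t F)"
  unfolding tw_def[abs_def] by (rule L2b_mono_norm[of w B F]) (auto simp: norm_mult L2b_def)

lemma tw_diff: "tw t F \<xi> - tw t F' \<xi> = tw t (\<lambda>\<xi>. F \<xi> - F' \<xi>) \<xi>"
  by (simp add: tw_def algebra_simps)

lemma tw_continuous: "continuous_on UNIV F \<Longrightarrow> continuous_on UNIV (tw t F)"
  unfolding tw_def[abs_def] using m by (intro continuous_intros)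

lemma tw_strip_continuous:
  assumes "continuous_on ({0..T} \<times> UNIV) (\<lambda>(t, \<xi>). F t \<xi>)"
  shows "continuous_on ({0..T} \<times> UNIV) (\<lambda>(t, \<xi>). tw t (F t) \<xi>)"
  using assms unfolding tw_def case_prod_beta
  by (intro continuous_intros continuous_on_compose2[OF m]) auto

lemma NN_zero [simp]: "NN t (\<lambda>_. 0) \<xi> = 0"
  by (simp add: NN_def nlc_def tw_def[abs_def] ift_def)

lemma NN_Lipschitz:
  assumes lip: "nlc_lip k q B L"
  shows "\<And>t F F' d. continuous_on UNIV F \<Longrightarrow> continuous_on UNIV F' \<Longrightarrow> L2b (sobw k) B F \<Longrightarrow> L2b (sobw k) B F' \<Longrightarrow>
       L2b (sobw k) d (\<lambda>\<xi>. F \<xi> - F' \<xi>) \<Longrightarrow> L2b (sobw k) (L * d) (\<lambda>\<xi>. NN t F \<xi> - NN t F' \<xi>)"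
    "\<And>t F F' d \<xi>. L2b (sobw k) B F \<Longrightarrow> L2b (sobw k) B F' \<Longrightarrow>
       L2b (\<lambda>_. 1) d (\<lambda>\<xi>. F \<xi> - F' \<xi>) \<Longrightarrow> norm (NN t F \<xi> - NN t F' \<xi>) \<le> L * d"
proof -
  note L = nlc_lipD[OF lip]
  have eq: "NN t F \<xi> - NN t F' \<xi> = \<i> * of_real \<mu> * cis (- (t * m \<xi>)) * (nlc q (tw t F) \<xi> - nlc q (tw t F') \<xi>)" for t F F' \<xi>
    by (simp add: NN_def algebra_simps)
  have n: "norm (NN t F \<xi> - NN t F' \<xi>) = norm (nlc q (tw t F) \<xi> - nlc q (tw t F') \<xi>)" for t F F' \<xi>
    unfolding eq using \<mu> by (simp add: norm_mult)
  {
    fix t F F' d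
    assume F: "L2b (sobw k) B F" "L2b (sobw k) B F'"
    {
      assume c: "continuous_on UNIV F" "continuous_on UNIV F'" and d: "L2b (sobw k) d (\<lambda>\<xi>. F \<xi> - F' \<xi>)"
      have *: "L2b (sobw k) (L * d) (\<lambda>\<xi>. nlc q (tw t F) \<xi> - nlc q (tw t F') \<xi>)"
        by (rule L(2)[OF tw_continuous[OF c(1)] tw_continuous[OF c(2)] L2b_tw[OF wt_sobw F(1)] L2b_tw[OF wt_sobw F(2)]])
           (unfold tw_diff, rule L2b_tw[OF wt_sobw d])
      show "L2b (sobw k) (L * d) (\<lambda>\<xi>. NN t F \<xi> - NN t F' \<xi>)"
      proof (rule L2b_mono_norm[OF wt_sobw *])
        have [measurable]: "(\<lambda>\<xi>. nlc q (tw t F) \<xi> - nlc q (tw t F') \<xi>) \<in> borel_measurable borel"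
          using * by (simp add: L2b_def)
        have [measurable]: "(\<lambda>\<xi>. cis (- (t * m \<xi>))) \<in> borel_measurable borel"
          using cis_m_measurable[of "- t"] by simp
        show "(\<lambda>\<xi>. NN t F \<xi> - NN t F' \<xi>) \<in> borel_measurable borel" unfolding eq by measurable
      qed (simp add: n)
    }
    {
      fix \<xi> assume d: "L2b (\<lambda>_. 1) d (\<lambda>\<xi>. F \<xi> - F' \<xi>)"
      show "norm (NN t F \<xi> - NN t F' \<xi>) \<le> L * d"
        unfolding n
        by (rule L(3)[OF L2b_tw[OF wt_sobw F(1)] L2b_tw[OF wt_sobw F(2)]])
           (unfold tw_diff, rule L2b_tw[OF wt_one d])
    }
  }
qed

text \<open>A variation of time is controlled at all frequencies at once by the pointwise Lipschitz
  estimate and continuity in L2; a variation of the frequency at fixed time by continuity of the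
  transform.\<close>

lemma nlc_strip_continuous:
  fixes H :: "real \<Rightarrow> real \<Rightarrow> complex"
  assumes cont: "continuous_on ({0..T} \<times> UNIV) (\<lambda>(t, \<xi>). H t \<xi>)"
    and b: "\<And>t. t \<in> {0..T} \<Longrightarrow> L2b (sobw k) B (H t)"
  shows "continuous_on ({0..T} \<times> UNIV) (\<lambda>(t, \<xi>). nlc q (H t) \<xi>)"
proof (cases "0 \<le> T")
  case False
  then have "{0..T} = {}" by simp
  then show ?thesis by (simp only: Sigma_empty1 continuous_on_empty)
next
  case True
  then have B: "0 \<le> B" using L2b_nonneg[OF b[of 0]] by simp
  obtain L where L: "0 < L" "\<And>F F' d \<xi>. L2b (sobw k) B F \<Longrightarrow> L2b (sobw k) B F' \<Longrightarrow>
       L2b (\<lambda>_. 1) d (\<lambda>\<xi>. F \<xi> - F' \<xi>) \<Longrightarrow> norm (nlc q F \<xi> - nlc q F' \<xi>) \<le> L * d"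
    by (rule nlc_lip_exists[OF k q kq B]) (rule that[OF nlc_lipD(1,3)])
  show ?thesis
    unfolding continuous_on_iff
  proof (intro ballI allI impI)
    fix x :: "real \<times> real" and \<epsilon> :: real assume x: "x \<in> {0..T} \<times> UNIV" and \<epsilon>: "0 < \<epsilon>"
    obtain t \<xi> where x_eq: "x = (t, \<xi>)" by force
    have t: "t \<in> {0..T}" using x x_eq by auto
    have "0 < \<epsilon> / (2 * L)" using \<epsilon> L by simp
    from L2_strip_continuous[OF k cont b t this] obtain \<delta>1 where
      \<delta>1: "0 < \<delta>1" "\<And>s. s \<in> {0..T} \<Longrightarrow> \<bar>s - t\<bar> < \<delta>1 \<Longrightarrow> L2b (\<lambda>_. 1) (\<epsilon> / (2 * L)) (\<lambda>\<xi>. H s \<xi> - H t \<xi>)"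
      by blast
    have "continuous_on UNIV (nlc q (H t))" by (rule nlc_continuous[OF k q b[OF t]])
    then obtain \<delta>2 where \<delta>2: "0 < \<delta>2" "\<And>y. dist y \<xi> < \<delta>2 \<Longrightarrow> dist (nlc q (H t) y) (nlc q (H t) \<xi>) < \<epsilon> / 2"
      unfolding continuous_on_iff using \<epsilon> by (metis UNIV_I half_gt_zero)
    show "\<exists>d>0. \<forall>x'\<in>{0..T} \<times> UNIV. dist x' x < d \<longrightarrow>
       dist (case x' of (t, \<xi>) \<Rightarrow> nlc q (H t) \<xi>) (case x of (t, \<xi>) \<Rightarrow> nlc q (H t) \<xi>) < \<epsilon>"
    proof (intro exI[of _ "min \<delta>1 \<delta>2"] conjI ballI impI)
      fix x' :: "real \<times> real" assume x': "x' \<in> {0..T} \<times> UNIV" "dist x' x < min \<delta>1 \<delta>2"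
      obtain s y where x'_eq: "x' = (s, y)" by force
      have s: "s \<in> {0..T}" using x' x'_eq by auto
      have d: "\<bar>s - t\<bar> < \<delta>1" "dist y \<xi> < \<delta>2"
        using x'(2) dist_fst_le[of x' x] dist_snd_le[of x' x] by (auto simp: x_eq x'_eq dist_real_def)
      have "norm (nlc q (H s) y - nlc q (H t) y) \<le> L * (\<epsilon> / (2 * L))"
        by (rule L(2)[OF b[OF s] b[OF t] \<delta>1(2)[OF s d(1)]])
      then have "dist (nlc q (H s) y) (nlc q (H t) y) \<le> \<epsilon> / 2" using L(1) by (simp add: dist_norm)
      with \<delta>2(2)[OF d(2)] have "dist (nlc q (H s) y) (nlc q (H t) \<xi>) < \<epsilon>"
        using dist_triangle[of "nlc q (H s) y" "nlc q (H t) \<xi>" "nlc q (H t) y"] by linarith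
      then show "dist (case x' of (t, \<xi>) \<Rightarrow> nlc q (H t) \<xi>) (case x of (t, \<xi>) \<Rightarrow> nlc q (H t) \<xi>) < \<epsilon>"
        by (simp add: x_eq x'_eq)
    qed (use \<delta>1 \<delta>2 in auto)
  qed
qed

lemma NN_strip_continuous:
  assumes cont: "continuous_on ({0..T} \<times> UNIV) (\<lambda>(t, \<xi>). F t \<xi>)"
    and b: "\<And>t. t \<in> {0..T} \<Longrightarrow> L2b (sobw k) B (F t)"
  shows "continuous_on ({0..T} \<times> UNIV) (\<lambda>(t, \<xi>). NN t (F t) \<xi>)"
proof -
  have "continuous_on ({0..T} \<times> UNIV) (\<lambda>(t, \<xi>). nlc q (tw t (F t)) \<xi>)"
    by (rule nlc_strip_continuous[OF tw_strip_continuous[OF cont] L2b_tw[OF wt_sobw b]])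
  then show ?thesis unfolding NN_def case_prod_beta
    by (intro continuous_intros continuous_on_compose2[OF m]) auto
qed

text \<open>Duhamel's formula, demanded at every frequency; in the interaction picture no propagator
  stands in front of the integral.\<close>

definition mild :: "real \<Rightarrow> (real \<Rightarrow> complex) \<Rightarrow> (real \<Rightarrow> real \<Rightarrow> complex) \<Rightarrow> bool" where
  "mild T f0 F \<longleftrightarrow> continuous_on ({0..T} \<times> UNIV) (\<lambda>(t, \<xi>). F t \<xi>) \<and>
     (\<exists>B. \<forall>t\<in>{0..T}. L2b (sobw k) B (F t)) \<and>
     (\<forall>t\<in>{0..T}. \<forall>\<xi>. F t \<xi> = f0 \<xi> + integral {0..t} (\<lambda>s. NN s (F s) \<xi>))"

text \<open>A convergent sequence keeps its frequencies in a compact set, where \<open>H\<close> is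
  bounded; the limits in the frequency and in the end point are then taken separately.\<close>

lemma integral_strip_continuous:
  fixes H :: "real \<Rightarrow> real \<Rightarrow> complex"
  assumes cont: "continuous_on ({0..T} \<times> UNIV) (\<lambda>(t, \<xi>). H t \<xi>)"
  shows "continuous_on ({0..T} \<times> UNIV) (\<lambda>(t, \<xi>). integral {0..t} (\<lambda>s. H s \<xi>))"
  unfolding continuous_on_sequentially
proof (intro allI ballI impI)
  fix u :: "nat \<Rightarrow> real \<times> real" and a
  assume a: "a \<in> {0..T} \<times> UNIV" and "(\<forall>n. u n \<in> {0..T} \<times> UNIV) \<and> u \<longlonglongrightarrow> a"
  then have u: "\<And>n. fst (u n) \<in> {0..T}" and lim: "u \<longlonglongrightarrow> a" by (auto simp: mem_Times_iff)
  have a1: "fst a \<in> {0..T}" using a by (auto simp: mem_Times_iff)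
  have l1: "(\<lambda>n. fst (u n)) \<longlonglongrightarrow> fst a" and l2: "(\<lambda>n. snd (u n)) \<longlonglongrightarrow> snd a"
    using lim by (auto intro: tendsto_fst tendsto_snd)
  obtain M where M: "\<And>n. \<bar>snd (u n)\<bar> \<le> M"
    using convergent_imp_Bseq[OF convergentI[OF l2]] by (auto simp: Bseq_def)
  have M2: "\<bar>snd a\<bar> \<le> M" by (rule LIMSEQ_le_const2[OF tendsto_rabs[OF l2]]) (use M in auto)
  have "bounded ((\<lambda>(t, \<xi>). H t \<xi>) ` ({0..T} \<times> {-M..M}))"
    by (intro compact_imp_bounded compact_continuous_image continuous_on_subset[OF cont] compact_Times) auto
  then obtain C where C: "\<And>t \<xi>. t \<in> {0..T} \<Longrightarrow> \<xi> \<in> {-M..M} \<Longrightarrow> norm (H t \<xi>) \<le> C"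
    unfolding bounded_iff by fastforce
  have sec: "continuous_on {0..t} (\<lambda>s. H s \<xi>)" if "t \<in> {0..T}" for t \<xi>
    using continuous_on_strip_section[OF cont, of \<xi>] that by (auto intro: continuous_on_subset)
  have lim1: "(\<lambda>n. integral {0..fst a} (\<lambda>s. H s (snd (u n)))) \<longlonglongrightarrow> integral {0..fst a} (\<lambda>s. H s (snd a))"
  proof -
    have i: "(\<lambda>s. H s (snd (u n))) integrable_on {0..fst a}" for n
      using sec[OF a1] by (intro integrable_continuous_interval)
    show ?thesis
    proof (rule dominated_convergence(2)[OF i, of "\<lambda>_. C"])
      show "norm (H s (snd (u n))) \<le> C" if "s \<in> {0..fst a}" for n s
        using M[of n] that a1 by (intro C) auto
      show "(\<lambda>n. H s (snd (u n))) \<longlonglongrightarrow> H s (snd a)" if "s \<in> {0..fst a}" for s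
      proof -
        have "continuous_on UNIV (H s)" using continuous_on_strip_section2[OF cont, of s] that a1 by auto
        then show ?thesis using l2 unfolding continuous_on_sequentially comp_def by auto
      qed
    qed auto
  qed
  have "(\<lambda>n. integral {0..fst (u n)} (\<lambda>s. H s (snd (u n))) - integral {0..fst a} (\<lambda>s. H s (snd (u n)))) \<longlonglongrightarrow> 0"
  proof (rule Lim_null_comparison[OF always_eventually])
    show "\<forall>n. norm (integral {0..fst (u n)} (\<lambda>s. H s (snd (u n))) - integral {0..fst a} (\<lambda>s. H s (snd (u n)))) \<le> C * \<bar>fst (u n) - fst a\<bar>"
    proof
      fix n
      have *: "norm (integral {0..y} h - integral {0..x} h) \<le> C * (y - x)"
        if "0 \<le> x" "x \<le> y" "continuous_on {0..y} h" "\<And>s. s \<in> {0..y} \<Longrightarrow> norm (h s) \<le> C" for x y and h :: "real \<Rightarrow> complex"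
      proof -
        have "integral {0..x} h + integral {x..y} h = integral {0..y} h"
          using that by (intro Henstock_Kurzweil_Integration.integral_combine integrable_continuous_interval) auto
        then have "integral {0..y} h - integral {0..x} h = integral {x..y} h" by (simp add: algebra_simps)
        also have "norm \<dots> \<le> C * (y - x)"
          using that by (intro integral_bound) (auto intro: continuous_on_subset)
        finally show ?thesis .
      qed
      have hb: "norm (H s (snd (u n))) \<le> C" if "s \<in> {0..T}" for s using M[of n] that by (intro C) auto
      show "norm (integral {0..fst (u n)} (\<lambda>s. H s (snd (u n))) - integral {0..fst a} (\<lambda>s. H s (snd (u n)))) \<le> C * \<bar>fst (u n) - fst a\<bar>"
      proof (cases "fst a \<le> fst (u n)")
        case True
        then show ?thesis using *[of "fst a" "fst (u n)" "\<lambda>s. H s (snd (u n))"] sec[OF u[of n]] u[of n] a1 hb by auto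
      next
        case False
        then show ?thesis
          using *[of "fst (u n)" "fst a" "\<lambda>s. H s (snd (u n))"] sec[OF a1] u[of n] a1 hb
          by (auto simp: norm_minus_commute abs_minus_commute)
      qed
    qed
    have "(\<lambda>n. C * \<bar>fst (u n) - fst a\<bar>) \<longlonglongrightarrow> C * \<bar>fst a - fst a\<bar>" by (intro tendsto_intros l1)
    then show "(\<lambda>n. C * \<bar>fst (u n) - fst a\<bar>) \<longlonglongrightarrow> 0" by simp
  qed
  from tendsto_add[OF this lim1]
  show "((\<lambda>(t, \<xi>). integral {0..t} (\<lambda>s. H s \<xi>)) \<circ> u) \<longlonglongrightarrow> (case a of (t, \<xi>) \<Rightarrow> integral {0..t} (\<lambda>s. H s \<xi>))"
    by (simp add: comp_def case_prod_beta)
qed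

text \<open>Existence near an approximate solution \<open>F0\<close> with residual \<eta>, on an
  interval of any prescribed length. The approximation lies in the ball of radius B - 1, and the
  smallness of \<eta> keeps all iterates within distance 1 of it, hence where \<open>L\<close> is
  valid.\<close>

theorem Picard:
  assumes B: "1 \<le> B" and lip: "nlc_lip k q B L"
    and T: "0 \<le> T" and f0: "continuous_on UNIV f0" and F0c: "continuous_on ({0..T} \<times> UNIV) (\<lambda>(t, \<xi>). F0 t \<xi>)"
    and F0b: "\<And>t. t \<in> {0..T} \<Longrightarrow> L2b (sobw k) (B - 1) (F0 t)" and \<eta>: "0 < \<eta>" "2 * \<eta> * exp (2 * L * T) \<le> 1"
    and res: "\<And>t. t \<in> {0..T} \<Longrightarrow> L2b (sobw k) \<eta> (\<lambda>\<xi>. f0 \<xi> + integral {0..t} (\<lambda>s. NN s (F0 s) \<xi>) - F0 t \<xi>)"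
  shows "\<exists>F. mild T f0 F \<and> (\<forall>t\<in>{0..T}. L2b (sobw k) B (F t)) \<and>
     (\<forall>t\<in>{0..T}. L2b (sobw k) (2 * \<eta> * exp (2 * L * T)) (\<lambda>\<xi>. F t \<xi> - F0 t \<xi>))"
proof -
  note L = nlc_lipD(1)[OF lip] NN_Lipschitz[OF lip]
    define \<Phi> where "\<Phi> F t \<xi> = f0 \<xi> + integral {0..t} (\<lambda>s. NN s (F s) \<xi>)" for F t \<xi>
    define P where "P n = (\<Phi> ^^ n) F0" for n
    have P0: "P 0 = F0" and PS: "P (Suc n) = \<Phi> (P n)" for n by (simp_all add: P_def)
    \<comment> \<open>The exponential weight makes the iteration contract by 1/2 for any T: the
      integral of L exp(2Ls) over [0,t] is at most exp(2Lt)/2.\<close>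
    define a where "a n t = \<eta> * exp (2 * L * t) * (1 / 2) ^ n" for n :: nat and t
    have a0: "0 < a n t" for n t using \<eta> by (simp add: a_def)
    have asum: "(\<Sum>j\<in>{i..<i + n}. a j t) \<le> 2 * a i t" for i n t
    proof -
      have "(\<Sum>j\<in>{i..<i + n}. a j t) = 2 * a i t * (1 - (1 / 2) ^ n)"
        by (induction n) (auto simp: a_def power_add algebra_simps)
      also have "\<dots> \<le> 2 * a i t * 1" using a0[of i t] by (intro mult_left_mono) auto
      finally show ?thesis by simp
    qed
    have aT: "2 * a 0 t \<le> 1" if "t \<in> {0..T}" for t
    proof -
      have "2 * a 0 t \<le> 2 * \<eta> * exp (2 * L * T)" using that \<eta> L(1) by (auto simp: a_def)
      with \<eta> show ?thesis by simp
    qed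
    have tele: "L2b (sobw k) (\<Sum>j\<in>{i..<i + n}. a j t) (\<lambda>\<xi>. P (i + n) t \<xi> - P i t \<xi>)"
      if "\<And>j. j < i + n \<Longrightarrow> L2b (sobw k) (a j t) (\<lambda>\<xi>. P (Suc j) t \<xi> - P j t \<xi>)" for i n t
      using that
    proof (induction n)
      case (Suc n)
      have "L2b (sobw k) ((\<Sum>j\<in>{i..<i + n}. a j t) + a (i + n) t)
         (\<lambda>\<xi>. (P (i + n) t \<xi> - P i t \<xi>) + (P (Suc (i + n)) t \<xi> - P (i + n) t \<xi>))"
        by (intro L2b_add wt_sobw Suc.IH Suc.prems) auto
      then show ?case by simp
    qed simp
    have inB: "L2b (sobw k) B (P n t)"
      if t: "t \<in> {0..T}" and d: "\<And>j. j < n \<Longrightarrow> L2b (sobw k) (a j t) (\<lambda>\<xi>. P (Suc j) t \<xi> - P j t \<xi>)" for n t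
    proof -
      have "L2b (sobw k) 1 (\<lambda>\<xi>. P n t \<xi> - P 0 t \<xi>)"
        using tele[of 0 n t] d asum[of t 0 n] aT[OF t] by (auto elim: L2b_mono_bound)
      from L2b_add[OF wt_sobw this F0b[OF t]] show ?thesis by (simp add: P0)
    qed
    \<comment> \<open>Continuity and increments go through one induction: the Lipschitz estimate
      needs continuous iterates in the ball, and the ball comes from the previous
      increments.\<close>
    have main: "(\<forall>j\<le>n. continuous_on ({0..T} \<times> UNIV) (\<lambda>(t, \<xi>). P j t \<xi>)) \<and>
        (\<forall>j<n. \<forall>t\<in>{0..T}. L2b (sobw k) (a j t) (\<lambda>\<xi>. P (Suc j) t \<xi> - P j t \<xi>))" for n
    proof (induction n)
      case 0
      then show ?case using F0c by (simp add: P0)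
    next
      case (Suc n)
      then have Pc: "\<And>j. j \<le> n \<Longrightarrow> continuous_on ({0..T} \<times> UNIV) (\<lambda>(t, \<xi>). P j t \<xi>)"
        and Pd: "\<And>j t. j < n \<Longrightarrow> t \<in> {0..T} \<Longrightarrow> L2b (sobw k) (a j t) (\<lambda>\<xi>. P (Suc j) t \<xi> - P j t \<xi>)" by auto
      have PB: "L2b (sobw k) B (P j t)" if "j \<le> n" "t \<in> {0..T}" for j t
        using that by (intro inB Pd) auto
      have Nc: "continuous_on ({0..T} \<times> UNIV) (\<lambda>(t, \<xi>). NN t (P j t) \<xi>)" if "j \<le> n" for j
        by (rule NN_strip_continuous[OF Pc[OF that] PB[OF that]])
      have "continuous_on ({0..T} \<times> UNIV) (\<lambda>(t, \<xi>). P (Suc n) t \<xi>)"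
        unfolding PS \<Phi>_def
        using integral_strip_continuous[OF Nc[OF order_refl]] unfolding case_prod_beta
        by (intro continuous_intros continuous_on_compose2[OF f0]) auto
      moreover have "L2b (sobw k) (a n t) (\<lambda>\<xi>. P (Suc n) t \<xi> - P n t \<xi>)" if t: "t \<in> {0..T}" for t
      proof (cases n)
        case 0
        have "\<eta> \<le> a 0 t" using t \<eta> L(1) by (simp add: a_def)
        with res[OF t] show ?thesis unfolding 0 PS P0 \<Phi>_def by (rule L2b_mono_bound)
      next
        case (Suc n')
        have n': "n' \<le> n" "n' < n" using Suc by auto
        have st: "{0..t} \<subseteq> {0..T}" using t by auto
        have c: "continuous_on ({0..t} \<times> UNIV) (\<lambda>(s, \<xi>). NN s (P n s) \<xi> - NN s (P n' s) \<xi>)"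
          using continuous_on_diff[OF Nc[of n] Nc[OF n'(1)]] st
          by (auto simp: case_prod_beta intro: continuous_on_subset)
        have "L2b (sobw k) (integral {0..t} (\<lambda>s. L * a n' s)) (\<lambda>\<xi>. integral {0..t} (\<lambda>s. NN s (P n s) \<xi> - NN s (P n' s) \<xi>))"
        proof (rule Minkowski_strip[OF wt_sobw c])
          fix s assume s: "s \<in> {0..t}"
          then have s': "s \<in> {0..T}" using st by auto
          show "L2b (sobw k) (L * a n' s) (\<lambda>\<xi>. NN s (P n s) \<xi> - NN s (P n' s) \<xi>)"
            using Pd[OF n'(2) s'] n'(1) s' Suc
            by (intro L(2) PB) (auto intro!: continuous_on_strip_section2[OF Pc])
          show "0 < L * a n' s" using L(1) a0 by simp
        qed (auto simp: a_def intro!: continuous_intros)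
        moreover have "integral {0..t} (\<lambda>s. L * a n' s) \<le> a n t"
        proof -
          \<comment> \<open>Differentiating the exponential produces 2L, and the 2 turns the power
            \<open>n\<close> into \<open>n'\<close>, since \<open>n = Suc n'\<close>.\<close>
          have "((\<lambda>s. L * a n' s) has_integral (\<eta> * exp (2 * L * t) * (1 / 2) ^ n - \<eta> * exp (2 * L * 0) * (1 / 2) ^ n)) {0..t}"
            using t L(1)
            by (intro fundamental_theorem_of_calculus)
               (auto simp: a_def Suc intro!: derivative_eq_intros simp flip: has_real_derivative_iff_has_vector_derivative)
          then have "integral {0..t} (\<lambda>s. L * a n' s) = \<eta> * exp (2 * L * t) * (1 / 2) ^ n - \<eta> * exp (2 * L * 0) * (1 / 2) ^ n"
            by (rule integral_unique)
          then show ?thesis using \<eta>(1) by (simp add: a_def)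
        qed
        ultimately have *: "L2b (sobw k) (a n t) (\<lambda>\<xi>. integral {0..t} (\<lambda>s. NN s (P n s) \<xi> - NN s (P n' s) \<xi>))"
          by (rule L2b_mono_bound)
        have i: "(\<lambda>s. NN s (P j s) \<xi>) integrable_on {0..t}" if "j \<le> n" for j \<xi>
          using continuous_on_strip_section[OF Nc[OF that], of \<xi>] st
          by (intro integrable_continuous_interval) (auto intro: continuous_on_subset)
        have "integral {0..t} (\<lambda>s. NN s (P n s) \<xi> - NN s (P n' s) \<xi>) = P (Suc n) t \<xi> - P n t \<xi>" for \<xi>
        proof -
          have "P (Suc n) t \<xi> - P n t \<xi> = integral {0..t} (\<lambda>s. NN s (P n s) \<xi>) - integral {0..t} (\<lambda>s. NN s (P n' s) \<xi>)"
            by (simp add: Suc PS \<Phi>_def)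
          then show ?thesis using i n' by (simp add: Henstock_Kurzweil_Integration.integral_diff)
        qed
        with * show ?thesis by simp
      qed
      ultimately show ?case using Pc Pd by (auto simp: le_Suc_eq less_Suc_eq)
    qed
    have Pc: "continuous_on ({0..T} \<times> UNIV) (\<lambda>(t, \<xi>). P j t \<xi>)" for j using main[of j] by blast
    have Pd: "L2b (sobw k) (a j t) (\<lambda>\<xi>. P (Suc j) t \<xi> - P j t \<xi>)" if "t \<in> {0..T}" for j t
      using main[of "Suc j"] that by blast
    have PB: "L2b (sobw k) B (P j t)" if "t \<in> {0..T}" for j t using that by (intro inB Pd)
    have Nc: "continuous_on ({0..T} \<times> UNIV) (\<lambda>(t, \<xi>). NN t (P j t) \<xi>)" for j by (rule NN_strip_continuous[OF Pc PB])
    have Ni: "(\<lambda>s. NN s (P j s) \<xi>) integrable_on {0..t}" if "t \<in> {0..T}" for j \<xi> t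
      using continuous_on_strip_section[OF Nc, of j \<xi>] that
      by (intro integrable_continuous_interval) (auto intro: continuous_on_subset)
    define C where "C = T * (L * a 0 T)"
    have sup: "norm (P (Suc (Suc n)) t \<xi> - P (Suc n) t \<xi>) \<le> C * (1 / 2) ^ n" if t: "t \<in> {0..T}" for n t \<xi>
    proof -
      have "P (Suc (Suc n)) t \<xi> - P (Suc n) t \<xi> = integral {0..t} (\<lambda>s. NN s (P (Suc n) s) \<xi> - NN s (P n s) \<xi>)"
        using Henstock_Kurzweil_Integration.integral_diff[OF Ni[OF t, of "Suc n" \<xi>] Ni[OF t, of n \<xi>]]
        by (simp only: PS \<Phi>_def) simp
      also have "norm \<dots> \<le> L * a n T * (t - 0)"
      proof (rule integral_bound)
        show "continuous_on {0..t} (\<lambda>s. NN s (P (Suc n) s) \<xi> - NN s (P n s) \<xi>)"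
          using t by (intro continuous_on_diff continuous_on_subset[OF continuous_on_strip_section[OF Nc]]) auto
        fix s assume s: "s \<in> {0..t}"
        then have s': "s \<in> {0..T}" using t by auto
        have "norm (NN s (P (Suc n) s) \<xi> - NN s (P n s) \<xi>) \<le> L * a n s"
          by (rule L(3)[OF PB[OF s'] PB[OF s'] L2b_sobw_L2[OF Pd[OF s']]])
        also have "\<dots> \<le> L * a n T" using s' L(1) \<eta>(1) by (intro mult_left_mono) (auto simp: a_def)
        finally show "norm (NN s (P (Suc n) s) \<xi> - NN s (P n s) \<xi>) \<le> L * a n T" .
      qed (use t in auto)
      also have "\<dots> \<le> L * a n T * T" using t L(1) a0[of n T] by (intro mult_left_mono) auto
      also have "\<dots> = C * (1 / 2) ^ n" by (simp add: C_def a_def)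
      finally show ?thesis .
    qed
    \<comment> \<open>The series starts at \<open>P 1\<close>: the sup bound concerns differences of
      two images under \<Phi>, and \<open>P 1 - P 0\<close> is not one.\<close>
    define S where "S x = suminf (\<lambda>i. P (Suc (Suc i)) (fst x) (snd x) - P (Suc i) (fst x) (snd x))" for x
    define F where "F t \<xi> = P 1 t \<xi> + S (t, \<xi>)" for t \<xi>
    have "uniform_limit ({0..T} \<times> UNIV) (\<lambda>n x. \<Sum>i<n. P (Suc (Suc i)) (fst x) (snd x) - P (Suc i) (fst x) (snd x)) S sequentially"
      unfolding S_def
    proof (rule Weierstrass_m_test)
      show "summable (\<lambda>n. C * (1 / 2) ^ n)" by (intro summable_mult summable_geometric) simp
      show "norm (P (Suc (Suc n)) (fst x) (snd x) - P (Suc n) (fst x) (snd x)) \<le> C * (1 / 2) ^ n"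
        if "x \<in> {0..T} \<times> UNIV" for n x using that by (intro sup) auto
    qed
    moreover have "(\<Sum>i<n. P (Suc (Suc i)) (fst x) (snd x) - P (Suc i) (fst x) (snd x)) =
        P (Suc n) (fst x) (snd x) - P 1 (fst x) (snd x)" for n x
      using sum_lessThan_telescope[of "\<lambda>i. P (Suc i) (fst x) (snd x)" n] by simp
    ultimately have ul: "uniform_limit ({0..T} \<times> UNIV) (\<lambda>n x. P (Suc n) (fst x) (snd x) - P 1 (fst x) (snd x)) S sequentially"
      by simp
    have Fc: "continuous_on ({0..T} \<times> UNIV) (\<lambda>(t, \<xi>). F t \<xi>)"
    proof -
      have "continuous_on ({0..T} \<times> UNIV) S"
      proof (rule uniform_limit_theorem[OF _ ul])
        have "continuous_on ({0..T} \<times> UNIV) (\<lambda>x. P (Suc n) (fst x) (snd x) - P 1 (fst x) (snd x))" for n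
          using Pc[of "Suc n"] Pc[of 1] unfolding case_prod_beta by (intro continuous_intros)
        then show "\<forall>\<^sub>F n in sequentially. continuous_on ({0..T} \<times> UNIV) (\<lambda>x. P (Suc n) (fst x) (snd x) - P 1 (fst x) (snd x))"
          by simp
      qed simp
      then show ?thesis using Pc[of 1] unfolding F_def case_prod_beta by (intro continuous_intros) auto
    qed
    have Plim: "(\<lambda>n. P n t \<xi>) \<longlonglongrightarrow> F t \<xi>" if "t \<in> {0..T}" for t \<xi>
    proof -
      have "(\<lambda>n. P (Suc n) t \<xi> - P 1 t \<xi>) \<longlonglongrightarrow> S (t, \<xi>)"
        using tendsto_uniform_limitI[OF ul, of "(t, \<xi>)"] that by simp
      from tendsto_add[OF tendsto_const[of "P 1 t \<xi>"] this] have "(\<lambda>n. P (Suc n) t \<xi>) \<longlonglongrightarrow> F t \<xi>"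
        by (simp add: F_def)
      then show ?thesis by (rule LIMSEQ_imp_Suc)
    qed
    have Fd: "L2b (sobw k) (2 * a n t) (\<lambda>\<xi>. F t \<xi> - P n t \<xi>)" if t: "t \<in> {0..T}" for n t
    proof (rule L2b_Fatou[OF wt_sobw _ _ tendsto_const])
      show "L2b (sobw k) (2 * a n t) (\<lambda>\<xi>. P (n + i) t \<xi> - P n t \<xi>)" for i
        by (rule L2b_mono_bound[OF tele[OF Pd[OF t]] asum])
      show "(\<lambda>i. P (n + i) t \<xi> - P n t \<xi>) \<longlonglongrightarrow> F t \<xi> - P n t \<xi>" for \<xi>
        using LIMSEQ_ignore_initial_segment[OF Plim[OF t, of \<xi>], of n]
        by (intro tendsto_intros) (simp add: add.commute)
    qed
    have FB: "L2b (sobw k) B (F t)" if t: "t \<in> {0..T}" for t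
    proof -
      have "L2b (sobw k) 1 (\<lambda>\<xi>. F t \<xi> - P 0 t \<xi>)" using Fd[OF t, of 0] aT[OF t] by (rule L2b_mono_bound)
      from L2b_add[OF wt_sobw this F0b[OF t]] show ?thesis by (simp add: P0)
    qed
    have NFc: "continuous_on ({0..T} \<times> UNIV) (\<lambda>(t, \<xi>). NN t (F t) \<xi>)" by (rule NN_strip_continuous[OF Fc FB])
    have NFi: "(\<lambda>s. NN s (F s) \<xi>) integrable_on {0..t}" if "t \<in> {0..T}" for \<xi> t
      using continuous_on_strip_section[OF NFc, of \<xi>] that
      by (intro integrable_continuous_interval) (auto intro: continuous_on_subset)
    have fixpt: "F t \<xi> = f0 \<xi> + integral {0..t} (\<lambda>s. NN s (F s) \<xi>)" if t: "t \<in> {0..T}" for t \<xi>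
    proof -
      have "(\<lambda>n. P (Suc n) t \<xi> - (f0 \<xi> + integral {0..t} (\<lambda>s. NN s (F s) \<xi>))) \<longlonglongrightarrow> 0"
      proof (rule Lim_null_comparison[OF always_eventually])
        show "\<forall>n. norm (P (Suc n) t \<xi> - (f0 \<xi> + integral {0..t} (\<lambda>s. NN s (F s) \<xi>))) \<le> L * (2 * a n T) * T"
        proof
          fix n
          have "P (Suc n) t \<xi> - (f0 \<xi> + integral {0..t} (\<lambda>s. NN s (F s) \<xi>)) =
             integral {0..t} (\<lambda>s. NN s (P n s) \<xi> - NN s (F s) \<xi>)"
            using Ni[OF t] NFi[OF t] by (subst Henstock_Kurzweil_Integration.integral_diff) (auto simp: PS \<Phi>_def)
          also have "norm \<dots> \<le> L * (2 * a n T) * (t - 0)"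
          proof (rule integral_bound)
            show "continuous_on {0..t} (\<lambda>s. NN s (P n s) \<xi> - NN s (F s) \<xi>)"
              using t by (intro continuous_on_diff continuous_on_subset[OF continuous_on_strip_section[OF Nc]]
                continuous_on_subset[OF continuous_on_strip_section[OF NFc]]) auto
            fix s assume s: "s \<in> {0..t}"
            then have s': "s \<in> {0..T}" using t by auto
            have "norm (NN s (F s) \<xi> - NN s (P n s) \<xi>) \<le> L * (2 * a n s)"
              by (rule L(3)[OF FB[OF s'] PB[OF s'] L2b_sobw_L2[OF Fd[OF s']]])
            also have "\<dots> \<le> L * (2 * a n T)" using s' L(1) \<eta>(1) by (intro mult_left_mono) (auto simp: a_def)
            finally show "norm (NN s (P n s) \<xi> - NN s (F s) \<xi>) \<le> L * (2 * a n T)" by (simp add: norm_minus_commute)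
          qed (use t in auto)
          also have "\<dots> \<le> L * (2 * a n T) * T" using t L(1) a0[of n T] by (intro mult_left_mono) auto
          finally show "norm (P (Suc n) t \<xi> - (f0 \<xi> + integral {0..t} (\<lambda>s. NN s (F s) \<xi>))) \<le> L * (2 * a n T) * T" .
        qed
        have "(\<lambda>n. L * (2 * (\<eta> * exp (2 * L * T) * (1 / 2) ^ n)) * T) \<longlonglongrightarrow> L * (2 * (\<eta> * exp (2 * L * T) * 0)) * T"
          by (intro tendsto_intros LIMSEQ_power_zero) auto
        then show "(\<lambda>n. L * (2 * a n T) * T) \<longlonglongrightarrow> 0" by (simp add: a_def)
      qed
      moreover have "(\<lambda>n. P (Suc n) t \<xi> - (f0 \<xi> + integral {0..t} (\<lambda>s. NN s (F s) \<xi>))) \<longlonglongrightarrow>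
          F t \<xi> - (f0 \<xi> + integral {0..t} (\<lambda>s. NN s (F s) \<xi>))"
        by (intro tendsto_intros LIMSEQ_Suc Plim t)
      ultimately have "F t \<xi> - (f0 \<xi> + integral {0..t} (\<lambda>s. NN s (F s) \<xi>)) = 0" using LIMSEQ_unique by blast
      then show ?thesis by simp
    qed
    show "\<exists>F. mild T f0 F \<and> (\<forall>t\<in>{0..T}. L2b (sobw k) B (F t)) \<and>
         (\<forall>t\<in>{0..T}. L2b (sobw k) (2 * \<eta> * exp (2 * L * T)) (\<lambda>\<xi>. F t \<xi> - F0 t \<xi>))"
    proof (intro exI[of _ F] conjI ballI)
      show "mild T f0 F" unfolding mild_def using Fc FB fixpt by blast
      show "L2b (sobw k) B (F t)" if "t \<in> {0..T}" for t by (rule FB[OF that])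
      fix t assume t: "t \<in> {0..T}"
      have "2 * a 0 t \<le> 2 * \<eta> * exp (2 * L * T)" using t \<eta> L(1) by (auto simp: a_def)
      with Fd[OF t, of 0] show "L2b (sobw k) (2 * \<eta> * exp (2 * L * T)) (\<lambda>\<xi>. F t \<xi> - F0 t \<xi>)"
        by (simp add: P0 L2b_mono_bound)
    qed
qed

lemma NN_bound:
  assumes "continuous_on UNIV F" "L2b (sobw k) B F" "nlc_lip k q B L"
  shows "L2b (sobw k) (L * B) (NN t F)"
  using NN_Lipschitz(1)[OF assms(3,1) continuous_on_const assms(2) L2b_zero, of B t] assms(2) L2b_nonneg[OF assms(2)]
  by simp

lemma mild_increment:
  assumes F: "mild T f0 F" and st: "0 \<le> s" "s \<le> t" "t \<le> T"
  shows "F t \<xi> - F s \<xi> = integral {0..t - s} (\<lambda>r. NN (s + r) (F (s + r)) \<xi>)"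
    and "continuous_on ({0..t - s} \<times> UNIV) (\<lambda>(r, \<xi>). NN (s + r) (F (s + r)) \<xi>)"
proof -
  have c: "continuous_on ({0..T} \<times> UNIV) (\<lambda>(t, \<xi>). F t \<xi>)" using F by (simp add: mild_def)
  obtain B where b: "\<And>t. t \<in> {0..T} \<Longrightarrow> L2b (sobw k) B (F t)" using F unfolding mild_def by blast
  have Nc: "continuous_on ({0..T} \<times> UNIV) (\<lambda>(t, \<xi>). NN t (F t) \<xi>)" by (rule NN_strip_continuous[OF c b])
  have "continuous_on ({0..t - s} \<times> UNIV) (\<lambda>x. (\<lambda>(t, \<xi>). NN t (F t) \<xi>) (s + fst x, snd x))"
    by (rule continuous_on_compose2[OF Nc]) (use st in \<open>auto intro!: continuous_intros\<close>)
  then show "continuous_on ({0..t - s} \<times> UNIV) (\<lambda>(r, \<xi>). NN (s + r) (F (s + r)) \<xi>)"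
    by (simp add: case_prod_beta)
  have i: "(\<lambda>s. NN s (F s) \<xi>) integrable_on {0..t}"
    using st by (intro integrable_continuous_interval continuous_on_subset[OF continuous_on_strip_section[OF Nc]]) auto
  have "integral {0..s} (\<lambda>s. NN s (F s) \<xi>) + integral {s..t} (\<lambda>s. NN s (F s) \<xi>) = integral {0..t} (\<lambda>s. NN s (F s) \<xi>)"
    using st by (intro Henstock_Kurzweil_Integration.integral_combine i) auto
  moreover have "integral {0..t - s} (\<lambda>r. NN (s + r) (F (s + r)) \<xi>) = integral {s..t} (\<lambda>s. NN s (F s) \<xi>)"
    using integral_shift_Icc_real[of "0::real" "t - s" "\<lambda>s. NN s (F s) \<xi>" s] by (simp add: o_def add.commute)
  moreover have "F t \<xi> = f0 \<xi> + integral {0..t} (\<lambda>s. NN s (F s) \<xi>)" "F s \<xi> = f0 \<xi> + integral {0..s} (\<lambda>s. NN s (F s) \<xi>)"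
    using F st by (auto simp: mild_def)
  ultimately show "F t \<xi> - F s \<xi> = integral {0..t - s} (\<lambda>r. NN (s + r) (F (s + r)) \<xi>)"
    by (simp add: algebra_simps)
qed

text \<open>In the interaction picture the time derivative is \<open>NN\<close> alone, bounded in
  H^k by L B; the unbounded symbol enters only through unimodular factors.\<close>

lemma mild_Lipschitz:
  assumes F: "mild T f0 F"
  shows "\<exists>C\<ge>0. \<forall>s\<in>{0..T}. \<forall>t\<in>{0..T}. L2b (sobw k) (C * \<bar>t - s\<bar>) (\<lambda>\<xi>. F t \<xi> - F s \<xi>)"
proof (cases "0 \<le> T")
  case True
  have c: "continuous_on ({0..T} \<times> UNIV) (\<lambda>(t, \<xi>). F t \<xi>)" using F by (simp add: mild_def)
  obtain B where b: "\<And>t. t \<in> {0..T} \<Longrightarrow> L2b (sobw k) B (F t)" using F unfolding mild_def by blast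
  have B: "0 \<le> B" using True L2b_nonneg[OF b[of 0]] by simp
  obtain L where lip: "nlc_lip k q B L" using nlc_lip_exists[OF k q kq B] .
  have LB: "0 \<le> L * B" using nlc_lipD(1)[OF lip] B by simp
  have *: "L2b (sobw k) (L * B * (t - s)) (\<lambda>\<xi>. F t \<xi> - F s \<xi>)" if st: "0 \<le> s" "s \<le> t" "t \<le> T" for s t
    unfolding mild_increment(1)[OF F st]
  proof (rule Minkowski_strip_const[OF wt_sobw mild_increment(2)[OF F st]])
    show "L2b (sobw k) (L * B) (NN (s + r) (F (s + r)))" if "r \<in> {0..t - s}" for r
      using that st by (intro NN_bound[OF continuous_on_strip_section2[OF c] b lip]) auto
  qed (use LB st in auto)
  show ?thesis
  proof (intro exI[of _ "L * B"] conjI ballI LB)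
    fix s t assume st: "s \<in> {0..T}" "t \<in> {0..T}"
    show "L2b (sobw k) (L * B * \<bar>t - s\<bar>) (\<lambda>\<xi>. F t \<xi> - F s \<xi>)"
    proof (cases "s \<le> t")
      case True
      then show ?thesis using *[of s t] st by simp
    next
      case False
      then show ?thesis using L2b_uminus[OF *[of t s]] st by simp
    qed
  qed
qed auto

end

section \<open>The dispersionless reference solution\<close>

text \<open>Horner induction in which each degree spends half of the available exponential rate;
  hence the generalisation over \<open>c\<close>.\<close>

lemma poly_le_exp:
  fixes P :: "'a::real_normed_field poly"
  shows "0 < c \<Longrightarrow> \<exists>C\<ge>0. \<forall>x. norm (poly P (of_real x)) \<le> C * exp (c * x\<^sup>2)"
proof (induction P arbitrary: c)
  case 0
  then show ?case by (intro exI[of _ 0]) auto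
next
  case (pCons a P)
  obtain C where C: "0 \<le> C" "\<And>x. norm (poly P (of_real x)) \<le> C * exp (c / 2 * x\<^sup>2)"
    using pCons.IH[of "c / 2"] pCons.prems by auto
  \<comment> \<open>From |x| <= 1 + x^2 <= D (1 + c x^2 / 2) and 1 + y <= exp y.\<close>
  define D where "D = 1 + 2 / c"
  have D: "0 \<le> D" using pCons.prems by (simp add: D_def)
  have x: "\<bar>x\<bar> \<le> D * exp (c / 2 * x\<^sup>2)" for x
  proof -
    have "0 \<le> (\<bar>x\<bar> - 1)\<^sup>2" by simp
    then have "\<bar>x\<bar> \<le> 1 + x\<^sup>2" by (simp add: power2_diff)
    also have "\<dots> \<le> D * (1 + c / 2 * x\<^sup>2)"
      using pCons.prems by (simp add: D_def field_simps add_nonneg_nonneg)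
    also have "\<dots> \<le> D * exp (c / 2 * x\<^sup>2)" using D by (intro mult_left_mono) auto
    finally show ?thesis .
  qed
  show ?case
  proof (intro exI[of _ "norm a + D * C"] conjI allI)
    fix x
    have "norm (poly (pCons a P) (of_real x)) \<le> norm a + \<bar>x\<bar> * norm (poly P (of_real x))"
      using norm_triangle_ineq[of a "of_real x * poly P (of_real x)"] by (simp add: norm_mult)
    also have "\<dots> \<le> norm a * exp (c * x\<^sup>2) + (D * exp (c / 2 * x\<^sup>2)) * (C * exp (c / 2 * x\<^sup>2))"
    proof (intro add_mono mult_mono x C)
      have "norm a * 1 \<le> norm a * exp (c * x\<^sup>2)" using pCons.prems by (intro mult_left_mono) auto
      then show "norm a \<le> norm a * exp (c * x\<^sup>2)" by simp
    qed (use D in auto)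
    also have "\<dots> = (norm a + D * C) * exp (c * x\<^sup>2)"
      by (simp add: algebra_simps flip: exp_add)
    finally show "norm (poly (pCons a P) (of_real x)) \<le> (norm a + D * C) * exp (c * x\<^sup>2)" .
  qed (use C D in auto)
qed

lemma integrable_gauss_exp: "0 < c \<Longrightarrow> integrable lborel (\<lambda>x. exp (- (c * x\<^sup>2) :: real))"
  using integrable_gauss_scaled[of "sqrt (2 * c)"] by (simp add: power_mult_distrib)

lemma L2b_exists:
  assumes "f \<in> borel_measurable borel" "integrable lborel (\<lambda>x. (norm (f x))\<^sup>2)"
  shows "\<exists>A. L2b (\<lambda>_. 1) A f"
  by (rule exI[of _ "sqrt (LINT x|lborel. (norm (f x))\<^sup>2)"]) (rule L2bI, use assms in auto)

text \<open>Polynomials times a fixed Gaussian are closed under differentiation, and each is square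
  integrable since half of the decay absorbs the polynomial.\<close>

lemma gauss_poly_hb:
  assumes c: "0 < c"
  shows "\<exists>A. hb j A (\<lambda>x. of_real (poly P x * exp (- (c * x\<^sup>2))))"
proof (induction j arbitrary: P)
  have L: "\<exists>A. L2b (\<lambda>_. 1) A (\<lambda>x. of_real (poly P x * exp (- (c * x\<^sup>2))))" for P
  proof (rule L2b_exists)
    obtain C where C: "0 \<le> C" "\<And>x. \<bar>poly P x\<bar> \<le> C * exp (c / 2 * x\<^sup>2)"
      using poly_le_exp[of "c / 2" P] c by (auto simp: real_norm_def)
    show [measurable]: "(\<lambda>x. complex_of_real (poly P x * exp (- (c * x\<^sup>2)))) \<in> borel_measurable borel"
      by (intro borel_measurable_continuous_onI continuous_intros)
    show "integrable lborel (\<lambda>x. (norm (complex_of_real (poly P x * exp (- (c * x\<^sup>2)))))\<^sup>2)"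
    proof (rule Bochner_Integration.integrable_bound)
      show "integrable lborel (\<lambda>x. C\<^sup>2 * exp (- (c * x\<^sup>2)))" using integrable_gauss_exp[OF c] by simp
      show "AE x in lborel. norm ((norm (complex_of_real (poly P x * exp (- (c * x\<^sup>2)))))\<^sup>2) \<le> norm (C\<^sup>2 * exp (- (c * x\<^sup>2)))"
      proof (intro AE_I2)
        fix x
        have "\<bar>poly P x\<bar> * exp (- (c * x\<^sup>2)) \<le> C * exp (c / 2 * x\<^sup>2) * exp (- (c * x\<^sup>2))"
          using C by (intro mult_right_mono) auto
        then have "(\<bar>poly P x\<bar> * exp (- (c * x\<^sup>2)))\<^sup>2 \<le> (C * exp (- (c / 2 * x\<^sup>2)))\<^sup>2"
          by (intro power_mono) (auto simp: mult.assoc algebra_simps simp flip: exp_add)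
        also have "\<dots> = C\<^sup>2 * exp (- (c * x\<^sup>2))"
          by (simp add: power_mult_distrib flip: exp_of_nat_mult)
        finally show "norm ((norm (complex_of_real (poly P x * exp (- (c * x\<^sup>2)))))\<^sup>2) \<le> norm (C\<^sup>2 * exp (- (c * x\<^sup>2)))"
          by (simp add: norm_mult abs_mult)
      qed
    qed measurable
  qed
  {
    case 0
    have "continuous_on UNIV (\<lambda>x. complex_of_real (poly P x * exp (- (c * x\<^sup>2))))"
      by (intro continuous_intros)
    with L[of P] show ?case by auto
  next
    case (Suc j)
    define Q where "Q = pderiv P - [:0, 2 * c:] * P"
    obtain A0 where A0: "L2b (\<lambda>_. 1) A0 (\<lambda>x. of_real (poly P x * exp (- (c * x\<^sup>2))))" using L by blast
    obtain A1 where A1: "hb j A1 (\<lambda>x. of_real (poly Q x * exp (- (c * x\<^sup>2))))" using Suc by blast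
    have d: "((\<lambda>x. complex_of_real (poly P x * exp (- (c * x\<^sup>2)))) has_vector_derivative of_real (poly Q x * exp (- (c * x\<^sup>2)))) (at x)" for x
    proof -
      have "((\<lambda>x. poly P x * exp (- (c * x\<^sup>2))) has_real_derivative poly Q x * exp (- (c * x\<^sup>2))) (at x)"
        by (auto intro!: derivative_eq_intros poly_DERIV simp: Q_def algebra_simps power2_eq_square)
      then show ?thesis
        by (intro has_vector_derivative_of_real) (simp add: has_real_derivative_iff_has_vector_derivative)
    qed
    have "hb (Suc j) (max A0 A1) (\<lambda>x. of_real (poly P x * exp (- (c * x\<^sup>2))))"
      by (rule hb_SucI[OF L2b_mono_bound[OF A0] d hb_mono[OF A1]]) auto
    then show ?case by blast
  }
qed

lemma gauss_hb:
  assumes "0 < c" shows "\<exists>A. hb j A (\<lambda>x. of_real (a * exp (- (c * x\<^sup>2))))"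
  using gauss_poly_hb[OF assms, of j "[:a:]"] by simp

lemma sb_exp:
  assumes R: "0 \<le> R"
  shows "sb R ((1 + \<bar>c\<bar>) ^ j * exp (\<bar>c\<bar> * R)) j (\<lambda>z. exp (\<i> * of_real c * z))"
proof (induction j)
  have b: "norm (exp (\<i> * complex_of_real c * z)) \<le> (1 + \<bar>c\<bar>) ^ j * exp (\<bar>c\<bar> * R)" if "norm z \<le> R" for z j
  proof -
    have "norm (exp (\<i> * complex_of_real c * z)) \<le> exp (norm (\<i> * complex_of_real c * z))" by (rule norm_exp)
    also have "\<dots> \<le> 1 * exp (\<bar>c\<bar> * R)" using that by (simp add: norm_mult mult_left_mono)
    also have "\<dots> \<le> (1 + \<bar>c\<bar>) ^ j * exp (\<bar>c\<bar> * R)" by (intro mult_right_mono one_le_power) auto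
    finally show ?thesis .
  qed
  {
    case 0
    show ?case using b[of _ 0] by (auto intro!: continuous_intros)
  next
    case (Suc j)
    show ?case
    proof (rule sb_SucI[OF b])
      show "((\<lambda>z. exp (\<i> * complex_of_real c * z)) has_derivative
         (\<lambda>h. (\<i> * of_real c * exp (\<i> * of_real c * z)) * h + 0 * cnj h)) (at z)" for z
        by (auto intro!: derivative_eq_intros simp: algebra_simps)
      have "norm (\<i> * complex_of_real c) * ((1 + \<bar>c\<bar>) ^ j * exp (\<bar>c\<bar> * R)) \<le> (1 + \<bar>c\<bar>) ^ Suc j * exp (\<bar>c\<bar> * R)"
        by (simp add: norm_mult mult_right_mono flip: mult.assoc)
      then show "sb R ((1 + \<bar>c\<bar>) ^ Suc j * exp (\<bar>c\<bar> * R)) j (\<lambda>z. \<i> * of_real c * exp (\<i> * of_real c * z))"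
        by (rule sb_mono[OF sb_cmult[OF Suc]])
    qed (auto intro!: sb_zero)
  }
qed

text \<open>The dispersionless flow conserves the modulus at each point, so it only rotates the
  datum a exp(-x^2/2) by its q-th power, again a Gaussian.\<close>

definition Phi :: "real \<Rightarrow> real \<Rightarrow> real \<Rightarrow> real \<Rightarrow> real \<Rightarrow> complex" where
  "Phi q \<mu> a t x = of_real (a * exp (- (x\<^sup>2 / 2))) * cis (\<mu> * t * (a powr q * exp (- (q * x\<^sup>2 / 2))))"

lemma norm_Phi: "0 < a \<Longrightarrow> norm (Phi q \<mu> a t x) = a * exp (- (x\<^sup>2 / 2))"
  by (simp add: Phi_def norm_mult abs_mult)

lemma Phi_continuous: "continuous_on UNIV (\<lambda>x. Phi q \<mu> a (fst x) (snd x))"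
  unfolding Phi_def by (intro continuous_intros) auto

lemma Phi_strip_continuous: "continuous_on A (\<lambda>(t, x). Phi q \<mu> a t x)"
  unfolding case_prod_beta by (rule continuous_on_subset[OF Phi_continuous]) simp

lemma Phi_integrable:
  assumes "0 < a" shows "integrable lborel (Phi q \<mu> a t)" "integrable lborel (\<lambda>x. a * exp (- (x\<^sup>2 / 2)))"
proof -
  show g: "integrable lborel (\<lambda>x. a * exp (- (x\<^sup>2 / 2)))"
    using integrable_gauss by simp
  have "continuous_on UNIV (Phi q \<mu> a t)" unfolding Phi_def[abs_def] by (intro continuous_intros) auto
  then have [measurable]: "Phi q \<mu> a t \<in> borel_measurable borel" by (rule borel_measurable_continuous_onI)
  show "integrable lborel (Phi q \<mu> a t)"
    by (rule Bochner_Integration.integrable_bound[OF g]) (use assms in \<open>auto simp: norm_Phi\<close>)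
qed

lemma Gq_Phi:
  assumes "0 < a"
  shows "Gq q (Phi q \<mu> a t x) = of_real (a powr q * exp (- (q * x\<^sup>2 / 2))) * Phi q \<mu> a t x"
proof -
  have "exp (- (x\<^sup>2 / 2)) powr q = exp (- (q * x\<^sup>2 / 2))"
    by (simp add: powr_def mult.commute)
  then show ?thesis using assms by (simp add: Gq_def norm_Phi powr_mult)
qed

text \<open>The phase factor is the entire function exp(i c z) at the Gaussian z = exp(-q x^2/2),
  which has values in the unit disc; \<open>hb_comp\<close> applies with the datum as linear factor.
  The bound is uniform in time because |c| <= K a^q.\<close>

lemma Phi_hb:
  assumes q: "0 < q" and \<mu>: "\<bar>\<mu>\<bar> = 1"
  shows "\<exists>A. \<forall>t\<in>{0..K}. hb j A (Phi q \<mu> a t)"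
proof -
  obtain B where B: "hb j B (\<lambda>x. of_real (1 * exp (- (q / 2 * x\<^sup>2))))" using gauss_hb[of "q / 2" j 1] q by auto
  obtain A where A: "hb j A (\<lambda>x. of_real (a * exp (- (1 / 2 * x\<^sup>2))))" using gauss_hb[of "1 / 2" j a] by auto
  define C where "C = (1 + K * a powr q) ^ j * exp (K * a powr q * 1)"
  show ?thesis
  proof (intro exI[of _ "C * comp_const j B * A"] ballI)
    fix t assume t: "t \<in> {0..K}"
    define c where "c = \<mu> * t * a powr q"
    have "\<bar>c\<bar> = t * a powr q" using t \<mu> by (simp add: c_def abs_mult)
    then have c: "\<bar>c\<bar> \<le> K * a powr q" using t by (simp add: mult_right_mono)
    have "(1 + \<bar>c\<bar>) ^ j * exp (\<bar>c\<bar> * 1) \<le> C"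
      unfolding C_def using c by (intro mult_mono power_mono) auto
    then have sb: "sb 1 C j (\<lambda>z. exp (\<i> * of_real c * z))" by (rule sb_mono[OF sb_exp[OF zero_le_one]])
    have "0 \<le> C" unfolding C_def using c by (intro mult_nonneg_nonneg zero_le_power) auto
    from hb_comp[OF _ this B A sb]
    have "hb j (C * comp_const j B * A) (\<lambda>x. exp (\<i> * complex_of_real c * complex_of_real (1 * exp (- (q / 2 * x\<^sup>2)))) * of_real (a * exp (- (1 / 2 * x\<^sup>2))))"
      using q by simp
    moreover have "(\<lambda>x. exp (\<i> * complex_of_real c * complex_of_real (1 * exp (- (q / 2 * x\<^sup>2)))) * of_real (a * exp (- (1 / 2 * x\<^sup>2)))) = Phi q \<mu> a t"
    proof
      fix x
      have "\<i> * complex_of_real c * complex_of_real (1 * exp (- (q / 2 * x\<^sup>2))) = \<i> * complex_of_real (\<mu> * t * (a powr q * exp (- (q * x\<^sup>2 / 2))))"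
        by (simp add: c_def)
      then show "exp (\<i> * complex_of_real c * complex_of_real (1 * exp (- (q / 2 * x\<^sup>2)))) * of_real (a * exp (- (1 / 2 * x\<^sup>2))) = Phi q \<mu> a t x"
        unfolding Phi_def by (simp add: c_def cis_conv_exp ac_simps)
    qed
    ultimately show "hb j (C * comp_const j B * A) (Phi q \<mu> a t)" by simp
  qed
qed

text \<open>At each x the reference solution obeys an ordinary differential equation; it is
  integrated in time and the time integral is exchanged with the transform, the Gaussian datum
  providing the majorant.\<close>

lemma Phi_ft_evolution:
  assumes a: "0 < a" and t: "0 \<le> t" and q: "0 < q"
  shows "integral {0..t} (\<lambda>s. \<i> * of_real \<mu> * ft (\<lambda>x. Gq q (Phi q \<mu> a s x)) \<xi>) = ft (Phi q \<mu> a t) \<xi> - ft (Phi q \<mu> a 0) \<xi>"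
    and "continuous_on ({0..t} \<times> UNIV) (\<lambda>(s, \<xi>). \<i> * of_real \<mu> * ft (\<lambda>x. Gq q (Phi q \<mu> a s x)) \<xi>)"
proof -
  define h where "h s x = \<i> * of_real \<mu> * (of_real (a powr q * exp (- (q * x\<^sup>2 / 2))) * Phi q \<mu> a s x)" for s x
  have eq: "\<i> * of_real \<mu> * ft (\<lambda>x. Gq q (Phi q \<mu> a s x)) \<xi> = ft (h s) \<xi>" for s \<xi>
    unfolding h_def Gq_Phi[OF a] by (simp only: ft_cmult)
  have hc: "continuous_on ({0..t} \<times> UNIV) (\<lambda>(s, x). h s x)"
    unfolding h_def case_prod_beta
    by (intro continuous_intros continuous_on_subset[OF Phi_continuous]) auto
  have gi: "integrable lborel (\<lambda>x. \<bar>\<mu>\<bar> * a powr q * (a * exp (- (x\<^sup>2 / 2))))"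
    using Phi_integrable(2)[OF a] by (rule integrable_mult_right)
  have b: "norm (h s x) \<le> \<bar>\<mu>\<bar> * a powr q * (a * exp (- (x\<^sup>2 / 2)))" for s x
  proof -
    have "norm (h s x) = \<bar>\<mu>\<bar> * a powr q * (a * exp (- (x\<^sup>2 / 2))) * exp (- (q * x\<^sup>2 / 2))"
      using a by (simp add: h_def norm_mult norm_Phi)
    also have "\<dots> \<le> \<bar>\<mu>\<bar> * a powr q * (a * exp (- (x\<^sup>2 / 2))) * 1"
      using a q by (intro mult_left_mono) auto
    finally show ?thesis by simp
  qed
  note s = ft_integral_strip[OF hc gi b]
  have "integral {0..t} (\<lambda>s. h s x) = Phi q \<mu> a t x - Phi q \<mu> a 0 x" for x
  proof -
    define c where "c = a powr q * exp (- (q * x\<^sup>2 / 2))"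
    have "((\<lambda>s. of_real (a * exp (- (x\<^sup>2 / 2))) * cis (s * (\<mu> * c))) has_vector_derivative
       of_real (a * exp (- (x\<^sup>2 / 2))) * (\<i> * of_real (\<mu> * c) * cis (s * (\<mu> * c)))) (at s)" for s
      by (intro has_vector_derivative_mult_right has_vector_derivative_cis_mult)
    note d = this
    have "((\<lambda>s. Phi q \<mu> a s x) has_vector_derivative h s x) (at s)" for s
      using d[of s] by (simp add: Phi_def h_def c_def[symmetric] ac_simps)
    from hb_FTC[OF this t] show ?thesis by (rule integral_unique)
  qed
  then have "integral {0..t} (\<lambda>s. ft (h s) \<xi>) = ft (\<lambda>x. Phi q \<mu> a t x - Phi q \<mu> a 0 x) \<xi>"
    using s(1) by simp
  also have "\<dots> = ft (Phi q \<mu> a t) \<xi> - ft (Phi q \<mu> a 0) \<xi>"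
    by (intro ft_diff Phi_integrable a)
  finally show "integral {0..t} (\<lambda>s. \<i> * of_real \<mu> * ft (\<lambda>x. Gq q (Phi q \<mu> a s x)) \<xi>) = ft (Phi q \<mu> a t) \<xi> - ft (Phi q \<mu> a 0) \<xi>"
    by (simp only: eq)
  show "continuous_on ({0..t} \<times> UNIV) (\<lambda>(s, \<xi>). \<i> * of_real \<mu> * ft (\<lambda>x. Gq q (Phi q \<mu> a s x)) \<xi>)"
    using s(2) by (simp only: eq)
qed

text \<open>\<open>B\<close> and \<open>C\<close> are obtained before the symbol and \<eta>; hence N
  can be chosen after them. The reference solution, moved to the interaction picture, fails the
  Duhamel formula only by the integral of \<open>\<i> * m * F0\<close>, and |m| <= \<eta> (1 +
  \<xi>^2) turns this into \<eta> times a bound with two more derivatives.\<close>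

lemma small_dispersion:
  assumes k: "1 \<le> k" and q: "1 \<le> q" "real k \<le> q \<or> q = 2" and \<mu>: "\<bar>\<mu>\<bar> = 1" and a: "0 < a" and K: "0 \<le> K"
  obtains B C where "1 \<le> B" "0 < C" "\<And>t. t \<in> {0..K} \<Longrightarrow> L2b (sobw k) B (ft (Phi q \<mu> a t))"
    "\<And>m \<eta>. continuous_on UNIV m \<Longrightarrow> 0 < \<eta> \<Longrightarrow> \<eta> * C \<le> 1 \<Longrightarrow> (\<And>\<xi>. \<bar>m \<xi>\<bar> \<le> \<eta> * (1 + \<xi>\<^sup>2)) \<Longrightarrow>
      \<exists>F. semilinear.mild k q \<mu> m K (ft (Phi q \<mu> a 0)) F \<and> (\<forall>t\<in>{0..K}. L2b (sobw k) B (F t)) \<and>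
        (\<forall>t\<in>{0..K}. L2b (sobw k) (\<eta> * C) (\<lambda>\<xi>. F t \<xi> - cis (- (t * m \<xi>)) * ft (Phi q \<mu> a t) \<xi>))"
proof -
  have q0: "0 < q" using q by simp
  obtain A where A: "\<And>t. t \<in> {0..K} \<Longrightarrow> hb (k + 2) A (Phi q \<mu> a t)" using Phi_hb[OF q0 \<mu>, of K "k + 2" a] by blast
  define D where "D = 2 ^ Suc (k + 2) * A"
  have PD: "L2b (sobw (k + 2)) D (ft (Phi q \<mu> a t))" if "t \<in> {0..K}" for t
    unfolding D_def by (rule hb_ft_sobw[OF Phi_integrable(1)[OF a] A[OF that]])
  have D0: "0 \<le> D" using L2b_nonneg[OF PD[of 0]] K by simp
  have Pk: "L2b (sobw k) D (ft (Phi q \<mu> a t))" if "t \<in> {0..K}" for t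
    by (rule L2b_mono_weight[OF wt_sobw PD[OF that] sobw_mono]) simp
  \<comment> \<open>\<open>Picard\<close> leaves room 1 between the approximation and the boundary
    of the ball.\<close>
  define B where "B = D + 1"
  have B: "1 \<le> B" "0 \<le> B" using D0 by (auto simp: B_def)
  obtain L where lip: "nlc_lip k q B L" using nlc_lip_exists[OF k q B(2)] .
  \<comment> \<open>The deviation bound of \<open>Picard\<close> for a residual \<eta> (D K + 1);
    the added 1 keeps the residual bound positive when D K is 0.\<close>
  define C where "C = 2 * (D * K + 1) * exp (2 * L * K)"
  have C: "0 < C" using D0 K by (simp add: C_def add_nonneg_pos)
  show thesis
  proof (rule that[OF B(1) C])
    show "L2b (sobw k) B (ft (Phi q \<mu> a t))" if "t \<in> {0..K}" for t
      by (rule L2b_mono_bound[OF Pk[OF that]]) (simp add: B_def)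
    fix m \<eta> assume m: "continuous_on UNIV m" and \<eta>: "0 < \<eta>" "\<eta> * C \<le> 1" and mb: "\<And>\<xi>. \<bar>m \<xi>\<bar> \<le> \<eta> * (1 + \<xi>\<^sup>2)"
    interpret semilinear k q \<mu> m
      by unfold_locales (use k q \<mu> m in auto)
    define P where "P t = ft (Phi q \<mu> a t)" for t
    define F0 where "F0 t \<xi> = cis (- (t * m \<xi>)) * P t \<xi>" for t \<xi>
    have Pc: "continuous_on ({0..K} \<times> UNIV) (\<lambda>(t, \<xi>). P t \<xi>)"
      unfolding P_def
      by (rule ft_integral_strip(2)[OF Phi_strip_continuous Phi_integrable(2)[OF a]]) (simp add: norm_Phi a)
    have F0c: "continuous_on ({0..K} \<times> UNIV) (\<lambda>(t, \<xi>). F0 t \<xi>)"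
      unfolding F0_def case_prod_beta using Pc unfolding case_prod_beta
      by (intro continuous_intros continuous_on_compose2[OF m]) auto
    have [measurable]: "F0 t \<in> borel_measurable borel" if "t \<in> {0..K}" for t
      using continuous_on_strip_section2[OF F0c that] by (rule borel_measurable_continuous_onI)
    have F0b: "L2b (sobw k) D (F0 t)" if t: "t \<in> {0..K}" for t
      by (rule L2b_mono_norm[OF wt_sobw Pk[OF t]]) (use t in \<open>auto simp: F0_def P_def norm_mult\<close>)
    have tw: "tw t (F0 t) = P t" for t by (auto simp: tw_def F0_def cis_mult simp flip: mult.assoc)
    have NF: "NN t (F0 t) \<xi> = cis (- (t * m \<xi>)) * (\<i> * of_real \<mu> * ft (\<lambda>x. Gq q (Phi q \<mu> a t x)) \<xi>)" if t: "t \<in> {0..K}" for t \<xi>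
    proof -
      have "ift (P t) x = Phi q \<mu> a t x" for x
        unfolding P_def
      proof (rule ft_inversion[OF Phi_integrable(1)[OF a]])
        show "continuous_on UNIV (Phi q \<mu> a t)" using A[OF t] by (rule hb_continuous)
        show "norm (Phi q \<mu> a t x) \<le> a * 1" for x unfolding norm_Phi[OF a] using a by (intro mult_left_mono) auto
        show "integrable lborel (ft (Phi q \<mu> a t))" by (rule L2b_sobw_L1(1)[OF k Pk[OF t]])
      qed
      then show ?thesis by (simp add: NN_def tw nlc_def ac_simps)
    qed
    \<comment> \<open>The product rule for the phase times P: differentiating P reproduces
      \<open>NN\<close>, since \<open>tw\<close> takes \<open>F0\<close> back to P, and
      differentiating the phase leaves the term with m.\<close>
    have res: "P 0 \<xi> + integral {0..t} (\<lambda>s. NN s (F0 s) \<xi>) - F0 t \<xi> = integral {0..t} (\<lambda>s. \<i> * of_real (m \<xi>) * F0 s \<xi>)"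
      if t: "t \<in> {0..K}" for t \<xi>
    proof -
      define G where "G s = \<i> * of_real \<mu> * ft (\<lambda>x. Gq q (Phi q \<mu> a s x)) \<xi>" for s
      have Gc: "continuous_on {0..t} G"
        unfolding G_def by (rule continuous_on_strip_section[OF Phi_ft_evolution(2)[OF a _ q0]]) (use t in auto)
      have PG: "P s \<xi> = P 0 \<xi> + integral {0..s} G" if "s \<in> {0..t}" for s
      proof -
        have "0 \<le> s" using that by simp
        from Phi_ft_evolution(1)[OF a this q0, of \<mu> \<xi>] show ?thesis by (simp only: P_def G_def[abs_def] add_diff_cancel_left' diff_add_cancel add.commute[of "ft (Phi q \<mu> a 0) \<xi>"])
      qed
      have Pd: "((\<lambda>s. P s \<xi>) has_vector_derivative G s) (at s within {0..t})" if s: "s \<in> {0..t}" for s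
      proof -
        have "((\<lambda>s. P 0 \<xi> + integral {0..s} G) has_vector_derivative G s) (at s within {0..t})"
          using has_vector_derivative_add[OF has_vector_derivative_const integral_has_vector_derivative[OF Gc s]] by simp
        from has_vector_derivative_transform[OF s PG this] show ?thesis by simp
      qed
      have Fd: "((\<lambda>s. F0 s \<xi>) has_vector_derivative (NN s (F0 s) \<xi> - \<i> * of_real (m \<xi>) * F0 s \<xi>)) (at s within {0..t})" if s: "s \<in> {0..t}" for s
      proof -
        have "((\<lambda>s. cis (s * (- m \<xi>))) has_vector_derivative (\<i> * of_real (- m \<xi>) * cis (s * (- m \<xi>)))) (at s within {0..t})"
          by (rule has_vector_derivative_at_within[OF has_vector_derivative_cis_mult])
        from has_vector_derivative_mult[OF this Pd[OF s]] NF[of s \<xi>] s t show ?thesis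
          by (simp add: F0_def G_def algebra_simps)
      qed
      have "((\<lambda>s. NN s (F0 s) \<xi> - \<i> * of_real (m \<xi>) * F0 s \<xi>) has_integral (F0 t \<xi> - F0 0 \<xi>)) {0..t}"
        by (rule fundamental_theorem_of_calculus) (use t Fd in auto)
      then have 1: "integral {0..t} (\<lambda>s. NN s (F0 s) \<xi> - \<i> * of_real (m \<xi>) * F0 s \<xi>) = F0 t \<xi> - F0 0 \<xi>"
        by (rule integral_unique)
      have i1: "(\<lambda>s. NN s (F0 s) \<xi>) integrable_on {0..t}"
        using t by (intro integrable_continuous_interval
            continuous_on_subset[OF continuous_on_strip_section[OF NN_strip_continuous[OF F0c F0b]]]) auto
      have i2: "(\<lambda>s. \<i> * of_real (m \<xi>) * F0 s \<xi>) integrable_on {0..t}"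
        using t by (intro integrable_continuous_interval continuous_intros
            continuous_on_subset[OF continuous_on_strip_section[OF F0c]]) auto
      have "F0 0 \<xi> = P 0 \<xi>" by (simp add: F0_def)
      with 1 show ?thesis
        unfolding Henstock_Kurzweil_Integration.integral_diff[OF i1 i2] by (simp add: algebra_simps)
    qed
    have "\<exists>F. mild K (P 0) F \<and> (\<forall>t\<in>{0..K}. L2b (sobw k) B (F t)) \<and>
       (\<forall>t\<in>{0..K}. L2b (sobw k) (2 * (\<eta> * (D * K + 1)) * exp (2 * L * K)) (\<lambda>\<xi>. F t \<xi> - F0 t \<xi>))"
    proof (rule Picard[OF B(1) lip K _ F0c])
      show "continuous_on UNIV (P 0)" by (rule continuous_on_strip_section2[OF Pc]) (use K in auto)
      show "L2b (sobw k) (B - 1) (F0 t)" if "t \<in> {0..K}" for t using F0b[OF that] by (simp add: B_def)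
      show "0 < \<eta> * (D * K + 1)" using \<eta> D0 K by (simp add: add_nonneg_pos)
      show "2 * (\<eta> * (D * K + 1)) * exp (2 * L * K) \<le> 1" using \<eta>(2) by (simp add: C_def mult.left_commute mult.assoc)
      fix t assume t: "t \<in> {0..K}"
      have mF: "L2b (sobw k) (\<eta> * D) (\<lambda>\<xi>. \<i> * of_real (m \<xi>) * F0 s \<xi>)" if s: "s \<in> {0..t}" for s
      proof (rule L2b_le[OF wt_sobw PD])
        show "s \<in> {0..K}" using s t by auto
        show "(\<lambda>\<xi>. \<i> * of_real (m \<xi>) * F0 s \<xi>) \<in> borel_measurable borel"
        proof -
          have [measurable]: "m \<in> borel_measurable borel" using m by (rule borel_measurable_continuous_onI)
          have [measurable]: "F0 s \<in> borel_measurable borel" using s t by auto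
          show ?thesis by measurable
        qed
        fix \<xi>
        have "(m \<xi>)\<^sup>2 \<le> (\<eta> * (1 + \<xi>\<^sup>2))\<^sup>2" using power_mono[OF mb[of \<xi>], of 2] by simp
        also have "\<dots> = \<eta>\<^sup>2 * (1 + \<xi>\<^sup>2)\<^sup>2" by (rule power_mult_distrib)
        finally have "sobw k \<xi> * (m \<xi>)\<^sup>2 \<le> sobw k \<xi> * (\<eta>\<^sup>2 * (1 + \<xi>\<^sup>2)\<^sup>2)"
          using wt_nonneg[OF wt_sobw] by (rule mult_left_mono)
        also have "\<dots> = \<eta>\<^sup>2 * sobw (k + 2) \<xi>" by (simp add: sobw_def power_add power2_eq_square ac_simps)
        finally have "sobw k \<xi> * (m \<xi>)\<^sup>2 * (norm (P s \<xi>))\<^sup>2 \<le> \<eta>\<^sup>2 * sobw (k + 2) \<xi> * (norm (P s \<xi>))\<^sup>2"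
          by (rule mult_right_mono) simp
        then show "sobw k \<xi> * (norm (\<i> * complex_of_real (m \<xi>) * F0 s \<xi>))\<^sup>2 \<le> \<eta>\<^sup>2 * (sobw (k + 2) \<xi> * (norm (ft (Phi q \<mu> a s) \<xi>))\<^sup>2)"
          by (simp add: F0_def norm_mult power_mult_distrib P_def mult.assoc)
      qed (use \<eta> in auto)
      have "L2b (sobw k) (\<eta> * D * t) (\<lambda>\<xi>. integral {0..t} (\<lambda>s. \<i> * of_real (m \<xi>) * F0 s \<xi>))"
      proof (rule Minkowski_strip_const[OF wt_sobw _ mF])
        have F0c': "continuous_on ({0..t} \<times> UNIV) (\<lambda>x. F0 (fst x) (snd x))"
          by (rule continuous_on_subset[OF F0c[unfolded case_prod_beta]]) (use t in auto)
        show "continuous_on ({0..t} \<times> UNIV) (\<lambda>(s, \<xi>). \<i> * of_real (m \<xi>) * F0 s \<xi>)"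
          unfolding case_prod_beta by (intro continuous_intros F0c' continuous_on_compose2[OF m]) auto
      qed (use \<eta> D0 t in auto)
      moreover have "\<eta> * D * t \<le> \<eta> * (D * K + 1)"
      proof -
        have "D * t \<le> D * K + 1" using t D0 mult_left_mono[of t K D] by auto
        then show ?thesis using \<eta> by (simp add: mult.assoc)
      qed
      ultimately have "L2b (sobw k) (\<eta> * (D * K + 1)) (\<lambda>\<xi>. integral {0..t} (\<lambda>s. \<i> * of_real (m \<xi>) * F0 s \<xi>))"
        by (rule L2b_mono_bound)
      then show "L2b (sobw k) (\<eta> * (D * K + 1)) (\<lambda>\<xi>. P 0 \<xi> + integral {0..t} (\<lambda>s. NN s (F0 s) \<xi>) - F0 t \<xi>)"
        by (simp only: res[OF t])
    qed
    moreover have "2 * (\<eta> * (D * K + 1)) * exp (2 * L * K) = \<eta> * C" by (simp add: C_def)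
    ultimately show "\<exists>F. mild K (ft (Phi q \<mu> a 0)) F \<and> (\<forall>t\<in>{0..K}. L2b (sobw k) B (F t)) \<and>
        (\<forall>t\<in>{0..K}. L2b (sobw k) (\<eta> * C) (\<lambda>\<xi>. F t \<xi> - cis (- (t * m \<xi>)) * ft (Phi q \<mu> a t) \<xi>))"
      by (simp add: P_def F0_def)
  qed
qed

section \<open>The moving frame\<close>

text \<open>For |y| <= 1/2 two mean value estimates give 8 y^2, the bound 4 being (1/2)^(-2). For
  larger |y| no cancellation is used: the three terms are at most 9 y^2, 4 y^2 and 4 y^2, and 17 is
  their sum.\<close>

lemma powr_second_order:
  assumes s: "0 < s" "s < (2::real)"
  shows "\<bar>\<bar>1 + y\<bar> powr s - 1 - s * y\<bar> \<le> 17 * y\<^sup>2"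
proof (cases "\<bar>y\<bar> \<le> 1 / 2")
  case True
  define r where "r = \<bar>y\<bar>"
  have r: "0 \<le> r" "r \<le> 1 / 2" using True by (auto simp: r_def)
  have pos: "1 / 2 \<le> 1 + x" "0 < 1 + x" if "x \<in> {-r..r}" for x using that r by auto
  have g: "\<bar>(1 + x) powr (s - 1) - 1\<bar> \<le> 4 * r" if x: "x \<in> {-r..r}" for x
  proof -
    have "norm ((1 + x) powr (s - 1) - (1 + 0) powr (s - 1)) \<le> 4 * norm (x - 0)"
    proof (rule field_differentiable_bound[of "{-r..r}"])
      show "((\<lambda>x. (1 + x) powr (s - 1)) has_field_derivative ((s - 1) * (1 + z) powr (s - 2))) (at z within {-r..r})" if "z \<in> {-r..r}" for z
        using pos(2)[OF that] by (auto intro!: derivative_eq_intros)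
      show "norm ((s - 1) * (1 + z) powr (s - 2)) \<le> 4" if "z \<in> {-r..r}" for z
      proof -
        have "(1 + z) powr (s - 2) \<le> (1 / 2) powr (s - 2)" using pos[OF that] s by (intro powr_mono2') auto
        also have "\<dots> \<le> (1 / 2) powr (- 2)" using s by (intro powr_mono') auto
        also have "\<dots> = (4::real)" by (simp add: powr_minus powr_numeral power2_eq_square)
        finally have "(1 + z) powr (s - 2) \<le> 4" .
        then have "\<bar>s - 1\<bar> * (1 + z) powr (s - 2) \<le> 1 * 4" using s by (intro mult_mono) auto
        then show ?thesis by (simp add: abs_mult)
      qed
    qed (use x r in auto)
    then have "\<bar>(1 + x) powr (s - 1) - 1\<bar> \<le> 4 * \<bar>x\<bar>" by simp
    also have "\<dots> \<le> 4 * r" using x by auto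
    finally show ?thesis .
  qed
  have "norm (((1 + y) powr s - 1 - s * y) - ((1 + 0) powr s - 1 - s * 0)) \<le> 8 * r * norm (y - 0)"
  proof (rule field_differentiable_bound[of "{-r..r}"])
    show "((\<lambda>x. (1 + x) powr s - 1 - s * x) has_field_derivative (s * ((1 + z) powr (s - 1) - 1))) (at z within {-r..r})" if "z \<in> {-r..r}" for z
      using pos(2)[OF that] by (auto intro!: derivative_eq_intros simp: algebra_simps)
    show "norm (s * ((1 + z) powr (s - 1) - 1)) \<le> 8 * r" if "z \<in> {-r..r}" for z
    proof -
      have "s * \<bar>(1 + z) powr (s - 1) - 1\<bar> \<le> 2 * (4 * r)" using g[OF that] s r by (intro mult_mono) auto
      then show ?thesis using s by (simp add: abs_mult)
    qed
  qed (use r in \<open>auto simp: r_def\<close>)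
  then have "\<bar>(1 + y) powr s - 1 - s * y\<bar> \<le> 8 * y\<^sup>2"
    by (simp add: r_def power2_eq_square abs_mult_self_eq mult.assoc)
  moreover have "\<bar>1 + y\<bar> = 1 + y" using True by auto
  ultimately show ?thesis by (smt (verit) zero_le_power2)
next
  case False
  then have y: "1 / 2 < \<bar>y\<bar>" by simp
  have y2: "\<bar>y\<bar> \<le> 2 * y\<^sup>2"
    using mult_right_mono[of "1 / 2" "\<bar>y\<bar>" "\<bar>y\<bar>"] y by (simp add: power2_eq_square)
  have y1: "1 \<le> 4 * y\<^sup>2" using y y2 by linarith
  have "\<bar>1 + y\<bar> powr s \<le> (1 + \<bar>y\<bar>) powr s" using s by (intro powr_mono2) auto
  also have "\<dots> \<le> (1 + \<bar>y\<bar>) powr 2" using s by (intro powr_mono) auto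
  also have "\<dots> = 1 + 2 * \<bar>y\<bar> + y\<^sup>2" by (simp add: powr_numeral power2_sum)
  also have "\<dots> \<le> 9 * y\<^sup>2" using y1 y2 by linarith
  finally have "\<bar>1 + y\<bar> powr s \<le> 9 * y\<^sup>2" .
  moreover have "\<bar>s * y\<bar> \<le> 4 * y\<^sup>2"
  proof -
    have "s * \<bar>y\<bar> \<le> 2 * (2 * y\<^sup>2)" using s y2 by (intro mult_mono) auto
    then show ?thesis using s by (simp add: abs_mult)
  qed
  ultimately show ?thesis using y1 powr_ge_zero[of "\<bar>1 + y\<bar>" s] by linarith
qed

text \<open>The symbol around frequency N without its first-order Taylor polynomial: the constant is
  a gauge phase and the linear part a translation with the group velocity. \<kappa> is the factor of
  the time rescaling.\<close>

definition mN :: "real \<Rightarrow> real \<Rightarrow> real \<Rightarrow> real \<Rightarrow> real" where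
  "mN \<sigma> \<kappa> N \<xi> = (\<bar>N + \<xi>\<bar> powr (2 * \<sigma>) - N powr (2 * \<sigma>) - 2 * \<sigma> * N powr (2 * \<sigma> - 1) * \<xi>) / \<kappa>"

lemma mN_bound:
  assumes \<sigma>: "0 < \<sigma>" "\<sigma> < 1" and "1 \<le> \<kappa>" "1 \<le> N"
  shows "\<bar>mN \<sigma> \<kappa> N \<xi>\<bar> \<le> 17 * N powr (2 * \<sigma> - 2) * (1 + \<xi>\<^sup>2)"
proof -
  define y where "y = \<xi> / N"
  have N: "0 < N" and \<xi>: "\<xi> = N * y" using assms by (auto simp: y_def)
  have "\<bar>N + \<xi>\<bar> = \<bar>N * (1 + y)\<bar>" by (simp add: \<xi> algebra_simps)
  also have "\<dots> = N * \<bar>1 + y\<bar>" using N by (simp only: abs_mult abs_of_pos)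
  finally have "\<bar>N + \<xi>\<bar> = N * \<bar>1 + y\<bar>" .
  then have 1: "\<bar>N + \<xi>\<bar> powr (2 * \<sigma>) = N powr (2 * \<sigma>) * \<bar>1 + y\<bar> powr (2 * \<sigma>)"
    using N by (simp add: powr_mult)
  have 2: "N powr (2 * \<sigma> - 1) * N = N powr (2 * \<sigma>)" "N powr (2 * \<sigma> - 2) * N\<^sup>2 = N powr (2 * \<sigma>)"
    using N powr_add[of N "2 * \<sigma> - 1" 1] powr_add[of N "2 * \<sigma> - 2" 2] by (auto simp: powr_numeral)
  have "mN \<sigma> \<kappa> N \<xi> = N powr (2 * \<sigma>) * (\<bar>1 + y\<bar> powr (2 * \<sigma>) - 1 - 2 * \<sigma> * y) / \<kappa>"
    unfolding mN_def 1 using 2(1) by (simp add: \<xi> algebra_simps)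
  then have "\<bar>mN \<sigma> \<kappa> N \<xi>\<bar> = N powr (2 * \<sigma>) * \<bar>\<bar>1 + y\<bar> powr (2 * \<sigma>) - 1 - 2 * \<sigma> * y\<bar> / \<kappa>"
    using assms by (simp add: abs_mult)
  also have "\<dots> \<le> N powr (2 * \<sigma>) * \<bar>\<bar>1 + y\<bar> powr (2 * \<sigma>) - 1 - 2 * \<sigma> * y\<bar> / 1"
    using assms by (intro divide_left_mono) auto
  also have "\<dots> \<le> N powr (2 * \<sigma>) * (17 * y\<^sup>2)"
    using powr_second_order[of "2 * \<sigma>" y] \<sigma> by (simp add: mult_left_mono)
  also have "\<dots> = 17 * N powr (2 * \<sigma> - 2) * \<xi>\<^sup>2"
    unfolding 2(2)[symmetric] by (simp add: \<xi> power_mult_distrib)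
  also have "\<dots> \<le> 17 * N powr (2 * \<sigma> - 2) * (1 + \<xi>\<^sup>2)"
    by (intro mult_left_mono) auto
  finally show ?thesis .
qed

lemma mN_continuous: "0 < \<sigma> \<Longrightarrow> continuous_on UNIV (mN \<sigma> \<kappa> N)"
  unfolding mN_def[abs_def] divide_inverse by (intro continuous_intros continuous_on_powr') auto

lemma Peetre: "1 + (x + y)\<^sup>2 \<le> 2 * (1 + x\<^sup>2) * (1 + (y::real)\<^sup>2)"
proof -
  have "(x + y)\<^sup>2 + (x - y)\<^sup>2 = 2 * x\<^sup>2 + 2 * y\<^sup>2" by (simp add: power2_eq_square algebra_simps)
  then have "(x + y)\<^sup>2 \<le> 2 * x\<^sup>2 + 2 * y\<^sup>2" by (smt (verit) zero_le_power2)
  moreover have "0 \<le> x\<^sup>2 * y\<^sup>2" by simp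
  moreover have "2 * (1 + x\<^sup>2) * (1 + y\<^sup>2) = 2 + 2 * x\<^sup>2 + 2 * y\<^sup>2 + 2 * (x\<^sup>2 * y\<^sup>2)"
    by (simp add: algebra_simps)
  ultimately show ?thesis by linarith
qed

lemma L2b_translate:
  assumes "wt w" "L2b w B f"
  shows "L2b (\<lambda>\<xi>. w (\<xi> - N)) B (\<lambda>\<xi>. f (\<xi> - N))"
proof -
  have [measurable]: "w \<in> borel_measurable borel" "f \<in> borel_measurable borel" using assms by (auto simp: wt_def L2b_def)
  have "(\<integral>\<^sup>+\<xi>. ennreal (w \<xi> * (norm (f \<xi>))\<^sup>2) \<partial>lborel) = (\<integral>\<^sup>+\<xi>. ennreal (w (\<xi> - N) * (norm (f (\<xi> - N)))\<^sup>2) \<partial>lborel)"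
    by (subst nn_integral_real_affine[of _ 1 "- N"]) (auto simp: add.commute)
  then show ?thesis using assms by (auto simp: L2b_def)
qed

lemma L2b_sobw_translate:
  assumes "L2b (sobw k) B f"
  shows "L2b (sobw k) (sqrt (2 ^ k * sobw k N) * B) (\<lambda>\<xi>. f (\<xi> - N))"
proof (rule L2b_le[OF _ L2b_translate[OF wt_sobw assms]])
  show "wt (\<lambda>\<xi>. sobw k (\<xi> - N))" by (auto simp: wt_def sobw_def)
  have [measurable]: "f \<in> borel_measurable borel" using assms by (simp add: L2b_def)
  show "(\<lambda>\<xi>. f (\<xi> - N)) \<in> borel_measurable borel" by measurable
  have c: "0 \<le> 2 ^ k * sobw k N" using sobw_ge_1[of k N] by simp
  then show "0 \<le> sqrt (2 ^ k * sobw k N)" by simp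
  fix \<xi>
  have "sobw k \<xi> \<le> (2 * (1 + N\<^sup>2) * (1 + (\<xi> - N)\<^sup>2)) ^ k"
    unfolding sobw_def using Peetre[of N "\<xi> - N"] by (intro power_mono) auto
  also have "\<dots> = 2 ^ k * sobw k N * sobw k (\<xi> - N)" by (simp only: sobw_def power_mult_distrib)
  finally show "sobw k \<xi> * (norm (f (\<xi> - N)))\<^sup>2 \<le> (sqrt (2 ^ k * sobw k N))\<^sup>2 * (sobw k (\<xi> - N) * (norm (f (\<xi> - N)))\<^sup>2)"
    using c by (simp add: mult_right_mono flip: mult.assoc)
qed

lemma ift_translate: "ift (\<lambda>\<xi>. G (\<xi> - N)) x = cis (N * x) * ift G x"
  using ft_shift[of G "- N" "- x"] by (simp add: ift_def)

lemma ift_modulate: "ift (\<lambda>\<xi>. cis (c * \<xi>) * G \<xi>) x = ift G (x + c)"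
  using ft_modulate[of c G "- x"] by (simp add: ift_def)

lemma integral_rescale:
  fixes H :: "real \<Rightarrow> complex"
  assumes H: "continuous_on {0..\<kappa> * t} H" and \<kappa>: "0 < \<kappa>" and t: "0 \<le> t"
  shows "integral {0..t} (\<lambda>s. of_real \<kappa> * H (\<kappa> * s)) = integral {0..\<kappa> * t} H"
proof -
  have "((\<lambda>s. integral {0..\<kappa> * s} H) has_vector_derivative of_real \<kappa> * H (\<kappa> * s)) (at s within {0..t})" if s: "s \<in> {0..t}" for s
  proof -
    have im: "(\<lambda>s. \<kappa> * s) ` {0..t} \<subseteq> {0..\<kappa> * t}" using \<kappa> by auto
    have 1: "((\<lambda>s. \<kappa> * s) has_vector_derivative \<kappa>) (at s within {0..t})"
      by (auto intro!: derivative_eq_intros simp flip: has_real_derivative_iff_has_vector_derivative)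
    have "((\<lambda>u. integral {0..u} H) has_vector_derivative H (\<kappa> * s)) (at (\<kappa> * s) within {0..\<kappa> * t})"
      using s \<kappa> by (intro integral_has_vector_derivative[OF H]) auto
    then have "((\<lambda>u. integral {0..u} H) has_vector_derivative H (\<kappa> * s)) (at (\<kappa> * s) within (\<lambda>s. \<kappa> * s) ` {0..t})"
      by (rule has_vector_derivative_within_subset[OF _ im])
    from vector_diff_chain_within[OF 1 this] show ?thesis by (simp add: o_def scaleR_conv_of_real)
  qed
  from fundamental_theorem_of_calculus[OF t this]
  have "((\<lambda>s. of_real \<kappa> * H (\<kappa> * s)) has_integral (integral {0..\<kappa> * t} H - integral {0..\<kappa> * 0} H)) {0..t}" .
  then have "((\<lambda>s. of_real \<kappa> * H (\<kappa> * s)) has_integral integral {0..\<kappa> * t} H) {0..t}" by simp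
  then show ?thesis by (rule integral_unique)
qed

lemma semilinear_frac_laplacian:
  assumes "1 \<le> k" "1 \<le> q" "real k \<le> q \<or> q = 2" "\<bar>\<mu>\<bar> = 1" "0 < \<sigma>"
  shows "semilinear k q \<mu> (\<lambda>\<xi>. \<bar>\<xi>\<bar> powr (2 * \<sigma>))"
proof
  show "continuous_on UNIV (\<lambda>\<xi>::real. \<bar>\<xi>\<bar> powr (2 * \<sigma>))"
    by (intro continuous_on_powr' continuous_intros) (use assms in auto)
qed (use assms in auto)

text \<open>In physical space the solution is A times a gauge phase, the modulation cis(N x), and
  the profile at time A^q t translated by the group velocity. In the interaction picture gauge and
  translation disappear from the formula, leaving a shift by N, a factor A and the rescaled
  time.\<close>

lemma frame_change:
  assumes k: "1 \<le> k" and q: "1 \<le> q" "real k \<le> q \<or> q = 2" and \<mu>: "\<bar>\<mu>\<bar> = 1" and \<sigma>: "0 < \<sigma>"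
    and A: "0 < A" and F: "semilinear.mild k q \<mu> (mN \<sigma> (A powr q) N) K f0 F"
  shows "semilinear.mild k q \<mu> (\<lambda>\<xi>. \<bar>\<xi>\<bar> powr (2 * \<sigma>)) (K / A powr q) (\<lambda>\<xi>. of_real A * f0 (\<xi> - N))
     (\<lambda>t \<xi>. of_real A * F (A powr q * t) (\<xi> - N))"
proof -
  define \<kappa> where "\<kappa> = A powr q"
  have \<kappa>: "0 < \<kappa>" using A by (simp add: \<kappa>_def)
  define c where "c = 2 * \<sigma> * N powr (2 * \<sigma> - 1)"
  interpret mv: semilinear k q \<mu> "mN \<sigma> \<kappa> N"
    by unfold_locales (use k q \<mu> mN_continuous[OF \<sigma>] in auto)
  interpret fx: semilinear k q \<mu> "\<lambda>\<xi>. \<bar>\<xi>\<bar> powr (2 * \<sigma>)"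
    by (rule semilinear_frac_laplacian[OF k q \<mu> \<sigma>])
  have F: "mv.mild K f0 F" using F by (simp add: \<kappa>_def)
  then have Fc: "continuous_on ({0..K} \<times> UNIV) (\<lambda>(t, \<xi>). F t \<xi>)" by (simp add: mv.mild_def)
  obtain B where B: "\<And>t. t \<in> {0..K} \<Longrightarrow> L2b (sobw k) B (F t)" using F unfolding mv.mild_def by blast
  define U where "U t \<xi> = of_real A * F (\<kappa> * t) (\<xi> - N)" for t \<xi>
  have tin: "\<kappa> * t \<in> {0..K}" if "t \<in> {0..K / \<kappa>}" for t using that \<kappa> by (simp add: field_simps)
  have key: "fx.NN s (U s) \<xi> = of_real A * (of_real \<kappa> * mv.NN (\<kappa> * s) (F (\<kappa> * s)) (\<xi> - N))" for s \<xi>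
  proof -
    define w where "w = ift (mv.tw (\<kappa> * s) (F (\<kappa> * s)))"
    \<comment> \<open>Taylor expansion of the phase at N: gauge, group velocity, and a remainder in
      the rescaled time.\<close>
    have ph: "s * \<bar>\<xi>\<bar> powr (2 * \<sigma>) = s * N powr (2 * \<sigma>) + (s * c * (\<xi> - N) + \<kappa> * s * mN \<sigma> \<kappa> N (\<xi> - N))" for \<xi>
    proof -
      have "\<kappa> * mN \<sigma> \<kappa> N (\<xi> - N) = \<bar>\<xi>\<bar> powr (2 * \<sigma>) - N powr (2 * \<sigma>) - c * (\<xi> - N)"
        using \<kappa> by (simp add: mN_def c_def)
      then have "s * (\<kappa> * mN \<sigma> \<kappa> N (\<xi> - N)) = s * (\<bar>\<xi>\<bar> powr (2 * \<sigma>) - N powr (2 * \<sigma>) - c * (\<xi> - N))"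
        by simp
      then show ?thesis by (simp add: algebra_simps)
    qed
    define G where "G \<eta> = cis (s * c * \<eta>) * mv.tw (\<kappa> * s) (F (\<kappa> * s)) \<eta>" for \<eta>
    have Gw: "ift G x = w (x + s * c)" for x unfolding G_def[abs_def] w_def by (rule ift_modulate)
    have tw: "fx.tw s (U s) = (\<lambda>\<xi>. of_real A * cis (s * N powr (2 * \<sigma>)) * G (\<xi> - N))"
      unfolding fx.tw_def mv.tw_def U_def G_def ph cis_mult[symmetric] by (simp add: fun_eq_iff ac_simps)
    have u: "ift (fx.tw s (U s)) x = (of_real A * cis (s * N powr (2 * \<sigma>)) * cis (N * x)) * w (x + s * c)" for x
      unfolding tw ift_cmult ift_translate Gw by (simp add: ac_simps)
    \<comment> \<open>Unimodular factors pass through the nonlinearity, and the amplitude A comes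
      out as A^(q+1), that is \<kappa> A; the \<kappa> is the Jacobian of the time change.\<close>
    have Gu: "Gq q (ift (fx.tw s (U s)) x) = of_real \<kappa> * (of_real A * cis (s * N powr (2 * \<sigma>))) * (cis (N * x) * Gq q (w (x + s * c)))" for x
      unfolding u Gq_def using A by (simp add: norm_mult powr_mult \<kappa>_def ac_simps)
    have "nlc q (fx.tw s (U s)) \<xi> = of_real \<kappa> * (of_real A * cis (s * N powr (2 * \<sigma>))) * (cis (s * c * (\<xi> - N)) * nlc q (mv.tw (\<kappa> * s) (F (\<kappa> * s))) (\<xi> - N))"
      unfolding nlc_def Gu ft_cmult ft_modulate w_def[symmetric] ft_shift[of "\<lambda>x. Gq q (w x)"] ..
    moreover have "cis (- (s * \<bar>\<xi>\<bar> powr (2 * \<sigma>))) * (cis (s * N powr (2 * \<sigma>)) * cis (s * c * (\<xi> - N))) = cis (- (\<kappa> * s * mN \<sigma> \<kappa> N (\<xi> - N)))"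
      unfolding cis_mult ph by simp
    ultimately show ?thesis unfolding fx.NN_def mv.NN_def
      by (simp add: ac_simps)
  qed
  have "fx.mild (K / \<kappa>) (\<lambda>\<xi>. of_real A * f0 (\<xi> - N)) U"
    unfolding fx.mild_def
  proof (intro conjI ballI allI)
    have "continuous_on ({0..K / \<kappa>} \<times> UNIV) (\<lambda>x. (\<lambda>(t, \<xi>). F t \<xi>) (\<kappa> * fst x, snd x - N))"
      by (rule continuous_on_compose2[OF Fc]) (use tin in \<open>auto intro!: continuous_intros\<close>)
    then show "continuous_on ({0..K / \<kappa>} \<times> UNIV) (\<lambda>(t, \<xi>). U t \<xi>)"
      unfolding U_def case_prod_beta by (intro continuous_intros) simp
    show "\<exists>B. \<forall>t\<in>{0..K / \<kappa>}. L2b (sobw k) B (U t)"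
      using L2b_cmult[OF wt_sobw L2b_sobw_translate[OF B[OF tin]], of _ "of_real A" N] unfolding U_def by blast
    fix t \<xi> assume t: "t \<in> {0..K / \<kappa>}"
    have Nc: "continuous_on {0..\<kappa> * t} (\<lambda>s. mv.NN s (F s) (\<xi> - N))"
      using tin[OF t] by (intro continuous_on_subset[OF continuous_on_strip_section[OF mv.NN_strip_continuous[OF Fc B]]]) auto
    have "integral {0..t} (\<lambda>s. fx.NN s (U s) \<xi>) = of_real A * integral {0..t} (\<lambda>s. of_real \<kappa> * mv.NN (\<kappa> * s) (F (\<kappa> * s)) (\<xi> - N))"
      unfolding key by simp
    also have "integral {0..t} (\<lambda>s. of_real \<kappa> * mv.NN (\<kappa> * s) (F (\<kappa> * s)) (\<xi> - N)) = integral {0..\<kappa> * t} (\<lambda>s. mv.NN s (F s) (\<xi> - N))"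
      by (rule integral_rescale[OF Nc \<kappa>]) (use t in auto)
    also have "\<dots> = F (\<kappa> * t) (\<xi> - N) - f0 (\<xi> - N)"
      using F tin[OF t] unfolding mv.mild_def by (simp add: algebra_simps)
    finally have I: "integral {0..t} (\<lambda>s. fx.NN s (U s) \<xi>) = of_real A * (F (\<kappa> * t) (\<xi> - N) - f0 (\<xi> - N))" .
    show "U t \<xi> = of_real A * f0 (\<xi> - N) + integral {0..t} (\<lambda>s. fx.NN s (U s) \<xi>)"
      unfolding I U_def[of t \<xi>] by (simp add: algebra_simps)
  qed
  then show ?thesis by (simp add: U_def[abs_def] \<kappa>_def)
qed

section \<open>Identification of the one-dimensional space with the real line\<close>

definition emb :: "real \<Rightarrow> real ^ 'd::finite" where
  "emb t = (\<chi> i. t)"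

text \<open>The index \<open>undefined\<close> is merely some element of the index type; it is the
  only one when the dimension is 1.\<close>

definition prj :: "real ^ 'd::finite \<Rightarrow> real" where
  "prj x = x $ undefined"

definition wps :: "real \<Rightarrow> real \<Rightarrow> real" where
  "wps s \<xi> = (1 + \<xi>\<^sup>2) powr s"

lemma wt_wps [simp]: "wt (wps s)"
  by (auto simp: wt_def wps_def[abs_def])

lemma wps_nat: "wps (real k) = sobw k"
proof
  fix \<xi> :: real
  have "0 < 1 + \<xi>\<^sup>2" by (simp add: add_pos_nonneg)
  then show "wps (real k) \<xi> = sobw k \<xi>" by (simp add: wps_def sobw_def powr_realpow)
qed

lemma prj_emb [simp]: "prj (emb t) = t"
  by (simp add: prj_def emb_def)

lemma bounded_linear_prj: "bounded_linear prj"
  unfolding prj_def[abs_def] by (rule bounded_linear_vec_nth)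

lemma prj_continuous [continuous_intros]: "continuous_on A f \<Longrightarrow> continuous_on A (\<lambda>x. prj (f x))"
  by (rule bounded_linear.continuous_on[OF bounded_linear_prj])

lemma prj_measurable [measurable]: "prj \<in> borel_measurable borel"
  by (intro borel_measurable_continuous_onI continuous_intros)

lemma emb_continuous: "continuous_on A emb"
  unfolding emb_def[abs_def] by (intro continuous_intros)

lemma emb_measurable [measurable]: "emb \<in> borel_measurable borel"
  using emb_continuous by (rule borel_measurable_continuous_onI)

text \<open>Square integrable up to a polynomial weight. The class is linear, consists of tempered
  functions, and contains Sobolev data, their products with the symbol, and bounded transforms of
  nonlinear terms.\<close>

definition TF :: "(real \<Rightarrow> complex) \<Rightarrow> bool" where
  "TF F \<longleftrightarrow> (\<exists>n B. L2b (\<lambda>\<xi>. inverse (sobw n \<xi>)) B F)"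

text \<open>\<open>F\<close> is the Fourier transform of \<open>T\<close> read on the line; all
  distributions of the Cauchy problem are handled through such an \<open>F\<close>.\<close>

definition repr :: "'d::finite distr \<Rightarrow> (real \<Rightarrow> complex) \<Rightarrow> bool" where
  "repr T F \<longleftrightarrow> TF F \<and> (\<forall>\<phi>. schwartz \<phi> \<longrightarrow> T (fourier \<phi>) = (LINT \<xi>|lborel. F \<xi> * \<phi> (emb \<xi>)))"

lemma wt_inverse_sobw [simp]: "wt (\<lambda>\<xi>. inverse (sobw n \<xi>))"
  using sobw_ge_1[of n] by (auto simp: wt_def sobw_def)

lemma TF_measurable: "TF F \<Longrightarrow> F \<in> borel_measurable borel"
  by (auto simp: TF_def L2b_def)

lemma TF_sobw:
  assumes "L2b (sobw k) B F" shows "TF F"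
proof -
  have "L2b (\<lambda>\<xi>. inverse (sobw 0 \<xi>)) B F" using L2b_sobw_L2[OF assms] by (simp add: sobw_def)
  then show ?thesis unfolding TF_def by blast
qed

lemma TF_lift:
  assumes "L2b (\<lambda>\<xi>. inverse (sobw n \<xi>)) B F" "n \<le> n'"
  shows "L2b (\<lambda>\<xi>. inverse (sobw n' \<xi>)) B F"
proof (rule L2b_mono_weight[OF wt_inverse_sobw assms(1)])
  show "inverse (sobw n' \<xi>) \<le> inverse (sobw n \<xi>)" for \<xi>
    using sobw_mono[OF assms(2), of \<xi>] sobw_ge_1[of n \<xi>] by (intro le_imp_inverse_le) auto
qed

lemma TF_lincomb:
  assumes "TF F" "TF G" shows "TF (\<lambda>\<xi>. a * F \<xi> + b * G \<xi>)"
proof -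
  obtain n B n' B' where 1: "L2b (\<lambda>\<xi>. inverse (sobw n \<xi>)) B F" "L2b (\<lambda>\<xi>. inverse (sobw n' \<xi>)) B' G"
    using assms by (auto simp: TF_def)
  have "L2b (\<lambda>\<xi>. inverse (sobw (max n n') \<xi>)) (norm a * B + norm b * B') (\<lambda>\<xi>. a * F \<xi> + b * G \<xi>)"
    by (intro L2b_add L2b_cmult TF_lift[OF 1(1)] TF_lift[OF 1(2)]) auto
  then show ?thesis unfolding TF_def by blast
qed

lemma TF_bounded:
  assumes [measurable]: "F \<in> borel_measurable borel" and b: "\<And>\<xi>. norm (F \<xi>) \<le> C"
  shows "TF F"
proof -
  have i: "integrable lborel (\<lambda>x. inverse (1 + x\<^sup>2) :: real)"
    using integrable_inverse_1_plus_square by (simp add: set_integrable_def interval_lebesgue_integral_def)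
  have C: "0 \<le> C" using b[of 0] norm_ge_zero order_trans by blast
  have "(\<integral>\<^sup>+\<xi>. ennreal (inverse (sobw 1 \<xi>) * (norm (F \<xi>))\<^sup>2) \<partial>lborel) \<le> (\<integral>\<^sup>+\<xi>. ennreal (inverse (1 + \<xi>\<^sup>2) * C\<^sup>2) \<partial>lborel)"
    using b by (intro nn_integral_mono ennreal_leI) (auto simp: sobw_def intro!: mult_left_mono power_mono)
  also have "\<dots> = ennreal (LINT \<xi>|lborel. inverse (1 + \<xi>\<^sup>2) * C\<^sup>2)"
    using i by (intro nn_integral_eq_integral) auto
  also have "(LINT \<xi>|lborel. inverse (1 + \<xi>\<^sup>2) * C\<^sup>2) = (sqrt (LINT \<xi>|lborel. inverse (1 + \<xi>\<^sup>2) * C\<^sup>2))\<^sup>2"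
    by (subst real_sqrt_pow2) (auto intro!: integral_nonneg_AE)
  finally show ?thesis unfolding TF_def L2b_def
    by (intro exI[of _ 1] exI[of _ "sqrt (LINT \<xi>|lborel. inverse (1 + \<xi>\<^sup>2) * C\<^sup>2)"]) (auto intro!: integral_nonneg_AE)
qed

context
  assumes one: "CARD('d::finite) = 1"
begin

lemma index_eq: "(i::'d) = j"
  using one by (metis (full_types) UNIV_I card_1_singletonE singletonD)

lemma UNIV_1: "(UNIV :: 'd set) = {undefined}"
  using index_eq by auto

lemma emb_prj [simp]: "emb (prj x) = (x :: real ^ 'd)"
proof (unfold vec_eq_iff, intro allI)
  fix i :: 'd
  have "i = undefined" by (rule index_eq)
  then show "emb (prj x) $ i = x $ i" by (simp add: emb_def prj_def)
qed

lemma inner_1: "x \<bullet> y = prj x * prj (y :: real ^ 'd)"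
  unfolding inner_vec_def UNIV_1 by (simp add: prj_def)

lemma norm_1: "norm (x :: real ^ 'd) = \<bar>prj x\<bar>"
  by (simp add: norm_eq_sqrt_inner inner_1 flip: power2_eq_square)

lemma emb_scaleR: "emb t = t *\<^sub>R (axis j 1 :: real ^ 'd)"
  using index_eq by (auto simp: vec_eq_iff emb_def axis_def)

lemma prj_axis: "prj (axis j 1 :: real ^ 'd) = 1"
  unfolding prj_def axis_def by (simp add: index_eq[of _ j])

lemma Basis_1: "(Basis :: (real ^ 'd) set) = {axis undefined 1}"
  unfolding Basis_vec_def UNIV_1 by simp

lemma lborel_1: "(lborel :: (real ^ 'd) measure) = distr lborel borel emb"
proof (rule lborel_eqI)
  fix l u :: "real ^ 'd" assume lu: "\<And>b. b \<in> Basis \<Longrightarrow> l \<bullet> b \<le> u \<bullet> b"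
  have p: "x \<bullet> axis undefined 1 = prj x" for x :: "real ^ 'd" by (simp add: inner_1 prj_axis)
  have "emeasure (distr lborel borel emb) (box l u) = emeasure lborel (emb -` box l u)"
    by (subst emeasure_distr) auto
  also have "emb -` box l u = box (prj l) (prj u)"
    by (auto simp: box_def Basis_1 p)
  also have "emeasure lborel \<dots> = ennreal (prj u - prj l)" using lu by (simp add: Basis_1 p)
  finally show "emeasure (distr lborel borel emb) (box l u) = ennreal (\<Prod>b\<in>Basis. (u - l) \<bullet> b)"
    by (simp add: Basis_1 p) (simp add: prj_def)
qed simp

lemma LINT_1:
  fixes f :: "real ^ 'd \<Rightarrow> 'b::{banach, second_countable_topology}"
  assumes "f \<in> borel_measurable borel"
  shows "(LINT x|lborel. f x) = (LINT t|lborel. f (emb t))"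
  using assms by (simp add: lborel_1 integral_distr)

lemma integrable_1:
  fixes f :: "real ^ 'd \<Rightarrow> 'b::{banach, second_countable_topology}"
  assumes "f \<in> borel_measurable borel"
  shows "integrable lborel f \<longleftrightarrow> integrable lborel (\<lambda>t. f (emb t))"
  using assms by (simp add: lborel_1 integrable_distr_eq)

lemma measurable_1:
  fixes f :: "real ^ 'd \<Rightarrow> 'b::topological_space"
  assumes "(\<lambda>t. f (emb t)) \<in> borel_measurable borel"
  shows "f \<in> borel_measurable borel"
proof -
  have "(\<lambda>x :: real ^ 'd. f (emb (prj x))) \<in> borel_measurable borel"
    using measurable_compose[OF prj_measurable assms] .
  then show ?thesis by simp
qed

lemma fourier_1:
  fixes f :: "real ^ 'd \<Rightarrow> complex"
  assumes [measurable]: "f \<in> borel_measurable borel"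
  shows "fourier f x = ft (\<lambda>t. f (emb t)) (prj x)"
proof -
  have [measurable]: "(\<lambda>y::real ^ 'd. y \<bullet> x) \<in> borel_measurable borel" by measurable
  have "(LINT y|lborel. cis (- (y \<bullet> x)) * f y) = (LINT t|lborel. cis (- (emb t \<bullet> x)) * f (emb t))"
    by (rule LINT_1) measurable
  moreover have "(2 * pi) powr (- real CARD('d) / 2) = 1 / sqrt (2 * pi)"
  proof -
    have "(2 * pi) powr (- real CARD('d) / 2) = inverse ((2 * pi) powr (1 / 2))"
      by (simp only: powr_minus[symmetric] one of_nat_1 minus_divide_left)
    also have "(2 * pi) powr (1 / 2) = sqrt (2 * pi)" by (rule powr_half_sqrt) simp
    finally show ?thesis by (simp only: inverse_eq_divide)
  qed
  ultimately show ?thesis unfolding fourier_def ft_def by (simp only: inner_1 prj_emb)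
qed

lemma schwartz_decay:
  fixes \<phi> :: "real ^ 'd \<Rightarrow> complex"
  assumes "schwartz \<phi>"
  shows "\<exists>C\<ge>0. \<forall>t. sobw n t * norm (foldr pderiv_dir js \<phi> (emb t)) \<le> C"
proof -
  obtain C0 where C0: "\<And>x. norm x ^ 0 * norm (foldr pderiv_dir js \<phi> x) \<le> C0"
    using assms unfolding schwartz_def by blast
  obtain C1 where C1: "\<And>x. norm x ^ (2 * n) * norm (foldr pderiv_dir js \<phi> x) \<le> C1"
    using assms unfolding schwartz_def by blast
  have b: "sobw n t * norm (foldr pderiv_dir js \<phi> (emb t)) \<le> 2 ^ n * (C0 + C1)" for t
  proof -
    have "sobw n t * norm (foldr pderiv_dir js \<phi> (emb t)) \<le> 2 ^ n * (1 + t ^ (2 * n)) * norm (foldr pderiv_dir js \<phi> (emb t))"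
      by (rule mult_right_mono[OF sobw_le]) simp
    also have "\<dots> = 2 ^ n * (norm (emb t :: real ^ 'd) ^ 0 * norm (foldr pderiv_dir js \<phi> (emb t)) + norm (emb t :: real ^ 'd) ^ (2 * n) * norm (foldr pderiv_dir js \<phi> (emb t)))"
      by (simp add: norm_1 power_even_abs algebra_simps)
    also have "\<dots> \<le> 2 ^ n * (C0 + C1)" by (intro mult_left_mono add_mono C0 C1) auto
    finally show ?thesis .
  qed
  have "0 \<le> sobw n 0 * norm (foldr pderiv_dir js \<phi> (emb 0))" by (simp add: sobw_def)
  with b[of 0] have "0 \<le> 2 ^ n * (C0 + C1)" by linarith
  with b show ?thesis by blast
qed

lemma schwartz_deriv:
  fixes \<phi> :: "real ^ 'd \<Rightarrow> complex"
  assumes "schwartz \<phi>"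
  shows "((\<lambda>t. foldr pderiv_dir js \<phi> (emb t)) has_vector_derivative foldr pderiv_dir (undefined # js) \<phi> (emb t)) (at t)"
proof -
  define \<psi> where "\<psi> = foldr pderiv_dir js \<phi>"
  have "\<psi> differentiable (at x)" for x using assms unfolding schwartz_def \<psi>_def by blast
  then have "(\<psi> has_derivative frechet_derivative \<psi> (at (emb t))) (at (emb t))"
    using frechet_derivative_works by blast
  moreover have "(emb has_derivative (\<lambda>h. h *\<^sub>R (axis undefined 1 :: real ^ 'd))) (at t)"
    unfolding emb_scaleR[of _ undefined] by (auto intro!: derivative_eq_intros)
  ultimately have d: "((\<lambda>t. \<psi> (emb t)) has_derivative (\<lambda>h. frechet_derivative \<psi> (at (emb t)) (h *\<^sub>R axis undefined 1))) (at t)"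
    by (rule has_derivative_compose[rotated])
  have "linear (frechet_derivative \<psi> (at (emb t)))"
    using \<open>(\<psi> has_derivative _) _\<close> has_derivative_linear by blast
  then have "frechet_derivative \<psi> (at (emb t)) (h *\<^sub>R axis undefined 1) = h *\<^sub>R pderiv_dir undefined \<psi> (emb t)" for h
    by (simp add: pderiv_dir_def linear_scale)
  with d show ?thesis by (simp add: has_vector_derivative_def \<psi>_def)
qed

lemma schwartz_continuous:
  fixes \<phi> :: "real ^ 'd \<Rightarrow> complex"
  assumes "schwartz \<phi>" shows "continuous_on UNIV (\<lambda>t. foldr pderiv_dir js \<phi> (emb t))"
  using has_vector_derivative_continuous[OF schwartz_deriv[OF assms]]
  by (simp add: continuous_on_eq_continuous_at)

lemma schwartz_measurable:
  fixes \<phi> :: "real ^ 'd \<Rightarrow> complex"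
  assumes "schwartz \<phi>" shows "\<phi> \<in> borel_measurable borel"
  using schwartz_continuous[OF assms, of "[]"] by (intro measurable_1 borel_measurable_continuous_onI) simp

text \<open>Decay of order n + 1 is used: the additional power of 1 + t^2 pays for
  integrability.\<close>

lemma schwartz_L2b:
  fixes \<phi> :: "real ^ 'd \<Rightarrow> complex"
  assumes "schwartz \<phi>" shows "\<exists>A. L2b (sobw n) A (\<lambda>t. foldr pderiv_dir js \<phi> (emb t))"
proof -
  define g where "g t = foldr pderiv_dir js \<phi> (emb t)" for t
  have [measurable]: "g \<in> borel_measurable borel"
    using schwartz_continuous[OF assms] by (intro borel_measurable_continuous_onI) (simp add: g_def)
  obtain C where C: "0 \<le> C" "\<And>t. sobw (n + 1) t * norm (g t) \<le> C"
    using schwartz_decay[OF assms, of "n + 1" js] unfolding g_def by blast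
  have i: "integrable lborel (\<lambda>x. inverse (1 + x\<^sup>2) :: real)"
    using integrable_inverse_1_plus_square by (simp add: set_integrable_def interval_lebesgue_integral_def)
  have "integrable lborel (\<lambda>t. sobw n t * (norm (g t))\<^sup>2)"
  proof (rule Bochner_Integration.integrable_bound)
    show "integrable lborel (\<lambda>t. C\<^sup>2 * inverse (1 + t\<^sup>2))" using i by simp
    show "(\<lambda>t. sobw n t * (norm (g t))\<^sup>2) \<in> borel_measurable lborel" unfolding sobw_def by measurable
    show "AE t in lborel. norm (sobw n t * (norm (g t))\<^sup>2) \<le> norm (C\<^sup>2 * inverse (1 + t\<^sup>2))"
    proof (intro AE_I2)
      fix t
      define v where "v = sobw n t"
      have v: "1 \<le> v" by (simp add: v_def sobw_ge_1)
      have p: "0 < 1 + t\<^sup>2" by (simp add: add_pos_nonneg)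
      have "((1 + t\<^sup>2) * v * norm (g t))\<^sup>2 \<le> C\<^sup>2"
        using C(2)[of t] v p by (intro power_mono) (auto simp: v_def sobw_def mult.assoc)
      moreover have "(1 + t\<^sup>2) * (v * (norm (g t))\<^sup>2) \<le> ((1 + t\<^sup>2) * v * norm (g t))\<^sup>2"
      proof -
        have "1 * 1 \<le> (1 + t\<^sup>2) * v" using v p by (intro mult_mono) auto
        then have "1 * ((1 + t\<^sup>2) * v * (norm (g t))\<^sup>2) \<le> ((1 + t\<^sup>2) * v) * ((1 + t\<^sup>2) * v * (norm (g t))\<^sup>2)"
          using v p by (intro mult_right_mono) auto
        then show ?thesis by (simp add: power2_eq_square ac_simps)
      qed
      ultimately have "(1 + t\<^sup>2) * (v * (norm (g t))\<^sup>2) \<le> C\<^sup>2" by linarith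
      then have "v * (norm (g t))\<^sup>2 \<le> C\<^sup>2 * inverse (1 + t\<^sup>2)" using p by (simp add: field_simps)
      then show "norm (sobw n t * (norm (g t))\<^sup>2) \<le> norm (C\<^sup>2 * inverse (1 + t\<^sup>2))"
        using v p by (simp add: v_def[symmetric] abs_mult)
    qed
  qed
  moreover have "0 \<le> (LINT t|lborel. sobw n t * (norm (g t))\<^sup>2)"
    by (intro integral_nonneg_AE AE_I2 mult_nonneg_nonneg wt_nonneg[OF wt_sobw]) simp
  ultimately have "L2b (sobw n) (sqrt (LINT t|lborel. sobw n t * (norm (g t))\<^sup>2)) g"
    by (intro L2bI) auto
  then show ?thesis unfolding g_def by blast
qed

lemma schwartz_integrable:
  fixes \<phi> :: "real ^ 'd \<Rightarrow> complex"
  assumes "schwartz \<phi>" shows "integrable lborel (\<lambda>t. \<phi> (emb t))"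
  using schwartz_L2b[OF assms, of 1 "[]"] L2b_sobw_L1(1)[of 1] by auto

text \<open>One derivative in L2 already puts the transform into the space with weight 1 + \<xi>^2,
  hence into L1, and inversion applies.\<close>

lemma schwartz_ft:
  fixes \<phi> :: "real ^ 'd \<Rightarrow> complex"
  assumes "schwartz \<phi>"
  shows "integrable lborel (ft (\<lambda>t. \<phi> (emb t)))" "ift (ft (\<lambda>t. \<phi> (emb t))) t = \<phi> (emb t)"
proof -
  define g where "g t = \<phi> (emb t)" for t
  have s0: "sobw 0 = (\<lambda>_. 1)" by (auto simp: sobw_def)
  obtain A0 where A0: "L2b (sobw 0) A0 g" using schwartz_L2b[OF assms, of 0 "[]"] by (auto simp: g_def[abs_def])
  obtain A1 where A1: "L2b (sobw 0) A1 (\<lambda>t. foldr pderiv_dir [undefined] \<phi> (emb t))" using schwartz_L2b[OF assms] by blast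
  have "hb 1 (max A0 A1) g"
    unfolding One_nat_def
  proof (rule hb_SucI)
    show "L2b (\<lambda>_. 1) (max A0 A1) g" using L2b_mono_bound[OF A0, of "max A0 A1"] by (simp add: s0)
    show "(g has_vector_derivative foldr pderiv_dir [undefined] \<phi> (emb t)) (at t)" for t
      using schwartz_deriv[OF assms, of "[]" t] by (simp add: g_def[abs_def])
    show "hb 0 (max A0 A1) (\<lambda>t. foldr pderiv_dir [undefined] \<phi> (emb t))"
      using L2b_mono_bound[OF A1, of "max A0 A1"] schwartz_continuous[OF assms, of "[undefined]"] by (simp add: s0)
  qed
  then have "L2b (sobw 1) (2 ^ Suc 1 * max A0 A1) (ft g)"
    using schwartz_integrable[OF assms] by (intro hb_ft_sobw) (auto simp: g_def[abs_def])
  from L2b_sobw_L1(1)[OF _ this] have i: "integrable lborel (ft g)" by simp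
  obtain C where C: "\<And>t. sobw 0 t * norm (g t) \<le> C" using schwartz_decay[OF assms, of 0 "[]"] by (auto simp: g_def)
  have "ift (ft g) t = g t"
  proof (rule ft_inversion)
    show "integrable lborel g" using schwartz_integrable[OF assms] by (simp add: g_def[abs_def])
    show "continuous_on UNIV g" using schwartz_continuous[OF assms, of "[]"] by (simp add: g_def[abs_def])
    show "norm (g x) \<le> C" for x using C[of x] by (simp add: sobw_def)
  qed (rule i)
  with i show "integrable lborel (ft (\<lambda>t. \<phi> (emb t)))" "ift (ft (\<lambda>t. \<phi> (emb t))) t = \<phi> (emb t)"
    by (simp_all add: g_def[abs_def])
qed

lemma TF_schwartz_integrable:
  fixes \<phi> :: "real ^ 'd \<Rightarrow> complex"
  assumes "TF F" "schwartz \<phi>"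
  shows "integrable lborel (\<lambda>t. F t * \<phi> (emb t))"
proof -
  obtain n B where F: "L2b (\<lambda>\<xi>. inverse (sobw n \<xi>)) B F" using assms by (auto simp: TF_def)
  have [measurable]: "F \<in> borel_measurable borel" "\<phi> \<in> borel_measurable borel"
    using TF_measurable[OF assms(1)] schwartz_measurable[OF assms(2)] by auto
  obtain A where A: "L2b (sobw n) A (\<lambda>t. \<phi> (emb t))" using schwartz_L2b[OF assms(2), of n "[]"] by auto
  have sq: "0 \<le> sobw n t" for t using sobw_ge_1[of n t] by simp
  define a where "a t = complex_of_real (1 / sqrt (sobw n t)) * F t" for t
  define b where "b t = complex_of_real (sqrt (sobw n t)) * \<phi> (emb t)" for t
  have [measurable]: "sobw n \<in> borel_measurable borel" using wt_sobw by (simp add: wt_def)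
  have 1: "L2b (\<lambda>_. 1) B a"
  proof (rule L2b_mono[OF wt_inverse_sobw F])
    show "a \<in> borel_measurable borel" unfolding a_def by measurable
    show "1 * (norm (a t))\<^sup>2 \<le> inverse (sobw n t) * (norm (F t))\<^sup>2" for t
      using sq[of t] by (simp add: a_def norm_mult norm_divide power_mult_distrib power_divide inverse_eq_divide)
  qed
  have 2: "L2b (\<lambda>_. 1) A b"
  proof (rule L2b_mono[OF wt_sobw A])
    show "b \<in> borel_measurable borel" unfolding b_def by measurable
    show "1 * (norm (b t))\<^sup>2 \<le> sobw n t * (norm (\<phi> (emb t)))\<^sup>2" for t
      using sq[of t] by (simp add: b_def norm_mult power_mult_distrib)
  qed
  have "a t * b t = F t * \<phi> (emb t)" for t
  proof -
    have "sqrt (sobw n t) \<noteq> 0" using sobw_ge_1[of n t] by simp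
    then show ?thesis by (simp add: a_def b_def field_simps)
  qed
  with L2b_prod_integrable(1)[OF 1 2] show ?thesis by simp
qed

lemma TF_tempered:
  assumes "TF F" shows "tempered_fun (\<lambda>x :: real ^ 'd. F (prj x))"
  unfolding tempered_fun_def
proof (intro conjI allI impI)
  have [measurable]: "F \<in> borel_measurable borel" using TF_measurable[OF assms] .
  show "(\<lambda>x :: real ^ 'd. F (prj x)) \<in> borel_measurable borel" by measurable
  fix \<phi> :: "real ^ 'd \<Rightarrow> complex" assume s: "schwartz \<phi>"
  have [measurable]: "\<phi> \<in> borel_measurable borel" using schwartz_measurable[OF s] .
  show "integrable lborel (\<lambda>x. F (prj x) * \<phi> x)"
    by (subst integrable_1) (use TF_schwartz_integrable[OF assms s] in auto)
qed

lemma repr_is_fourier: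
  fixes T :: "'d distr"
  assumes "repr T F" shows "is_fourier_of_distr T (\<lambda>x. F (prj x))"
  unfolding is_fourier_of_distr_def
proof (intro conjI allI impI)
  have TF: "TF F" using assms by (simp add: repr_def)
  have [measurable]: "F \<in> borel_measurable borel" using TF_measurable[OF TF] .
  show "tempered_fun (\<lambda>x :: real ^ 'd. F (prj x))" by (rule TF_tempered[OF TF])
  fix \<phi> :: "real ^ 'd \<Rightarrow> complex" assume s: "schwartz \<phi>"
  have [measurable]: "\<phi> \<in> borel_measurable borel" using schwartz_measurable[OF s] .
  have "distr_of (\<lambda>x. F (prj x)) \<phi> = (LINT t|lborel. F t * \<phi> (emb t))"
    unfolding distr_of_def by (subst LINT_1) auto
  then show "T (fourier \<phi>) = distr_of (\<lambda>x. F (prj x)) \<phi>" using assms s by (simp add: repr_def)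
qed

text \<open>Polynomial times plane wave times Gaussian: closed under differentiation, hence
  Schwartz. It serves as the initial data of frequency N and as test functions separating tempered
  functions.\<close>

definition gp :: "real \<Rightarrow> real \<Rightarrow> complex poly \<Rightarrow> real ^ 'd \<Rightarrow> complex" where
  "gp b c P x = poly P (of_real (prj x)) * cis (prj x * b) * of_real (exp (- (c * (prj x)\<^sup>2)))"

lemma gp_deriv:
  "(gp b c P has_derivative (\<lambda>h. prj h *\<^sub>R gp b c (pderiv P + [:\<i> * of_real b:] * P - [:0, 2 * of_real c:] * P) x)) (at x)"
proof -
  define Q where "Q = pderiv P + [:\<i> * of_real b:] * P - [:0, 2 * of_real c:] * P"
  define t where "t = prj x"
  have p: "((\<lambda>t. poly P (complex_of_real t)) has_vector_derivative poly (pderiv P) (of_real t)) (at t)"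
    by (rule has_vector_derivative_real_field) (rule poly_DERIV)
  have "((\<lambda>t. exp (- (c * t\<^sup>2))) has_real_derivative - (2 * c * t) * exp (- (c * t\<^sup>2))) (at t)"
    by (auto intro!: derivative_eq_intros)
  then have e: "((\<lambda>t. complex_of_real (exp (- (c * t\<^sup>2)))) has_vector_derivative of_real (- (2 * c * t) * exp (- (c * t\<^sup>2)))) (at t)"
    by (intro has_vector_derivative_of_real) (simp add: has_real_derivative_iff_has_vector_derivative)
  have "((\<lambda>t. poly P (of_real t) * cis (t * b) * of_real (exp (- (c * t\<^sup>2)))) has_vector_derivative
      poly Q (of_real t) * cis (t * b) * of_real (exp (- (c * t\<^sup>2)))) (at t)"
    using has_vector_derivative_mult[OF has_vector_derivative_mult[OF p has_vector_derivative_cis_mult[of b t]] e]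
    by (simp add: Q_def algebra_simps)
  then have "((\<lambda>t. poly P (of_real t) * cis (t * b) * of_real (exp (- (c * t\<^sup>2)))) has_derivative
      (\<lambda>h. h *\<^sub>R (poly Q (of_real t) * cis (t * b) * of_real (exp (- (c * t\<^sup>2)))))) (at (prj x))"
    by (simp add: has_vector_derivative_def t_def)
  from has_derivative_compose[OF bounded_linear_imp_has_derivative[OF bounded_linear_prj] this]
  show ?thesis unfolding gp_def[abs_def] Q_def[symmetric] t_def .
qed

lemma gp_foldr: "\<exists>Q. foldr pderiv_dir js (gp b c P) = gp b c Q"
proof (induction js)
  case (Cons j js)
  then obtain Q where Q: "foldr pderiv_dir js (gp b c P) = gp b c Q" by blast
  define Q' where "Q' = pderiv Q + [:\<i> * of_real b:] * Q - [:0, 2 * of_real c:] * Q"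
  have "pderiv_dir j (gp b c Q) = gp b c Q'"
    unfolding pderiv_dir_def frechet_derivative_at[OF gp_deriv, symmetric] Q'_def by (simp add: prj_axis)
  then show ?case using Q by (intro exI[of _ Q']) simp
qed auto

lemma gp_schwartz:
  assumes c: "0 < c" shows "schwartz (gp b c P)"
  unfolding schwartz_def
proof (intro allI conjI)
  fix js :: "'d list"
  obtain Q where Q: "foldr pderiv_dir js (gp b c P) = gp b c Q" using gp_foldr by blast
  show "foldr pderiv_dir js (gp b c P) differentiable (at x)" for x
    unfolding Q using gp_deriv differentiable_def by blast
  fix m :: nat
  obtain C where C: "0 \<le> C" "\<And>t. norm (poly (monom 1 m * Q) (complex_of_real t)) \<le> C * exp (c * t\<^sup>2)"
    using poly_le_exp[OF c, of "monom 1 m * Q"] by blast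
  show "\<exists>C. \<forall>x. norm x ^ m * norm (foldr pderiv_dir js (gp b c P) x) \<le> C"
  proof (intro exI[of _ C] allI)
    fix x :: "real ^ 'd"
    have "norm x ^ m * norm (foldr pderiv_dir js (gp b c P) x) = norm (poly (monom 1 m * Q) (complex_of_real (prj x))) * exp (- (c * (prj x)\<^sup>2))"
      unfolding Q gp_def by (simp add: norm_1 norm_mult poly_monom norm_power)
    also have "\<dots> \<le> C * exp (c * (prj x)\<^sup>2) * exp (- (c * (prj x)\<^sup>2))"
      by (intro mult_right_mono C) simp
    also have "\<dots> = C" by (simp add: mult.assoc flip: exp_add)
    finally show "norm x ^ m * norm (foldr pderiv_dir js (gp b c P) x) \<le> C" .
  qed
qed

text \<open>Testing with a plane wave times exp(-t^2) shows that (g - g') exp(-t^2) has vanishing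
  transform. It is integrable, so it is null, and the Gaussian has no zeros.\<close>

lemma is_fourier_unique:
  fixes T :: "'d distr"
  assumes "is_fourier_of_distr T g" "is_fourier_of_distr T g'"
  shows "AE t in lborel. g (emb t) = g' (emb t)"
proof -
  have gt: "tempered_fun g" "tempered_fun g'" using assms by (auto simp: is_fourier_of_distr_def)
  have [measurable]: "g \<in> borel_measurable borel" "g' \<in> borel_measurable borel" using gt by (auto simp: tempered_fun_def)
  have [measurable]: "gp b 1 1 \<in> borel_measurable borel" for b by (rule schwartz_measurable[OF gp_schwartz]) simp
  have gpe: "gp b 1 1 (emb t :: real ^ 'd) = cis (t * b) * of_real (exp (- t\<^sup>2))" for b t by (simp add: gp_def)
  have int: "integrable lborel (\<lambda>t. f (emb t) * (cis (t * b) * of_real (exp (- t\<^sup>2))))"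
    if "tempered_fun f" for f :: "real ^ 'd \<Rightarrow> complex" and b
  proof -
    have fm: "f \<in> borel_measurable borel" using that by (simp add: tempered_fun_def)
    have "integrable lborel (\<lambda>x. f x * gp b 1 1 x)" using that gp_schwartz[of 1 b 1] by (simp add: tempered_fun_def)
    then show ?thesis by (subst (asm) integrable_1) (use fm in \<open>auto simp: gpe\<close>)
  qed
  define h where "h t = (g (emb t) - g' (emb t)) * of_real (exp (- t\<^sup>2))" for t
  have "AE t in lborel. h t = 0"
  proof (rule L1_uniqueness)
    show "integrable lborel h"
      using Bochner_Integration.integrable_diff[OF int[OF gt(1), of 0] int[OF gt(2), of 0]]
      by (simp add: h_def[abs_def] algebra_simps)
    fix \<xi>
    have D: "T (fourier (gp (- \<xi>) 1 1)) = (LINT t|lborel. f (emb t) * (cis (t * (- \<xi>)) * of_real (exp (- t\<^sup>2))))"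
      if "is_fourier_of_distr T f" for f
    proof -
      have fm [measurable]: "f \<in> borel_measurable borel" using that by (simp add: is_fourier_of_distr_def tempered_fun_def)
      have "T (fourier (gp (- \<xi>) 1 1)) = (LINT x|lborel. f x * gp (- \<xi>) 1 1 x)"
        using that gp_schwartz[of 1 "- \<xi>" 1] by (simp add: is_fourier_of_distr_def distr_of_def)
      also have "\<dots> = (LINT t|lborel. f (emb t) * gp (- \<xi>) 1 1 (emb t))" by (rule LINT_1) measurable
      finally show ?thesis by (simp only: gpe)
    qed
    have "(LINT t|lborel. cis (- (t * \<xi>)) * h t) =
       (LINT t|lborel. g (emb t) * (cis (t * (- \<xi>)) * of_real (exp (- t\<^sup>2))) - g' (emb t) * (cis (t * (- \<xi>)) * of_real (exp (- t\<^sup>2))))"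
      by (intro Bochner_Integration.integral_cong refl) (simp add: h_def algebra_simps)
    also have "\<dots> = 0"
      unfolding Bochner_Integration.integral_diff[OF int[OF gt(1)] int[OF gt(2)]] D[OF assms(1), symmetric] D[OF assms(2), symmetric] by simp
    finally show "ft h \<xi> = 0" by (simp add: ft_def)
  qed
  then show ?thesis by eventually_elim (simp add: h_def)
qed

lemma fourier_distr_repr:
  fixes T :: "'d distr"
  assumes "repr T F" shows "AE t in lborel. fourier_distr T (emb t) = F t" "fourier_distr T \<in> borel_measurable borel"
proof -
  have 1: "is_fourier_of_distr T (fourier_distr T)"
    unfolding fourier_distr_def by (rule someI[of "is_fourier_of_distr T", OF repr_is_fourier[OF assms]])
  from is_fourier_unique[OF 1 repr_is_fourier[OF assms]] show "AE t in lborel. fourier_distr T (emb t) = F t" by simp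
  show "fourier_distr T \<in> borel_measurable borel" using 1 by (simp add: is_fourier_of_distr_def tempered_fun_def)
qed

lemma sobolev_weight_repr:
  fixes T :: "'d distr"
  assumes "repr T F"
  shows "integrable lborel (sobolev_weight s T) \<longleftrightarrow> integrable lborel (\<lambda>t. wps s t * (norm (F t))\<^sup>2)"
    and "(LINT \<xi>|lborel. sobolev_weight s T \<xi>) = (LINT t|lborel. wps s t * (norm (F t))\<^sup>2)"
proof -
  note r = fourier_distr_repr[OF assms]
  have [measurable]: "fourier_distr T \<in> borel_measurable borel" by (rule r(2))
  have [measurable]: "F \<in> borel_measurable borel" using assms by (simp add: repr_def TF_measurable)
  have wm: "sobolev_weight s T \<in> borel_measurable borel" unfolding sobolev_weight_def[abs_def] by measurable
  have ae: "AE t in lborel. sobolev_weight s T (emb t) = wps s t * (norm (F t))\<^sup>2"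
    using r(1) by eventually_elim (simp add: sobolev_weight_def wps_def norm_1)
  have m: "(\<lambda>t. sobolev_weight s T (emb t)) \<in> borel_measurable lborel" "(\<lambda>t. wps s t * (norm (F t))\<^sup>2) \<in> borel_measurable lborel"
    using wm by (auto simp: wps_def)
  show "integrable lborel (sobolev_weight s T) \<longleftrightarrow> integrable lborel (\<lambda>t. wps s t * (norm (F t))\<^sup>2)"
    unfolding integrable_1[OF wm] by (rule integrable_cong_AE[OF m ae])
  show "(LINT \<xi>|lborel. sobolev_weight s T \<xi>) = (LINT t|lborel. wps s t * (norm (F t))\<^sup>2)"
    unfolding LINT_1[OF wm] by (rule integral_cong_AE[OF m ae])
qed

lemma sobolev_norm_leI:
  fixes T :: "'d distr"
  assumes "repr T F" "L2b (wps s) B F"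
  shows "T \<in> sobolev_space s" "sobolev_norm s T \<le> ennreal B"
proof -
  note i = L2b_integrable[OF wt_wps assms(2)] and w = sobolev_weight_repr[OF assms(1), of s]
  show T: "T \<in> sobolev_space s" using i w repr_is_fourier[OF assms(1)] by (auto simp: sobolev_space_def)
  have "sqrt (LINT \<xi>|lborel. sobolev_weight s T \<xi>) \<le> B"
    using i(2) L2b_nonneg[OF assms(2)] by (simp add: w real_le_lsqrt)
  with T show "sobolev_norm s T \<le> ennreal B" by (simp add: sobolev_norm_def ennreal_leI)
qed

lemma sobolev_norm_leD:
  fixes T :: "'d distr"
  assumes "repr T F" "sobolev_norm s T \<le> ennreal B" "0 \<le> B"
  shows "L2b (wps s) B F"
proof (rule L2bI)
  note w = sobolev_weight_repr[OF assms(1), of s]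
  have T: "T \<in> sobolev_space s" using assms(2) by (auto simp: sobolev_norm_def top_unique split: if_splits)
  then show "integrable lborel (\<lambda>x. wps s x * (norm (F x))\<^sup>2)" by (simp add: sobolev_space_def w)
  have "sqrt (LINT t|lborel. wps s t * (norm (F t))\<^sup>2) \<le> B"
    using assms(2,3) T by (simp add: sobolev_norm_def w)
  then show "(LINT t|lborel. wps s t * (norm (F t))\<^sup>2) \<le> B\<^sup>2" by (simp add: sqrt_le_D)
  show "F \<in> borel_measurable borel" using assms(1) by (simp add: repr_def TF_measurable)
qed (use assms in auto)

lemma repr_lincomb:
  fixes T T' :: "'d distr"
  assumes "repr T F" "repr T' F'"
  shows "repr (\<lambda>\<phi>. a * T \<phi> + b * T' \<phi>) (\<lambda>\<xi>. a * F \<xi> + b * F' \<xi>)"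
  unfolding repr_def
proof (intro conjI allI impI)
  have TF: "TF F" "TF F'" using assms by (auto simp: repr_def)
  show "TF (\<lambda>\<xi>. a * F \<xi> + b * F' \<xi>)" by (rule TF_lincomb[OF TF])
  fix \<phi> :: "real ^ 'd \<Rightarrow> complex" assume s: "schwartz \<phi>"
  have "(LINT \<xi>|lborel. (a * F \<xi> + b * F' \<xi>) * \<phi> (emb \<xi>)) = (LINT \<xi>|lborel. a * (F \<xi> * \<phi> (emb \<xi>)) + b * (F' \<xi> * \<phi> (emb \<xi>)))"
    by (intro Bochner_Integration.integral_cong refl) (simp add: algebra_simps)
  also have "\<dots> = a * T (fourier \<phi>) + b * T' (fourier \<phi>)"
    using TF_schwartz_integrable[OF TF(1) s] TF_schwartz_integrable[OF TF(2) s] assms s by (simp add: repr_def)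
  finally show "a * T (fourier \<phi>) + b * T' (fourier \<phi>) = (LINT \<xi>|lborel. (a * F \<xi> + b * F' \<xi>) * \<phi> (emb \<xi>))" by simp
qed

lemma distr_of_fourier:
  fixes \<phi> :: "real ^ 'd \<Rightarrow> complex"
  assumes [measurable]: "f \<in> borel_measurable borel" and s: "schwartz \<phi>"
  shows "distr_of (\<lambda>x. f (prj x)) (fourier \<phi>) = (LINT t|lborel. f t * ft (\<lambda>t. \<phi> (emb t)) t)"
proof -
  have [measurable]: "\<phi> \<in> borel_measurable borel" using schwartz_measurable[OF s] .
  have [measurable]: "ft (\<lambda>t. \<phi> (emb t)) \<in> borel_measurable borel" by (rule ft_measurable[OF schwartz_integrable[OF s]])
  have "fourier \<phi> = (\<lambda>x. ft (\<lambda>t. \<phi> (emb t)) (prj x))" by (intro ext fourier_1) measurable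
  then show ?thesis unfolding distr_of_def by (subst LINT_1) auto
qed

lemma repr_ft:
  assumes "integrable lborel h"
  shows "repr (distr_of (\<lambda>x :: real ^ 'd. h (prj x))) (ft h)"
  unfolding repr_def
proof (intro conjI allI impI)
  show "TF (ft h)" by (rule TF_bounded[OF ft_measurable[OF assms] norm_ft_le])
  fix \<phi> :: "real ^ 'd \<Rightarrow> complex" assume s: "schwartz \<phi>"
  have "h \<in> borel_measurable borel" using assms by auto
  then show "distr_of (\<lambda>x. h (prj x)) (fourier \<phi>) = (LINT \<xi>|lborel. ft h \<xi> * \<phi> (emb \<xi>))"
    by (simp add: distr_of_fourier[OF _ s] ft_multiplication[OF assms schwartz_integrable[OF s]])
qed

lemma ift_multiplication:
  assumes F: "integrable lborel F" and G: "integrable lborel G"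
  shows "(LINT x|lborel. ift F x * G x) = (LINT x|lborel. F x * ift G x)"
proof -
  have r: "(LINT x|lborel. H x) = (LINT x|lborel. H (- x))" for H :: "real \<Rightarrow> complex"
    using lborel_integral_real_affine[of "-1" H 0] by simp
  have G': "integrable lborel (\<lambda>x. G (- x))" using lborel_integrable_real_affine[OF G, of "-1" 0] by simp
  have "(LINT x|lborel. ift F x * G x) = (LINT x|lborel. ft F x * G (- x))"
    by (subst r) (simp add: ift_def)
  also have "\<dots> = (LINT x|lborel. F x * ft (\<lambda>x. G (- x)) x)" by (rule ft_multiplication[OF F G'])
  also have "ft (\<lambda>x. G (- x)) = ift G"
  proof
    fix \<xi>
    have "(LINT x|lborel. cis (- (x * \<xi>)) * G (- x)) = (LINT x|lborel. cis (x * \<xi>) * G x)"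
      by (subst r) simp
    then show "ft (\<lambda>x. G (- x)) \<xi> = ift G \<xi>" by (simp add: ft_def ift_def)
  qed
  finally show ?thesis .
qed

lemma repr_ift:
  assumes k: "1 \<le> k" and F: "L2b (sobw k) B F"
  shows "repr (distr_of (\<lambda>x :: real ^ 'd. ift F (prj x))) F"
  unfolding repr_def
proof (intro conjI allI impI)
  show "TF F" by (rule TF_sobw[OF F])
  note i = L2b_sobw_L1(1)[OF k F]
  fix \<phi> :: "real ^ 'd \<Rightarrow> complex" assume s: "schwartz \<phi>"
  show "distr_of (\<lambda>x. ift F (prj x)) (fourier \<phi>) = (LINT \<xi>|lborel. F \<xi> * \<phi> (emb \<xi>))"
    by (simp add: distr_of_fourier[OF ift_measurable[OF i] s] ift_multiplication[OF i schwartz_ft(1)[OF s]] schwartz_ft(2)[OF s])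
qed

text \<open>The definition of the multiplier already evaluates \<open>fourier_distr\<close>, which
  agrees with \<open>F\<close> almost everywhere by uniqueness; testing on
  \<open>fourier \<phi>\<close> then leaves the inverse transform of a transform.\<close>

lemma repr_frac_laplacian:
  fixes T :: "'d distr"
  assumes T: "repr T F" and F: "L2b (sobw k) B F" and \<sigma>: "0 < \<sigma>" "\<sigma> < 1"
  shows "repr (frac_laplacian \<sigma> T) (\<lambda>\<xi>. of_real (\<bar>\<xi>\<bar> powr (2 * \<sigma>)) * F \<xi>)"
  unfolding repr_def
proof (intro conjI allI impI)
  have [measurable]: "F \<in> borel_measurable borel" using F by (simp add: L2b_def)
  have m2: "(\<bar>\<xi>\<bar> powr (2 * \<sigma>))\<^sup>2 \<le> sobw 2 \<xi>" for \<xi>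
  proof -
    have "\<bar>\<xi>\<bar> powr (2 * \<sigma>) = (\<xi>\<^sup>2) powr \<sigma>"
    proof (cases "\<xi> = 0")
      case False
      then have "\<xi>\<^sup>2 = \<bar>\<xi>\<bar> powr 2" by (simp add: powr_numeral)
      then show ?thesis by (simp only: powr_powr)
    qed simp
    also have "\<dots> \<le> (1 + \<xi>\<^sup>2) powr \<sigma>" using \<sigma> by (intro powr_mono2) auto
    also have "\<dots> \<le> (1 + \<xi>\<^sup>2) powr 1" using \<sigma> by (intro powr_mono) auto
    finally have "\<bar>\<xi>\<bar> powr (2 * \<sigma>) \<le> 1 + \<xi>\<^sup>2" by simp
    then show ?thesis unfolding sobw_def by (intro power_mono) auto
  qed
  have "L2b (\<lambda>\<xi>. inverse (sobw 2 \<xi>)) B (\<lambda>\<xi>. of_real (\<bar>\<xi>\<bar> powr (2 * \<sigma>)) * F \<xi>)"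
  proof (rule L2b_mono[OF wt_one L2b_sobw_L2[OF F]])
    fix \<xi>
    have "inverse (sobw 2 \<xi>) * (\<bar>\<xi>\<bar> powr (2 * \<sigma>))\<^sup>2 \<le> 1"
      using m2[of \<xi>] sobw_ge_1[of 2 \<xi>] by (simp add: field_simps)
    then have "inverse (sobw 2 \<xi>) * (\<bar>\<xi>\<bar> powr (2 * \<sigma>))\<^sup>2 * (norm (F \<xi>))\<^sup>2 \<le> 1 * (norm (F \<xi>))\<^sup>2"
      by (rule mult_right_mono) simp
    then show "inverse (sobw 2 \<xi>) * (norm (of_real (\<bar>\<xi>\<bar> powr (2 * \<sigma>)) * F \<xi>))\<^sup>2 \<le> 1 * (norm (F \<xi>))\<^sup>2"
      by (simp add: norm_mult power_mult_distrib mult.assoc)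
  qed measurable
  then show "TF (\<lambda>\<xi>. of_real (\<bar>\<xi>\<bar> powr (2 * \<sigma>)) * F \<xi>)" unfolding TF_def by blast
  fix \<phi> :: "real ^ 'd \<Rightarrow> complex" assume s: "schwartz \<phi>"
  note fr = fourier_distr_repr[OF T]
  have [measurable]: "fourier_distr T \<in> borel_measurable borel" by (rule fr(2))
  have [measurable]: "\<phi> \<in> borel_measurable borel" using schwartz_measurable[OF s] .
  define g where "g = (\<lambda>t. \<phi> (emb t))"
  have [measurable]: "ft g \<in> borel_measurable borel" unfolding g_def by (rule ft_measurable[OF schwartz_integrable[OF s]])
  have f1: "fourier \<phi> = (\<lambda>x. ft g (prj x))" unfolding g_def by (intro ext fourier_1) measurable
  have f2m: "fourier \<phi> \<in> borel_measurable borel" unfolding f1 by measurable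
  \<comment> \<open>The reflected argument in \<open>fourier_multiplier\<close> turns the second
    transform into the inverse one.\<close>
  have f2: "fourier (fourier \<phi>) (- x) = \<phi> x" for x
  proof -
    have "fourier (fourier \<phi>) (- x) = ft (ft g) (prj (- x))" by (subst fourier_1[OF f2m]) (simp add: f1)
    also have "\<dots> = ift (ft g) (prj x)" by (simp add: ift_def prj_def)
    also have "\<dots> = \<phi> x" unfolding g_def by (simp add: schwartz_ft(2)[OF s])
    finally show ?thesis .
  qed
  have "frac_laplacian \<sigma> T (fourier \<phi>) = (LINT \<xi>|lborel. complex_of_real (norm \<xi> powr (2 * \<sigma>)) * fourier_distr T \<xi> * \<phi> \<xi>)"
    by (simp add: frac_laplacian_def fourier_multiplier_def f2)
  also have "\<dots> = (LINT t|lborel. complex_of_real (norm (emb t :: real ^ 'd) powr (2 * \<sigma>)) * fourier_distr T (emb t) * \<phi> (emb t))"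
    by (rule LINT_1) measurable
  also have "\<dots> = (LINT t|lborel. of_real (\<bar>t\<bar> powr (2 * \<sigma>)) * F t * \<phi> (emb t))"
  proof (rule integral_cong_AE)
    show "AE t in lborel. complex_of_real (norm (emb t :: real ^ 'd) powr (2 * \<sigma>)) * fourier_distr T (emb t) * \<phi> (emb t) = of_real (\<bar>t\<bar> powr (2 * \<sigma>)) * F t * \<phi> (emb t)"
      using fr(1) by eventually_elim (simp add: norm_1)
  qed measurable
  finally show "frac_laplacian \<sigma> T (fourier \<phi>) = (LINT t|lborel. of_real (\<bar>t\<bar> powr (2 * \<sigma>)) * F t * \<phi> (emb t))" .
qed

end

section \<open>From mild solutions to solutions of the Cauchy problem\<close>

text \<open>Dominated convergence in the \<delta> form that L2 bounds require. The majorant is asked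
  for only away from \<open>t\<close>, because difference quotients degenerate there.\<close>

lemma dct_small:
  fixes H :: "real \<Rightarrow> real \<Rightarrow> complex"
  assumes w: "wt w" and Hm: "\<And>r. r \<in> S \<Longrightarrow> H r \<in> borel_measurable borel"
    and b: "\<And>r \<xi>. r \<in> S \<Longrightarrow> r \<noteq> t \<Longrightarrow> w \<xi> * (norm (H r \<xi>))\<^sup>2 \<le> h \<xi>" and h: "integrable lborel h"
    and lim: "\<And>\<xi>. ((\<lambda>r. H r \<xi>) \<longlongrightarrow> 0) (at t within S)" and \<epsilon>: "0 < \<epsilon>"
  shows "\<exists>\<delta>>0. \<forall>r\<in>S. r \<noteq> t \<longrightarrow> \<bar>r - t\<bar> < \<delta> \<longrightarrow> L2b w \<epsilon> (H r)"
proof -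
  have [measurable]: "w \<in> borel_measurable borel" using w by (simp add: wt_def)
  define J where "J r = (LINT \<xi>|lborel. w \<xi> * (norm (H r \<xi>))\<^sup>2)" for r
  have "(J \<longlongrightarrow> 0) (at t within S)"
    unfolding tendsto_at_iff_sequentially comp_def
  proof (intro allI impI)
    fix X assume X: "\<forall>i. X i \<in> S - {t}" "X \<longlonglongrightarrow> t"
    have [measurable]: "H (X i) \<in> borel_measurable borel" for i using X by (intro Hm) auto
    have "(\<lambda>i. J (X i)) \<longlonglongrightarrow> (LINT \<xi>|(lborel :: real measure). (0 :: real))"
      unfolding J_def
    proof (rule integral_dominated_convergence[OF _ _ h])
      show "AE \<xi> in lborel. (\<lambda>i. w \<xi> * (norm (H (X i) \<xi>))\<^sup>2) \<longlonglongrightarrow> 0"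
      proof (intro AE_I2)
        fix \<xi>
        have "(\<lambda>i. H (X i) \<xi>) \<longlonglongrightarrow> 0"
          using lim[of \<xi>] X unfolding tendsto_at_iff_sequentially comp_def by blast
        then have "(\<lambda>i. w \<xi> * (norm (H (X i) \<xi>))\<^sup>2) \<longlonglongrightarrow> w \<xi> * (norm (0::complex))\<^sup>2"
          by (intro tendsto_intros)
        then show "(\<lambda>i. w \<xi> * (norm (H (X i) \<xi>))\<^sup>2) \<longlonglongrightarrow> 0" by simp
      qed
      show "AE \<xi> in lborel. norm (w \<xi> * (norm (H (X i) \<xi>))\<^sup>2) \<le> h \<xi>" for i
        using b[of "X i"] X wt_nonneg[OF w] by (auto simp: abs_mult)
    qed auto
    then show "(\<lambda>i. J (X i)) \<longlonglongrightarrow> 0" by simp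
  qed
  then have "eventually (\<lambda>r. dist (J r) 0 < \<epsilon>\<^sup>2) (at t within S)" using \<epsilon> by (intro tendstoD) auto
  then obtain \<delta> where \<delta>: "\<delta> > 0" "\<And>r. r \<in> S \<Longrightarrow> r \<noteq> t \<Longrightarrow> dist r t < \<delta> \<Longrightarrow> dist (J r) 0 < \<epsilon>\<^sup>2"
    unfolding eventually_at by blast
  show ?thesis
  proof (intro exI[of _ \<delta>] conjI ballI impI \<delta>(1))
    fix r assume r: "r \<in> S" "r \<noteq> t" "\<bar>r - t\<bar> < \<delta>"
    have [measurable]: "H r \<in> borel_measurable borel" using r by (intro Hm)
    show "L2b w \<epsilon> (H r)"
    proof (rule L2bI[OF _ w])
      show "integrable lborel (\<lambda>x. w x * (norm (H r x))\<^sup>2)"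
        by (rule Bochner_Integration.integrable_bound[OF h])
           (use b[OF r(1,2)] wt_nonneg[OF w] in \<open>auto simp: abs_mult intro: order_trans[OF _ abs_ge_self]\<close>)
      show "(LINT x|lborel. w x * (norm (H r x))\<^sup>2) \<le> \<epsilon>\<^sup>2"
        using \<delta>(2)[OF r(1,2)] r(3) by (simp add: J_def dist_real_def)
    qed (use \<epsilon> in auto)
  qed
qed

lemma norm_cis_diff_le: "norm (cis a - cis b) \<le> \<bar>a - b\<bar>"
proof -
  have "cis a - cis b = cis b * (cis (a - b) - 1)" by (simp add: cis_mult algebra_simps)
  then have "norm (cis a - cis b) = norm (cis (a - b) - 1)" by (simp add: norm_mult)
  also have "\<dots> \<le> \<bar>a - b\<bar>" using iexp_approx1[of "a - b" 0] by (simp add: cis_conv_exp)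
  finally show ?thesis .
qed

lemma cis_diffquot_tendsto:
  "((\<lambda>r. (cis (r * m) - cis (t * m)) / of_real (r - t)) \<longlongrightarrow> \<i> * of_real m * cis (t * m)) (at t within S)"
proof -
  have "((\<lambda>z. exp (\<i> * of_real m * z)) has_field_derivative (\<i> * of_real m * exp (\<i> * of_real m * of_real t))) (at (of_real t))"
    by (auto intro!: derivative_eq_intros)
  then have "((\<lambda>h. (exp (\<i> * of_real m * (of_real t + h)) - exp (\<i> * of_real m * of_real t)) / h) \<longlongrightarrow> \<i> * of_real m * exp (\<i> * of_real m * of_real t)) (at 0)"
    unfolding DERIV_def .
  moreover have "filterlim (\<lambda>r. complex_of_real (r - t)) (at 0) (at t within S)"
  proof -
    have "((\<lambda>r. complex_of_real (r - t)) \<longlongrightarrow> of_real (t - t)) (at t within S)" by (intro tendsto_intros)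
    then show ?thesis unfolding filterlim_at by (auto simp: eventually_at_filter)
  qed
  ultimately have "((\<lambda>r. (exp (\<i> * of_real m * (of_real t + complex_of_real (r - t))) - exp (\<i> * of_real m * of_real t)) / complex_of_real (r - t)) \<longlongrightarrow> \<i> * of_real m * exp (\<i> * of_real m * of_real t)) (at t within S)"
    by (rule filterlim_compose)
  then show ?thesis by (simp add: cis_conv_exp ac_simps)
qed

lemma ennreal_tendsto_0I:
  fixes f :: "'a \<Rightarrow> ennreal"
  assumes "\<And>\<epsilon>::real. 0 < \<epsilon> \<Longrightarrow> eventually (\<lambda>x. f x \<le> ennreal \<epsilon>) F"
  shows "(f \<longlongrightarrow> 0) F"
proof (rule order_tendstoI)
  fix a :: ennreal assume "0 < a"
  then obtain b where b: "0 < b" "b < a" using dense by blast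
  then obtain \<epsilon> where e: "b = ennreal \<epsilon>" "0 \<le> \<epsilon>" by (cases b) auto
  then have "0 < \<epsilon>" using b by simp
  from assms[OF this] show "eventually (\<lambda>x. f x < a) F"
    by eventually_elim (use b e in auto)
qed auto

context semilinear
begin

text \<open>Two sources of change: the phase acting on the fixed \<open>F t\<close>, treated by
  dominated convergence because the symbol is unbounded, and the increment of \<open>F\<close>,
  which is Lipschitz in time and passes through the unimodular phase.\<close>

lemma tw_mild_continuous:
  assumes F: "mild T f0 F" and t: "t \<in> {0..T}" and \<epsilon>: "0 < \<epsilon>"
  shows "\<exists>\<delta>>0. \<forall>r\<in>{0..T}. \<bar>r - t\<bar> < \<delta> \<longrightarrow> L2b (sobw k) \<epsilon> (\<lambda>\<xi>. tw r (F r) \<xi> - tw t (F t) \<xi>)"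
proof -
  obtain B where b: "\<And>t. t \<in> {0..T} \<Longrightarrow> L2b (sobw k) B (F t)" using F unfolding mild_def by blast
  have [measurable]: "F t \<in> borel_measurable borel" using b[OF t] by (simp add: L2b_def)
  obtain C where C: "0 \<le> C" "\<And>s t. s \<in> {0..T} \<Longrightarrow> t \<in> {0..T} \<Longrightarrow> L2b (sobw k) (C * \<bar>t - s\<bar>) (\<lambda>\<xi>. F t \<xi> - F s \<xi>)"
    using mild_Lipschitz[OF F] by blast
  define H where "H r \<xi> = (cis (r * m \<xi>) - cis (t * m \<xi>)) * F t \<xi>" for r \<xi>
  have "\<exists>\<delta>>0. \<forall>r\<in>{0..T}. r \<noteq> t \<longrightarrow> \<bar>r - t\<bar> < \<delta> \<longrightarrow> L2b (sobw k) (\<epsilon> / 2) (H r)"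
  proof (rule dct_small[OF wt_sobw])
    show "H r \<in> borel_measurable borel" for r unfolding H_def by measurable
    show "integrable lborel (\<lambda>\<xi>. 4 * (sobw k \<xi> * (norm (F t \<xi>))\<^sup>2))"
      using L2b_integrable(1)[OF wt_sobw b[OF t]] by simp
    show "sobw k \<xi> * (norm (H r \<xi>))\<^sup>2 \<le> 4 * (sobw k \<xi> * (norm (F t \<xi>))\<^sup>2)" for r \<xi>
    proof -
      have "norm (cis (r * m \<xi>) - cis (t * m \<xi>)) \<le> 2" using norm_triangle_ineq4[of "cis (r * m \<xi>)" "cis (t * m \<xi>)"] by simp
      then have "(norm (cis (r * m \<xi>) - cis (t * m \<xi>)))\<^sup>2 \<le> 2\<^sup>2" by (intro power_mono) auto
      then have "(norm (cis (r * m \<xi>) - cis (t * m \<xi>)))\<^sup>2 * (sobw k \<xi> * (norm (F t \<xi>))\<^sup>2) \<le> 2\<^sup>2 * (sobw k \<xi> * (norm (F t \<xi>))\<^sup>2)"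
        using wt_nonneg[OF wt_sobw] by (intro mult_right_mono) auto
      then show ?thesis by (simp add: H_def norm_mult power_mult_distrib ac_simps)
    qed
    show "((\<lambda>r. H r \<xi>) \<longlongrightarrow> 0) (at t within {0..T})" for \<xi>
    proof -
      have "continuous_on UNIV (\<lambda>r. (cis (r * m \<xi>) - cis (t * m \<xi>)) * F t \<xi>)" by (intro continuous_intros)
      then have "isCont (\<lambda>r. (cis (r * m \<xi>) - cis (t * m \<xi>)) * F t \<xi>) t"
        by (simp only: continuous_on_eq_continuous_at open_UNIV) blast
      then have "((\<lambda>r. H r \<xi>) \<longlongrightarrow> H t \<xi>) (at t)"
        unfolding H_def by (rule isContD)
      then show ?thesis by (simp add: H_def tendsto_within_subset[of _ _ _ UNIV])
    qed
  qed (use \<epsilon> in auto)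
  then obtain \<delta>1 where \<delta>1: "0 < \<delta>1" "\<And>r. r \<in> {0..T} \<Longrightarrow> r \<noteq> t \<Longrightarrow> \<bar>r - t\<bar> < \<delta>1 \<Longrightarrow> L2b (sobw k) (\<epsilon> / 2) (H r)" by blast
  \<comment> \<open>The second entry makes C |r - t| at most \<epsilon>/2; C + 1 avoids dividing by
    zero.\<close>
  define \<delta> where "\<delta> = min \<delta>1 (\<epsilon> / (2 * (C + 1)))"
  have \<delta>: "0 < \<delta>" using \<delta>1 \<epsilon> C by (simp add: \<delta>_def)
  show ?thesis
  proof (intro exI[of _ \<delta>] conjI \<delta> ballI impI)
    fix r assume r: "r \<in> {0..T}" "\<bar>r - t\<bar> < \<delta>"
    have 1: "L2b (sobw k) (\<epsilon> / 2) (H r)"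
    proof (cases "r = t")
      case True
      then show ?thesis using \<epsilon> by (simp add: H_def[abs_def])
    qed (use \<delta>1 r in \<open>auto simp: \<delta>_def\<close>)
    have "C * \<bar>r - t\<bar> \<le> C * (\<epsilon> / (2 * (C + 1)))" using r C by (intro mult_left_mono) (auto simp: \<delta>_def)
    also have "\<dots> \<le> \<epsilon> / 2" using C \<epsilon> by (simp add: field_simps)
    finally have 2: "L2b (sobw k) (\<epsilon> / 2) (tw r (\<lambda>\<xi>. F r \<xi> - F t \<xi>))"
      using L2b_mono_bound[OF L2b_tw[OF wt_sobw C(2)[OF t r(1)]]] by blast
    have "(\<lambda>\<xi>. tw r (F r) \<xi> - tw t (F t) \<xi>) = (\<lambda>\<xi>. H r \<xi> + tw r (\<lambda>\<xi>. F r \<xi> - F t \<xi>) \<xi>)"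
      by (simp add: tw_def H_def algebra_simps)
    with L2b_add[OF wt_sobw 1 2] show "L2b (sobw k) \<epsilon> (\<lambda>\<xi>. tw r (F r) \<xi> - tw t (F t) \<xi>)" by simp
  qed
qed

text \<open>The product rule for the propagator times \<open>F\<close>. The condition on w m^2
  expresses that \<open>w\<close> gives up the derivatives which one factor of the symbol
  costs.\<close>

lemma mild_derivative:
  assumes F: "mild T f0 F" and t: "t \<in> {0..T}" and \<epsilon>: "0 < \<epsilon>"
    and w: "wt w" "\<And>\<xi>. w \<xi> \<le> sobw k \<xi>" "\<And>\<xi>. w \<xi> * (m \<xi>)\<^sup>2 \<le> sobw k \<xi>"
  shows "\<exists>\<delta>>0. \<forall>r\<in>{0..T}. r \<noteq> t \<longrightarrow> \<bar>r - t\<bar> < \<delta> \<longrightarrow>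
    L2b w \<epsilon> (\<lambda>\<xi>. \<i> * ((tw r (F r) \<xi> - tw t (F t) \<xi>) / of_real (r - t)) + of_real (m \<xi>) * tw t (F t) \<xi> + of_real \<mu> * nlc q (tw t (F t)) \<xi>)"
proof -
  have [measurable]: "m \<in> borel_measurable borel" using m by (rule borel_measurable_continuous_onI)
  have Fc: "continuous_on ({0..T} \<times> UNIV) (\<lambda>(t, \<xi>). F t \<xi>)" using F by (simp add: mild_def)
  obtain B where b: "\<And>t. t \<in> {0..T} \<Longrightarrow> L2b (sobw k) B (F t)" using F unfolding mild_def by blast
  have Fm [measurable]: "F s \<in> borel_measurable borel" if "s \<in> {0..T}" for s using b[OF that] by (simp add: L2b_def)
  have B: "0 \<le> B" using L2b_nonneg[OF b[OF t]] .
  obtain L where lip: "nlc_lip k q B L" using nlc_lip_exists[OF k q kq B] .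
  note L = nlc_lipD[OF lip]
  define U where "U s = tw s (F s)" for s
  have Uc: "continuous_on UNIV (U s)" if "s \<in> {0..T}" for s
    unfolding U_def by (rule tw_continuous[OF continuous_on_strip_section2[OF Fc that]])
  have Ub: "L2b (sobw k) B (U s)" if "s \<in> {0..T}" for s unfolding U_def by (rule L2b_tw[OF wt_sobw b[OF that]])
  have Nb: "L2b (sobw k) (L * B) (nlc q (U s))" if "s \<in> {0..T}" for s
  proof -
    have "nlc q (\<lambda>_. 0) = (\<lambda>_. 0)" by (auto simp: nlc_def ift_def)
    then show ?thesis
      using L(2)[OF Uc[OF that] continuous_on_const Ub[OF that] L2b_zero[OF B], of B] Ub[OF that] by simp
  qed
  have Nc: "continuous_on ({0..T} \<times> UNIV) (\<lambda>(s, \<xi>). nlc q (U s) \<xi>)"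
    unfolding U_def by (rule nlc_strip_continuous[OF tw_strip_continuous[OF Fc] L2b_tw[OF wt_sobw b]])
  \<comment> \<open>The linear part: the quotient of the propagator on the fixed \<open>F t\<close>
    cancels against \<open>m\<close> in the limit, with majorant a multiple of |m| |F t|.\<close>
  define P1 where "P1 r \<xi> = (\<i> * ((cis (r * m \<xi>) - cis (t * m \<xi>)) / of_real (r - t)) + of_real (m \<xi>) * cis (t * m \<xi>)) * F t \<xi>" for r \<xi>
  have "\<exists>\<delta>>0. \<forall>r\<in>{0..T}. r \<noteq> t \<longrightarrow> \<bar>r - t\<bar> < \<delta> \<longrightarrow> L2b w (\<epsilon> / 2) (P1 r)"
  proof (rule dct_small[OF w(1)])
    show "P1 r \<in> borel_measurable borel" for r using Fm[OF t] unfolding P1_def by measurable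
    show "integrable lborel (\<lambda>\<xi>. 4 * (sobw k \<xi> * (norm (F t \<xi>))\<^sup>2))"
      using L2b_integrable(1)[OF wt_sobw b[OF t]] by simp
    show "w \<xi> * (norm (P1 r \<xi>))\<^sup>2 \<le> 4 * (sobw k \<xi> * (norm (F t \<xi>))\<^sup>2)" if "r \<noteq> t" for r \<xi>
    proof -
      have "norm (cis (r * m \<xi>) - cis (t * m \<xi>)) \<le> \<bar>r - t\<bar> * \<bar>m \<xi>\<bar>"
        using norm_cis_diff_le[of "r * m \<xi>" "t * m \<xi>"] by (simp add: abs_mult[symmetric] left_diff_distrib)
      then have "norm (\<i> * ((cis (r * m \<xi>) - cis (t * m \<xi>)) / of_real (r - t))) \<le> \<bar>m \<xi>\<bar>"
        using that by (simp add: norm_mult norm_divide divide_simps mult.commute del: of_real_diff)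
      then have "norm (\<i> * ((cis (r * m \<xi>) - cis (t * m \<xi>)) / of_real (r - t)) + of_real (m \<xi>) * cis (t * m \<xi>)) \<le> \<bar>m \<xi>\<bar> + \<bar>m \<xi>\<bar>"
        by (intro norm_triangle_mono) (auto simp: norm_mult)
      then have "norm (P1 r \<xi>) \<le> 2 * \<bar>m \<xi>\<bar> * norm (F t \<xi>)" by (simp add: P1_def norm_mult mult_right_mono)
      then have "(norm (P1 r \<xi>))\<^sup>2 \<le> (2 * \<bar>m \<xi>\<bar> * norm (F t \<xi>))\<^sup>2" by (intro power_mono) auto
      then have "w \<xi> * (norm (P1 r \<xi>))\<^sup>2 \<le> w \<xi> * (2 * \<bar>m \<xi>\<bar> * norm (F t \<xi>))\<^sup>2"
        using wt_nonneg[OF w(1)] by (intro mult_left_mono)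
      also have "\<dots> = 4 * (w \<xi> * (m \<xi>)\<^sup>2 * (norm (F t \<xi>))\<^sup>2)" by (simp add: power_mult_distrib)
      also have "\<dots> \<le> 4 * (sobw k \<xi> * (norm (F t \<xi>))\<^sup>2)" using w(3) by (intro mult_left_mono mult_right_mono) auto
      finally show ?thesis .
    qed
    show "((\<lambda>r. P1 r \<xi>) \<longlongrightarrow> 0) (at t within {0..T})" for \<xi>
    proof -
      have "((\<lambda>r. P1 r \<xi>) \<longlongrightarrow> (\<i> * (\<i> * of_real (m \<xi>) * cis (t * m \<xi>)) + of_real (m \<xi>) * cis (t * m \<xi>)) * F t \<xi>) (at t within {0..T})"
        unfolding P1_def by (intro tendsto_intros cis_diffquot_tendsto)
      then show ?thesis by (simp flip: mult.assoc)
    qed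
  qed (use \<epsilon> in auto)
  then obtain \<delta>1 where \<delta>1: "0 < \<delta>1" "\<And>r. r \<in> {0..T} \<Longrightarrow> r \<noteq> t \<Longrightarrow> \<bar>r - t\<bar> < \<delta>1 \<Longrightarrow> L2b w (\<epsilon> / 2) (P1 r)" by blast
  have "0 < \<epsilon> / (4 * L)" using \<epsilon> L(1) by simp
  from tw_mild_continuous[OF F t this] obtain \<delta>2 where
    \<delta>2: "0 < \<delta>2" "\<And>r. r \<in> {0..T} \<Longrightarrow> \<bar>r - t\<bar> < \<delta>2 \<Longrightarrow> L2b (sobw k) (\<epsilon> / (4 * L)) (\<lambda>\<xi>. U r \<xi> - U t \<xi>)"
    unfolding U_def by blast
  define \<delta> where "\<delta> = min (min \<delta>1 \<delta>2) (\<epsilon> / (4 * (L * B + 1)))"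
  have LB: "0 \<le> L * B" using L(1) B by simp
  have \<delta>: "0 < \<delta>" using \<delta>1 \<delta>2 \<epsilon> LB by (simp add: \<delta>_def)
  show ?thesis
  proof (intro exI[of _ \<delta>] conjI \<delta> ballI impI)
    fix r assume r: "r \<in> {0..T}" "r \<noteq> t" "\<bar>r - t\<bar> < \<delta>"
    \<comment> \<open>The ordered end points treat \<open>r\<close> on either side of
      \<open>t\<close> together; the quotient is unchanged when both differences change
      sign.\<close>
    define a where "a = min r t"
    define e where "e = max r t"
    define l where "l = e - a"
    have l: "l = \<bar>r - t\<bar>" "0 < l" using r by (auto simp: l_def a_def e_def)
    have ae: "0 \<le> a" "a \<le> e" "e \<le> T" using r t by (auto simp: a_def e_def)
    have quot: "(F r \<xi> - F t \<xi>) / of_real (r - t) = (F e \<xi> - F a \<xi>) / of_real l" for \<xi>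
    proof (cases "t \<le> r")
      case True
      then show ?thesis by (simp add: a_def e_def l_def)
    next
      case False
      then have "(F e \<xi> - F a \<xi>) / of_real l = (- (F r \<xi> - F t \<xi>)) / (- of_real (r - t))"
        by (simp add: a_def e_def l_def)
      then show ?thesis by (simp only: minus_divide_divide)
    qed
    \<comment> \<open>The nonlinear part is the mean of \<open>H\<close> over an interval of length
      l.\<close>
    define H where "H y \<xi> = \<i> * cis (r * m \<xi>) * NN (a + y) (F (a + y)) \<xi> + of_real \<mu> * nlc q (U t) \<xi>" for y \<xi>
    have s: "a + y \<in> {0..T}" "\<bar>a + y - t\<bar> < \<delta>" "\<bar>r - (a + y)\<bar> \<le> l" if "y \<in> {0..l}" for y
      using that r t by (auto simp: a_def e_def l_def)
    have Nct: "continuous_on UNIV (nlc q (U t))" by (rule continuous_on_strip_section2[OF Nc t])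
    have Hc: "continuous_on ({0..l} \<times> UNIV) (\<lambda>(y, \<xi>). H y \<xi>)"
      using mild_increment(2)[OF F ae] unfolding H_def case_prod_beta l_def
      by (intro continuous_intros continuous_on_compose2[OF m] continuous_on_compose2[OF Nct]) auto
    have HL: "L2b w (\<epsilon> / 2) (H y)" if y: "y \<in> {0..l}" for y
    proof -
      note s = s[OF y]
      \<comment> \<open>Small by continuity of U in H^k and, for the second summand, because the
        phase is within l |m| of 1, which the weight \<open>w\<close> absorbs.\<close>
      have Heq: "H y \<xi> = of_real \<mu> * ((nlc q (U t) \<xi> - nlc q (U (a + y)) \<xi>) + (1 - cis ((r - (a + y)) * m \<xi>)) * nlc q (U (a + y)) \<xi>)" for \<xi>
      proof -
        have "cis (r * m \<xi>) * cis (- ((a + y) * m \<xi>)) = cis ((r - (a + y)) * m \<xi>)"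
          by (simp add: cis_mult algebra_simps)
        then have "\<i> * cis (r * m \<xi>) * NN (a + y) (F (a + y)) \<xi> = - (of_real \<mu> * (cis ((r - (a + y)) * m \<xi>) * nlc q (U (a + y)) \<xi>))"
          by (simp add: NN_def U_def flip: mult.assoc) (simp add: mult.assoc mult.left_commute)
        then show ?thesis by (simp add: H_def algebra_simps)
      qed
      have 1: "L2b w (\<epsilon> / 4) (\<lambda>\<xi>. nlc q (U t) \<xi> - nlc q (U (a + y)) \<xi>)"
      proof -
        have "L2b (sobw k) (\<epsilon> / (4 * L)) (\<lambda>\<xi>. U t \<xi> - U (a + y) \<xi>)"
          using L2b_uminus[OF \<delta>2(2)[OF s(1)]] s(2) by (simp add: \<delta>_def)
        from L(2)[OF Uc[OF t] Uc[OF s(1)] Ub[OF t] Ub[OF s(1)] this]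
        have "L2b (sobw k) (\<epsilon> / 4) (\<lambda>\<xi>. nlc q (U t) \<xi> - nlc q (U (a + y)) \<xi>)" using L(1) by simp
        from L2b_mono_weight[OF wt_sobw this w(2)] show ?thesis .
      qed
      have 2: "L2b w (l * (L * B)) (\<lambda>\<xi>. (1 - cis ((r - (a + y)) * m \<xi>)) * nlc q (U (a + y)) \<xi>)"
      proof (rule L2b_le[OF wt_sobw Nb[OF s(1)]])
        have [measurable]: "nlc q (U (a + y)) \<in> borel_measurable borel" using Nb[OF s(1)] by (simp add: L2b_def)
        show "(\<lambda>\<xi>. (1 - cis ((r - (a + y)) * m \<xi>)) * nlc q (U (a + y)) \<xi>) \<in> borel_measurable borel" by measurable
        fix \<xi>
        have "norm (1 - cis ((r - (a + y)) * m \<xi>)) \<le> \<bar>r - (a + y)\<bar> * \<bar>m \<xi>\<bar>"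
          using norm_cis_diff_le[of 0 "(r - (a + y)) * m \<xi>"] by (simp add: abs_mult)
        also have "\<dots> \<le> l * \<bar>m \<xi>\<bar>" using s(3) by (intro mult_right_mono) auto
        finally have "(norm (1 - cis ((r - (a + y)) * m \<xi>)))\<^sup>2 \<le> (l * \<bar>m \<xi>\<bar>)\<^sup>2" by (intro power_mono) auto
        then have "w \<xi> * (norm (1 - cis ((r - (a + y)) * m \<xi>)))\<^sup>2 \<le> w \<xi> * (l * \<bar>m \<xi>\<bar>)\<^sup>2"
          using wt_nonneg[OF w(1)] by (rule mult_left_mono)
        also have "\<dots> = l\<^sup>2 * (w \<xi> * (m \<xi>)\<^sup>2)" by (simp add: power_mult_distrib)
        also have "\<dots> \<le> l\<^sup>2 * sobw k \<xi>" using w(3) by (intro mult_left_mono) auto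
        finally have "w \<xi> * (norm (1 - cis ((r - (a + y)) * m \<xi>)))\<^sup>2 * (norm (nlc q (U (a + y)) \<xi>))\<^sup>2 \<le> l\<^sup>2 * sobw k \<xi> * (norm (nlc q (U (a + y)) \<xi>))\<^sup>2"
          by (rule mult_right_mono) simp
        then show "w \<xi> * (norm ((1 - cis ((r - (a + y)) * m \<xi>)) * nlc q (U (a + y)) \<xi>))\<^sup>2 \<le> l\<^sup>2 * (sobw k \<xi> * (norm (nlc q (U (a + y)) \<xi>))\<^sup>2)"
          by (simp add: norm_mult power_mult_distrib mult.assoc)
      qed (use l in auto)
      have "l * (L * B) \<le> \<epsilon> / (4 * (L * B + 1)) * (L * B)"
        using r(3) LB l by (intro mult_right_mono) (auto simp: \<delta>_def)
      also have "\<dots> \<le> \<epsilon> / 4" using \<epsilon> LB by (simp add: field_simps)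
      finally have "L2b w (\<epsilon> / 4) (\<lambda>\<xi>. (1 - cis ((r - (a + y)) * m \<xi>)) * nlc q (U (a + y)) \<xi>)"
        using L2b_mono_bound[OF 2] by blast
      from L2b_cmult[OF w(1) L2b_add[OF w(1) 1 this], of "of_real \<mu>"] show ?thesis
        using \<mu> by (simp add: Heq[abs_def])
    qed
    have "L2b w (\<epsilon> / 2 * l) (\<lambda>\<xi>. integral {0..l} (\<lambda>y. H y \<xi>))"
      by (rule Minkowski_strip_const[OF w(1) Hc HL]) (use \<epsilon> l in auto)
    from L2b_cmult[OF w(1) this, of "1 / of_real l"]
    have P2: "L2b w (\<epsilon> / 2) (\<lambda>\<xi>. 1 / of_real l * integral {0..l} (\<lambda>y. H y \<xi>))"
      using l by (simp add: norm_divide)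
    have P2eq: "1 / of_real l * integral {0..l} (\<lambda>y. H y \<xi>) = \<i> * cis (r * m \<xi>) * ((F r \<xi> - F t \<xi>) / of_real (r - t)) + of_real \<mu> * nlc q (U t) \<xi>" for \<xi>
    proof -
      have i: "(\<lambda>y. NN (a + y) (F (a + y)) \<xi>) integrable_on {0..l}"
        unfolding l_def by (intro integrable_continuous_interval continuous_on_strip_section[OF mild_increment(2)[OF F ae]])
      have "integral {0..l} (\<lambda>y. H y \<xi>) = \<i> * cis (r * m \<xi>) * integral {0..l} (\<lambda>y. NN (a + y) (F (a + y)) \<xi>) + of_real l * (of_real \<mu> * nlc q (U t) \<xi>)"
        unfolding H_def using i l(2)
        by (subst Henstock_Kurzweil_Integration.integral_add) (auto intro: integrable_on_mult_right simp: scaleR_conv_of_real)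
      also have "integral {0..l} (\<lambda>y. NN (a + y) (F (a + y)) \<xi>) = F e \<xi> - F a \<xi>"
        unfolding l_def by (rule mild_increment(1)[OF F ae, symmetric])
      finally show ?thesis unfolding quot using l(2) by (simp add: field_simps)
    qed
    have "L2b w (\<epsilon> / 2) (P1 r)" using \<delta>1(2)[OF r(1,2)] r(3) by (simp add: \<delta>_def)
    from L2b_add[OF w(1) this P2]
    have "L2b w \<epsilon> (\<lambda>\<xi>. P1 r \<xi> + 1 / of_real l * integral {0..l} (\<lambda>y. H y \<xi>))" by simp
    moreover have "P1 r \<xi> + 1 / of_real l * integral {0..l} (\<lambda>y. H y \<xi>) =
       \<i> * ((tw r (F r) \<xi> - tw t (F t) \<xi>) / of_real (r - t)) + of_real (m \<xi>) * tw t (F t) \<xi> + of_real \<mu> * nlc q (tw t (F t)) \<xi>" for \<xi>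
    proof -
      have "of_real (r - t) \<noteq> (0 :: complex)" using r(2) by simp
      then show ?thesis unfolding P2eq P1_def U_def tw_def by (simp add: field_simps del: of_real_diff)
    qed
    ultimately show "L2b w \<epsilon> (\<lambda>\<xi>. \<i> * ((tw r (F r) \<xi> - tw t (F t) \<xi>) / of_real (r - t)) + of_real (m \<xi>) * tw t (F t) \<xi> + of_real \<mu> * nlc q (tw t (F t)) \<xi>)"
      by simp
  qed
qed

end

lemma mild_imp_nls_solution:
  assumes one: "CARD('d::finite) = 1" and k: "1 \<le> k" and p: "2 \<le> p" "real k \<le> p - 1 \<or> p = 3" and \<mu>: "\<bar>\<mu>\<bar> = 1" and \<sigma>: "0 < \<sigma>" "\<sigma> < 1" and T: "0 \<le> T"
    and F: "semilinear.mild k (p - 1) \<mu> (\<lambda>\<xi>. \<bar>\<xi>\<bar> powr (2 * \<sigma>)) T f0 F"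
  shows "nls_solution \<sigma> \<mu> p k T (\<lambda>x :: real ^ 'd. ift f0 (prj x)) (\<lambda>t x. ift (semilinear.tw (\<lambda>\<xi>. \<bar>\<xi>\<bar> powr (2 * \<sigma>)) t (F t)) (prj x))"
proof -
  define q where "q = p - 1"
  have q': "1 \<le> q" "real k \<le> q \<or> q = 2" "p = q + 1" using p by (auto simp: q_def)
  define m where "m \<xi> = \<bar>\<xi>\<bar> powr (2 * \<sigma>)" for \<xi> :: real
  have m_eq: "(\<lambda>\<xi>. \<bar>\<xi>\<bar> powr (2 * \<sigma>)) = m" by (simp add: m_def[abs_def])
  interpret semilinear k q \<mu> m
    unfolding m_eq[symmetric] by (rule semilinear_frac_laplacian[OF k q'(1,2) \<mu> \<sigma>(1)])
  have F: "mild T f0 F" using F by (simp add: m_eq q_def)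
  obtain B where b: "\<And>t. t \<in> {0..T} \<Longrightarrow> L2b (sobw k) B (F t)" using F unfolding mild_def by blast
  define U where "U t = tw t (F t)" for t
  have Ub: "L2b (sobw k) B (U t)" if "t \<in> {0..T}" for t unfolding U_def by (rule L2b_tw[OF wt_sobw b[OF that]])
  define u where "u t x = ift (U t) (prj x)" for t and x :: "real ^ 'd"
  have Urepr: "repr (distr_of (u t)) (U t)" if "t \<in> {0..T}" for t
    using repr_ift[OF one k Ub[OF that]] by (simp add: u_def[abs_def])
  have cont: "continuous_in_sobolev (real k) T u"
    unfolding continuous_in_sobolev_def
  proof (intro ballI conjI)
    fix t assume t: "t \<in> {0..T}"
    show "tempered_fun (u t)"
      unfolding u_def by (rule TF_tempered[OF one TF_bounded[OF ift_measurable[OF L2b_sobw_L1(1)[OF k Ub[OF t]]] norm_ift_le]])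
    show "distr_of (u t) \<in> sobolev_space (real k)"
      by (rule sobolev_norm_leI(1)[OF one Urepr[OF t]]) (use Ub[OF t] in \<open>simp add: wps_nat\<close>)
    show "((\<lambda>r. sobolev_norm (real k) (distr_of (\<lambda>x. u r x - u t x))) \<longlongrightarrow> 0) (at t within {0..T})"
    proof (rule ennreal_tendsto_0I)
      fix \<epsilon> :: real assume "0 < \<epsilon>"
      from tw_mild_continuous[OF F t this] obtain \<delta> where
        \<delta>: "0 < \<delta>" "\<And>r. r \<in> {0..T} \<Longrightarrow> \<bar>r - t\<bar> < \<delta> \<Longrightarrow> L2b (sobw k) \<epsilon> (\<lambda>\<xi>. U r \<xi> - U t \<xi>)"
        unfolding U_def by blast
      show "\<forall>\<^sub>F r in at t within {0..T}. sobolev_norm (real k) (distr_of (\<lambda>x. u r x - u t x)) \<le> ennreal \<epsilon>"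
        unfolding eventually_at
      proof (intro exI[of _ \<delta>] conjI \<delta>(1) ballI impI)
        fix r assume r: "r \<in> {0..T}" "r \<noteq> t \<and> dist r t < \<delta>"
        have d: "L2b (sobw k) \<epsilon> (\<lambda>\<xi>. U r \<xi> - U t \<xi>)" using \<delta>(2) r by (simp add: dist_real_def)
        have "(\<lambda>x :: real ^ 'd. u r x - u t x) = (\<lambda>x. ift (\<lambda>\<xi>. U r \<xi> - U t \<xi>) (prj x))"
          unfolding u_def by (intro ext ift_diff[symmetric] L2b_sobw_L1(1)[OF k Ub] r(1) t)
        then have "repr (distr_of (\<lambda>x :: real ^ 'd. u r x - u t x)) (\<lambda>\<xi>. U r \<xi> - U t \<xi>)"
          using repr_ift[OF one k d] by simp
        from sobolev_norm_leI(2)[OF one this] d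
        show "sobolev_norm (real k) (distr_of (\<lambda>x. u r x - u t x)) \<le> ennreal \<epsilon>" by (simp add: wps_nat)
      qed
    qed
  qed
  \<comment> \<open>The squared symbol is at most (1 + \<xi>^2)^(2\<sigma>), exactly the power by
    which this weight is weaker than that of H^k.\<close>
  define w where "w = wps (real k - 2 * \<sigma>)"
  have w1: "w \<xi> \<le> sobw k \<xi>" for \<xi>
    unfolding w_def wps_nat[symmetric] wps_def using \<sigma> by (intro powr_mono) auto
  have w2: "w \<xi> * (m \<xi>)\<^sup>2 \<le> sobw k \<xi>" for \<xi>
  proof -
    have "m \<xi> \<le> (1 + \<xi>\<^sup>2) powr \<sigma>"
    proof (cases "\<xi> = 0")
      case False
      then have "\<xi>\<^sup>2 = \<bar>\<xi>\<bar> powr 2" by (simp add: powr_numeral)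
      then have "m \<xi> = (\<xi>\<^sup>2) powr \<sigma>" by (simp only: m_def powr_powr)
      also have "\<dots> \<le> (1 + \<xi>\<^sup>2) powr \<sigma>" using \<sigma> by (intro powr_mono2) auto
      finally show ?thesis .
    qed (simp add: m_def)
    then have "(m \<xi>)\<^sup>2 \<le> ((1 + \<xi>\<^sup>2) powr \<sigma>)\<^sup>2" by (intro power_mono) (auto simp: m_def)
    also have "\<dots> = (1 + \<xi>\<^sup>2) powr (2 * \<sigma>)" by (simp add: power2_eq_square flip: powr_add)
    finally have "w \<xi> * (m \<xi>)\<^sup>2 \<le> w \<xi> * (1 + \<xi>\<^sup>2) powr (2 * \<sigma>)" by (intro mult_left_mono) (auto simp: w_def wps_def)
    also have "\<dots> = sobw k \<xi>" unfolding w_def wps_nat[symmetric] wps_def by (simp flip: powr_add)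
    finally show ?thesis .
  qed
  have der: "((\<lambda>r. sobolev_norm (real k - 2 * \<sigma>)
            (\<lambda>\<phi>. \<i> * ((distr_of (u r) \<phi> - distr_of (u t) \<phi>) / of_real (r - t))
                 + frac_laplacian \<sigma> (distr_of (u t)) \<phi>
                 + of_real \<mu> * distr_of (nonlinearity p (u t)) \<phi>)) \<longlongrightarrow> 0) (at t within {0..T})" if t: "t \<in> {0..T}" for t
  proof (rule ennreal_tendsto_0I)
    fix \<epsilon> :: real assume \<epsilon>: "0 < \<epsilon>"
    have ww: "wt w" by (simp add: w_def)
    from mild_derivative[OF F t \<epsilon> ww w1 w2] obtain \<delta> where
      \<delta>: "0 < \<delta>" "\<And>r. r \<in> {0..T} \<Longrightarrow> r \<noteq> t \<Longrightarrow> \<bar>r - t\<bar> < \<delta> \<Longrightarrow>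
        L2b w \<epsilon> (\<lambda>\<xi>. \<i> * ((U r \<xi> - U t \<xi>) / of_real (r - t)) + of_real (m \<xi>) * U t \<xi> + of_real \<mu> * nlc q (U t) \<xi>)"
      unfolding U_def by blast
    have Nrepr: "repr (distr_of (nonlinearity p (u t))) (nlc q (U t))"
    proof -
      have "nonlinearity p (u t) = (\<lambda>x :: real ^ 'd. Gq q (ift (U t) (prj x)))"
        by (auto simp: nonlinearity_def Gq_def u_def q'(3))
      then show ?thesis using repr_ft[OF one Gq_ift_integrable[OF k q'(1) Ub[OF t]]] by (simp add: nlc_def)
    qed
    have Lrepr: "repr (frac_laplacian \<sigma> (distr_of (u t))) (\<lambda>\<xi>. of_real (m \<xi>) * U t \<xi>)"
      using repr_frac_laplacian[OF one Urepr[OF t] Ub[OF t] \<sigma>] by (simp add: m_def)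
    show "\<forall>\<^sub>F r in at t within {0..T}. sobolev_norm (real k - 2 * \<sigma>)
            (\<lambda>\<phi>. \<i> * ((distr_of (u r) \<phi> - distr_of (u t) \<phi>) / of_real (r - t))
                 + frac_laplacian \<sigma> (distr_of (u t)) \<phi>
                 + of_real \<mu> * distr_of (nonlinearity p (u t)) \<phi>) \<le> ennreal \<epsilon>"
      unfolding eventually_at
    proof (intro exI[of _ \<delta>] conjI \<delta>(1) ballI impI)
      fix r assume r: "r \<in> {0..T}" "r \<noteq> t \<and> dist r t < \<delta>"
      \<comment> \<open>With this coefficient the residual of the equation is a linear combination
        of four represented distributions.\<close>
      define c where "c = \<i> / complex_of_real (r - t)"
      note rc = repr_lincomb[OF one repr_lincomb[OF one repr_lincomb[OF one Urepr[OF r(1)] Urepr[OF t], of c "- c"] Lrepr, of 1 1] Nrepr, of 1 "of_real \<mu>"]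
      have e1: "(\<lambda>\<phi>. 1 * (1 * (c * distr_of (u r) \<phi> + - c * distr_of (u t) \<phi>) + 1 * frac_laplacian \<sigma> (distr_of (u t)) \<phi>) + of_real \<mu> * distr_of (nonlinearity p (u t)) \<phi>)
        = (\<lambda>\<phi>. \<i> * ((distr_of (u r) \<phi> - distr_of (u t) \<phi>) / of_real (r - t)) + frac_laplacian \<sigma> (distr_of (u t)) \<phi>
                 + of_real \<mu> * distr_of (nonlinearity p (u t)) \<phi>)"
        by (simp add: c_def diff_divide_distrib right_diff_distrib)
      have e2: "(\<lambda>\<xi>. 1 * (1 * (c * U r \<xi> + - c * U t \<xi>) + 1 * (of_real (m \<xi>) * U t \<xi>)) + of_real \<mu> * nlc q (U t) \<xi>)
        = (\<lambda>\<xi>. \<i> * ((U r \<xi> - U t \<xi>) / of_real (r - t)) + of_real (m \<xi>) * U t \<xi> + of_real \<mu> * nlc q (U t) \<xi>)"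
        by (simp add: c_def diff_divide_distrib right_diff_distrib)
      have "L2b w \<epsilon> (\<lambda>\<xi>. \<i> * ((U r \<xi> - U t \<xi>) / of_real (r - t)) + of_real (m \<xi>) * U t \<xi> + of_real \<mu> * nlc q (U t) \<xi>)"
        using \<delta>(2) r by (simp add: dist_real_def)
      from sobolev_norm_leI(2)[OF one rc[unfolded e1 e2] this[unfolded w_def]]
      show "sobolev_norm (real k - 2 * \<sigma>)
            (\<lambda>\<phi>. \<i> * ((distr_of (u r) \<phi> - distr_of (u t) \<phi>) / of_real (r - t))
                 + frac_laplacian \<sigma> (distr_of (u t)) \<phi>
                 + of_real \<mu> * distr_of (nonlinearity p (u t)) \<phi>) \<le> ennreal \<epsilon>" .
    qed
  qed
  have init: "u 0 x = ift f0 (prj x)" for x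
  proof -
    have "F 0 = f0" using F T by (auto simp: mild_def)
    then have "U 0 = f0" by (auto simp: U_def tw_def)
    then show ?thesis by (simp add: u_def)
  qed
  show ?thesis
    unfolding nls_solution_def m_eq using cont der init by (auto simp: u_def[abs_def] U_def)
qed

section \<open>Separation of the two solutions\<close>

definition gap :: "real \<Rightarrow> real \<Rightarrow> complex" where
  "gap q x = of_real (exp (- (x\<^sup>2 / 2)) * sin (exp (- (q * x\<^sup>2 / 2))))"

text \<open>The argument of the sine lies in (0, 1], so \<open>gap\<close> has no zeros. The
  constant depends on \<open>q\<close> only and hence survives as b tends to 1.\<close>

lemma gap_not_null:
  assumes q: "0 \<le> q"
  shows "\<exists>c>0. \<not> L2b (\<lambda>_. 1) c (gap q)"
proof (rule ccontr)
  assume "\<not> (\<exists>c>0. \<not> L2b (\<lambda>_. 1) c (gap q))"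
  then have "L2b (\<lambda>_. 1) (inverse (real (Suc n))) (gap q)" for n by simp
  from L2b_lim_bound[OF this LIMSEQ_inverse_real_of_nat] have "L2b (\<lambda>_. 1) 0 (gap q)" .
  then have "(\<integral>\<^sup>+x. ennreal ((norm (gap q x))\<^sup>2) \<partial>lborel) = 0" and [measurable]: "gap q \<in> borel_measurable borel"
    by (auto simp: L2b_def)
  then have "AE x in lborel. ennreal ((norm (gap q x))\<^sup>2) = 0" by (subst (asm) nn_integral_0_iff_AE) auto
  moreover have "ennreal ((norm (gap q x))\<^sup>2) \<noteq> 0" for x
  proof -
    have "exp (- (q * x\<^sup>2 / 2)) \<le> 1" using q by simp
    then have "exp (- (q * x\<^sup>2 / 2)) < pi" using pi_gt3 by linarith
    then have "0 < sin (exp (- (q * x\<^sup>2 / 2)))" by (intro sin_gt_zero exp_gt_zero)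
    then show ?thesis by (simp add: gap_def)
  qed
  ultimately have "AE x in (lborel :: real measure). False" by simp
  then have "emeasure (lborel :: real measure) UNIV = 0" unfolding eventually_False ae_filter_eq_bot_iff by simp
  then show False by simp
qed

text \<open>The two reference phases differ by \<open>\<mu> \<psi>\<close> at time \<open>K\<close>, where \<open>\<psi>\<close> is the \<open>q\<close>-th power of the profile.\<close>

lemma norm_gap_le:
  assumes b: "1 \<le> b" and \<mu>: "\<bar>\<mu>\<bar> = 1" and K: "(b powr q - 1) * K = 1" and q: "0 \<le> q"
  shows "norm (gap q x) \<le> norm (Phi q \<mu> 1 K x - Phi q \<mu> b K x)"
proof -
  define \<phi> where "\<phi> = exp (- (x\<^sup>2 / 2))"
  define \<psi> where "\<psi> = exp (- (q * x\<^sup>2 / 2))"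
  have \<psi>: "0 < \<psi>" "\<psi> \<le> 1" using q by (auto simp: \<psi>_def)
  have s: "0 < sin \<psi>" using \<psi> pi_gt3 by (intro sin_gt_zero) auto
  have "\<mu> * K * (b powr q * \<psi>) = \<mu> * \<psi> * ((b powr q - 1) * K) + \<mu> * K * (1 powr q * \<psi>)"
    by (simp add: algebra_simps)
  then have ph: "\<mu> * K * (b powr q * \<psi>) = \<mu> * \<psi> + \<mu> * K * (1 powr q * \<psi>)" by (simp add: K)
  have "Phi q \<mu> 1 K x - Phi q \<mu> b K x = of_real \<phi> * cis (\<mu> * K * (1 powr q * \<psi>)) * (1 - of_real b * cis (\<mu> * \<psi>))"
    unfolding Phi_def \<phi>_def[symmetric] \<psi>_def[symmetric] ph cis_mult[symmetric] by (simp add: algebra_simps)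
  then have "norm (Phi q \<mu> 1 K x - Phi q \<mu> b K x) = \<phi> * norm (1 - of_real b * cis (\<mu> * \<psi>))"
    by (simp add: norm_mult \<phi>_def)
  moreover have "\<bar>Im (1 - of_real b * cis (\<mu> * \<psi>))\<bar> \<le> norm (1 - of_real b * cis (\<mu> * \<psi>))"
    by (rule abs_Im_le_cmod)
  \<comment> \<open>Keeping only the imaginary part gives a lower bound insensitive to the sign of
    \<mu>.\<close>
  moreover have "\<bar>Im (1 - of_real b * cis (\<mu> * \<psi>))\<bar> = b * sin \<psi>"
  proof -
    have "\<mu> = 1 \<or> \<mu> = -1" using \<mu> by linarith
    then show ?thesis using b s by (auto simp: abs_mult)
  qed
  moreover have "1 * sin \<psi> \<le> b * sin \<psi>" using b s by (intro mult_right_mono) auto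
  ultimately have "\<phi> * sin \<psi> \<le> norm (Phi q \<mu> 1 K x - Phi q \<mu> b K x)"
    by (auto simp: \<phi>_def intro: order_trans[OF mult_left_mono])
  moreover have "norm (gap q x) = \<phi> * sin \<psi>"
    unfolding gap_def \<phi>_def[symmetric] \<psi>_def[symmetric] norm_of_real using s by (simp add: abs_mult \<phi>_def)
  ultimately show ?thesis by simp
qed

text \<open>Peetre's inequality bounds N^2 by 2 (1 + \<xi>^2) (1 + (\<xi> - N)^2). Raised to the
  negative power s it gives a factor N^s on the norm and a loss (1 + (\<xi> - N)^2)^(-s) in the
  weight, absorbed by \<open>j\<close> derivatives of the profile. The factor N^s cancels against
  the amplitude \<kappa> N^(-s).\<close>

lemma L2b_wps_translate:
  assumes s: "s < 0" "- s \<le> real j" and N: "1 \<le> N" and G: "L2b (sobw j) C G"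
  shows "L2b (wps s) (2 powr (- s / 2) * N powr s * C) (\<lambda>\<xi>. G (\<xi> - N))"
proof (rule L2b_le[OF _ L2b_translate[OF wt_sobw G]])
  show "wt (\<lambda>\<xi>. sobw j (\<xi> - N))" by (auto simp: wt_def sobw_def)
  have [measurable]: "G \<in> borel_measurable borel" using G by (simp add: L2b_def)
  show "(\<lambda>\<xi>. G (\<xi> - N)) \<in> borel_measurable borel" by measurable
  fix \<xi> :: real
  define X where "X = 1 + \<xi>\<^sup>2"
  define Y where "Y = 1 + (\<xi> - N)\<^sup>2"
  have XY: "0 < X" "1 \<le> Y" by (auto simp: X_def Y_def add_pos_nonneg)
  have "N\<^sup>2 \<le> 2 * X * Y" using Peetre[of \<xi> "N - \<xi>"] by (simp add: X_def Y_def power2_commute)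
  then have "(2 * X * Y) powr s \<le> (N\<^sup>2) powr s" using N s by (intro powr_mono2') auto
  also have "(N\<^sup>2) powr s = N powr (2 * s)" using N by (simp add: powr_powr flip: powr_numeral)
  finally have "2 powr s * X powr s * Y powr s \<le> N powr (2 * s)" using XY by (simp add: powr_mult)
  then have "2 powr (- s) * Y powr (- s) * (2 powr s * X powr s * Y powr s) \<le> 2 powr (- s) * Y powr (- s) * N powr (2 * s)"
    by (intro mult_left_mono) auto
  moreover have "2 powr (- s) * Y powr (- s) * (2 powr s * X powr s * Y powr s) = X powr s"
  proof -
    have "2 powr (- s) * 2 powr s = 1" "Y powr (- s) * Y powr s = 1" using XY by (simp_all flip: powr_add)
    then show ?thesis by (metis (no_types, lifting) mult.assoc mult.commute mult.left_neutral)
  qed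
  ultimately have "X powr s \<le> 2 powr (- s) * Y powr (- s) * N powr (2 * s)" by linarith
  also have "\<dots> \<le> 2 powr (- s) * Y powr (real j) * N powr (2 * s)"
    using XY s by (intro mult_left_mono mult_right_mono powr_mono) auto
  also have "\<dots> = (2 powr (- s / 2) * N powr s)\<^sup>2 * sobw j (\<xi> - N)"
  proof -
    have "(2 powr (- s / 2))\<^sup>2 = 2 powr (- s)" "(N powr s)\<^sup>2 = N powr (2 * s)"
      by (simp_all add: power2_eq_square flip: powr_add)
    moreover have "Y powr (real j) = sobw j (\<xi> - N)"
      unfolding sobw_def Y_def[symmetric] using XY by (intro powr_realpow) auto
    ultimately show ?thesis by (simp add: power_mult_distrib)
  qed
  finally show "wps s \<xi> * (norm (G (\<xi> - N)))\<^sup>2 \<le> (2 powr (- s / 2) * N powr s)\<^sup>2 * (sobw j (\<xi> - N) * (norm (G (\<xi> - N)))\<^sup>2)"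
    by (simp add: wps_def X_def mult_right_mono flip: mult.assoc)
qed auto

text \<open>One pair of solutions for a given b: the data differ by (b - 1) times a constant, while
  the lower bound at the final time does not involve b.\<close>

lemma one_step:
  assumes one: "CARD('d::finite) = 1" and k: "1 \<le> k" and p: "2 \<le> p" "real k \<le> p - 1 \<or> p = 3" and \<mu>: "\<bar>\<mu>\<bar> = 1"
    and \<sigma>: "0 < \<sigma>" "\<sigma> < 1" and s: "s < 0" "- s \<le> real j" and T: "0 < T" and \<kappa>: "0 < \<kappa>" and b: "1 < b" "b \<le> 2"
    and C0: "L2b (sobw j) C0 (ft (Phi (p - 1) \<mu> 1 0))" and c: "0 < c" "\<not> L2b (\<lambda>_. 1) c (gap (p - 1))"
  shows "\<exists>u0 v0 \<tau> u v. schwartz (u0 :: real ^ 'd \<Rightarrow> complex) \<and> schwartz v0 \<and>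
     sobolev_norm s (distr_of u0) \<le> ennreal (2 * (\<kappa> * 2 powr (- s / 2) * C0)) \<and>
     sobolev_norm s (distr_of v0) \<le> ennreal (2 * (\<kappa> * 2 powr (- s / 2) * C0)) \<and>
     sobolev_norm s (distr_of (\<lambda>x. u0 x - v0 x)) \<le> ennreal ((b - 1) * (\<kappa> * 2 powr (- s / 2) * C0)) \<and>
     \<tau> \<in> {0..T} \<and> nls_solution \<sigma> \<mu> p k \<tau> u0 u \<and> nls_solution \<sigma> \<mu> p k \<tau> v0 v \<and>
     ennreal (\<kappa> * 5 powr (s / 2) * (c / 4)) \<le> sobolev_norm s (distr_of (\<lambda>x. u \<tau> x - v \<tau> x))"
proof -
  define q where "q = p - 1"
  have q: "1 \<le> q" "real k \<le> q \<or> q = 2" using p by (auto simp: q_def)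
  \<comment> \<open>The rescaled time at which the two phases differ by exactly the q-th power of
    the profile.\<close>
  define K where "K = 1 / (b powr q - 1)"
  have "1 powr q < b powr q" using b q by (intro powr_less_mono2) auto
  then have bq: "0 < b powr q - 1" by simp
  have K: "0 < K" "(b powr q - 1) * K = 1" using bq by (auto simp: K_def)
  have K0: "0 \<le> K" using K by simp
  have b0: "0 < b" using b by simp
  obtain B1 C1 where S1: "1 \<le> B1" "0 < C1" "\<And>t. t \<in> {0..K} \<Longrightarrow> L2b (sobw k) B1 (ft (Phi q \<mu> 1 t))"
    "\<And>m \<eta>. continuous_on UNIV m \<Longrightarrow> 0 < \<eta> \<Longrightarrow> \<eta> * C1 \<le> 1 \<Longrightarrow> (\<And>\<xi>. \<bar>m \<xi>\<bar> \<le> \<eta> * (1 + \<xi>\<^sup>2)) \<Longrightarrow>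
      \<exists>F. semilinear.mild k q \<mu> m K (ft (Phi q \<mu> 1 0)) F \<and> (\<forall>t\<in>{0..K}. L2b (sobw k) B1 (F t)) \<and>
        (\<forall>t\<in>{0..K}. L2b (sobw k) (\<eta> * C1) (\<lambda>\<xi>. F t \<xi> - cis (- (t * m \<xi>)) * ft (Phi q \<mu> 1 t) \<xi>))"
  proof (rule small_dispersion[OF k q \<mu> zero_less_one K0], goal_cases)
    case (1 B C)
    show ?case by (rule that[of B C]) (fact 1)+
  qed
  obtain B2 C2 where S2: "1 \<le> B2" "0 < C2" "\<And>t. t \<in> {0..K} \<Longrightarrow> L2b (sobw k) B2 (ft (Phi q \<mu> b t))"
    "\<And>m \<eta>. continuous_on UNIV m \<Longrightarrow> 0 < \<eta> \<Longrightarrow> \<eta> * C2 \<le> 1 \<Longrightarrow> (\<And>\<xi>. \<bar>m \<xi>\<bar> \<le> \<eta> * (1 + \<xi>\<^sup>2)) \<Longrightarrow>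
      \<exists>F. semilinear.mild k q \<mu> m K (ft (Phi q \<mu> b 0)) F \<and> (\<forall>t\<in>{0..K}. L2b (sobw k) B2 (F t)) \<and>
        (\<forall>t\<in>{0..K}. L2b (sobw k) (\<eta> * C2) (\<lambda>\<xi>. F t \<xi> - cis (- (t * m \<xi>)) * ft (Phi q \<mu> b t) \<xi>))"
  proof (rule small_dispersion[OF k q \<mu> b0 K0], goal_cases)
    case (1 B C)
    show ?case by (rule that[of B C]) (fact 1)+
  qed
  \<comment> \<open>17 is the constant of \<open>mN_bound\<close>. The 1 is the smallness that
    \<open>small_dispersion\<close> asks for; c/4 is one share of the final error budget.\<close>
  define e1 where "e1 = min 1 (c / 4) / (17 * (C1 + C2))"
  have e1: "0 < e1" using c S1 S2 by (simp add: e1_def)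
  have ev1: "eventually (\<lambda>N. N powr (2 * \<sigma> - 2) < e1) at_top"
    by (rule order_tendstoD(2)[OF tendsto_neg_powr[OF _ filterlim_ident] e1]) (use \<sigma> in auto)
  \<comment> \<open>A >= 1 is required by \<open>mN_bound\<close>; the second entry brings the
    physical time K / A^q below T.\<close>
  define A0 where "A0 = max 1 ((K / T) powr (1 / q))"
  have A0: "1 \<le> A0" "(K / T) powr (1 / q) \<le> A0" by (auto simp: A0_def)
  have ev2: "eventually (\<lambda>N. N powr s < \<kappa> / A0) at_top"
    by (rule order_tendstoD(2)[OF tendsto_neg_powr[OF s(1) filterlim_ident]]) (use \<kappa> A0 in auto)
  have "eventually (\<lambda>N::real. N powr (2 * \<sigma> - 2) < e1 \<and> N powr s < \<kappa> / A0 \<and> 1 \<le> N \<and> 4 * (B1 + B2) / c \<le> N) at_top"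
    by (intro eventually_conj ev1 ev2 eventually_ge_at_top)
  then obtain N :: real where N: "N powr (2 * \<sigma> - 2) < e1" "N powr s < \<kappa> / A0" "1 \<le> N" "4 * (B1 + B2) / c \<le> N"
    using eventually_happens'[OF trivial_limit_at_top_linorder] by blast
  have N0: "0 < N" using N by simp
  define A where "A = \<kappa> * N powr (- s)"
  have As: "A * N powr s = \<kappa>" using N0 by (simp add: A_def mult.assoc flip: powr_add)
  have A: "A0 \<le> A"
  proof -
    have "A0 * N powr s \<le> \<kappa>" using N(2) A0 by (simp add: field_simps)
    then have "A0 * N powr s \<le> A * N powr s" by (simp add: As)
    then show ?thesis using N0 by simp
  qed
  have Apos: "0 < A" "1 \<le> A" using A A0 by auto
  have Aq: "1 \<le> A powr q" using Apos q by (simp add: ge_one_powr_ge_zero)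
  have AqT: "K / A powr q \<le> T"
  proof -
    have "K / T = ((K / T) powr (1 / q)) powr q" using K T q by (simp add: powr_powr)
    also have "\<dots> \<le> A powr q" using A A0 q by (intro powr_mono2) auto
    finally have "K \<le> T * A powr q" using T by (simp add: pos_divide_le_eq mult.commute)
    then show ?thesis using Aq by (intro divide_le_eq[THEN iffD2]) auto
  qed
  define \<tau> where "\<tau> = K / A powr q"
  have \<tau>: "0 \<le> \<tau>" "\<tau> \<le> T" "A powr q * \<tau> = K" using K AqT Aq by (auto simp: \<tau>_def)
  define m where "m = mN \<sigma> (A powr q) N"
  have mc: "continuous_on UNIV m" unfolding m_def by (rule mN_continuous[OF \<sigma>(1)])
  define \<eta> where "\<eta> = 17 * N powr (2 * \<sigma> - 2)"
  have \<eta>: "0 < \<eta>" using N0 by (simp add: \<eta>_def)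
  have \<eta>C: "\<eta> * (C1 + C2) \<le> min 1 (c / 4)"
    using N(1) S1(2) S2(2) by (simp add: \<eta>_def e1_def field_simps)
  have \<eta>C1: "\<eta> * C1 \<le> min 1 (c / 4)" "\<eta> * C2 \<le> min 1 (c / 4)"
    using \<eta>C \<eta> S1(2) S2(2) by (auto simp: distrib_left intro: order_trans[rotated])
  have mb: "\<bar>m \<xi>\<bar> \<le> \<eta> * (1 + \<xi>\<^sup>2)" for \<xi> unfolding m_def \<eta>_def by (rule mN_bound[OF \<sigma> Aq N(3)])
  obtain F1 where F1: "semilinear.mild k q \<mu> m K (ft (Phi q \<mu> 1 0)) F1" "\<And>t. t \<in> {0..K} \<Longrightarrow> L2b (sobw k) B1 (F1 t)"
    "\<And>t. t \<in> {0..K} \<Longrightarrow> L2b (sobw k) (\<eta> * C1) (\<lambda>\<xi>. F1 t \<xi> - cis (- (t * m \<xi>)) * ft (Phi q \<mu> 1 t) \<xi>)"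
    using S1(4)[OF mc \<eta> _ mb] \<eta>C1 by auto
  obtain F2 where F2: "semilinear.mild k q \<mu> m K (ft (Phi q \<mu> b 0)) F2" "\<And>t. t \<in> {0..K} \<Longrightarrow> L2b (sobw k) B2 (F2 t)"
    "\<And>t. t \<in> {0..K} \<Longrightarrow> L2b (sobw k) (\<eta> * C2) (\<lambda>\<xi>. F2 t \<xi> - cis (- (t * m \<xi>)) * ft (Phi q \<mu> b t) \<xi>)"
    using S2(4)[OF mc \<eta> _ mb] \<eta>C1 by auto
  define G where "G = ft (Phi q \<mu> 1 0)"
  have Phi0: "Phi q \<mu> a 0 = (\<lambda>x. of_real a * Phi q \<mu> 1 0 x)" for a by (auto simp: Phi_def)
  have Gb: "ft (Phi q \<mu> b 0) = (\<lambda>\<xi>. of_real b * G \<xi>)" unfolding Phi0[of b] G_def by (auto simp: ft_cmult)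
  have GL: "L2b (sobw k) B1 G" using S1(3)[of 0] K0 by (simp add: G_def)
  have iG: "ift G x = Phi q \<mu> 1 0 x" for x
    unfolding G_def
  proof (rule ft_inversion[OF Phi_integrable(1)[OF zero_less_one]])
    show "continuous_on UNIV (Phi q \<mu> 1 0)" unfolding Phi_def[abs_def] by (intro continuous_intros) auto
    show "norm (Phi q \<mu> 1 0 x) \<le> 1" for x by (simp add: norm_Phi)
    show "integrable lborel (ft (Phi q \<mu> 1 0))" using L2b_sobw_L1(1)[OF k GL] by (simp add: G_def)
  qed
  define f where "f a \<xi> = of_real (A * a) * G (\<xi> - N)" for a \<xi>
  define u0 where "u0 a x = ift (f a) (prj x)" for a and x :: "real ^ 'd"
  have u0: "u0 a = gp N (1 / 2) [:of_real (A * a):]" for a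
  proof
    fix x :: "real ^ 'd"
    show "u0 a x = gp N (1 / 2) [:of_real (A * a):] x"
      unfolding u0_def f_def[abs_def] ift_cmult ift_translate iG
      by (simp add: gp_def[OF one] Phi_def mult.commute)
  qed
  have sch: "schwartz (u0 a)" for a unfolding u0 by (rule gp_schwartz[OF one]) simp
  obtain B' where fB': "L2b (sobw k) B' (\<lambda>\<xi>. G (\<xi> - N))" using L2b_sobw_translate[OF GL, of N] by blast
  have fB: "L2b (sobw k) (norm (complex_of_real (A * a)) * B') (f a)" for a
    unfolding f_def[abs_def] by (rule L2b_cmult[OF wt_sobw fB'])
  have fr: "repr (distr_of (u0 a)) (f a)" for a unfolding u0_def[abs_def] by (rule repr_ift[OF one k fB])
  define c1 where "c1 = \<kappa> * 2 powr (- s / 2) * C0"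
  have c1: "0 \<le> c1" using \<kappa> L2b_nonneg[OF C0] by (simp add: c1_def)
  have fs: "L2b (wps s) (\<bar>a\<bar> * c1) (f a)" for a
  proof -
    have "L2b (sobw j) C0 G" using C0 by (simp add: G_def q_def)
    from L2b_cmult[OF wt_wps L2b_wps_translate[OF s N(3) this], of "of_real (A * a)"]
    have "L2b (wps s) (A * \<bar>a\<bar> * (2 powr (- s / 2) * N powr s * C0)) (f a)"
      using Apos by (simp add: f_def[abs_def] norm_mult)
    moreover have "A * \<bar>a\<bar> * (2 powr (- s / 2) * N powr s * C0) = \<bar>a\<bar> * c1"
      unfolding c1_def As[symmetric] by (simp add: ac_simps)
    ultimately show ?thesis by (simp only:)
  qed
  have n1: "sobolev_norm s (distr_of (u0 a)) \<le> ennreal (2 * c1)" if "\<bar>a\<bar> \<le> 2" for a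
  proof -
    have "sobolev_norm s (distr_of (u0 a)) \<le> ennreal (\<bar>a\<bar> * c1)" by (rule sobolev_norm_leI(2)[OF one fr fs])
    also have "\<dots> \<le> ennreal (2 * c1)" using that c1 by (intro ennreal_leI mult_right_mono)
    finally show ?thesis .
  qed
  have n2: "sobolev_norm s (distr_of (\<lambda>x. u0 1 x - u0 b x)) \<le> ennreal ((b - 1) * c1)"
  proof -
    have "(\<lambda>x. u0 1 x - u0 b x) = u0 (1 - b)"
      unfolding u0 gp_def[OF one, abs_def] by (auto simp: algebra_simps)
    then have "sobolev_norm s (distr_of (\<lambda>x. u0 1 x - u0 b x)) \<le> ennreal (\<bar>1 - b\<bar> * c1)"
      using sobolev_norm_leI(2)[OF one fr fs, of "1 - b"] by simp
    then show ?thesis using b by simp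
  qed
  interpret fx: semilinear k q \<mu> "\<lambda>\<xi>. \<bar>\<xi>\<bar> powr (2 * \<sigma>)"
    by (rule semilinear_frac_laplacian[OF k q \<mu> \<sigma>(1)])
  define U1 where "U1 t \<xi> = of_real A * F1 (A powr q * t) (\<xi> - N)" for t \<xi>
  define U2 where "U2 t \<xi> = of_real A * F2 (A powr q * t) (\<xi> - N)" for t \<xi>
  define u where "u t x = ift (fx.tw t (U1 t)) (prj x)" for t and x :: "real ^ 'd"
  define v where "v t x = ift (fx.tw t (U2 t)) (prj x)" for t and x :: "real ^ 'd"
  have f1: "(\<lambda>\<xi>. of_real A * ft (Phi q \<mu> 1 0) (\<xi> - N)) = f 1" by (simp add: f_def[abs_def] G_def)
  have f2: "(\<lambda>\<xi>. of_real A * ft (Phi q \<mu> b 0) (\<xi> - N)) = f b" by (simp add: f_def[abs_def] Gb mult.assoc)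
  have M1: "fx.mild \<tau> (f 1) U1"
    using frame_change[OF k q \<mu> \<sigma>(1) Apos(1) F1(1)[unfolded m_def]] unfolding f1 \<tau>_def U1_def[abs_def] .
  have M2: "fx.mild \<tau> (f b) U2"
    using frame_change[OF k q \<mu> \<sigma>(1) Apos(1) F2(1)[unfolded m_def]] unfolding f2 \<tau>_def U2_def[abs_def] .
  have sol1: "nls_solution \<sigma> \<mu> p k \<tau> (u0 1) u"
    using mild_imp_nls_solution[OF one k p \<mu> \<sigma> \<tau>(1) M1[unfolded q_def]] by (simp add: u0_def[abs_def] u_def[abs_def])
  have sol2: "nls_solution \<sigma> \<mu> p k \<tau> (u0 b) v"
    using mild_imp_nls_solution[OF one k p \<mu> \<sigma> \<tau>(1) M2[unfolded q_def]] by (simp add: u0_def[abs_def] v_def[abs_def])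
  define E where "E \<xi> = F1 K \<xi> - F2 K \<xi>" for \<xi>
  have KK: "K \<in> {0..K}" using K0 by simp
  have EL: "L2b (sobw k) (B1 + B2) E" unfolding E_def[abs_def] by (intro L2b_diff wt_sobw F1(2) F2(2) KK)
  have [measurable]: "E \<in> borel_measurable borel" using EL by (simp add: L2b_def)
  define D where "D \<xi> = fx.tw \<tau> (U1 \<tau>) \<xi> - fx.tw \<tau> (U2 \<tau>) \<xi>" for \<xi>
  have D: "norm (D \<xi>) = A * norm (E (\<xi> - N))" for \<xi>
  proof -
    have "D \<xi> = cis (\<tau> * \<bar>\<xi>\<bar> powr (2 * \<sigma>)) * (of_real A * E (\<xi> - N))"
      unfolding D_def fx.tw_def U1_def U2_def \<tau>(3) E_def by (simp add: algebra_simps)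
    then show ?thesis using Apos by (simp add: norm_mult)
  qed
  obtain B1' B2' where "L2b (sobw k) B1' (U1 \<tau>)" "L2b (sobw k) B2' (U2 \<tau>)"
    using M1 M2 \<tau>(1) unfolding fx.mild_def by fastforce
  note tw = this[THEN fx.L2b_tw[OF wt_sobw, of _ _ _ \<tau>]]
  have DB: "L2b (sobw k) (B1' + B2') D" unfolding D_def[abs_def] by (rule L2b_diff[OF wt_sobw tw])
  have uv: "(\<lambda>x :: real ^ 'd. u \<tau> x - v \<tau> x) = (\<lambda>x. ift D (prj x))"
    unfolding D_def[abs_def] u_def v_def using tw by (intro ext ift_diff[symmetric] L2b_sobw_L1(1)[OF k])
  have Dr: "repr (distr_of (\<lambda>x :: real ^ 'd. u \<tau> x - v \<tau> x)) D" unfolding uv by (rule repr_ift[OF one k DB])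
  define c0 where "c0 = \<kappa> * 5 powr (s / 2) * (c / 4)"
  have c0: "0 \<le> c0" using \<kappa> c by (simp add: c0_def)
  \<comment> \<open>By contradiction. A small H^s norm would make the profile difference small on
    |\<xi>| <= N; four errors of size c/4 (the band, its tail and the two deviations from the
    reference) would then bound \<open>gap\<close> by c.\<close>
  have low: "ennreal c0 \<le> sobolev_norm s (distr_of (\<lambda>x. u \<tau> x - v \<tau> x))"
  proof (rule ccontr)
    assume "\<not> ennreal c0 \<le> sobolev_norm s (distr_of (\<lambda>x. u \<tau> x - v \<tau> x))"
    then have "sobolev_norm s (distr_of (\<lambda>x. u \<tau> x - v \<tau> x)) \<le> ennreal c0" by simp
    from sobolev_norm_leD[OF one Dr this c0] have "L2b (wps s) c0 D" .
    from L2b_translate[OF wt_wps this, of "- N"]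
    have DL: "L2b (\<lambda>\<xi>. wps s (\<xi> + N)) c0 (\<lambda>\<xi>. D (\<xi> + N))" by simp
    \<comment> \<open>On the band, 1 + (\<xi> + N)^2 <= 5 N^2. As s < 0, the H^s norm is there at
      least A N^s 5^(s/2), that is \<kappa> 5^(s/2), times the L2 norm of E.\<close>
    define \<gamma> where "\<gamma> = 1 / (\<kappa> * 5 powr (s / 2))"
    have g0: "0 \<le> \<gamma>" using \<kappa> by (simp add: \<gamma>_def)
    have low1: "L2b (\<lambda>_. 1) (\<gamma> * c0) (bl N E)"
    proof (rule L2b_le[OF _ DL _ g0])
      show "wt (\<lambda>\<xi>. wps s (\<xi> + N))" by (auto simp: wt_def wps_def)
      show "bl N E \<in> borel_measurable borel" by measurable
      fix \<xi>
      show "1 * (norm (bl N E \<xi>))\<^sup>2 \<le> \<gamma>\<^sup>2 * (wps s (\<xi> + N) * (norm (D (\<xi> + N)))\<^sup>2)"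
      proof (cases "\<xi> \<in> {-N..N}")
        case True
        have "(\<xi> + N)\<^sup>2 \<le> (2 * N)\<^sup>2" using True by (intro power_mono) auto
        moreover have "1 \<le> N\<^sup>2" using N(3) by simp
        ultimately have "1 + (\<xi> + N)\<^sup>2 \<le> 5 * N\<^sup>2" by (simp add: power_mult_distrib)
        then have "(5 * N\<^sup>2) powr s \<le> wps s (\<xi> + N)"
          unfolding wps_def using s by (intro powr_mono2') (auto simp: add_pos_nonneg)
        moreover have "(5 * N\<^sup>2) powr s = 5 powr s * (N powr s)\<^sup>2"
          using N0 by (simp add: powr_mult power2_eq_square)
        ultimately have "\<gamma>\<^sup>2 * (5 powr s * (N powr s)\<^sup>2) * A\<^sup>2 \<le> \<gamma>\<^sup>2 * wps s (\<xi> + N) * A\<^sup>2"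
          by (intro mult_right_mono mult_left_mono) auto
        moreover have "\<gamma>\<^sup>2 * (5 powr s * (N powr s)\<^sup>2) * A\<^sup>2 = 1"
        proof -
          have "\<gamma>\<^sup>2 * (5 powr s * (N powr s)\<^sup>2) * A\<^sup>2 = \<gamma>\<^sup>2 * 5 powr s * (A * N powr s)\<^sup>2"
            by (simp add: power_mult_distrib)
          also have "\<dots> = 1"
          proof -
            have "(5 powr (s / 2))\<^sup>2 = (5::real) powr s" by (simp add: power2_eq_square flip: powr_add)
            then show ?thesis unfolding As \<gamma>_def using \<kappa> by (simp add: power_divide power_mult_distrib)
          qed
          finally show ?thesis .
        qed
        ultimately have "1 * (norm (E \<xi>))\<^sup>2 \<le> \<gamma>\<^sup>2 * wps s (\<xi> + N) * A\<^sup>2 * (norm (E \<xi>))\<^sup>2"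
          by (intro mult_right_mono) auto
        then show ?thesis using True by (simp add: bl_def D power_mult_distrib ac_simps)
      next
        case False
        then show ?thesis by (simp add: bl_def wps_def)
      qed
    qed
    have "\<gamma> * c0 = c / 4" using \<kappa> by (simp add: \<gamma>_def c0_def)
    then have low1: "L2b (\<lambda>_. 1) (c / 4) (bl N E)" using low1 by (simp only:)
    have "(B1 + B2) / N \<le> c / 4" using N(4) N0 c by (simp add: field_simps)
    then have low2: "L2b (\<lambda>_. 1) (c / 4) (\<lambda>\<xi>. bl N E \<xi> - E \<xi>)" by (rule L2b_mono_bound[OF L2b_bl_tail[OF k EL N0]])
    have E2: "L2b (\<lambda>_. 1) (c / 4 + c / 4) E" using L2b_diff[OF wt_one low1 low2] by simp
    define P where "P \<xi> = ft (Phi q \<mu> 1 K) \<xi> - ft (Phi q \<mu> b K) \<xi>" for \<xi>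
    define R1 where "R1 \<xi> = F1 K \<xi> - cis (- (K * m \<xi>)) * ft (Phi q \<mu> 1 K) \<xi>" for \<xi>
    define R2 where "R2 \<xi> = F2 K \<xi> - cis (- (K * m \<xi>)) * ft (Phi q \<mu> b K) \<xi>" for \<xi>
    have R1: "L2b (\<lambda>_. 1) (c / 4) R1"
      using L2b_mono_bound[OF L2b_sobw_L2[OF F1(3)[OF KK]], of "c / 4"] \<eta>C1(1) by (simp add: R1_def[abs_def])
    have R2: "L2b (\<lambda>_. 1) (c / 4) R2"
      using L2b_mono_bound[OF L2b_sobw_L2[OF F2(3)[OF KK]], of "c / 4"] \<eta>C1(2) by (simp add: R2_def[abs_def])
    have "L2b (\<lambda>_. 1) (c / 4 + c / 4 + c / 4 + c / 4) (\<lambda>\<xi>. E \<xi> - R1 \<xi> + R2 \<xi>)"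
      by (intro L2b_add[OF wt_one L2b_diff[OF wt_one E2 R1] R2])
    then have ER: "L2b (\<lambda>_. 1) c (\<lambda>\<xi>. E \<xi> - R1 \<xi> + R2 \<xi>)" by simp
    have Pn: "norm (P \<xi>) = norm (E \<xi> - R1 \<xi> + R2 \<xi>)" for \<xi>
    proof -
      have "E \<xi> - R1 \<xi> + R2 \<xi> = cis (- (K * m \<xi>)) * P \<xi>" by (simp add: E_def R1_def R2_def P_def algebra_simps)
      then show ?thesis by (simp add: norm_mult)
    qed
    note i1 = L2b_sobw_L1(1)[OF k S1(3)[OF KK]] and i2 = L2b_sobw_L1(1)[OF k S2(3)[OF KK]]
    have Pi: "integrable lborel P" unfolding P_def[abs_def] using i1 i2 by simp
    then have [measurable]: "P \<in> borel_measurable borel" by auto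
    have "L2b (\<lambda>_. 1) c P" by (rule L2b_mono_norm[OF wt_one ER]) (simp_all add: Pn)
    from Bessel_ift[OF Pi this] have iP: "L2b (\<lambda>_. 1) c (ift P)" .
    have inv: "ift (ft (Phi q \<mu> a K)) x = Phi q \<mu> a K x" if "0 < a" "integrable lborel (ft (Phi q \<mu> a K))" for a x
    proof (rule ft_inversion[OF Phi_integrable(1)[OF that(1)] _ _ that(2)])
      show "continuous_on UNIV (Phi q \<mu> a K)" unfolding Phi_def[abs_def] by (intro continuous_intros) auto
      show "norm (Phi q \<mu> a K x) \<le> a * 1" for x unfolding norm_Phi[OF that(1)] using that by (intro mult_left_mono) auto
    qed
    have "ift P x = Phi q \<mu> 1 K x - Phi q \<mu> b K x" for x
      unfolding P_def[abs_def] ift_diff[OF i1 i2] inv[OF zero_less_one i1] inv[OF b0 i2] ..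
    then have "norm (gap q x) \<le> norm (ift P x)" for x
      using norm_gap_le[OF _ \<mu> K(2), of x] b q by simp
    moreover have "gap q \<in> borel_measurable borel"
      unfolding gap_def[abs_def] by (intro borel_measurable_continuous_onI continuous_intros) auto
    ultimately have "L2b (\<lambda>_. 1) c (gap q)" by (intro L2b_mono_norm[OF wt_one iP])
    with c show False by (simp add: q_def)
  qed
  show ?thesis
    by (intro exI[of _ "u0 1"] exI[of _ "u0 b"] exI[of _ \<tau>] exI[of _ u] exI[of _ v] conjI sch sol1 sol2)
       (use n1[of 1] n1[of b] n2 b \<tau> low in \<open>auto simp: c1_def c0_def\<close>)
qed

theorem theorem1p5:
  fixes \<sigma> \<mu> p s :: real and k :: nat
  assumes "CARD('d::finite) \<in> {1, 2, 3}"
    and "real CARD('d) / 4 < \<sigma>" and "\<sigma> < 1" and "\<sigma> \<noteq> 1 / 2"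
    and "\<mu> \<in> {1, -1}"
    and "1 < p"
    and "real CARD('d) / 2 < real k"
    and "\<not> (\<exists>m::int. odd m \<and> p = of_int m) \<Longrightarrow> real k + 1 \<le> p"
    and "real CARD('d) / 2 - 2 * \<sigma> / (p - 1) < s" and "s < 0"
  shows "nls_ill_posed TYPE('d) \<sigma> \<mu> p k s"
proof -
  define d where "d = real CARD('d)"
  have d1: "1 \<le> d" using assms(1) by (auto simp: d_def)
  have "d / 2 < 2 * \<sigma> / (p - 1)" using assms(9,10) by (simp add: d_def)
  then have pd: "d * (p - 1) < 4 * \<sigma>" using assms(6) by (simp add: field_simps)
  \<comment> \<open>From d (p - 1) < 4 \<sigma> < 4; the only odd integer left above 1 is then
    3.\<close>
  have p5: "p < 5"
  proof -
    have "1 * (p - 1) \<le> d * (p - 1)" using d1 assms(6) by (intro mult_right_mono) auto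
    from le_less_trans[OF this pd] show ?thesis using assms(3) by simp
  qed
  have odd3: "p = 3" if "odd m" "p = of_int m" for m :: int
  proof -
    have "1 < m" "m < 5" using that(2) assms(6) p5 by auto
    then have "m = 2 \<or> m = 3 \<or> m = 4" by auto
    then show ?thesis using that by auto
  qed
  \<comment> \<open>For d >= 2 the same inequality gives p < 3, which rules out odd integers, while
    k >= 2 would force p >= 3.\<close>
  have one: "CARD('d) = 1"
  proof (rule ccontr)
    assume "CARD('d) \<noteq> 1"
    then have d2: "2 \<le> d" "1 < k" using assms(1,7) by (auto simp: d_def)
    have "2 * (p - 1) \<le> d * (p - 1)" using d2 assms(6) by (intro mult_right_mono) auto
    from le_less_trans[OF this pd] have p3: "p < 3" using assms(3) by simp
    then have "\<not> (\<exists>m::int. odd m \<and> p = of_int m)" using odd3 by fastforce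
    from assms(8)[OF this] p3 d2(2) show False by linarith
  qed
  have k: "1 \<le> k" using assms(7) one by (cases k) auto
  have p: "2 \<le> p" "real k \<le> p - 1 \<or> p = 3"
  proof -
    have "p = 3 \<or> real k + 1 \<le> p" using odd3 assms(8) by blast
    then show "2 \<le> p" "real k \<le> p - 1 \<or> p = 3" using k by auto
  qed
  have \<mu>: "\<bar>\<mu>\<bar> = 1" using assms(5) by auto
  have \<sigma>: "0 < \<sigma>" "\<sigma> < 1" using assms(2,3) one by auto
  obtain c where c: "0 < c" "\<not> L2b (\<lambda>_. 1) c (gap (p - 1))" using gap_not_null[of "p - 1"] p by auto
  obtain j :: nat where j: "- s \<le> real j" using real_arch_simple by blast
  obtain A where A: "hb j A (Phi (p - 1) \<mu> 1 0)" using Phi_hb[of "p - 1" \<mu> 0 j 1] p \<mu> by auto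
  \<comment> \<open>The added 1 makes the constant positive, since \<kappa> is obtained by dividing
    by it.\<close>
  define C0 where "C0 = 2 ^ Suc j * A + 1"
  have C0: "L2b (sobw j) C0 (ft (Phi (p - 1) \<mu> 1 0))"
    by (rule L2b_mono_bound[OF hb_ft_sobw[OF Phi_integrable(1)[OF zero_less_one] A]]) (simp add: C0_def)
  have C0pos: "0 < C0" using hb_nonneg[OF A] by (simp add: C0_def add_nonneg_pos)
  show ?thesis
    unfolding nls_ill_posed_def
  proof (intro allI impI)
    fix R T :: real assume R: "0 < R" and T: "0 < T"
    \<comment> \<open>Solves 2 \<kappa> 2^(-s/2) C0 = R, the bound of \<open>one_step\<close> on the
      data.\<close>
    define \<kappa> where "\<kappa> = R / (2 * (2 powr (- s / 2) * C0))"
    have \<kappa>: "0 < \<kappa>" using R C0pos by (simp add: \<kappa>_def)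
    have \<kappa>R: "\<kappa> * 2 powr (- s / 2) * C0 = R / 2" using C0pos by (simp add: \<kappa>_def)
    define c0 where "c0 = \<kappa> * 5 powr (s / 2) * (c / 4)"
    have c0: "0 < c0" using \<kappa> c by (simp add: c0_def)
    have "\<forall>n::nat. \<exists>u0 v0 \<tau> u v. schwartz (u0 :: real ^ 'd \<Rightarrow> complex) \<and> schwartz v0 \<and>
       sobolev_norm s (distr_of u0) \<le> ennreal R \<and> sobolev_norm s (distr_of v0) \<le> ennreal R \<and>
       sobolev_norm s (distr_of (\<lambda>x. u0 x - v0 x)) \<le> ennreal (inverse (real (Suc n)) * (R / 2)) \<and>
       \<tau> \<in> {0..T} \<and> nls_solution \<sigma> \<mu> p k \<tau> u0 u \<and> nls_solution \<sigma> \<mu> p k \<tau> v0 v \<and>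
       ennreal c0 \<le> sobolev_norm s (distr_of (\<lambda>x. u \<tau> x - v \<tau> x))"
    proof
      fix n :: nat
      \<comment> \<open>The ratio b = 1 + 1/(n+1) of the two amplitudes tends to 1, so the data
        approach each other while the separation stays above \<open>c0\<close>.\<close>
      have b: "1 < 1 + inverse (real (Suc n))" "1 + inverse (real (Suc n)) \<le> 2" by (auto simp: inverse_le_1_iff)
      from one_step[OF one k p \<mu> \<sigma> assms(10) j T \<kappa> b C0 c]
      show "\<exists>u0 v0 \<tau> u v. schwartz (u0 :: real ^ 'd \<Rightarrow> complex) \<and> schwartz v0 \<and>
       sobolev_norm s (distr_of u0) \<le> ennreal R \<and> sobolev_norm s (distr_of v0) \<le> ennreal R \<and>
       sobolev_norm s (distr_of (\<lambda>x. u0 x - v0 x)) \<le> ennreal (inverse (real (Suc n)) * (R / 2)) \<and>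
       \<tau> \<in> {0..T} \<and> nls_solution \<sigma> \<mu> p k \<tau> u0 u \<and> nls_solution \<sigma> \<mu> p k \<tau> v0 v \<and>
       ennreal c0 \<le> sobolev_norm s (distr_of (\<lambda>x. u \<tau> x - v \<tau> x))"
        by (simp only: \<kappa>R c0_def add_diff_cancel_left' mult_2 field_sum_of_halves)
    qed
    then obtain u0 v0 \<tau> u v where sol: "\<And>n. schwartz (u0 n :: real ^ 'd \<Rightarrow> complex) \<and> schwartz (v0 n) \<and>
       sobolev_norm s (distr_of (u0 n)) \<le> ennreal R \<and> sobolev_norm s (distr_of (v0 n)) \<le> ennreal R \<and>
       sobolev_norm s (distr_of (\<lambda>x. u0 n x - v0 n x)) \<le> ennreal (inverse (real (Suc n)) * (R / 2)) \<and>
       \<tau> n \<in> {0..T} \<and> nls_solution \<sigma> \<mu> p k (\<tau> n) (u0 n) (u n) \<and> nls_solution \<sigma> \<mu> p k (\<tau> n) (v0 n) (v n) \<and>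
       ennreal c0 \<le> sobolev_norm s (distr_of (\<lambda>x. u n (\<tau> n) x - v n (\<tau> n) x))"
      unfolding choice_iff by blast
    have lim: "(\<lambda>n. sobolev_norm s (distr_of (\<lambda>x. u0 n x - v0 n x))) \<longlonglongrightarrow> 0"
    proof (rule tendsto_sandwich[OF _ _ tendsto_const])
      show "\<forall>\<^sub>F n in sequentially. sobolev_norm s (distr_of (\<lambda>x. u0 n x - v0 n x)) \<le> ennreal (inverse (real (Suc n)) * (R / 2))"
        using sol by simp
      have "(\<lambda>n. ennreal (inverse (real (Suc n)) * (R / 2))) \<longlonglongrightarrow> ennreal (0 * (R / 2))"
        by (intro tendsto_ennrealI tendsto_mult LIMSEQ_inverse_real_of_nat tendsto_const)
      then show "(\<lambda>n. ennreal (inverse (real (Suc n)) * (R / 2))) \<longlonglongrightarrow> 0" by simp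
    qed simp
    have "ennreal c0 \<le> liminf (\<lambda>n. sobolev_norm s (distr_of (\<lambda>x. u n (\<tau> n) x - v n (\<tau> n) x)))"
      by (rule Liminf_bounded) (use sol in simp)
    then have pos: "0 < liminf (\<lambda>n. sobolev_norm s (distr_of (\<lambda>x. u n (\<tau> n) x - v n (\<tau> n) x)))"
      using less_le_trans[of 0 "ennreal c0"] c0 by simp
    show "\<exists>(u0 :: nat \<Rightarrow> real ^ 'd \<Rightarrow> complex) v0 \<tau> u v.
        (\<forall>n. schwartz (u0 n) \<and> schwartz (v0 n) \<and>
             sobolev_norm s (distr_of (u0 n)) \<le> ennreal R \<and>
             sobolev_norm s (distr_of (v0 n)) \<le> ennreal R) \<and>
        (\<lambda>n. sobolev_norm s (distr_of (\<lambda>x. u0 n x - v0 n x))) \<longlonglongrightarrow> 0 \<and>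
        (\<forall>n. \<tau> n \<in> {0..T} \<and>
             nls_solution \<sigma> \<mu> p k (\<tau> n) (u0 n) (u n) \<and>
             nls_solution \<sigma> \<mu> p k (\<tau> n) (v0 n) (v n)) \<and>
        0 < liminf (\<lambda>n. sobolev_norm s (distr_of (\<lambda>x. u n (\<tau> n) x - v n (\<tau> n) x)))"
      using sol lim pos by blast
  qed
qed

end
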